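(* Let $f:[0,1]\to[0,1]$ be a non-flat map that is a $C^2$ local diffeomorphism on the whole interval except for a finite set $\mathcal{C}_f\subset(0,1)$. If $x\in[0,1]\setminus\big(\mathbb{B}_0(f)\cup\mathcal{O}_f^-(\operatorname{Per}(f))\big)$ and $\overline{\mathcal{O}_f^+(x)}\cap\mathcal{C}_f=\emptyset$, then $\sup_{n}|Df^n(x)|=\infty$. Furthermore, $\omega_f(x)\cap\mathcal{C}_f\ne\emptyset$ for Lebesgue almost every $x\in[0,1]\setminus\big(\mathbb{B}_0(f)\cup\mathcal{O}_f^-(\operatorname{Per}(f))\big)$.
   Context: Non-flatness: $f$ is non-flat at $c\in[0,1]$ if there are $\varepsilon>0$, constants $\alpha,\beta\ge1$ and $C^2$ diffeomorphisms $\phi_0:[-\varepsilon,0]\to\operatorname{Im}(\phi_0)\subset\mathbb{R}$, $\phi_1:[0,\varepsilon]\to\operatorname{Im}(\phi_1)\subset\mathbb{R}$ with $\phi_0(0)=\phi_1(0)=0$ such that $f(x)=a+(\phi_0(x-c))^\alpha$ for $x\in(c-\varepsilon,c)\cap(0,1)$ and $f(x)=b+(\phi_1(x-c))^\beta$ for $x\in(c,c+\varepsilon)\cap(0,1)$, where $a=\lim_{x\nearrow c}f(x)$, $b=\lim_{x\searrow c}f(x)$ and $t^\alpha$ means $\operatorname{sgn}(t)|t|^\alpha$. The map $f$ is non-flat if it is non-flat at every point of $[0,1]$. The finite exceptional set $\mathcal{C}_f$ contains all critical points and all discontinuities of $f$. Orbits: $\mathcal{O}_f^-(U)=\bigcup_{j\ge0}f^{-j}(U)$.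 If $x\notin\mathcal{O}_f^-(\mathcal{C}_f)$, then $\mathcal{O}_f^+(x)=\{f^j(x):j\ge0\}$ and $\omega_f(x)$ is the set of accumulation points of the sequence $(f^n(x))_n$. If $x\in\mathcal{O}_f^-(\mathcal{C}_f)$, then $\mathcal{O}^+_f(x)=\{x,\dots,f^n(x)\}$ with $n=\min\{j\ge0: f^j(x)\in\mathcal{C}_f\}$. (The set $\mathcal{O}_f^-(\mathcal{C}_f)$ has zero Lebesgue measure.) $\operatorname{Per}(f)=\{p\in[0,1]\setminus\mathcal{O}_f^-(\mathcal{C}_f): f^n(p)=p\text{ for some }n\ge1\}$. Attractors: the basin of a compact set $A$ is $\beta_f(A)=\{x:\omega_f(x)\subset A\}$. A compact set $A$ is an attractor if $\beta_f(A)$ has positive Lebesgue measure and there is no strictly smaller closed set $A'\subset A$ such that $\beta_f(A')$ equals $\beta_f(A)$ up to a set of Lebesgue measure zero. Periodic-like points: $p\in[0,1]$ is right-periodic of period $n$ if $n$ is the smallest integer $\ell\ge1$ such that $f^\ell(x)\searrow p$ as $x\searrow p$; it is left-periodic of period $n$ if $n$ is the smallest integer $\ell\ge1$ such that $f^\ell(x)\nearrow p$ as $x\nearrow p$. A point is periodic-like if it is left- or right-periodic; its (periodic-like) orbit is the finite set of the corresponding lateral limits of $f^j(x)$ as $x\to p$ from that side, $0\le j<n$. A periodic-like orbit is attracting if it is an attractor. $\mathbb{B}_0(f)$ is the union of the basins of attraction of all attracting periodic-like orbits. *)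

theory Defs
  imports "HOL-Analysis.Analysis"
begin

text \<open>
  A map of the interval is represented by a function \<open>f :: real \<Rightarrow> real\<close> with
  \<open>f ` {0..1} \<subseteq> {0..1}\<close>. The values of \<open>f\<close> outside \<open>{0..1}\<close> are irrelevant: every limit,
  derivative and preimage below is taken relative to \<open>{0..1}\<close>.
\<close>

definition C2_on :: "real set \<Rightarrow> (real \<Rightarrow> real) \<Rightarrow> bool" where
  "C2_on S g \<longleftrightarrow> (\<exists>g' g''.
     (\<forall>x\<in>S. (g has_real_derivative g' x) (at x within S)) \<and>
     (\<forall>x\<in>S. (g' has_real_derivative g'' x) (at x within S)) \<and>
     continuous_on S g'')"

definition C2_diffeo_on :: "real set \<Rightarrow> (real \<Rightarrow> real) \<Rightarrow> bool" where
  "C2_diffeo_on S g \<longleftrightarrow> inj_on g S \<and> C2_on S g \<and> C2_on (g ` S) (inv_into S g)"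

text \<open>
  At an end point of \<open>{0..1}\<close> that lies in \<open>M\<close> this is a one-sided condition; local
  diffeomorphisms are onto their image, so \<open>0\<close> and \<open>1\<close> need not be mapped to end points.
\<close>

definition C2_local_diffeo_on :: "real set \<Rightarrow> (real \<Rightarrow> real) \<Rightarrow> bool" where
  "C2_local_diffeo_on M f \<longleftrightarrow>
     (\<forall>x\<in>M. \<exists>U. openin (top_of_set M) U \<and> x \<in> U \<and> C2_diffeo_on U f)"

definition signed_powr :: "real \<Rightarrow> real \<Rightarrow> real" where
  "signed_powr t \<alpha> = sgn t * \<bar>t\<bar> powr \<alpha>"

text \<open>
  For \<open>c = 0\<close> the filter \<open>at c within {0..<c}\<close> is \<open>bot\<close>, so the conditions on the left of
  \<open>c\<close> are void, as they should be; likewise on the right for \<open>c = 1\<close>.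
\<close>

definition nonflat_at :: "(real \<Rightarrow> real) \<Rightarrow> real \<Rightarrow> bool" where
  "nonflat_at f c \<longleftrightarrow> (\<exists>\<epsilon>>0. \<exists>\<alpha>\<ge>1. \<exists>\<beta>\<ge>1. \<exists>\<phi>\<^sub>0 \<phi>\<^sub>1 a b.
     C2_diffeo_on {-\<epsilon>..0} \<phi>\<^sub>0 \<and> C2_diffeo_on {0..\<epsilon>} \<phi>\<^sub>1 \<and> \<phi>\<^sub>0 0 = 0 \<and> \<phi>\<^sub>1 0 = 0 \<and>
     (f \<longlongrightarrow> a) (at c within {0..<c}) \<and> (f \<longlongrightarrow> b) (at c within {c<..1}) \<and>
     (\<forall>x\<in>{c-\<epsilon><..<c} \<inter> {0<..<1}. f x = a + signed_powr (\<phi>\<^sub>0 (x - c)) \<alpha>) \<and>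
     (\<forall>x\<in>{c<..<c+\<epsilon>} \<inter> {0<..<1}. f x = b + signed_powr (\<phi>\<^sub>1 (x - c)) \<beta>))"

definition nonflat :: "(real \<Rightarrow> real) \<Rightarrow> bool" where
  "nonflat f \<longleftrightarrow> (\<forall>c\<in>{0..1}. nonflat_at f c)"

definition backward_orbit :: "(real \<Rightarrow> real) \<Rightarrow> real set \<Rightarrow> real set" where
  "backward_orbit f U = (\<Union>j. {x\<in>{0..1}. (f ^^ j) x \<in> U})"

definition forward_orbit :: "(real \<Rightarrow> real) \<Rightarrow> real set \<Rightarrow> real \<Rightarrow> real set" where
  "forward_orbit f C x =
     (if x \<in> backward_orbit f C
      then {(f ^^ j) x | j. j \<le> (LEAST n. (f ^^ n) x \<in> C)}
      else {(f ^^ j) x | j. True})"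

text \<open>
  The set of accumulation points of the sequence \<open>(f ^^ n) x\<close>, which is the \<open>\<omega>\<close>-limit set
  of \<open>x\<close> when \<open>x\<close> is outside the backward orbit of \<open>C\<close>. On that backward orbit, which is a
  null set, the \<open>\<omega>\<close>-limit set is undefined; accordingly, basins contain none of its points.
\<close>

definition omega_limit :: "(real \<Rightarrow> real) \<Rightarrow> real \<Rightarrow> real set" where
  "omega_limit f x =
     {y. \<exists>r :: nat \<Rightarrow> nat. strict_mono r \<and> (\<lambda>n. (f ^^ r n) x) \<longlonglongrightarrow> y}"

definition basin :: "(real \<Rightarrow> real) \<Rightarrow> real set \<Rightarrow> real set \<Rightarrow> real set" where
  "basin f C A = {x \<in> {0..1} - backward_orbit f C. omega_limit f x \<subseteq> A}"

definition attractor :: "(real \<Rightarrow> real) \<Rightarrow> real set \<Rightarrow> real set \<Rightarrow> bool" where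
  "attractor f C A \<longleftrightarrow>
     A \<subseteq> {0..1} \<and> compact A \<and> emeasure lebesgue (basin f C A) > 0 \<and>
     \<not> (\<exists>A'. closed A' \<and> A' \<subset> A \<and>
            sym_diff (basin f C A') (basin f C A) \<in> null_sets lebesgue)"

definition periodic_points :: "(real \<Rightarrow> real) \<Rightarrow> real set \<Rightarrow> real set" where
  "periodic_points f C = {p \<in> {0..1} - backward_orbit f C. \<exists>n\<ge>1. (f ^^ n) p = p}"

text \<open>
  \<open>filterlim g (at_right p) (at_right p)\<close> says that \<open>g x\<close> tends to \<open>p\<close> through values larger
  than \<open>p\<close> as \<open>x\<close> tends to \<open>p\<close> from the right.
\<close>

definition right_periodic :: "(real \<Rightarrow> real) \<Rightarrow> real \<Rightarrow> nat \<Rightarrow> bool" where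
  "right_periodic f p n \<longleftrightarrow>
     0 \<le> p \<and> p < 1 \<and> n \<ge> 1 \<and> filterlim (f ^^ n) (at_right p) (at_right p) \<and>
     (\<forall>l. 1 \<le> l \<and> l < n \<longrightarrow> \<not> filterlim (f ^^ l) (at_right p) (at_right p))"

definition left_periodic :: "(real \<Rightarrow> real) \<Rightarrow> real \<Rightarrow> nat \<Rightarrow> bool" where
  "left_periodic f p n \<longleftrightarrow>
     0 < p \<and> p \<le> 1 \<and> n \<ge> 1 \<and> filterlim (f ^^ n) (at_left p) (at_left p) \<and>
     (\<forall>l. 1 \<le> l \<and> l < n \<longrightarrow> \<not> filterlim (f ^^ l) (at_left p) (at_left p))"

definition periodic_like_orbit :: "(real \<Rightarrow> real) \<Rightarrow> real set \<Rightarrow> bool" where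
  "periodic_like_orbit f A \<longleftrightarrow> (\<exists>p n.
     right_periodic f p n \<and> A = {y. \<exists>j<n. ((f ^^ j) \<longlongrightarrow> y) (at_right p)} \<or>
     left_periodic f p n \<and> A = {y. \<exists>j<n. ((f ^^ j) \<longlongrightarrow> y) (at_left p)})"

definition B0 :: "(real \<Rightarrow> real) \<Rightarrow> real set \<Rightarrow> real set" where
  "B0 f C = \<Union> {basin f C A | A. periodic_like_orbit f A \<and> attractor f C A}"

definition D_iter :: "(real \<Rightarrow> real) \<Rightarrow> nat \<Rightarrow> real \<Rightarrow> real" where
  "D_iter f n x = vector_derivative (f ^^ n) (at x within {0..1})"

end

theory Submission
  imports Defs
begin

text \<open>
  \<^bold>\<open>Reduction.\<close> Consider an orbit that keeps a positive distance from \<open>C\<close> (\<open>apart\<close>). Along it \<open>f\<close> is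
  a local diffeomorphism and \<open>ln \<bar>f'\<bar>\<close> is Lipschitz, so iterates have bounded distortion on
  intervals whose images have bounded total length. A homterval is an open interval none of
  whose images meets \<open>C\<close>. Schwartz's argument shows that homtervals touched by such an orbit
  do not wander (\<open>no_wandering_homterval\<close>); hence they are attracted to periodic orbits, and a
  point in the closure of a homterval lies in \<open>B0 f C\<close> or is preperiodic
  (\<open>B0_or_preperiodic_of_homterval\<close>). What remains are the \<open>wild\<close> points: infinite orbits apart
  from \<open>C\<close> that never touch the closure of a homterval.

  Both parts of the theorem follow from \<open>unsettled_negligible\<close>: for \<open>d > 0\<close>, the points that lie
  in no homterval and whose orbits are \<open>d\<close>-apart from \<open>C\<close> form a null set. A point whose orbit
  and \<open>\<omega>\<close>-limit set miss \<open>C\<close> is \<open>d\<close>-apart from \<open>C\<close> for some \<open>d\<close>, which gives the second part. For the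
  first part, the closure of a wild orbit consists of such points and is therefore null, and
  \<open>orbit_derivative_unbounded\<close> applies.

  \<^bold>\<open>Inducing.\<close> Near an accumulation point of a wild orbit there are intervals \<open>V\<close> that are nice
  (their end points do not return to \<open>V\<close>) and whose pullbacks along the orbit are all short
  (\<open>admissible_exists\<close>). Niceness makes pullbacks nested or disjoint. Start in \<open>V\<close>, wait until
  the orbit leaves the branch \<open>W\<close> of the first return map that it starts in, and stop at the
  next return to \<open>V\<close>. This is a stage (\<open>run_stage\<close>): a diffeomorphism from an interval \<open>J \<subseteq> V\<close>
  onto \<open>V\<close>. Its intermediate images form two towers of disjoint intervals inside a
  neighbourhood of the orbit, so the distortion is controlled by the measure of that
  neighbourhood; and \<open>J\<close> fills at most a definite fraction of \<open>V\<close>, because \<open>J\<close> and its first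
  return are disjoint and comparable. If the orbit closure is null, the neighbourhood can be
  taken so small that every stage expands by \<open>3/2\<close> (\<open>stage_expansion\<close>), and the derivative along
  the orbit is unbounded.

  \<^bold>\<open>Nullity.\<close> Let \<open>K\<close> be the closed set of \<open>unsettled_negligible\<close>. It is forward invariant and
  contains no interval. If it is not null, it has a density point \<open>y\<close>; apart from countably
  many exceptions \<open>y\<close> is wild. A pullback of \<open>V\<close> to \<open>y\<close> of bounded distortion cannot be very
  short, since it would carry the density of \<open>K\<close> at \<open>y\<close> over to \<open>V\<close>, which has a gap of \<open>K\<close> of fixed
  size. Therefore compositions of bounded total length have bounded duration
  (\<open>stage_times_bounded\<close>). In particular uniformly expanding stages are impossible
  (\<open>no_uniform_stages\<close>), because their total lengths are bounded by a geometric series. So the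
  orbit closure of \<open>y\<close> is not null (\<open>dense_wild_not_null\<close>). Bounded durations also imply that
  \<open>\<omega>\<close>-limit sets of such points contain no periodic point (\<open>dense_no_periodic\<close>) and are minimal
  (\<open>dense_omega_minimal\<close>). Thus \<open>\<omega>(y)\<close> has positive measure, and it is the orbit closure of any
  of its own density points \<open>x\<close>.

  This is contradictory (\<open>dense_minimal_impossible\<close>). If all first return branches of a small
  \<open>V\<close> are short, they expand uniformly. Otherwise let \<open>W\<close> be a long branch, and let \<open>J\<^sub>i\<close> be the
  domain of the \<open>i\<close>-th iterate of \<open>W \<rightarrow> V\<close>. The quotients \<open>\<bar>J\<^sub>i\<^sub>+\<^sub>1\<bar> / \<bar>J\<^sub>i\<bar>\<close> are bounded below
  (\<open>branch_ratio\<close>). Since durations are bounded, there is a last \<open>J\<^sub>k\<close> that the orbit visits;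
  then \<open>J\<^sub>k\<^sub>+\<^sub>1\<close> is a gap of the orbit closure that occupies a definite fraction of \<open>J\<^sub>k\<close>. But
  the first entrance of \<open>x\<close> into \<open>J\<^sub>k\<close> has bounded distortion and carries the density at \<open>x\<close> over
  to \<open>J\<^sub>k\<close>, so gaps in \<open>J\<^sub>k\<close> are small (\<open>entrance_density\<close>).
\<close>

section \<open>Lebesgue density and the measure of images\<close>

text \<open>
  Change of variables for an injective differentiable map, with the derivative replaced by a
  bound.
\<close>

lemma measure_image_bounds:
  fixes g g' :: "real \<Rightarrow> real"
  assumes S: "S \<in> lmeasurable" and bd: "g ` S \<subseteq> {0..1}"
    and der: "\<And>x. x \<in> S \<Longrightarrow> (g has_real_derivative g' x) (at x within S)"
    and inj: "inj_on g S"
  shows "g ` S \<in> lmeasurable"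
    and "(\<And>x. x \<in> S \<Longrightarrow> \<bar>g' x\<bar> \<le> B) \<Longrightarrow> measure lebesgue (g ` S) \<le> B * measure lebesgue S"
    and "(\<And>x. x \<in> S \<Longrightarrow> B \<le> \<bar>g' x\<bar>) \<Longrightarrow> B * measure lebesgue S \<le> measure lebesgue (g ` S)"
proof -
  have Sl: "S \<in> sets lebesgue" using S by (simp add: fmeasurableD)
  have "g differentiable_on S"
    using der by (meson differentiable_on_def field_differentiable_def field_differentiable_imp_differentiable)
  then have "g ` S \<in> sets lebesgue"
    by (intro differentiable_image_in_sets_lebesgue[OF Sl]) auto
  then show im: "g ` S \<in> lmeasurable"
    using bd by (meson bounded_closed_interval bounded_subset bounded_set_imp_lmeasurable)
  have one: "(\<lambda>x. 1::real) absolutely_integrable_on g ` S"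
    using im by (simp add: absolutely_integrable_on_iff_nonneg integrable_on_const)
  have iS: "(\<lambda>x. \<bar>g' x\<bar> * 1) absolutely_integrable_on S \<and>
      integral S (\<lambda>x. \<bar>g' x\<bar> * 1) = integral (g ` S) (\<lambda>x. 1::real)"
    using has_absolute_integral_change_of_variables_1'[OF Sl der inj, of "\<lambda>x. 1" "integral (g ` S) (\<lambda>x. 1)"]
      one by simp
  have m1: "integral (g ` S) (\<lambda>x. 1) = measure lebesgue (g ` S)"
    using lmeasure_integral[OF im] by simp
  have ig: "(\<lambda>x. \<bar>g' x\<bar>) integrable_on S" using iS absolutely_integrable_on_def by auto
  have eq: "measure lebesgue (g ` S) = integral S (\<lambda>x. \<bar>g' x\<bar>)" using iS m1 by simp
  have cB: "(\<lambda>x. B) integrable_on S" using S by (simp add: integrable_on_const)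
  have iB: "integral S (\<lambda>x. B) = B * measure lebesgue S"
  proof -
    have "integral S (\<lambda>x. B * 1) = B * integral S (\<lambda>x. 1)" by (rule integral_mult_right)
    then show ?thesis using lmeasure_integral[OF S] by simp
  qed
  show "measure lebesgue (g ` S) \<le> B * measure lebesgue S" if "\<And>x. x \<in> S \<Longrightarrow> \<bar>g' x\<bar> \<le> B"
    unfolding eq iB[symmetric] by (rule integral_le[OF ig cB]) (use that in auto)
  show "B * measure lebesgue S \<le> measure lebesgue (g ` S)" if "\<And>x. x \<in> S \<Longrightarrow> B \<le> \<bar>g' x\<bar>"
    unfolding eq iB[symmetric] by (rule integral_le[OF cB ig]) (use that in auto)
qed

text \<open>
  Density through all short intervals around \<open>y\<close>, not only those centred at \<open>y\<close>: pullbacks that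
  contain \<open>y\<close> need not be centred.
\<close>

definition dense_at :: "real set \<Rightarrow> real \<Rightarrow> bool" where
  "dense_at K y \<longleftrightarrow> (\<forall>\<beta>>0. \<exists>\<eta>>0. \<forall>u v. u < y \<and> y < v \<and> v - u < \<eta> \<longrightarrow>
      measure lebesgue ({u<..<v} - K) \<le> \<beta> * (v - u))"

text \<open>
  Lebesgue's density theorem for closed sets. If a point fails the condition with constant
  \<open>\<beta>\<close>, then it has arbitrarily short neighbourhoods with a \<open>\<beta>\<close>-fraction outside \<open>K\<close>. Disjoint ones
  among them, chosen by Vitali's theorem inside an open set \<open>T \<supseteq> K\<close> that exceeds \<open>K\<close> by little,
  have total length at most \<open>measure (T - K) / \<beta>\<close>.
\<close>

lemma negligible_not_dense_at:
  fixes K :: "real set"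
  assumes K: "closed K" and b: "bounded K"
  shows "negligible {y \<in> K. \<not> dense_at K y}"
proof -
  define Y where "Y \<beta> = {y \<in> K. \<forall>\<eta>>0. \<exists>u v. u < y \<and> y < v \<and> v - u < \<eta> \<and>
      measure lebesgue ({u<..<v} - K) > \<beta> * (v - u)}" for \<beta> :: real
  have Yneg: "negligible (Y \<beta>)" if \<beta>: "\<beta> > 0" for \<beta>
  proof -
    have Kl: "K \<in> lmeasurable" using K b by (simp add: lmeasurable_compact compact_eq_bounded_closed)
    then have Ks: "K \<in> sets lebesgue" by (rule fmeasurableD)
    have Bl: "ball a r - K \<in> lmeasurable" for a r
      by (rule fmeasurable_Diff[OF lmeasurable_ball Ks])
    then have Bs: "ball a r - K \<in> sets lebesgue" for a r by (rule fmeasurableD)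
    show ?thesis
      unfolding negligible_outer_le
    proof (intro allI impI)
      fix e :: real assume e: "e > 0"
      obtain T where T: "open T" "K \<subseteq> T" "T - K \<in> lmeasurable" "emeasure lebesgue (T - K) < ennreal (\<beta> * e)"
        using sets_lebesgue_outer_open[OF Ks mult_pos_pos[OF \<beta> e]] by blast
      have TK: "measure lebesgue (T - K) < \<beta> * e"
        using T(3,4) by (simp add: emeasure_eq_measure2 ennreal_less_iff)
      define I where "I = {(a,r). r > (0::real) \<and> ball a r \<subseteq> T \<and> measure lebesgue (ball a r - K) > \<beta> * (2 * r)}"
      have cov: "\<exists>i. i \<in> I \<and> x \<in> ball (fst i) (snd i) \<and> snd i < d" if x: "x \<in> Y \<beta>" and d: "d > 0" for x d
      proof -
        have "x \<in> T" using x T by (auto simp: Y_def)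
        then obtain \<rho> where \<rho>: "\<rho> > 0" "ball x \<rho> \<subseteq> T" using T(1) openE by blast
        have "min d \<rho> > 0" using d \<rho> by simp
        then obtain u v where uv: "u < x" "x < v" "v - u < min d \<rho>"
          "measure lebesgue ({u<..<v} - K) > \<beta> * (v - u)"
          using x unfolding Y_def by blast
        have bl: "ball ((u+v)/2) ((v-u)/2) = {u<..<v}"
          by (auto simp: ball_eq_greaterThanLessThan field_simps)
        have "{u<..<v} \<subseteq> ball x \<rho>" using uv by (auto simp: dist_real_def)
        then have "((u+v)/2, (v-u)/2) \<in> I"
        proof -
          have e: "2 * ((v - u) / 2) = v - u" by simp
          have "(v - u) / 2 > 0" using uv by simp
          moreover have "ball ((u+v)/2) ((v-u)/2) \<subseteq> T"
            unfolding bl using \<open>{u<..<v} \<subseteq> ball x \<rho>\<close> \<rho>(2) by (rule subset_trans)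
          moreover have "measure lebesgue (ball ((u+v)/2) ((v-u)/2) - K) > \<beta> * (2 * ((v-u)/2))"
            unfolding bl e by (rule uv(4))
          ultimately show ?thesis unfolding I_def by blast
        qed
        moreover have "x \<in> ball ((u+v)/2) ((v-u)/2)" using bl uv by simp
        moreover have "(v-u)/2 < d" using uv by auto
        ultimately show ?thesis by (intro exI[of _ "((u+v)/2, (v-u)/2)"]) simp
      qed
      obtain D where D: "countable D" "D \<subseteq> I"
        "pairwise (\<lambda>i j. disjnt (ball (fst i) (snd i)) (ball (fst j) (snd j))) D"
        "negligible (Y \<beta> - (\<Union>i\<in>D. ball (fst i) (snd i)))"
        by (rule Vitali_covering_theorem_balls[of "Y \<beta>" I fst snd, OF cov])
      let ?B = "\<lambda>i. ball (fst i) (snd (i::real\<times>real))"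
      have fin: "measure lebesgue (\<Union>i\<in>F. ?B i) \<le> e" if F: "F \<subseteq> D" "finite F" for F
      proof -
        have "measure lebesgue (\<Union>i\<in>F. ?B i) \<le> (\<Sum>i\<in>F. measure lebesgue (?B i))"
          by (rule measure_UNION_le) (use F lmeasurable_ball in \<open>auto intro: fmeasurableD\<close>)
        also have "\<dots> \<le> (\<Sum>i\<in>F. measure lebesgue (?B i - K) / \<beta>)"
        proof (rule sum_mono)
          fix i assume i: "i \<in> F"
          have "measure lebesgue (?B i) = 2 * snd i"
            using i F D(2) by (auto simp: I_def ball_eq_greaterThanLessThan)
          then show "measure lebesgue (?B i) \<le> measure lebesgue (?B i - K) / \<beta>"
            using i F D(2) \<beta> by (auto simp: I_def field_simps split: prod.splits)
        qed
        also have "\<dots> = (\<Sum>i\<in>F. measure lebesgue (?B i - K)) / \<beta>" by (simp add: sum_divide_distrib)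
        also have "(\<Sum>i\<in>F. measure lebesgue (?B i - K)) = measure lebesgue (\<Union>i\<in>F. ?B i - K)"
        proof (rule measure_finite_Union[symmetric])
          show "disjoint_family_on (\<lambda>i. ?B i - K) F"
            using D(3) F(1) unfolding pairwise_def disjoint_family_on_def disjnt_def by blast
          show "emeasure lebesgue (?B i - K) \<noteq> \<infinity>" if "i \<in> F" for i
            using fmeasurableD2[OF Bl] by simp
          show "(\<lambda>i. ?B i - K) ` F \<subseteq> sets lebesgue" using Bs by blast
        qed (rule F(2))
        also have "measure lebesgue (\<Union>i\<in>F. ?B i - K) \<le> measure lebesgue (T - K)"
        proof (rule measure_mono_fmeasurable)
          show "(\<Union>i\<in>F. ?B i - K) \<subseteq> T - K" using F D(2) unfolding I_def by fastforce
          show "(\<Union>i\<in>F. ?B i - K) \<in> sets lebesgue"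
            using F(2) Bs by (intro sets.finite_UN) blast+
        qed (rule T(3))
        finally have "measure lebesgue (\<Union>i\<in>F. ?B i) \<le> measure lebesgue (T - K) / \<beta>"
          using \<beta> by (simp add: divide_right_mono)
        also have "\<dots> \<le> e" using TK \<beta> by (simp add: field_simps)
        finally show ?thesis .
      qed
      have U: "(\<Union>i\<in>D. ?B i) \<in> lmeasurable \<and> measure lebesgue (\<Union>i\<in>D. ?B i) \<le> e"
        using fmeasurable_UN_bound[OF D(1) lmeasurable_ball fin] measure_UN_bound[OF D(1) lmeasurable_ball fin]
        by blast
      show "\<exists>T. Y \<beta> \<subseteq> T \<and> T \<in> lmeasurable \<and> measure lebesgue T \<le> e"
      proof (intro exI conjI)
        let ?N = "Y \<beta> - (\<Union>i\<in>D. ?B i)"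
        have N: "?N \<in> lmeasurable" "measure lebesgue ?N = 0"
          using D(4) by (simp_all add: negligible_imp_measurable negligible_imp_measure0)
        show "Y \<beta> \<subseteq> (\<Union>i\<in>D. ?B i) \<union> ?N" by blast
        show "(\<Union>i\<in>D. ?B i) \<union> ?N \<in> lmeasurable" using U N(1) by (blast intro: fmeasurable.Un)
        have "measure lebesgue ((\<Union>i\<in>D. ?B i) \<union> ?N) \<le> measure lebesgue (\<Union>i\<in>D. ?B i) + measure lebesgue ?N"
          by (rule measure_Un_le[OF fmeasurableD[OF conjunct1[OF U]] fmeasurableD[OF N(1)]])
        then show "measure lebesgue ((\<Union>i\<in>D. ?B i) \<union> ?N) \<le> e" using U N by linarith
      qed
    qed
  qed
  have "{y \<in> K. \<not> dense_at K y} \<subseteq> (\<Union>k. Y (1 / real (Suc k)))"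
  proof
    fix y assume "y \<in> {y \<in> K. \<not> dense_at K y}"
    then obtain \<beta> where y: "y \<in> K" and \<beta>: "\<beta> > 0"
      "\<And>\<eta>. \<eta> > 0 \<Longrightarrow> \<exists>u v. u < y \<and> y < v \<and> v - u < \<eta> \<and> measure lebesgue ({u<..<v} - K) > \<beta> * (v - u)"
      unfolding dense_at_def by (auto simp: not_le)
    obtain k where k: "1 / real (Suc k) < \<beta>" using \<beta>(1) nat_approx_posE by metis
    have "y \<in> Y (1 / real (Suc k))"
      unfolding Y_def
    proof (safe; (rule y)?)
      fix \<eta> :: real assume "\<eta> > 0"
      then obtain u v where uv: "u < y" "y < v" "v - u < \<eta>" "measure lebesgue ({u<..<v} - K) > \<beta> * (v - u)"
        using \<beta>(2) by blast
      have "1 / real (Suc k) * (v - u) < \<beta> * (v - u)" using k uv by (intro mult_strict_right_mono) auto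
      then show "\<exists>u v. u < y \<and> y < v \<and> v - u < \<eta> \<and> 1 / real (Suc k) * (v - u) < measure lebesgue ({u<..<v} - K)"
        using uv by (intro exI[of _ u] exI[of _ v]) auto
    qed
    then show "y \<in> (\<Union>k. Y (1 / real (Suc k)))" by blast
  qed
  moreover have "negligible (\<Union>k. Y (1 / real (Suc k)))"
    by (rule negligible_countable_Union) (auto intro!: Yneg)
  ultimately show ?thesis using negligible_subset by blast
qed

section \<open>Open intervals\<close>

abbreviation len :: "real set \<Rightarrow> real" where "len J \<equiv> measure lebesgue J"

text \<open>
  Nondegenerate open subintervals of \<open>(0,1)\<close>; they may share end points with \<open>[0,1]\<close>.
\<close>

definition openiv :: "real set \<Rightarrow> bool" where
  "openiv J \<longleftrightarrow> (\<exists>a b. 0 \<le> a \<and> a < b \<and> b \<le> 1 \<and> J = {a<..<b})"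

lemma openivI:
  assumes "open J" "connected J" "J \<noteq> {}" "J \<subseteq> {0..1}"
  shows "openiv J"
proof -
  let ?a = "Inf J" and ?b = "Sup J"
  have bd: "bdd_below J" "bdd_above J" using assms(4) by (meson bdd_below_Icc bdd_below_mono bdd_above_Icc bdd_above_mono)+
  have *: "\<exists>s\<in>J. s < t" "\<exists>s\<in>J. t < s" if t: "t \<in> J" for t
  proof -
    obtain e where e: "e > 0" "\<And>s. dist s t < e \<Longrightarrow> s \<in> J" using assms(1) t unfolding open_dist by blast
    have "t - e/2 \<in> J" "t + e/2 \<in> J" using e by (auto simp: dist_real_def)
    then show "\<exists>s\<in>J. s < t" "\<exists>s\<in>J. t < s" using e(1) by (auto intro: bexI[of _ "t - e/2"] bexI[of _ "t + e/2"])
  qed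
  have J: "J = {?a<..<?b}"
  proof
    show "J \<subseteq> {?a<..<?b}"
    proof
      fix t assume t: "t \<in> J"
      then obtain s u where "s \<in> J" "s < t" "u \<in> J" "t < u" using * by meson
      then show "t \<in> {?a<..<?b}" using bd cInf_lower[of s J] cSup_upper[of u J] by fastforce
    qed
    show "{?a<..<?b} \<subseteq> J"
    proof
      fix t assume "t \<in> {?a<..<?b}"
      then obtain s u where su: "s \<in> J" "s < t" "u \<in> J" "t < u"
        using bd assms(3) cInf_less_iff[of J t] less_cSup_iff[of J t] by auto
      then show "t \<in> J" using connected_contains_Icc[OF assms(2), of s u] by auto
    qed
  qed
  obtain t where t: "t \<in> J" using assms(3) by blast
  have "0 \<le> ?a" using assms(3,4) by (intro cInf_greatest) auto
  moreover have "?b \<le> 1" using assms(3,4) by (intro cSup_least) auto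
  moreover have "?a < ?b"
  proof -
    have "t \<in> {?a<..<?b}" by (rule subsetD[OF equalityD1[OF J] t])
    then show ?thesis by simp
  qed
  ultimately show ?thesis unfolding openiv_def by (intro exI[of _ ?a] exI[of _ ?b] conjI J)
qed

lemma
  assumes "openiv J"
  shows openiv_open: "open J" and openiv_conn: "connected J" and openiv_ne: "J \<noteq> {}"
    and openiv_sub: "J \<subseteq> {0<..<1}" and openiv_interval: "is_interval J"
    and openiv_lmeas: "J \<in> lmeasurable" and openiv_len_pos: "len J > 0"
    and openiv_len_le: "len J \<le> 1"
proof -
  obtain a b where J: "0 \<le> a" "a < b" "b \<le> 1" "J = {a<..<b}" using assms unfolding openiv_def by blast
  show "open J" "connected J" "J \<noteq> {}" "J \<subseteq> {0<..<1}" "is_interval J" "J \<in> lmeasurable" "len J > 0" "len J \<le> 1"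
    using J by (auto simp: is_interval_def)
qed

lemma openiv_sub01: "openiv J \<Longrightarrow> J \<subseteq> {0..1}"
  using openiv_sub by fastforce

lemma openiv_mid: "openiv J \<Longrightarrow> s \<in> J \<Longrightarrow> u \<in> J \<Longrightarrow> {s..u} \<subseteq> J"
  using openiv_conn connected_contains_Icc by blast

lemma openiv_diff_less_len:
  assumes "openiv J" "s \<in> J" "u \<in> J" shows "\<bar>s - u\<bar> < len J"
  using assms unfolding openiv_def by auto

lemma openiv_diff_le_len_closure:
  assumes "openiv J" "s \<in> closure J" "u \<in> closure J" shows "\<bar>s - u\<bar> \<le> len J"
  using assms unfolding openiv_def by auto

lemma openiv_Union:
  assumes "\<And>J. J \<in> \<J> \<Longrightarrow> openiv J \<and> t \<in> J" "\<J> \<noteq> {}"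
  shows "openiv (\<Union>\<J>)"
proof (intro openivI)
  show "open (\<Union>\<J>)" using assms openiv_open by blast
  show "connected (\<Union>\<J>)" by (rule connected_Union) (use assms openiv_conn in blast)+
  show "\<Union>\<J> \<noteq> {}" using assms by blast
  show "\<Union>\<J> \<subseteq> {0..1}" using assms openiv_sub01 by blast
qed

lemma openiv_Un: "openiv J \<Longrightarrow> openiv J' \<Longrightarrow> J \<inter> J' \<noteq> {} \<Longrightarrow> openiv (J \<union> J')"
  using openiv_Union[of "{J,J'}"] by fastforce

lemma openiv_len_mono: "openiv J \<Longrightarrow> openiv J' \<Longrightarrow> J \<subseteq> J' \<Longrightarrow> len J \<le> len J'"
  by (rule measure_mono_fmeasurable) (auto simp: openiv_lmeas fmeasurableD)

section \<open>Interval maps and their iterates\<close>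

definition away :: "real set \<Rightarrow> real \<Rightarrow> real set" where
  "away C d = {t\<in>{0..1}. \<forall>c\<in>C. d \<le> \<bar>t - c\<bar>}"

text \<open>
  The form in which \<open>C\<^sup>2\<close> smoothness enters: distortion estimates compare values of \<open>ln \<bar>f'\<bar>\<close> on
  intervals away from \<open>C\<close>.
\<close>

definition log_lipschitz :: "(real \<Rightarrow> real) \<Rightarrow> real set \<Rightarrow> real \<Rightarrow> real \<Rightarrow> bool" where
  "log_lipschitz f' C d L \<longleftrightarrow> L > 0 \<and> (\<forall>u v. u \<le> v \<and> {u..v} \<subseteq> away C d \<longrightarrow>
     \<bar>ln \<bar>f' u\<bar> - ln \<bar>f' v\<bar>\<bar> \<le> L * (v - u))"

text \<open>
  The dynamics is developed from a chosen derivative \<open>f'\<close> on \<open>[0,1] - C\<close>, which is one-sided at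
  \<open>0\<close> and \<open>1\<close>.
\<close>

locale interval_map =
  fixes f f' :: "real \<Rightarrow> real" and C :: "real set"
  assumes maps: "\<And>x. x \<in> {0..1} \<Longrightarrow> f x \<in> {0..1}"
    and finC: "finite C"
    and deriv: "\<And>x. x \<in> {0..1} - C \<Longrightarrow> (f has_real_derivative f' x) (at x within {0..1})"
    and nz: "\<And>x. x \<in> {0..1} - C \<Longrightarrow> f' x \<noteq> 0"
    and lip: "\<And>d. d > 0 \<Longrightarrow> \<exists>L. log_lipschitz f' C d L"
    and contf': "continuous_on ({0..1} - C) f'"
begin

text \<open>
  The first \<open>n\<close> iterates, starting with the identity, keep \<open>J\<close> away from \<open>C\<close>; so \<open>f\<^sup>n\<close> is a
  diffeomorphism on an open interval \<open>J\<close>.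
\<close>

definition free :: "nat \<Rightarrow> real set \<Rightarrow> bool" where
  "free n J \<longleftrightarrow> (\<forall>i<n. (f ^^ i) ` J \<inter> C = {})"

text \<open>
  The derivative of the \<open>n\<close>-th iterate, by the chain rule.
\<close>

definition Dn :: "nat \<Rightarrow> real \<Rightarrow> real" where
  "Dn n t = (\<Prod>i<n. f' ((f ^^ i) t))"

lemma it_add: "(f ^^ (m + n)) x = (f ^^ m) ((f ^^ n) x)"
  by (simp add: funpow_add)

lemma it_Suc: "(f ^^ Suc n) x = (f ^^ n) (f x)"
  using it_add[of n 1] by simp

lemma it_range: "x \<in> {0..1} \<Longrightarrow> (f ^^ n) x \<in> {0..1}"
  by (induction n) (use maps in auto)

lemma at_within_unit_interval: "x \<in> {0<..<1::real} \<Longrightarrow> at x within {0..1} = at x"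
  using at_within_interior[of x "{0..1::real}"] by simp

text \<open>
  At an interior point with value \<open>0\<close> or \<open>1\<close> the map would have a local extremum, but its
  derivative does not vanish.
\<close>

lemma interior_step:
  assumes x: "x \<in> {0<..<1}" "x \<notin> C" shows "f x \<in> {0<..<1}"
proof -
  have D: "DERIV f x :> f' x" using deriv[of x] x at_within_unit_interval[of x] by auto
  let ?d = "min x (1 - x)"
  have d: "?d > 0" using x by auto
  have r: "f y \<in> {0..1}" if "\<bar>x - y\<bar> < ?d" for y
  proof -
    have "\<bar>x - y\<bar> < x" "\<bar>x - y\<bar> < 1 - x" using that by simp_all
    then have "y \<in> {0..1}" by auto
    then show ?thesis by (rule maps)
  qed
  have "f x \<noteq> 0"
  proof
    assume "f x = 0"
    then have "f' x = 0" using DERIV_local_min[OF D d] r by auto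
    then show False using nz x by auto
  qed
  moreover have "f x \<noteq> 1"
  proof
    assume "f x = 1"
    then have "f' x = 0" using DERIV_local_max[OF D d] r by auto
    then show False using nz x by auto
  qed
  moreover have "f x \<in> {0..1}" using maps x by auto
  ultimately show ?thesis by auto
qed

lemma it_interior: "x \<in> {0<..<1} \<Longrightarrow> (\<And>i. i < n \<Longrightarrow> (f ^^ i) x \<notin> C) \<Longrightarrow> (f ^^ n) x \<in> {0<..<1}"
proof (induction n)
  case (Suc n)
  then have "(f ^^ n) x \<in> {0<..<1}" "(f ^^ n) x \<notin> C" by simp_all
  then show ?case using interior_step by simp
qed simp

lemma it_deriv_within:
  assumes "x \<in> {0..1}" "\<And>i. i < n \<Longrightarrow> (f ^^ i) x \<notin> C"
  shows "((f ^^ n) has_real_derivative Dn n x) (at x within {0..1})"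
  using assms(2)
proof (induction n)
  case 0
  show ?case by (simp add: Dn_def id_def)
next
  case (Suc n)
  have 1: "((f ^^ n) has_real_derivative Dn n x) (at x within {0..1})" using Suc by auto
  have "(f has_real_derivative f' ((f ^^ n) x)) (at ((f ^^ n) x) within {0..1})"
    by (rule deriv) (use it_range[OF assms(1), of n] Suc.prems[of n] in auto)
  then have "(f has_real_derivative f' ((f ^^ n) x)) (at ((f ^^ n) x) within (f ^^ n) ` {0..1})"
    by (rule has_field_derivative_subset) (use it_range in auto)
  from DERIV_image_chain[OF this 1] show ?case by (simp add: Dn_def mult.commute o_def)
qed

lemma it_deriv:
  assumes "x \<in> {0<..<1}" "\<And>i. i < n \<Longrightarrow> (f ^^ i) x \<notin> C"
  shows "((f ^^ n) has_real_derivative Dn n x) (at x)"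
  using it_deriv_within[of x n] assms at_within_unit_interval[of x] by auto

lemma Dn_nz: "x \<in> {0..1} \<Longrightarrow> (\<And>i. i < n \<Longrightarrow> (f ^^ i) x \<notin> C) \<Longrightarrow> Dn n x \<noteq> 0"
  unfolding Dn_def using it_range nz by auto

lemma Dn_add: "Dn (m + n) x = Dn m ((f ^^ n) x) * Dn n x"
  by (induction m) (simp_all add: Dn_def it_add)

lemma it_cont:
  assumes "x \<in> {0<..<1}" "\<And>i. i < n \<Longrightarrow> (f ^^ i) x \<notin> C"
  shows "isCont (f ^^ n) x"
  using it_deriv[OF assms] DERIV_isCont by blast

lemma it_cont_within:
  assumes "x \<in> {0..1}" "\<And>i. i < n \<Longrightarrow> (f ^^ i) x \<notin> C"
  shows "continuous (at x within {0..1}) (f ^^ n)"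
  using it_deriv_within[OF assms] has_field_derivative_imp_has_derivative has_derivative_continuous by blast

lemma it_tendsto:
  assumes "x \<in> {0..1}" "\<And>i. i < n \<Longrightarrow> (f ^^ i) x \<notin> C" "s \<longlonglongrightarrow> x" "\<And>k. s k \<in> {0..1}"
  shows "(\<lambda>k. (f ^^ n) (s k)) \<longlonglongrightarrow> (f ^^ n) x"
  using it_cont_within[OF assms(1,2)] assms(3,4) unfolding continuous_within_sequentially by (auto simp: o_def)

lemma free_le: "free n J \<Longrightarrow> m \<le> n \<Longrightarrow> free m J"
  unfolding free_def by auto

lemma free_mono: "free n J \<Longrightarrow> J' \<subseteq> J \<Longrightarrow> free n J'"
  unfolding free_def by blast

lemma freeD: "free n J \<Longrightarrow> t \<in> J \<Longrightarrow> i < n \<Longrightarrow> (f ^^ i) t \<notin> C"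
  unfolding free_def by blast

lemma freeI: "(\<And>t i. t \<in> J \<Longrightarrow> i < n \<Longrightarrow> (f ^^ i) t \<notin> C) \<Longrightarrow> free n J"
  unfolding free_def by blast

lemma free_add: "free (n + m) J \<longleftrightarrow> free n J \<and> free m ((f ^^ n) ` J)"
proof
  assume a: "free (n + m) J"
  have "free m ((f ^^ n) ` J)"
  proof (rule freeI)
    fix t i assume t: "t \<in> (f ^^ n) ` J" and i: "i < m"
    then obtain s where "s \<in> J" "t = (f ^^ n) s" by blast
    then show "(f ^^ i) t \<notin> C" using freeD[OF a, of s "i + n"] i by (simp add: it_add)
  qed
  then show "free n J \<and> free m ((f ^^ n) ` J)" using a free_le by auto
next
  assume a: "free n J \<and> free m ((f ^^ n) ` J)"
  show "free (n + m) J"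
  proof (rule freeI)
    fix t i assume t: "t \<in> J" and i: "i < n + m"
    show "(f ^^ i) t \<notin> C"
    proof (cases "i < n")
      case True then show ?thesis using a t freeD by blast
    next
      case False
      have "(f ^^ (i - n)) ((f ^^ n) t) \<notin> C" using a t i False freeD[of m "(f ^^ n) ` J"] by auto
      then show ?thesis using False by (simp flip: it_add)
    qed
  qed
qed

lemma free_Un: "free n J \<Longrightarrow> free n J' \<Longrightarrow> free n (J \<union> J')"
  unfolding free_def by blast

lemma free_deriv:
  assumes "openiv J" "free n J" "t \<in> J"
  shows "((f ^^ n) has_real_derivative Dn n t) (at t)" "Dn n t \<noteq> 0"
proof -
  have t: "t \<in> {0<..<1}" "t \<in> {0..1}" using openiv_sub[OF assms(1)] openiv_sub01[OF assms(1)] assms(3) by blast+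
  show "((f ^^ n) has_real_derivative Dn n t) (at t)" by (rule it_deriv[OF t(1) freeD[OF assms(2,3)]])
  show "Dn n t \<noteq> 0" by (rule Dn_nz[OF t(2) freeD[OF assms(2,3)]])
qed

lemma free_cont: "openiv J \<Longrightarrow> free n J \<Longrightarrow> continuous_on J (f ^^ n)"
  by (rule continuous_at_imp_continuous_on) (use free_deriv(1) DERIV_isCont in blast)

text \<open>
  The derivative of \<open>f\<^sup>n\<close> has no zero on \<open>J\<close>, so Rolle's theorem applies.
\<close>

lemma free_inj:
  assumes J: "openiv J" and fr: "free n J"
  shows "inj_on (f ^^ n) J"
proof -
  have "(f ^^ n) s \<noteq> (f ^^ n) t" if st: "s \<in> J" "t \<in> J" "s < t" for s t
  proof -
    have sub: "z \<in> J" if "s \<le> z" "z \<le> t" for z using openiv_mid[OF J st(1,2)] that by auto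
    have "\<exists>z>s. z < t \<and> (f ^^ n) t - (f ^^ n) s = (t - s) * Dn n z"
      by (rule MVT2[OF st(3) free_deriv(1)[OF J fr sub]])
    then obtain z where z: "z > s" "z < t" "(f ^^ n) t - (f ^^ n) s = (t - s) * Dn n z" by blast
    have "Dn n z \<noteq> 0" by (rule free_deriv(2)[OF J fr sub]) (use z in auto)
    then have "(t - s) * Dn n z \<noteq> 0" using st(3) by simp
    then show ?thesis using z(3) by linarith
  qed
  then show ?thesis by (intro inj_onI) (metis linorder_cases)
qed

lemma free_image:
  assumes J: "openiv J" and fr: "free n J"
  shows "openiv ((f ^^ n) ` J)"
proof (rule openivI)
  show "open ((f ^^ n) ` J)"
    using invariance_of_domain[OF free_cont[OF assms] openiv_open[OF J] free_inj[OF assms]] .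
  show "connected ((f ^^ n) ` J)"
    using connected_continuous_image[OF free_cont[OF assms] openiv_conn[OF J]] .
  show "(f ^^ n) ` J \<noteq> {}" using openiv_ne[OF J] by simp
  show "(f ^^ n) ` J \<subseteq> {0..1}" using openiv_sub01[OF J] it_range by blast
qed

lemma free_strict:
  assumes J: "openiv J" and fr: "free n J"
  shows "strict_mono_on J (f ^^ n) \<or> strict_antimono_on J (f ^^ n)"
  using injective_eq_monotone_map[OF openiv_interval[OF J] free_cont[OF assms]] free_inj[OF assms] by blast

section \<open>Pullbacks and nice intervals\<close>

text \<open>
  \<open>J\<close> is a pullback of \<open>V\<close> of order \<open>n\<close>: a diffeomorphic inverse branch of \<open>f\<^sup>n\<close> over \<open>V\<close>.
\<close>

definition pb :: "nat \<Rightarrow> real set \<Rightarrow> real set \<Rightarrow> bool" where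
  "pb n J V \<longleftrightarrow> openiv J \<and> free n J \<and> (f ^^ n) ` J = V"

lemma pb_0: "openiv V \<Longrightarrow> pb 0 V V"
  unfolding pb_def free_def by auto

lemma pb_openiv: "pb n J V \<Longrightarrow> openiv J" unfolding pb_def by simp
lemma pb_free: "pb n J V \<Longrightarrow> free n J" unfolding pb_def by simp
lemma pb_img: "pb n J V \<Longrightarrow> (f ^^ n) ` J = V" unfolding pb_def by simp
lemma pb_target: "pb n J V \<Longrightarrow> openiv V" using free_image[OF pb_openiv pb_free] by (simp add: pb_img)
lemma pb_in: "pb n J V \<Longrightarrow> t \<in> J \<Longrightarrow> (f ^^ n) t \<in> V" using pb_img by blast

lemma pb_comp: "pb n J W \<Longrightarrow> pb m W V \<Longrightarrow> pb (n + m) J V"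
proof -
  assume p: "pb n J W" "pb m W V"
  have "(f ^^ (n + m)) ` J = (f ^^ m) ` ((f ^^ n) ` J)"
    unfolding add.commute[of n m] funpow_add image_comp ..
  then show ?thesis using p free_add[of n m J] unfolding pb_def by simp
qed

lemma pb_image:
  assumes "pb n J V" "i \<le> n" shows "pb (n - i) ((f ^^ i) ` J) V"
proof -
  have "free i J" "free (n - i) ((f ^^ i) ` J)" using free_add[of i "n - i" J] assms unfolding pb_def by auto
  moreover have "(f ^^ (n - i)) ` ((f ^^ i) ` J) = (f ^^ (n - i + i)) ` J"
    unfolding funpow_add image_comp ..
  then have "(f ^^ (n - i)) ` ((f ^^ i) ` J) = V" using assms pb_img by simp
  ultimately show ?thesis using free_image[OF pb_openiv[OF assms(1)], of i] unfolding pb_def by blast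
qed

lemma openiv_pre:
  assumes J: "openiv J" and fr: "free n J" and V': "openiv V'" and ne: "(f ^^ n) ` J \<inter> V' \<noteq> {}"
  shows "openiv {t\<in>J. (f ^^ n) t \<in> V'}"
proof (rule openivI)
  have "open (J \<inter> (f ^^ n) -` V')"
    using continuous_open_preimage[OF free_cont[OF J fr] openiv_open[OF J] openiv_open[OF V']] .
  moreover have "J \<inter> (f ^^ n) -` V' = {t\<in>J. (f ^^ n) t \<in> V'}" by auto
  ultimately show "open {t\<in>J. (f ^^ n) t \<in> V'}" by simp
  have "is_interval {t\<in>J. (f ^^ n) t \<in> V'}"
    unfolding is_interval_1
  proof (intro ballI allI impI)
    fix a b x assume a: "a \<in> {t\<in>J. (f ^^ n) t \<in> V'}" and b: "b \<in> {t\<in>J. (f ^^ n) t \<in> V'}" and x: "a \<le> x \<and> x \<le> b"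
    have xJ: "x \<in> J" using openiv_mid[OF J, of a b] a b x by auto
    have "(f ^^ n) a \<le> (f ^^ n) x \<and> (f ^^ n) x \<le> (f ^^ n) b \<or> (f ^^ n) b \<le> (f ^^ n) x \<and> (f ^^ n) x \<le> (f ^^ n) a"
      using free_strict[OF J fr]
    proof
      assume "strict_mono_on J (f ^^ n)"
      then show ?thesis using a b x xJ by (auto simp: strict_mono_on_leD)
    next
      assume "strict_antimono_on J (f ^^ n)"
      then have "(f ^^ n) t \<le> (f ^^ n) s" if "s \<in> J" "t \<in> J" "s \<le> t" for s t
        using that monotone_onD[of J "(<)" "(>)" "f ^^ n" s t] by (cases "s = t") auto
      then show ?thesis using a b x xJ by auto
    qed
    then have "(f ^^ n) x \<in> V'"
      using openiv_mid[OF V', of "(f ^^ n) a" "(f ^^ n) b"] openiv_mid[OF V', of "(f ^^ n) b" "(f ^^ n) a"] a b by auto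
    then show "x \<in> {t\<in>J. (f ^^ n) t \<in> V'}" using xJ by simp
  qed
  then show "connected {t\<in>J. (f ^^ n) t \<in> V'}" using is_interval_connected by blast
  show "{t\<in>J. (f ^^ n) t \<in> V'} \<noteq> {}" using ne by auto
  show "{t\<in>J. (f ^^ n) t \<in> V'} \<subseteq> {0..1}" using openiv_sub01[OF J] by auto
qed

lemma pb_sub:
  assumes p: "pb n J V" and V': "openiv V'" "V' \<subseteq> V"
  shows "pb n {t\<in>J. (f ^^ n) t \<in> V'} V'"
  unfolding pb_def
proof (intro conjI)
  have "(f ^^ n) ` J \<inter> V' \<noteq> {}" using V' openiv_ne[OF V'(1)] pb_img[OF p] by blast
  then show "openiv {t\<in>J. (f ^^ n) t \<in> V'}"
    by (rule openiv_pre[OF pb_openiv[OF p] pb_free[OF p] V'(1)])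
  show "free n {t\<in>J. (f ^^ n) t \<in> V'}" using free_mono[OF pb_free[OF p]] by auto
  show "(f ^^ n) ` {t\<in>J. (f ^^ n) t \<in> V'} = V'" using V' pb_img[OF p] by auto
qed

text \<open>
  End points that reach \<open>C\<close> are exempt from the moment they do so. This is harmless, since \<open>f\<^sup>k\<close>
  is only applied where the first \<open>k\<close> iterates avoid \<open>C\<close>, and it is what permits end points in
  the backward orbit of \<open>C\<close>.
\<close>

definition nice :: "real set \<Rightarrow> bool" where
  "nice V \<longleftrightarrow> openiv V \<and> (\<forall>e\<in>closure V - V. \<forall>k\<ge>1. (\<forall>j<k. (f ^^ j) e \<notin> C) \<longrightarrow> (f ^^ k) e \<notin> V)"

lemma nice_openiv: "nice V \<Longrightarrow> openiv V" unfolding nice_def by simp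

lemma niceD: "nice V \<Longrightarrow> e \<in> closure V - V \<Longrightarrow> 1 \<le> k \<Longrightarrow> \<forall>j<k. (f ^^ j) e \<notin> C \<Longrightarrow> (f ^^ k) e \<notin> V"
  unfolding nice_def by simp

lemma strict_between:
  fixes g :: "real \<Rightarrow> real"
  assumes "strict_mono_on J g \<or> strict_antimono_on J g" "x \<in> J" "s \<in> J" "t \<in> J" "x < s \<and> s < t \<or> t < s \<and> s < x"
  shows "(g x - g s) * (g t - g s) < 0"
  using assms(1)
proof
  assume "strict_mono_on J g"
  then have "p \<in> J \<Longrightarrow> q \<in> J \<Longrightarrow> p < q \<Longrightarrow> g p < g q" for p q by (simp add: strict_mono_onD)
  then show ?thesis using assms(2-5) mult_neg_pos[of "g x - g s" "g t - g s"] mult_pos_neg[of "g x - g s" "g t - g s"]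
    by (meson diff_gt_0_iff_gt diff_less_0_iff_less)
next
  assume "strict_antimono_on J g"
  then have "p \<in> J \<Longrightarrow> q \<in> J \<Longrightarrow> p < q \<Longrightarrow> g p > g q" for p q by (rule monotone_onD)
  then show ?thesis using assms(2-5) mult_neg_pos[of "g x - g s" "g t - g s"] mult_pos_neg[of "g x - g s" "g t - g s"]
    by (meson diff_gt_0_iff_gt diff_less_0_iff_less)
qed

text \<open>
  A strictly monotone map sends end points to end points. The statement is about the value
  of \<open>f\<^sup>n\<close> at the end point itself, so it rests on continuity of \<open>f\<^sup>n\<close> there.
\<close>

lemma endpoint_image:
  assumes J: "openiv J" and fr: "free n J" and e: "e \<in> closure J - J" and av: "\<And>i. i < n \<Longrightarrow> (f ^^ i) e \<notin> C"
  shows "(f ^^ n) e \<in> closure ((f ^^ n) ` J) - (f ^^ n) ` J"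
proof -
  obtain s where s: "\<And>k. s k \<in> J" "s \<longlonglongrightarrow> e" using e closure_sequential by blast
  have e01: "e \<in> {0..1}" using e closure_mono[OF openiv_sub01[OF J]] by auto
  have lim: "(\<lambda>k. (f ^^ n) (s k)) \<longlonglongrightarrow> (f ^^ n) e"
    by (rule it_tendsto[OF e01 av s(2) subsetD[OF openiv_sub01[OF J] s(1)]])
  have "(f ^^ n) (s k) \<in> (f ^^ n) ` J" for k using s(1) by blast
  then have cl: "(f ^^ n) e \<in> closure ((f ^^ n) ` J)" using lim unfolding closure_sequential by (intro exI conjI allI)
  have "(f ^^ n) e \<notin> (f ^^ n) ` J"
  proof
    assume "(f ^^ n) e \<in> (f ^^ n) ` J"
    then obtain t where t: "t \<in> J" "(f ^^ n) e = (f ^^ n) t" by blast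
    obtain a b where ab: "a < b" "J = {a<..<b}" using J unfolding openiv_def by blast
    define w where "w = (e + t) / 2"
    have eab: "e = a \<or> e = b" using e unfolding ab(2) closure_greaterThanLessThan[OF ab(1)] by auto
    have w: "w \<in> J" using eab t(1) ab(2) unfolding w_def by auto
    have "e \<noteq> t" using eab t(1) ab(2) by auto
    then have "\<forall>\<^sub>F k in sequentially. dist (s k) e < \<bar>t - e\<bar> / 2"
      by (intro tendstoD[OF s(2)]) simp
    then have ev: "\<forall>\<^sub>F k in sequentially. ((f ^^ n) (s k) - (f ^^ n) w) * ((f ^^ n) t - (f ^^ n) w) \<le> 0"
    proof (rule eventually_mono)
      fix k assume d: "dist (s k) e < \<bar>t - e\<bar> / 2"
      have sk: "a < s k" "s k < b" using s(1)[of k] unfolding ab(2) by auto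
      have "s k < w \<and> w < t \<or> t < w \<and> w < s k"
        using eab
      proof
        assume "e = a"
        then show ?thesis using d t(1) sk unfolding ab(2) w_def dist_real_def by (auto simp: abs_if split: if_splits)
      next
        assume "e = b"
        then show ?thesis using d t(1) sk unfolding ab(2) w_def dist_real_def by (auto simp: abs_if split: if_splits)
      qed
      then show "((f ^^ n) (s k) - (f ^^ n) w) * ((f ^^ n) t - (f ^^ n) w) \<le> 0"
        using strict_between[OF free_strict[OF J fr] s(1)[of k] w t(1)] by linarith
    qed
    have "((f ^^ n) e - (f ^^ n) w) * ((f ^^ n) t - (f ^^ n) w) \<le> 0"
      by (rule tendsto_upperbound[OF tendsto_mult[OF tendsto_diff[OF lim tendsto_const] tendsto_const] ev
            trivial_limit_sequentially])
    then have "((f ^^ n) t - (f ^^ n) w)^2 \<le> 0" using t(2) by (simp add: power2_eq_square)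
    then have "(f ^^ n) t = (f ^^ n) w" by simp
    then have "t = w" using inj_onD[OF free_inj[OF J fr] _ t(1) w] by blast
    then show False using \<open>e \<noteq> t\<close> unfolding w_def by (simp add: field_simps)
  qed
  then show ?thesis using cl by blast
qed

lemma pb_boundary:
  assumes p: "pb m J' V" and e: "e \<in> closure J' - J'" and av: "\<And>i. i < m \<Longrightarrow> (f ^^ i) e \<notin> C"
  shows "(f ^^ m) e \<in> closure V - V"
  using endpoint_image[OF pb_openiv[OF p] pb_free[OF p] e av] pb_img[OF p] by simp

text \<open>
  If \<open>J\<close> were not inside \<open>J'\<close>, it would contain an end point \<open>e\<close> of \<open>J'\<close>. Then \<open>f\<^sup>m e\<close> is an end point
  of \<open>V\<close> whose iterate \<open>f\<^sup>n\<^sup>-\<^sup>m\<close> lies in \<open>V\<close>, against niceness.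
\<close>

lemma pullbacks_nested:
  assumes V: "nice V" and p: "pb n J V" and p': "pb m J' V" and mn: "m \<le> n" and ne: "J \<inter> J' \<noteq> {}"
  shows "J \<subseteq> J'"
proof (rule ccontr)
  assume "\<not> J \<subseteq> J'"
  then have "J \<inter> frontier J' \<noteq> {}"
    using connected_Int_frontier[OF openiv_conn[OF pb_openiv[OF p]] ne] by blast
  then obtain e where e: "e \<in> J" "e \<in> closure J' - J'"
    using openiv_open[OF pb_openiv[OF p']] unfolding frontier_def by (auto simp: interior_open)
  have fm: "free m J" using free_le[OF pb_free[OF p] mn] .
  have bd: "(f ^^ m) e \<in> closure V - V"
    by (rule pb_boundary[OF p' e(2)]) (use freeD[OF fm e(1)] in auto)
  have V2: "(f ^^ (n - m)) ((f ^^ m) e) \<in> V"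
    using pb_in[OF p e(1)] mn by (simp flip: it_add)
  show False
  proof (cases "m = n")
    case True then show False using V2 bd by simp
  next
    case False
    have "\<forall>j<n-m. (f ^^ j) ((f ^^ m) e) \<notin> C"
      using freeD[OF pb_free[OF p] e(1)] by (simp flip: it_add)
    moreover have "1 \<le> n - m" using False mn by linarith
    ultimately show False using niceD[OF V bd, of "n - m"] V2 by blast
  qed
qed

lemma pullbacks_equal:
  assumes "nice V" "pb n J V" "pb n J' V" "J \<inter> J' \<noteq> {}" shows "J = J'"
  using pullbacks_nested[OF assms(1,2,3)] pullbacks_nested[OF assms(1,3,2)] assms(4) by blast

lemma nice_pb:
  assumes V: "nice V" and p: "pb n J V"
  shows "nice J"
  unfolding nice_def
proof (intro conjI ballI allI impI)
  show "openiv J" using p pb_openiv by blast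
  fix e k assume e: "e \<in> closure J - J" and k: "1 \<le> k" and av: "\<forall>j<k. (f ^^ j) e \<notin> C"
  show "(f ^^ k) e \<notin> J"
  proof
    assume kJ: "(f ^^ k) e \<in> J"
    have avn: "(f ^^ j) e \<notin> C" if "j < n + k" for j
    proof (cases "j < k")
      case False
      have "(f ^^ (j - k)) ((f ^^ k) e) \<notin> C" using freeD[OF pb_free[OF p] kJ] False that by auto
      then show ?thesis using False by (simp flip: it_add)
    qed (use av in auto)
    have bd: "(f ^^ n) e \<in> closure V - V"
      by (rule pb_boundary[OF p e]) (use avn in auto)
    have "(f ^^ k) ((f ^^ n) e) \<in> V" using pb_in[OF p kJ] by (simp add: add.commute flip: it_add)
    moreover have "\<forall>j<k. (f ^^ j) ((f ^^ n) e) \<notin> C" using avn by (simp flip: it_add)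
    ultimately show False using niceD[OF V bd k] by blast
  qed
qed

section \<open>Bounded distortion\<close>

lemma log_lipschitz_exists: "d > 0 \<Longrightarrow> \<exists>L. log_lipschitz f' C d L" using lip .

text \<open>
  The Lipschitz constant of \<open>ln \<bar>f'\<bar>\<close> bounds the variation of \<open>ln \<bar>(f\<^sup>n)'\<bar>\<close> on \<open>J\<close> by \<open>L\<close> times the
  sum of the lengths of the intermediate images.
\<close>

lemma distortion:
  assumes L: "log_lipschitz f' C d L" and J: "openiv J" "free n J" and aw: "\<And>i. i < n \<Longrightarrow> (f ^^ i) ` J \<subseteq> away C d"
    and sum: "(\<Sum>i<n. len ((f ^^ i) ` J)) \<le> S" and u: "u \<in> J" and v: "v \<in> J"
  shows "\<bar>Dn n u\<bar> \<le> exp (L * S) * \<bar>Dn n v\<bar>"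
proof -
  have L0: "L > 0" using L unfolding log_lipschitz_def by simp
  have nzi: "f' ((f ^^ i) t) \<noteq> 0" if "t \<in> J" "i < n" for i t
    by (rule nz) (use that it_range openiv_sub01[OF J(1)] freeD[OF J(2)] in blast)
  have lnD: "ln \<bar>Dn n t\<bar> = (\<Sum>i<n. ln \<bar>f' ((f ^^ i) t)\<bar>)" if "t \<in> J" for t
    unfolding Dn_def abs_prod using nzi[OF that] by (subst ln_prod) auto
  have step: "ln \<bar>f' ((f ^^ i) u)\<bar> - ln \<bar>f' ((f ^^ i) v)\<bar> \<le> L * len ((f ^^ i) ` J)" if i: "i < n" for i
  proof -
    let ?a = "min ((f ^^ i) u) ((f ^^ i) v)" and ?b = "max ((f ^^ i) u) ((f ^^ i) v)"
    have o: "openiv ((f ^^ i) ` J)" using free_image[OF J(1)] free_le[OF J(2)] i by auto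
    have sub: "{?a..?b} \<subseteq> (f ^^ i) ` J" using openiv_mid[OF o, of ?a ?b] u v by (auto simp: min_def max_def)
    have "\<bar>ln \<bar>f' ?a\<bar> - ln \<bar>f' ?b\<bar>\<bar> \<le> L * (?b - ?a)"
      using L sub aw[OF i] unfolding log_lipschitz_def by (smt (verit) subset_trans)
    moreover have "?b - ?a \<le> len ((f ^^ i) ` J)"
      using openiv_diff_less_len[OF o, of "(f ^^ i) u" "(f ^^ i) v"] u v by auto
    ultimately have "\<bar>ln \<bar>f' ?a\<bar> - ln \<bar>f' ?b\<bar>\<bar> \<le> L * len ((f ^^ i) ` J)"
      using L0 by (meson mult_left_mono less_imp_le order_trans)
    then show ?thesis by (auto simp: min_def max_def split: if_splits)
  qed
  have "ln \<bar>Dn n u\<bar> - ln \<bar>Dn n v\<bar> = (\<Sum>i<n. ln \<bar>f' ((f ^^ i) u)\<bar> - ln \<bar>f' ((f ^^ i) v)\<bar>)"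
    using lnD u v by (simp add: sum_subtractf)
  also have "\<dots> \<le> (\<Sum>i<n. L * len ((f ^^ i) ` J))" by (rule sum_mono) (use step in auto)
  also have "\<dots> \<le> L * S" using sum L0 by (simp flip: sum_distrib_left)
  finally have "ln \<bar>Dn n u\<bar> \<le> L * S + ln \<bar>Dn n v\<bar>" by simp
  moreover have "Dn n u \<noteq> 0" "Dn n v \<noteq> 0" using free_deriv(2)[OF J] u v by auto
  ultimately have "\<bar>Dn n u\<bar> \<le> exp (L * S + ln \<bar>Dn n v\<bar>)" by (metis exp_le_cancel_iff exp_ln zero_less_abs_iff)
  then show ?thesis using \<open>Dn n v \<noteq> 0\<close> by (simp add: exp_add)
qed

lemma img_open:
  assumes J: "openiv J" "free n J" and S: "open S" "S \<subseteq> J"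
  shows "open ((f ^^ n) ` S)" "S \<in> lmeasurable" "(f ^^ n) ` S \<in> lmeasurable"
proof -
  show "open ((f ^^ n) ` S)"
    using invariance_of_domain[OF continuous_on_subset[OF free_cont[OF J] S(2)] S(1) inj_on_subset[OF free_inj[OF J] S(2)]] .
  then show "(f ^^ n) ` S \<in> lmeasurable"
  proof (rule lmeasurable_open[rotated])
    have "(f ^^ n) ` S \<subseteq> {0..1}" using it_range openiv_sub01[OF J(1)] S(2) by blast
    then show "bounded ((f ^^ n) ` S)" using bounded_subset bounded_closed_interval by blast
  qed
  show "S \<in> lmeasurable"
  proof (rule lmeasurable_open[OF _ S(1)])
    have "S \<subseteq> {0..1}" using openiv_sub01[OF J(1)] S(2) by blast
    then show "bounded S" using bounded_subset bounded_closed_interval by blast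
  qed
qed

lemma
  assumes J: "openiv J" "free n J" and S: "open S" "S \<subseteq> J"
  shows img_le: "(\<And>t. t \<in> S \<Longrightarrow> \<bar>Dn n t\<bar> \<le> B) \<Longrightarrow> len ((f ^^ n) ` S) \<le> B * len S"
    and img_ge: "(\<And>t. t \<in> S \<Longrightarrow> B \<le> \<bar>Dn n t\<bar>) \<Longrightarrow> B * len S \<le> len ((f ^^ n) ` S)"
proof -
  have 1: "(f ^^ n) ` S \<subseteq> {0..1}" using it_range openiv_sub01[OF J(1)] S(2) by blast
  have 2: "((f ^^ n) has_real_derivative Dn n t) (at t within S)" if "t \<in> S" for t
    using free_deriv(1)[OF J] that S(2) by (meson has_field_derivative_at_within subsetD)
  note * = measure_image_bounds[OF img_open(2)[OF J S] 1 2 inj_on_subset[OF free_inj[OF J] S(2)]]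
  show "(\<And>t. t \<in> S \<Longrightarrow> \<bar>Dn n t\<bar> \<le> B) \<Longrightarrow> len ((f ^^ n) ` S) \<le> B * len S" using *(2) by blast
  show "(\<And>t. t \<in> S \<Longrightarrow> B \<le> \<bar>Dn n t\<bar>) \<Longrightarrow> B * len S \<le> len ((f ^^ n) ` S)" using *(3) by blast
qed

lemma
  assumes J: "openiv J" "free n J" and D: "\<And>u v. u \<in> J \<Longrightarrow> v \<in> J \<Longrightarrow> \<bar>Dn n u\<bar> \<le> D * \<bar>Dn n v\<bar>"
  shows ratio_deriv: "v \<in> J \<Longrightarrow> len ((f ^^ n) ` J) \<le> D * \<bar>Dn n v\<bar> * len J"
    and ratio_le: "open S \<Longrightarrow> S \<subseteq> J \<Longrightarrow> len ((f ^^ n) ` S) * len J \<le> D * len S * len ((f ^^ n) ` J)"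
    and ratio_ge: "open S \<Longrightarrow> S \<subseteq> J \<Longrightarrow> len S * len ((f ^^ n) ` J) \<le> D * len ((f ^^ n) ` S) * len J"
proof -
  obtain v0 where v0: "v0 \<in> J" using openiv_ne[OF J(1)] by blast
  have D0: "D > 0"
    using D[OF v0 v0] free_deriv(2)[OF J v0] by (smt (verit) mult_nonpos_nonneg zero_less_abs_iff)
  have lJ: "len J > 0" using openiv_len_pos[OF J(1)] .
  show d: "v \<in> J \<Longrightarrow> len ((f ^^ n) ` J) \<le> D * \<bar>Dn n v\<bar> * len J" for v
    by (rule img_le[OF J openiv_open[OF J(1)] order_refl]) (use D in auto)
  show "len ((f ^^ n) ` S) * len J \<le> D * len S * len ((f ^^ n) ` J)" if S: "open S" "S \<subseteq> J"
  proof -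
    have *: "len ((f ^^ n) ` S) \<le> D * \<bar>Dn n v\<bar> * len S" if "v \<in> J" for v
      by (rule img_le[OF J S]) (use D that S in auto)
    show ?thesis
    proof (cases "len S = 0")
      case True
      then have "len ((f ^^ n) ` S) = 0" using *[OF v0] measure_nonneg[of lebesgue "(f ^^ n) ` S"] by simp
      then show ?thesis using True by simp
    next
      case False
      then have lS: "len S > 0" by (simp add: zero_less_measure_iff)
      have "len ((f ^^ n) ` S) / (D * len S) * len J \<le> len ((f ^^ n) ` J)"
        by (rule img_ge[OF J openiv_open[OF J(1)] order_refl]) (use * D0 lS in \<open>simp add: field_simps\<close>)
      then show ?thesis using D0 lS by (simp add: field_simps)
    qed
  qed
  show "len S * len ((f ^^ n) ` J) \<le> D * len ((f ^^ n) ` S) * len J" if S: "open S" "S \<subseteq> J"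
  proof -
    have "len ((f ^^ n) ` J) / (D * len J) * len S \<le> len ((f ^^ n) ` S)"
      by (rule img_ge[OF J S]) (use d S D0 lJ in \<open>auto simp: field_simps\<close>)
    then show ?thesis using D0 lJ by (simp add: field_simps)
  qed
qed

end

section \<open>Homtervals do not wander\<close>

lemma sum_len_disjoint_le:
  assumes "finite I" "disjoint_family_on A I" "\<And>i. i \<in> I \<Longrightarrow> openiv (A i)" "\<And>i. i \<in> I \<Longrightarrow> A i \<subseteq> T" "T \<in> lmeasurable"
  shows "(\<Sum>i\<in>I. len (A i)) \<le> len T"
proof -
  have m: "A i \<in> lmeasurable" if "i \<in> I" for i using assms(3)[OF that] openiv_lmeas by blast
  have s: "A i \<in> sets lebesgue" if "i \<in> I" for i using m[OF that] by (rule fmeasurableD)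
  have "(\<Sum>i\<in>I. len (A i)) = len (\<Union>i\<in>I. A i)"
  proof (rule measure_finite_Union[symmetric, OF assms(1) _ assms(2)])
    show "A ` I \<subseteq> sets lebesgue" using s by blast
    show "emeasure lebesgue (A i) \<noteq> \<infinity>" if "i \<in> I" for i using fmeasurableD2[OF m[OF that]] by simp
  qed
  also have "\<dots> \<le> len T"
  proof (rule measure_mono_fmeasurable[OF _ _ assms(5)])
    show "(\<Union>i\<in>I. A i) \<subseteq> T" using assms(4) by blast
    show "(\<Union>i\<in>I. A i) \<in> sets lebesgue" using assms(1) s by (rule sets.finite_UN)
  qed
  finally show ?thesis .
qed

lemma sum_len_disjoint_le1:
  assumes "finite I" "disjoint_family_on A I" "\<And>i. i \<in> I \<Longrightarrow> openiv (A i)"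
  shows "(\<Sum>i\<in>I. len (A i)) \<le> 1"
proof -
  have "A i \<subseteq> {0..1}" if "i \<in> I" for i using openiv_sub01[OF assms(3)[OF that]] .
  then have "(\<Sum>i\<in>I. len (A i)) \<le> len {0..1}" by (intro sum_len_disjoint_le assms) auto
  then show ?thesis by simp
qed

text \<open>
  The characterisation by infinitely many visits avoids subsequences in the rest of the
  development.
\<close>

lemma omega_limit_iff:
  "z \<in> omega_limit f x \<longleftrightarrow> (\<forall>e>0. \<forall>N. \<exists>n\<ge>N. \<bar>(f ^^ n) x - z\<bar> < e)"
proof
  assume "z \<in> omega_limit f x"
  then obtain r where r: "strict_mono r" "(\<lambda>n. (f ^^ r n) x) \<longlonglongrightarrow> z" unfolding omega_limit_def by blast
  show "\<forall>e>0. \<forall>N. \<exists>n\<ge>N. \<bar>(f ^^ n) x - z\<bar> < e"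
  proof (intro allI impI)
    fix e :: real and N assume "e > 0"
    then have "\<forall>\<^sub>F n in sequentially. dist ((f ^^ r n) x) z < e" using tendstoD[OF r(2)] by blast
    then obtain M where M: "\<And>n. n \<ge> M \<Longrightarrow> dist ((f ^^ r n) x) z < e" unfolding eventually_sequentially by blast
    have "max M N \<le> r (max M N)" using strict_mono_imp_increasing[OF r(1)] .
    then show "\<exists>n\<ge>N. \<bar>(f ^^ n) x - z\<bar> < e"
      using M[of "max M N"] by (intro exI[of _ "r (max M N)"]) (auto simp: dist_real_def)
  qed
next
  assume a: "\<forall>e>0. \<forall>N. \<exists>n\<ge>N. \<bar>(f ^^ n) x - z\<bar> < e"
  have "\<exists>r. \<forall>n. \<bar>(f ^^ r n) x - z\<bar> < 1 / real (Suc n) \<and> r n < r (Suc n)"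
  proof (rule dependent_nat_choice)
    show "\<exists>k. \<bar>(f ^^ k) x - z\<bar> < 1 / real (Suc 0)" using a by (meson zero_less_divide_1_iff of_nat_0_less_iff zero_less_Suc)
    fix k n :: nat assume "\<bar>(f ^^ k) x - z\<bar> < 1 / real (Suc n)"
    obtain y where "y \<ge> Suc k" "\<bar>(f ^^ y) x - z\<bar> < 1 / real (Suc (Suc n))"
      using a by (meson zero_less_divide_1_iff of_nat_0_less_iff zero_less_Suc)
    then show "\<exists>y. \<bar>(f ^^ y) x - z\<bar> < 1 / real (Suc (Suc n)) \<and> k < y" by auto
  qed
  then obtain r where r: "\<And>n. \<bar>(f ^^ r n) x - z\<bar> < 1 / real (Suc n)" "\<And>n. r n < r (Suc n)" by blast
  have "(\<lambda>n. (f ^^ r n) x - z) \<longlonglongrightarrow> 0"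
    by (rule Lim_null_comparison[OF _ LIMSEQ_inverse_real_of_nat])
       (use r(1) in \<open>auto simp: inverse_eq_divide intro!: always_eventually less_imp_le\<close>)
  then have "(\<lambda>n. (f ^^ r n) x) \<longlonglongrightarrow> z" by (simp add: LIM_zero_iff)
  moreover have "strict_mono r" using r(2) by (rule strict_mono_Suc_iff[THEN iffD2, rule_format])
  ultimately show "z \<in> omega_limit f x" unfolding omega_limit_def by blast
qed

lemma omega_limit_shift: "omega_limit f ((f ^^ m) x) = omega_limit f x"
proof -
  have e: "(f ^^ n) ((f ^^ m) x) = (f ^^ (n + m)) x" for n by (simp add: funpow_add)
  have "z \<in> omega_limit f ((f ^^ m) x) \<longleftrightarrow> z \<in> omega_limit f x" for z
    unfolding omega_limit_iff e
  proof (intro iffI allI impI)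
    fix e :: real and N assume "\<forall>e>0. \<forall>N. \<exists>n\<ge>N. \<bar>(f ^^ (n + m)) x - z\<bar> < e" "0 < e"
    then obtain n where "n \<ge> N" "\<bar>(f ^^ (n + m)) x - z\<bar> < e" by blast
    then show "\<exists>n\<ge>N. \<bar>(f ^^ n) x - z\<bar> < e" by (intro exI[of _ "n + m"]) auto
  next
    fix e :: real and N assume "\<forall>e>0. \<forall>N. \<exists>n\<ge>N. \<bar>(f ^^ n) x - z\<bar> < e" "0 < e"
    then obtain n where "n \<ge> N + m" "\<bar>(f ^^ n) x - z\<bar> < e" by blast
    then show "\<exists>n\<ge>N. \<bar>(f ^^ (n + m)) x - z\<bar> < e" by (intro exI[of _ "n - m"]) auto
  qed
  then show ?thesis by blast
qed

context interval_map begin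

text \<open>
  All iterates are diffeomorphisms on \<open>J\<close>.
\<close>

definition homterval :: "real set \<Rightarrow> bool" where
  "homterval J \<longleftrightarrow> openiv J \<and> (\<forall>n. free n J)"

lemma homterval_openiv: "homterval J \<Longrightarrow> openiv J" unfolding homterval_def by simp
lemma homterval_free: "homterval J \<Longrightarrow> free n J" unfolding homterval_def by simp

lemma homterval_sub: "homterval J \<Longrightarrow> openiv J' \<Longrightarrow> J' \<subseteq> J \<Longrightarrow> homterval J'"
  unfolding homterval_def using free_mono by blast

lemma homterval_Un: "homterval J \<Longrightarrow> homterval J' \<Longrightarrow> J \<inter> J' \<noteq> {} \<Longrightarrow> homterval (J \<union> J')"
  unfolding homterval_def using openiv_Un free_Un by blast

lemma homterval_image: "homterval J \<Longrightarrow> homterval ((f ^^ n) ` J)"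
  unfolding homterval_def using free_image free_add by blast

text \<open>
  A maximal homterval: overlapping homtervals unite, so it absorbs every homterval that it
  meets.
\<close>

definition maxhom :: "real set \<Rightarrow> bool" where
  "maxhom M \<longleftrightarrow> homterval M \<and> (\<forall>M'. homterval M' \<longrightarrow> M' \<inter> M \<noteq> {} \<longrightarrow> M' \<subseteq> M)"

lemma maxhom_exists:
  assumes J: "homterval J" shows "\<exists>M. maxhom M \<and> J \<subseteq> M"
proof -
  obtain t where t: "t \<in> J" using openiv_ne[OF homterval_openiv[OF J]] by blast
  let ?M = "\<Union>{M'. homterval M' \<and> J \<subseteq> M'}"
  have "openiv ?M" by (rule openiv_Union[of _ t]) (use J t homterval_openiv in auto)
  moreover have "free n ?M" for n by (rule freeI) (use freeD homterval_free in blast)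
  ultimately have M: "homterval ?M" unfolding homterval_def by blast
  have "J \<subseteq> ?M" using J by blast
  moreover have "M' \<subseteq> ?M" if "homterval M'" "M' \<inter> ?M \<noteq> {}" for M'
  proof -
    have "homterval (?M \<union> M')" by (rule homterval_Un[OF M that(1)]) (use that(2) in blast)
    then show ?thesis using \<open>J \<subseteq> ?M\<close> by blast
  qed
  ultimately show ?thesis unfolding maxhom_def using M by blast
qed

text \<open>
  The whole orbit of \<open>x\<close> keeps distance \<open>d\<close> from \<open>C\<close>.
\<close>

definition apart :: "real \<Rightarrow> real \<Rightarrow> bool" where
  "apart d x \<longleftrightarrow> x \<in> {0..1} \<and> (\<forall>n. \<forall>c\<in>C. d \<le> \<bar>(f ^^ n) x - c\<bar>)"

lemma apart01: "apart d x \<Longrightarrow> x \<in> {0..1}" unfolding apart_def by simp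

lemma apart_notC: "apart d x \<Longrightarrow> d > 0 \<Longrightarrow> (f ^^ n) x \<notin> C"
proof
  assume a: "apart d x" "d > 0" "(f ^^ n) x \<in> C"
  then have "d \<le> \<bar>(f ^^ n) x - (f ^^ n) x\<bar>" unfolding apart_def by blast
  then show False using a(2) by simp
qed

lemma apart_it: "apart d x \<Longrightarrow> apart d ((f ^^ n) x)"
  unfolding apart_def using it_range by (simp flip: it_add)

lemma apart_tendsto:
  assumes s: "\<And>k. apart d (s k)" "s \<longlonglongrightarrow> p" and d: "d > 0"
  shows "apart d p" "(\<lambda>k. (f ^^ n) (s k)) \<longlonglongrightarrow> (f ^^ n) p"
proof -
  have s01: "s k \<in> {0..1}" for k using apart01[OF s(1)] .
  have p01: "p \<in> {0..1}" using closed_sequentially[OF closed_real_atLeastAtMost s01 s(2)] .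
  have *: "(\<lambda>k. (f ^^ n) (s k)) \<longlonglongrightarrow> (f ^^ n) p \<and> (\<forall>c\<in>C. d \<le> \<bar>(f ^^ n) p - c\<bar>)" for n
  proof (induction n rule: less_induct)
    case (less n)
    have "(f ^^ i) p \<notin> C" if "i < n" for i using less[OF that] d by fastforce
    then have l: "(\<lambda>k. (f ^^ n) (s k)) \<longlonglongrightarrow> (f ^^ n) p" by (rule it_tendsto[OF p01 _ s(2) s01])
    have "d \<le> \<bar>(f ^^ n) p - c\<bar>" if c: "c \<in> C" for c
    proof (rule tendsto_lowerbound[OF tendsto_rabs[OF tendsto_diff[OF l tendsto_const]] _ trivial_limit_sequentially])
      show "\<forall>\<^sub>F k in sequentially. d \<le> \<bar>(f ^^ n) (s k) - c\<bar>" using s(1) c unfolding apart_def by simp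
    qed
    then show ?case using l by blast
  qed
  show "apart d p" unfolding apart_def using p01 * by blast
  show "(\<lambda>k. (f ^^ n) (s k)) \<longlonglongrightarrow> (f ^^ n) p" using * by blast
qed

lemma closure_img:
  assumes x: "x \<in> closure J" and J: "J \<subseteq> {0..1}" and av: "\<And>i. i < n \<Longrightarrow> (f ^^ i) x \<notin> C"
  shows "(f ^^ n) x \<in> closure ((f ^^ n) ` J)"
proof -
  obtain s where s: "\<And>k. s k \<in> J" "s \<longlonglongrightarrow> x" using x closure_sequential by blast
  have x01: "x \<in> {0..1}" using x closure_mono[OF J] by auto
  have "(\<lambda>k. (f ^^ n) (s k)) \<longlonglongrightarrow> (f ^^ n) x"
    by (rule it_tendsto[OF x01 av s(2) subsetD[OF J s(1)]])
  moreover have "(f ^^ n) (s k) \<in> (f ^^ n) ` J" for k using s(1) by blast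
  ultimately show ?thesis unfolding closure_sequential by (intro exI conjI allI)
qed

text \<open>
  Schwartz's argument. If the maximal homtervals along the orbit are pairwise disjoint,
  their lengths are summable. Take one of them, \<open>S\<close>, so late in the orbit that all later ones
  are short, and extend it by a small fraction \<open>\<theta>\<close> of its length to \<open>S'\<close>. As long as the images
  of \<open>S'\<close> are at most three times as long as those of \<open>S\<close>, they stay away from \<open>C\<close> and the
  distortion on \<open>S'\<close> is at most \<open>exp (3 L)\<close>; then the collar \<open>S' - S\<close> occupies at most half of the
  next image, which keeps the factor three. So \<open>S'\<close> is a homterval, against maximality.
\<close>

lemma no_wandering_homterval:
  assumes x: "apart d x" "d > 0"
    and M: "\<And>n. maxhom (M n)" "\<And>n. (f ^^ n) x \<in> closure (M n)" "\<And>n. (f ^^ n) ` M 0 \<subseteq> M n"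
    and disj: "\<And>n m. n \<noteq> m \<Longrightarrow> M n \<inter> M m = {}"
  shows False
proof -
  have Mh: "homterval (M n)" for n using M(1) unfolding maxhom_def by blast
  note Mo = homterval_openiv[OF Mh]
  have sum1: "(\<Sum>i<n. len (M i)) \<le> 1" for n
    by (rule sum_len_disjoint_le1) (use disj Mo in \<open>auto simp: disjoint_family_on_def\<close>)
  have "summable (\<lambda>n. len (M n))"
    by (rule summableI_nonneg_bounded[OF _ sum1]) simp
  then have "(\<lambda>n. len (M n)) \<longlonglongrightarrow> 0" by (rule summable_LIMSEQ_zero)
  then have "\<forall>\<^sub>F n in sequentially. len (M n) < min (d/8) (1/2)" by (rule order_tendstoD) (use x(2) in auto)
  then obtain n0 where n0: "\<And>n. n \<ge> n0 \<Longrightarrow> len (M n) < min (d/8) (1/2)" unfolding eventually_sequentially by blast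
  obtain L where L: "log_lipschitz f' C (d/2) L" using log_lipschitz_exists[of "d/2"] x(2) by auto
  have L0: "L > 0" using L unfolding log_lipschitz_def by simp
  define S where "S = M n0"
  obtain a b where ab: "0 \<le> a" "a < b" "b \<le> 1" "S = {a<..<b}" using Mo[of n0] unfolding S_def openiv_def by blast
  have So: "openiv S" and Sh: "homterval S" using Mo Mh unfolding S_def by auto
  have lS: "len S = b - a" using ab by simp
  define w where "w i = len ((f ^^ i) ` S)" for i
  have fS: "(f ^^ i) ` S \<subseteq> M (i + n0)" for i
  proof -
    have h: "homterval ((f ^^ i) ` S)" using homterval_image[OF Sh] .
    obtain t where t: "t \<in> M 0" using openiv_ne[OF Mo] by blast
    have "(f ^^ n0) t \<in> S" using t M(3)[of n0] unfolding S_def by blast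
    then have "(f ^^ i) ((f ^^ n0) t) \<in> (f ^^ i) ` S" by blast
    moreover have "(f ^^ (i + n0)) t \<in> M (i + n0)" using t M(3)[of "i + n0"] by blast
    ultimately have "(f ^^ i) ` S \<inter> M (i + n0) \<noteq> {}" unfolding it_add by blast
    then show ?thesis using M(1) h unfolding maxhom_def by blast
  qed
  have iSo: "openiv ((f ^^ i) ` S)" for i using homterval_openiv[OF homterval_image[OF Sh]] .
  have wle: "w i \<le> len (M (i + n0))" for i unfolding w_def by (rule openiv_len_mono[OF iSo Mo fS])
  have wd: "w i < d/8" for i using wle[of i] n0[of "i + n0"] by simp
  have sumw: "(\<Sum>i<k. w i) \<le> 1" for k
    unfolding w_def
  proof (rule sum_len_disjoint_le1)
    show "disjoint_family_on (\<lambda>i. (f ^^ i) ` S) {..<k}"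
      unfolding disjoint_family_on_def
    proof (intro ballI impI)
      fix m n :: nat assume "m \<noteq> n"
      then have "M (m + n0) \<inter> M (n + n0) = {}" by (intro disj) simp
      then show "(f ^^ m) ` S \<inter> (f ^^ n) ` S = {}" using fS[of m] fS[of n] by blast
    qed
  qed (use iSo in auto)
  \<comment> \<open>chosen such that, with distortion at most \<open>exp (3 L)\<close>, the collar of relative size \<open>\<theta>\<close> keeps at most half of every image\<close>
  define \<theta> where "\<theta> = exp (- (L * 3)) / 2"
  have th: "\<theta> > 0" "\<theta> \<le> 1/2" using L0 unfolding \<theta>_def by auto
  define \<kappa> where "\<kappa> = \<theta> * (b - a) / 2"
  have kp: "\<kappa> > 0" using th ab unfolding \<kappa>_def by simp
  \<comment> \<open>the collar may be cut off by \<open>0\<close> or \<open>1\<close>, but not on both sides, as \<open>S\<close> is shorter than \<open>1/2\<close>\<close>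
  define S' where "S' = {max 0 (a - \<kappa>)<..<min 1 (b + \<kappa>)}"
  have S'o: "openiv S'" unfolding S'_def openiv_def using ab kp by (intro exI conjI refl) auto
  have SS': "S \<subseteq> S'" unfolding S'_def ab(4) using ab kp by auto
  have lS': "len S' \<le> (1 + \<theta>) * (b - a)" "len S' \<ge> b - a"
    using ab kp unfolding S'_def \<kappa>_def by (auto simp: field_simps min_def max_def)
  have near: "(f ^^ i) ` S' \<subseteq> away C (d/2)" if fr: "free i S'" and l: "len ((f ^^ i) ` S') \<le> 3 * w i" for i
  proof
    fix t assume t: "t \<in> (f ^^ i) ` S'"
    have o: "openiv ((f ^^ i) ` S')" using free_image[OF S'o fr] .
    obtain s where s: "s \<in> (f ^^ i) ` S" using openiv_ne[OF iSo] by blast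
    have s': "s \<in> (f ^^ i) ` S'" using s SS' by blast
    have 1: "\<bar>t - s\<bar> < 3 * (d/8)" using openiv_diff_less_len[OF o t s'] l wd[of i] by linarith
    have "s \<in> closure (M (i + n0))" using s fS[of i] closure_subset by blast
    then have "\<bar>s - (f ^^ (i + n0)) x\<bar> \<le> len (M (i + n0))"
      using openiv_diff_le_len_closure[OF Mo] M(2) by blast
    then have 2: "\<bar>s - (f ^^ (i + n0)) x\<bar> < d/8" using n0[of "i + n0"] by simp
    have "d/2 \<le> \<bar>t - c\<bar>" if "c \<in> C" for c
    proof -
      have "d \<le> \<bar>(f ^^ (i + n0)) x - c\<bar>" using x(1) that unfolding apart_def by blast
      then show ?thesis using 1 2 by linarith
    qed
    then show "t \<in> away C (d/2)" unfolding away_def using openiv_sub01[OF o] t by blast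
  qed
  have main: "free k S' \<and> (\<forall>i\<le>k. len ((f ^^ i) ` S') \<le> 3 * w i)" for k
  proof (induction k)
    case 0
    have "(1 + \<theta>) * (b - a) \<le> 3 * (b - a)" using th ab by (intro mult_right_mono) auto
    then show ?case using lS' lS unfolding free_def w_def by simp
  next
    case (Suc k)
    have aw: "(f ^^ i) ` S' \<subseteq> away C (d/2)" if "i \<le> k" for i
      by (rule near) (use Suc free_le that in blast)+
    have "(f ^^ k) ` S' \<inter> C = {}" using aw[of k] x(2) unfolding away_def by fastforce
    then have fr: "free (Suc k) S'" using Suc unfolding free_def by (auto simp: less_Suc_eq)
    have "(\<Sum>i<Suc k. len ((f ^^ i) ` S')) \<le> (\<Sum>i<Suc k. 3 * w i)" using Suc by (intro sum_mono) auto
    also have "\<dots> \<le> 3" using sumw[of "Suc k"] by (simp flip: sum_distrib_left)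
    finally have sm: "(\<Sum>i<Suc k. len ((f ^^ i) ` S')) \<le> 3" .
    have dist: "\<bar>Dn (Suc k) u\<bar> \<le> exp (L * 3) * \<bar>Dn (Suc k) v\<bar>" if "u \<in> S'" "v \<in> S'" for u v
      by (rule distortion[OF L S'o fr _ sm that]) (use aw in auto)
    define T where "T = S' - {a..b}"
    define X where "X = len ((f ^^ Suc k) ` S')"
    have To: "open T" "T \<subseteq> S'" unfolding T_def using openiv_open[OF S'o] by auto
    have lT: "len T \<le> \<theta> * (b - a)"
    proof -
      have "len S' = len T + len S"
      proof -
        have "len S' = len (T \<union> {a..b} \<inter> S')" unfolding T_def by (rule arg_cong[where f=len]) blast
        also have "\<dots> = len T + len ({a..b} \<inter> S') - len (T \<inter> ({a..b} \<inter> S'))"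
          by (rule measure_Un3) (use img_open(2)[OF S'o fr To] openiv_lmeas[OF S'o] in \<open>auto intro!: fmeasurable.Int\<close>)
        also have "T \<inter> ({a..b} \<inter> S') = {}" unfolding T_def by blast
        also have "len T + len ({a..b} \<inter> S') - len {} = len T + len ({a..b} \<inter> S')" by simp
        also have "len ({a..b} \<inter> S') = len S"
        proof (rule antisym)
          show "len ({a..b} \<inter> S') \<le> len S" unfolding lS
            using measure_mono_fmeasurable[of "{a..b} \<inter> S'" "{a..b}" lebesgue] ab openiv_lmeas[OF S'o] by (auto simp: fmeasurableD)
          show "len S \<le> len ({a..b} \<inter> S')"
            by (rule measure_mono_fmeasurable) (use SS' ab openiv_lmeas[OF S'o] in \<open>auto intro!: fmeasurable.Int\<close>)
        qed
        finally show ?thesis .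
      qed
      then show ?thesis using lS' lS by (simp add: algebra_simps)
    qed
    have X0: "X \<ge> 0" unfolding X_def by simp
    have "len ((f ^^ Suc k) ` T) * len S' \<le> exp (L * 3) * len T * X"
      unfolding X_def by (rule ratio_le[OF S'o fr dist To])
    also have "\<dots> \<le> exp (L * 3) * (\<theta> * (b - a)) * X" using lT X0 by (intro mult_right_mono mult_left_mono) auto
    also have "\<dots> = (1/2) * (b - a) * X" unfolding \<theta>_def by (simp add: exp_minus field_simps)
    also have "\<dots> \<le> (1/2) * X * len S'" using mult_right_mono[OF lS'(2) X0] by (simp add: algebra_simps)
    finally have "len ((f ^^ Suc k) ` T) \<le> (1/2) * X" using openiv_len_pos[OF S'o] by simp
    moreover have "X \<le> w (Suc k) + len ((f ^^ Suc k) ` T)"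
    proof -
      let ?g = "f ^^ Suc k"
      have N: "negligible (?g ` {a,b})" by (rule negligible_finite) simp
      have Nl: "?g ` {a,b} \<in> lmeasurable" "len (?g ` {a,b}) = 0"
        using N negligible_imp_measurable negligible_imp_measure0 by blast+
      have Sl: "?g ` S \<in> lmeasurable" using openiv_lmeas[OF iSo] .
      have Tl: "?g ` T \<in> lmeasurable" using img_open(3)[OF S'o fr To] .
      have "S' \<subseteq> S \<union> T \<union> {a,b}" unfolding T_def ab(4) by auto
      then have "?g ` S' \<subseteq> ?g ` S \<union> ?g ` T \<union> ?g ` {a,b}" unfolding image_Un[symmetric] by (rule image_mono)
      then have "X \<le> len (?g ` S \<union> ?g ` T \<union> ?g ` {a,b})"
        unfolding X_def using Sl Tl Nl(1) openiv_lmeas[OF free_image[OF S'o fr]]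
        by (intro measure_mono_fmeasurable fmeasurable.Un fmeasurableD)
      also have "\<dots> \<le> len (?g ` S \<union> ?g ` T) + len (?g ` {a,b})"
        by (intro measure_Un_le fmeasurableD fmeasurable.Un Sl Tl Nl(1))
      also have "len (?g ` S \<union> ?g ` T) \<le> len (?g ` S) + len (?g ` T)"
        by (intro measure_Un_le fmeasurableD Sl Tl)
      finally show ?thesis unfolding w_def using Nl(2) by simp
    qed
    ultimately have "X \<le> 2 * w (Suc k)" by simp
    then have "X \<le> 3 * w (Suc k)" using X0 by simp
    then show ?case using Suc fr unfolding X_def by (auto simp: le_Suc_eq)
  qed
  then have "homterval S'" unfolding homterval_def using S'o by blast
  then have "S' \<subseteq> S" using M(1)[of n0] SS' openiv_ne[OF So] unfolding S_def[symmetric] maxhom_def by blast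
  then have "len S' \<le> len S" by (rule openiv_len_mono[OF S'o So])
  moreover have "b - a < 1/2" using n0[of n0] lS unfolding S_def by simp
  then have "len S' > b - a" using ab kp unfolding S'_def by (auto simp: min_def max_def)
  ultimately show False using lS by simp
qed

section \<open>Attraction to periodic orbits\<close>

text \<open>
  An increasing self-map of an open interval pushes a point that moves left monotonically to
  a limit, which may be the end point of the interval and need not belong to it.
\<close>

lemma monotone_attraction_left:
  fixes G :: "real \<Rightarrow> real"
  assumes M: "openiv M" and G: "strict_mono_on M G" "G ` M \<subseteq> M" and y: "y \<in> M" "G y < y"
  obtains p where "0 \<le> p" "p < y" "(\<lambda>i. (G ^^ i) y) \<longlonglongrightarrow> p" "{p<..<y} \<subseteq> M" "G ` {p<..<y} \<subseteq> {p<..<y}"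
    "G y \<in> {p<..<y}" "\<And>t. t \<in> {p<..<y} \<Longrightarrow> (\<lambda>i. (G ^^ i) t) \<longlonglongrightarrow> p"
proof -
  let ?s = "\<lambda>i. (G ^^ i) y"
  have GM: "t \<in> M \<Longrightarrow> G t \<in> M" for t using G(2) by blast
  have itM: "t \<in> M \<Longrightarrow> (G ^^ i) t \<in> M" for t i by (induction i) (auto intro: GM)
  have mo: "t \<in> M \<Longrightarrow> u \<in> M \<Longrightarrow> t < u \<Longrightarrow> G t < G u" for t u using G(1) by (rule strict_mono_onD)
  have itmo: "t \<in> M \<Longrightarrow> u \<in> M \<Longrightarrow> t < u \<Longrightarrow> (G ^^ i) t < (G ^^ i) u" for t u i
    by (induction i) (auto intro: mo itM)
  have dec: "?s (Suc i) < ?s i" for i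
    using itmo[OF GM[OF y(1)] y(1) y(2), of i] by (simp add: funpow_swap1)
  then have ds: "decseq ?s" by (intro decseq_SucI less_imp_le)
  have s0: "0 \<le> ?s i" for i using openiv_sub01[OF M] itM[OF y(1), of i] by auto
  obtain p where p: "?s \<longlonglongrightarrow> p" "\<And>i. p \<le> ?s i" by (rule decseq_convergent[OF ds allI[OF s0]]) blast
  have pl: "p < ?s i" for i using p(2)[of "Suc i"] dec[of i] by linarith
  have p0: "0 \<le> p" by (rule LIMSEQ_le_const[OF p(1)]) (use s0 in blast)
  have sm: "\<exists>i. ?s i < t" if "p < t" for t
    using order_tendstoD(2)[OF p(1) that] by (auto simp: eventually_sequentially)
  have IM: "{p<..<y} \<subseteq> M"
  proof
    fix t assume t: "t \<in> {p<..<y}"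
    then obtain i where "?s i < t" using sm by auto
    then show "t \<in> M" using openiv_mid[OF M itM[OF y(1), of i] y(1)] t by auto
  qed
  have lo: "p < (G ^^ i) t" if t: "t \<in> {p<..<y}" for t i
  proof -
    obtain j where j: "?s j < t" using sm t by auto
    have "(G ^^ i) (?s j) < (G ^^ i) t" using itmo[OF itM[OF y(1)] _ j] t IM by blast
    moreover have "(G ^^ i) (?s j) = ?s (i + j)" by (simp add: funpow_add)
    ultimately show ?thesis using pl[of "i + j"] by simp
  qed
  have hi: "(G ^^ i) t < ?s i" if t: "t \<in> {p<..<y}" for t i
    using itmo[OF _ y(1)] t IM by auto
  show thesis
  proof (rule that[OF p0 _ p(1) IM])
    show "p < y" using pl[of 0] by simp
    show "G ` {p<..<y} \<subseteq> {p<..<y}"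
    proof
      fix u assume "u \<in> G ` {p<..<y}"
      then obtain t where t: "t \<in> {p<..<y}" "u = G t" by blast
      have "p < u" "u < G y" using lo[OF t(1), of 1] hi[OF t(1), of 1] t(2) by auto
      then show "u \<in> {p<..<y}" using y(2) by simp
    qed
    show "G y \<in> {p<..<y}" using pl[of 1] y(2) by simp
    show "(\<lambda>i. (G ^^ i) t) \<longlonglongrightarrow> p" if t: "t \<in> {p<..<y}" for t
      by (rule tendsto_sandwich[OF _ _ tendsto_const p(1)])
         (use lo[OF t] hi[OF t] in \<open>auto intro!: always_eventually less_imp_le\<close>)
  qed
qed

lemma monotone_attraction_right:
  fixes G :: "real \<Rightarrow> real"
  assumes M: "openiv M" and G: "strict_mono_on M G" "G ` M \<subseteq> M" and y: "y \<in> M" "y < G y"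
  obtains p where "p \<le> 1" "y < p" "(\<lambda>i. (G ^^ i) y) \<longlonglongrightarrow> p" "{y<..<p} \<subseteq> M" "G ` {y<..<p} \<subseteq> {y<..<p}"
    "G y \<in> {y<..<p}" "\<And>t. t \<in> {y<..<p} \<Longrightarrow> (\<lambda>i. (G ^^ i) t) \<longlonglongrightarrow> p"
proof -
  let ?s = "\<lambda>i. (G ^^ i) y"
  have GM: "t \<in> M \<Longrightarrow> G t \<in> M" for t using G(2) by blast
  have itM: "t \<in> M \<Longrightarrow> (G ^^ i) t \<in> M" for t i by (induction i) (auto intro: GM)
  have mo: "t \<in> M \<Longrightarrow> u \<in> M \<Longrightarrow> t < u \<Longrightarrow> G t < G u" for t u using G(1) by (rule strict_mono_onD)
  have itmo: "t \<in> M \<Longrightarrow> u \<in> M \<Longrightarrow> t < u \<Longrightarrow> (G ^^ i) t < (G ^^ i) u" for t u i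
    by (induction i) (auto intro: mo itM)
  have inc: "?s i < ?s (Suc i)" for i
    using itmo[OF y(1) GM[OF y(1)] y(2), of i] by (simp add: funpow_swap1)
  then have ds: "incseq ?s" by (intro incseq_SucI less_imp_le)
  have s1: "?s i \<le> 1" for i using openiv_sub01[OF M] itM[OF y(1), of i] by auto
  obtain p where p: "?s \<longlonglongrightarrow> p" "\<And>i. ?s i \<le> p" by (rule incseq_convergent[OF ds allI[OF s1]]) blast
  have pl: "?s i < p" for i using p(2)[of "Suc i"] inc[of i] by linarith
  have p1: "p \<le> 1" by (rule LIMSEQ_le_const2[OF p(1)]) (use s1 in blast)
  have sm: "\<exists>i. t < ?s i" if "t < p" for t
    using order_tendstoD(1)[OF p(1) that] by (auto simp: eventually_sequentially)
  have IM: "{y<..<p} \<subseteq> M"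
  proof
    fix t assume t: "t \<in> {y<..<p}"
    then obtain i where "t < ?s i" using sm by auto
    then show "t \<in> M" using openiv_mid[OF M y(1) itM[OF y(1), of i]] t by auto
  qed
  have hi: "(G ^^ i) t < p" if t: "t \<in> {y<..<p}" for t i
  proof -
    obtain j where j: "t < ?s j" using sm t by auto
    have "(G ^^ i) t < (G ^^ i) (?s j)" using itmo[OF _ itM[OF y(1)] j] t IM by blast
    moreover have "(G ^^ i) (?s j) = ?s (i + j)" by (simp add: funpow_add)
    ultimately show ?thesis using pl[of "i + j"] by simp
  qed
  have lo: "?s i < (G ^^ i) t" if t: "t \<in> {y<..<p}" for t i
    using itmo[OF y(1)] t IM by auto
  show thesis
  proof (rule that[OF p1 _ p(1) IM])
    show "y < p" using pl[of 0] by simp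
    show "G ` {y<..<p} \<subseteq> {y<..<p}"
    proof
      fix u assume "u \<in> G ` {y<..<p}"
      then obtain t where t: "t \<in> {y<..<p}" "u = G t" by blast
      have "u < p" "G y < u" using hi[OF t(1), of 1] lo[OF t(1), of 1] t(2) by auto
      then show "u \<in> {y<..<p}" using y(2) by simp
    qed
    show "G y \<in> {y<..<p}" using pl[of 1] y(2) by simp
    show "(\<lambda>i. (G ^^ i) t) \<longlonglongrightarrow> p" if t: "t \<in> {y<..<p}" for t
      by (rule tendsto_sandwich[OF _ _ p(1) tendsto_const])
         (use lo[OF t] hi[OF t] in \<open>auto intro!: always_eventually less_imp_le\<close>)
  qed
qed

text \<open>
  From time \<open>m\<close> on, \<open>x\<close> lies in a homterval \<open>I\<close> next to the periodic point \<open>p\<close> that \<open>f\<^sup>q\<close> contracts to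
  \<open>p\<close>. The interval is one-sided at \<open>p\<close> since nothing is known about the other side.
\<close>

definition attracted :: "real \<Rightarrow> nat \<Rightarrow> nat \<Rightarrow> real \<Rightarrow> real set \<Rightarrow> bool" where
  "attracted x m q p I \<longleftrightarrow> homterval I \<and> (f ^^ m) x \<in> I \<and> p \<in> closure I - I \<and> (f ^^ q) ` I \<subseteq> I \<and>
     (\<forall>t\<in>I. (\<lambda>i. (f ^^ (q * i)) t) \<longlonglongrightarrow> p)"

text \<open>
  By \<open>no_wandering_homterval\<close> two of the maximal homtervals along the orbit coincide; so some
  \<open>M\<close> is mapped into itself by \<open>f\<^sup>q\<close>, and by the increasing map \<open>f\<^sup>2\<^sup>q\<close>. Unless the orbit of \<open>x\<close> is
  finite it enters \<open>M\<close> itself, because \<open>M\<close> has only two end points. There it moves monotonically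
  to a periodic point.
\<close>

lemma homterval_attracted:
  assumes J: "homterval J" and xJ: "x \<in> closure J" and x: "apart d x" "d > 0"
  shows "\<exists>m q p. q \<ge> 1 \<and> apart d p \<and> (f ^^ q) p = p \<and> ((f ^^ m) x = p \<or> (\<exists>I. attracted x m q p I))"
proof (cases "\<exists>i j. i < j \<and> (f ^^ i) x = (f ^^ j) x")
  case True
  then obtain i j where ij: "i < j" "(f ^^ i) x = (f ^^ j) x" by blast
  have "(f ^^ (j - i)) ((f ^^ i) x) = (f ^^ i) x" using ij it_add[of "j - i" i x] by simp
  then show ?thesis using apart_it[OF x(1), of i] ij(1)
    by (intro exI[of _ i] exI[of _ "j - i"] exI[of _ "(f ^^ i) x"]) auto
next
  case False
  then have inj: "(f ^^ i) x \<noteq> (f ^^ j) x" if "i < j" for i j using that by blast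
  have notC: "(f ^^ i) x \<notin> C" for i using apart_notC[OF x] .
  have "\<exists>M. maxhom M \<and> (f ^^ n) ` J \<subseteq> M" for n using maxhom_exists[OF homterval_image[OF J]] .
  then obtain M0 where M0: "\<And>n. maxhom (M0 n)" "\<And>n. (f ^^ n) ` J \<subseteq> M0 n" by metis
  have Mh: "homterval (M0 n)" for n using M0(1) unfolding maxhom_def by blast
  note Mo = homterval_openiv[OF Mh]
  have Jne: "J \<noteq> {}" using openiv_ne[OF homterval_openiv[OF J]] .
  have mx: "M' \<subseteq> M0 n" if "homterval M'" "M' \<inter> M0 n \<noteq> {}" for M' n using M0(1) that unfolding maxhom_def by blast
  have cl: "(f ^^ n) x \<in> closure (M0 n)" for n
    using closure_img[OF xJ openiv_sub01[OF homterval_openiv[OF J]] notC] closure_mono[OF M0(2)] by blast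
  have fM: "(f ^^ n) ` M0 0 \<subseteq> M0 n" for n
  proof (rule mx[OF homterval_image[OF Mh]])
    have "J \<subseteq> M0 0" using M0(2)[of 0] by simp
    then have "(f ^^ n) ` J \<subseteq> (f ^^ n) ` M0 0" by (rule image_mono)
    then show "(f ^^ n) ` M0 0 \<inter> M0 n \<noteq> {}" using M0(2)[of n] Jne by blast
  qed
  have "\<not> (\<forall>n m. n \<noteq> m \<longrightarrow> M0 n \<inter> M0 m = {})"
  proof
    assume "\<forall>n m. n \<noteq> m \<longrightarrow> M0 n \<inter> M0 m = {}"
    then have dj: "\<And>n m. n \<noteq> m \<Longrightarrow> M0 n \<inter> M0 m = {}" by blast
    show False by (rule no_wandering_homterval[OF x M0(1) cl fM dj])
  qed
  then obtain n m where nm: "n < m" "M0 n \<inter> M0 m \<noteq> {}"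
    by (metis Int_commute linorder_neqE_nat)
  define M where "M = M0 n"
  have MM: "M0 m = M" unfolding M_def using mx[OF Mh[of m], of n] mx[OF Mh[of n], of m] nm(2) by blast
  define q where "q = m - n"
  have Mho: "homterval M" "openiv M" using Mh Mo unfolding M_def by auto
  have fq: "(f ^^ q) ` M \<subseteq> M"
  proof -
    have "(f ^^ q) ` M \<subseteq> M0 m"
    proof (rule mx[OF homterval_image[OF Mho(1)]])
      obtain t where t: "t \<in> J" using Jne by blast
      have "(f ^^ n) t \<in> M" "(f ^^ m) t \<in> M0 m" using M0(2)[of n] M0(2)[of m] t unfolding M_def by blast+
      moreover have "(f ^^ m) t = (f ^^ q) ((f ^^ n) t)" unfolding q_def using nm(1) by (simp flip: it_add)
      ultimately show "(f ^^ q) ` M \<inter> M0 m \<noteq> {}" by blast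
    qed
    then show ?thesis unfolding MM .
  qed
  \<comment> \<open>the square of a monotone map is increasing\<close>
  define Q where "Q = q + q"
  have Q1: "Q \<ge> 1" unfolding Q_def q_def using nm(1) by simp
  let ?G = "f ^^ Q"
  have GM: "?G ` M \<subseteq> M" unfolding Q_def funpow_add using fq by auto
  have Gmono: "strict_mono_on M ?G"
    using free_strict[OF Mho(2) homterval_free[OF Mho(1)], of q]
  proof
    assume a: "strict_mono_on M (f ^^ q)"
    show ?thesis unfolding Q_def funpow_add
      by (rule strict_mono_onI) (use strict_mono_onD[OF a] fq in \<open>simp add: image_subset_iff\<close>)
  next
    assume a: "strict_antimono_on M (f ^^ q)"
    show ?thesis unfolding Q_def funpow_add
      by (rule strict_mono_onI) (use monotone_onD[OF a] fq in \<open>simp add: image_subset_iff\<close>)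
  qed
  have itQ: "(f ^^ (Q * i)) t = (?G ^^ i) t" for i t by (simp add: funpow_mult)
  \<comment> \<open>otherwise three points of the orbit are end points of \<open>M\<close>\<close>
  have "\<exists>k. (f ^^ k) x \<in> M"
  proof (rule ccontr)
    assume no: "\<not> (\<exists>k. (f ^^ k) x \<in> M)"
    obtain a b where ab: "a < b" "M = {a<..<b}" using Mho(2) unfolding openiv_def by blast
    have st: "(f ^^ (k + q)) x \<in> closure M - M" if k: "(f ^^ k) x \<in> closure M - M" for k
    proof -
      have "(f ^^ q) ((f ^^ k) x) \<in> closure ((f ^^ q) ` M)"
        by (rule closure_img[OF _ openiv_sub01[OF Mho(2)]]) (use k notC in \<open>auto simp flip: it_add\<close>)
      then have "(f ^^ q) ((f ^^ k) x) \<in> closure M" using closure_mono[OF fq] by blast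
      then show ?thesis using no by (simp add: add.commute flip: it_add)
    qed
    have e0: "(f ^^ n) x \<in> closure M - M" using cl[of n] no unfolding M_def by blast
    note e1 = st[OF e0] note e2 = st[OF e1]
    have "closure M - M \<subseteq> {a, b}" unfolding ab(2) closure_greaterThanLessThan[OF ab(1)] by auto
    then have "(f ^^ n) x \<in> {a,b}" "(f ^^ (n + q)) x \<in> {a,b}" "(f ^^ (n + q + q)) x \<in> {a,b}" using e0 e1 e2 by blast+
    moreover have "q > 0" using nm(1) unfolding q_def by simp
    ultimately show False using inj[of n "n + q"] inj[of "n + q" "n + q + q"] inj[of n "n + q + q"] by auto
  qed
  then obtain k where k: "(f ^^ k) x \<in> M" by blast
  let ?y = "(f ^^ k) x"
  have yG: "?G ?y = (f ^^ (Q + k)) x" by (simp add: it_add)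
  have ap: "apart d ((?G ^^ i) ?y)" for i using apart_it[OF x(1), of "Q * i + k"] by (simp add: it_add itQ)
  have fin: ?thesis if lim: "(\<lambda>i. (?G ^^ i) ?y) \<longlonglongrightarrow> p" and I: "openiv I" "I \<subseteq> M" "?G ` I \<subseteq> I" "?G ?y \<in> I" "p \<in> closure I - I"
      "\<And>t. t \<in> I \<Longrightarrow> (\<lambda>i. (?G ^^ i) t) \<longlonglongrightarrow> p" for p I
  proof -
    note at = apart_tendsto[OF ap lim x(2)]
    have "(\<lambda>i. ?G ((?G ^^ i) ?y)) \<longlonglongrightarrow> ?G p" using at(2) .
    moreover have "(\<lambda>i. ?G ((?G ^^ i) ?y)) \<longlonglongrightarrow> p" using LIMSEQ_Suc[OF lim] by simp
    ultimately have "?G p = p" using LIMSEQ_unique by blast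
    moreover have "attracted x (Q + k) Q p I"
      unfolding attracted_def itQ using homterval_sub[OF Mho(1) I(1,2)] I yG by auto
    ultimately show ?thesis using Q1 at(1) by (intro exI[of _ "Q + k"] exI[of _ Q] exI[of _ p]) blast
  qed
  have "?G ?y \<noteq> ?y" using inj[of k "Q + k"] Q1 yG by simp
  then consider "?G ?y < ?y" | "?y < ?G ?y" by linarith
  then show ?thesis
  proof cases
    case 1
    obtain p where p: "0 \<le> p" "p < ?y" "(\<lambda>i. (?G ^^ i) ?y) \<longlonglongrightarrow> p" "{p<..<?y} \<subseteq> M" "?G ` {p<..<?y} \<subseteq> {p<..<?y}"
      "?G ?y \<in> {p<..<?y}" "\<And>t. t \<in> {p<..<?y} \<Longrightarrow> (\<lambda>i. (?G ^^ i) t) \<longlonglongrightarrow> p"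
      by (rule monotone_attraction_left[OF Mho(2) Gmono GM k 1]) blast
    have "?y \<le> 1" using openiv_sub01[OF Mho(2)] k by auto
    then have o: "openiv {p<..<?y}" unfolding openiv_def using p(1,2) by blast
    show ?thesis by (rule fin[OF p(3) o p(4,5,6) _ p(7)]) (use p(2) in auto)
  next
    case 2
    obtain p where p: "p \<le> 1" "?y < p" "(\<lambda>i. (?G ^^ i) ?y) \<longlonglongrightarrow> p" "{?y<..<p} \<subseteq> M" "?G ` {?y<..<p} \<subseteq> {?y<..<p}"
      "?G ?y \<in> {?y<..<p}" "\<And>t. t \<in> {?y<..<p} \<Longrightarrow> (\<lambda>i. (?G ^^ i) t) \<longlonglongrightarrow> p"
      by (rule monotone_attraction_right[OF Mho(2) Gmono GM k 2]) blast
    have "0 \<le> ?y" using openiv_sub01[OF Mho(2)] k by auto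
    then have o: "openiv {?y<..<p}" unfolding openiv_def using p(1,2) by blast
    show ?thesis by (rule fin[OF p(3) o p(4,5,6) _ p(7)]) (use p(2) in auto)
  qed
qed

lemma attracted_iter:
  assumes a: "attracted x m q p I" and p: "apart d p" "d > 0" and t: "t \<in> I"
  shows "(\<lambda>i. (f ^^ (j + q * i)) t) \<longlonglongrightarrow> (f ^^ j) p"
proof -
  have I: "openiv I" using a homterval_openiv unfolding attracted_def by blast
  have tq: "(f ^^ (q * i)) t \<in> I" for i
  proof (induction i)
    case (Suc i)
    have "(f ^^ (q * Suc i)) t = (f ^^ q) ((f ^^ (q * i)) t)" by (simp flip: it_add)
    then show ?case using Suc a unfolding attracted_def by auto
  qed (use t in simp)
  have "(\<lambda>i. (f ^^ j) ((f ^^ (q * i)) t)) \<longlonglongrightarrow> (f ^^ j) p"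
    by (rule it_tendsto[OF apart01[OF p(1)] apart_notC[OF p] _ subsetD[OF openiv_sub01[OF I] tq]])
       (use a t in \<open>simp add: attracted_def\<close>)
  then show ?thesis by (simp add: it_add)
qed

text \<open>
  Each of the finitely many residue classes of times converges.
\<close>

lemma omega_periodic_attractor:
  assumes q: "q \<ge> 1" and lim: "\<And>j. (\<lambda>i. (f ^^ (j + q * i)) t) \<longlonglongrightarrow> (f ^^ j) p"
  shows "omega_limit f t = range (\<lambda>j. (f ^^ j) p)"
proof
  show "range (\<lambda>j. (f ^^ j) p) \<subseteq> omega_limit f t"
  proof
    fix z assume "z \<in> range (\<lambda>j. (f ^^ j) p)"
    then obtain j where "z = (f ^^ j) p" by blast
    moreover have "strict_mono (\<lambda>i. j + q * i)" using q by (auto simp: strict_mono_def)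
    ultimately show "z \<in> omega_limit f t" unfolding omega_limit_def using lim[of j] by blast
  qed
  show "omega_limit f t \<subseteq> range (\<lambda>j. (f ^^ j) p)"
  proof (rule ccontr)
    assume "\<not> omega_limit f t \<subseteq> range (\<lambda>j. (f ^^ j) p)"
    then obtain z where z: "z \<in> omega_limit f t" "\<And>j. z \<noteq> (f ^^ j) p" by blast
    have "\<exists>N. \<forall>i\<ge>N. dist ((f ^^ (j + q * i)) t) ((f ^^ j) p) < dist ((f ^^ j) p) z / 2" for j
      using tendstoD[OF lim[of j], of "dist ((f ^^ j) p) z / 2"] z(2)[of j] by (auto simp: eventually_sequentially)
    then obtain N where N: "\<And>j i. i \<ge> N j \<Longrightarrow> dist ((f ^^ (j + q * i)) t) ((f ^^ j) p) < dist ((f ^^ j) p) z / 2" by metis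
    \<comment> \<open>a distance from \<open>z\<close> that works for all residue classes at once\<close>
    define e where "e = Min ((\<lambda>j. dist ((f ^^ j) p) z / 2) ` {..<q})"
    have e0: "e > 0" unfolding e_def using z(2) q by (subst Min_gr_iff) (auto simp: lessThan_empty_iff)
    have el: "e \<le> dist ((f ^^ j) p) z / 2" if "j < q" for j unfolding e_def using that by (intro Min_le) auto
    define K where "K = Max (N ` {..<q})"
    have KN: "N j \<le> K" if "j < q" for j unfolding K_def using that by (intro Max_ge) auto
    obtain n where n: "n \<ge> q * Suc K" "\<bar>(f ^^ n) t - z\<bar> < e" using z(1) e0 unfolding omega_limit_iff by blast
    have "n mod q < q" using q by simp
    have nd: "n = n mod q + q * (n div q)" by simp
    have "n div q \<ge> K" using n(1) q by (metis Suc_leD div_le_mono nonzero_mult_div_cancel_left not_one_le_zero)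
    then have "dist ((f ^^ n) t) ((f ^^ (n mod q)) p) < dist ((f ^^ (n mod q)) p) z / 2"
      using N[of "n mod q" "n div q"] KN[OF \<open>n mod q < q\<close>] nd by simp
    then have "dist ((f ^^ n) t) z > dist ((f ^^ (n mod q)) p) z / 2"
      using dist_triangle[of "(f ^^ (n mod q)) p" z "(f ^^ n) t"] by (simp add: dist_commute)
    then show False using n(2) el[OF \<open>n mod q < q\<close>] by (simp add: dist_real_def)
  qed
qed

section \<open>Basins of periodic-like attractors\<close>

text \<open>
  An attractor requires a basin of positive measure, and \<open>emeasure\<close> vanishes on nonmeasurable
  sets. Extending \<open>f\<close> by a constant on \<open>C\<close> gives a Borel function with the same orbits off the
  backward orbit of \<open>C\<close>; for finite \<open>A\<close>, an \<open>\<omega>\<close>-limit set lies in \<open>A\<close> iff the distance of the orbit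
  to \<open>A\<close> tends to zero.
\<close>

lemma basin_measurable:
  assumes A: "finite A" "A \<noteq> {}"
  shows "basin f C A \<in> sets lebesgue"
proof -
  define D where "D = {0..1} - C"
  define g where "g = (\<lambda>x. if x \<in> D then f x else 0)"
  have Db: "D \<in> sets borel" unfolding D_def by (intro sets.Diff borel_closed closed_real_atLeastAtMost finite_imp_closed finC)
  have "continuous_on D f"
  proof -
    have "continuous (at x within D) f" if "x \<in> D" for x
    proof -
      have "(f has_real_derivative f' x) (at x within {0..1})" using deriv that unfolding D_def by blast
      then have "continuous (at x within {0..1}) f" using has_field_derivative_imp_has_derivative has_derivative_continuous by blast
      then show ?thesis by (rule continuous_within_subset) (auto simp: D_def)
    qed
    then show ?thesis by (simp add: continuous_on_eq_continuous_within)
  qed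
  then have gm: "g \<in> borel_measurable borel"
    unfolding g_def by (rule borel_measurable_continuous_on_if[OF Db]) auto
  have gn: "(g ^^ n) \<in> borel_measurable borel" for n
    by (induction n) (auto intro: measurable_comp[OF _ gm, unfolded o_def] simp: id_def)
  have eqg: "(g ^^ n) x = (f ^^ n) x" if "\<And>i. i < n \<Longrightarrow> (f ^^ i) x \<in> D" for n x
    using that by (induction n) (auto simp: g_def)
  have eqf: "(g ^^ n) x = (f ^^ n) x" if "\<And>i. i < n \<Longrightarrow> (g ^^ i) x \<in> D" for n x
    using that
  proof (induction n)
    case (Suc n)
    have "(g ^^ n) x = (f ^^ n) x" using Suc by simp
    moreover have "(g ^^ n) x \<in> D" using Suc.prems[of n] by simp
    ultimately show ?case by (simp add: g_def)
  qed simp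
  have Ac: "closed A" using A(1) by (rule finite_imp_closed)
  have om: "omega_limit f x \<subseteq> A \<longleftrightarrow> (\<forall>k. \<exists>N. \<forall>n\<ge>N. infdist ((f ^^ n) x) A < 1 / real (Suc k))" if x: "x \<in> {0..1}" for x
  proof
    assume o: "omega_limit f x \<subseteq> A"
    show "\<forall>k. \<exists>N. \<forall>n\<ge>N. infdist ((f ^^ n) x) A < 1 / real (Suc k)"
    proof (rule ccontr)
      assume "\<not> (\<forall>k. \<exists>N. \<forall>n\<ge>N. infdist ((f ^^ n) x) A < 1 / real (Suc k))"
      then obtain k where "\<not> (\<exists>N. \<forall>n\<ge>N. infdist ((f ^^ n) x) A < 1 / real (Suc k))" by blast
      then have k: "\<exists>n\<ge>N. infdist ((f ^^ n) x) A \<ge> 1 / real (Suc k)" for N using not_less by blast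
      have "\<exists>n>N. infdist ((f ^^ n) x) A \<ge> 1 / real (Suc k)" for N
        using k[of "Suc N"] by (auto simp: Suc_le_eq)
      then have "infinite {n. infdist ((f ^^ n) x) A \<ge> 1 / real (Suc k)}" unfolding infinite_nat_iff_unbounded by blast
      from infinite_enumerate[OF this] obtain r :: "nat \<Rightarrow> nat"
        where r': "strict_mono r" "\<forall>n. r n \<in> {n. infdist ((f ^^ n) x) A \<ge> 1 / real (Suc k)}" by blast
      then have r: "strict_mono r" "\<And>n. infdist ((f ^^ r n) x) A \<ge> 1 / real (Suc k)" by simp_all
      have "\<forall>n. (f ^^ r n) x \<in> {0..1}" using it_range[OF x] by blast
      then obtain z s where z: "strict_mono s" "((\<lambda>n. (f ^^ r n) x) \<circ> s) \<longlonglongrightarrow> z"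
        using compact_imp_seq_compact[OF compact_Icc[of 0 1]] unfolding seq_compact_def by meson
      have "z \<in> omega_limit f x" unfolding omega_limit_def
        using strict_mono_o[OF r(1) z(1)] z(2) by (auto simp: o_def)
      then have "infdist z A = 0" using o by auto
      moreover have "infdist z A \<ge> 1 / real (Suc k)"
        by (rule tendsto_lowerbound[OF tendsto_infdist[OF z(2)]]) (use r(2) in auto)
      ultimately show False by simp
    qed
  next
    assume a: "\<forall>k. \<exists>N. \<forall>n\<ge>N. infdist ((f ^^ n) x) A < 1 / real (Suc k)"
    show "omega_limit f x \<subseteq> A"
    proof
      fix z assume "z \<in> omega_limit f x"
      then obtain r where r: "strict_mono r" "(\<lambda>n. (f ^^ r n) x) \<longlonglongrightarrow> z" unfolding omega_limit_def by blast
      have "infdist z A \<le> 1 / real (Suc k)" for k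
      proof -
        obtain N where N: "\<And>n. n \<ge> N \<Longrightarrow> infdist ((f ^^ n) x) A < 1 / real (Suc k)" using a by blast
        show ?thesis
        proof (rule tendsto_upperbound[OF tendsto_infdist[OF r(2)] _ trivial_limit_sequentially])
          show "\<forall>\<^sub>F n in sequentially. infdist ((f ^^ r n) x) A \<le> 1 / real (Suc k)"
            unfolding eventually_sequentially
            using N strict_mono_imp_increasing[OF r(1)] by (meson le_trans less_imp_le)
        qed
      qed
      then have "infdist z A \<le> 0" by (metis nat_approx_posE not_le)
      then have "infdist z A = 0" using infdist_nonneg[of z A] by linarith
      then show "z \<in> A" using in_closed_iff_infdist_zero[OF Ac A(2)] by blast
    qed
  qed
  have "basin f C A = {x. (\<forall>n. (g ^^ n) x \<in> D) \<and> (\<forall>k. \<exists>N. \<forall>n\<ge>N. infdist ((g ^^ n) x) A < 1 / real (Suc k))}"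
  proof (intro set_eqI iffI)
    fix x assume "x \<in> basin f C A"
    then have x: "x \<in> {0..1}" "\<And>n. (f ^^ n) x \<notin> C" "omega_limit f x \<subseteq> A"
      unfolding basin_def backward_orbit_def by blast+
    have xD: "(f ^^ n) x \<in> D" for n using it_range[OF x(1)] x(2) unfolding D_def by blast
    have e: "(g ^^ n) x = (f ^^ n) x" for n by (rule eqg[OF xD])
    show "x \<in> {x. (\<forall>n. (g ^^ n) x \<in> D) \<and> (\<forall>k. \<exists>N. \<forall>n\<ge>N. infdist ((g ^^ n) x) A < 1 / real (Suc k))}"
      unfolding mem_Collect_eq e using om[OF x(1)] x(3) xD by blast
  next
    fix x assume "x \<in> {x. (\<forall>n. (g ^^ n) x \<in> D) \<and> (\<forall>k. \<exists>N. \<forall>n\<ge>N. infdist ((g ^^ n) x) A < 1 / real (Suc k))}"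
    then have x: "\<And>n. (g ^^ n) x \<in> D" "\<forall>k. \<exists>N. \<forall>n\<ge>N. infdist ((g ^^ n) x) A < 1 / real (Suc k)"
      unfolding mem_Collect_eq by blast+
    have e: "(g ^^ n) x = (f ^^ n) x" for n by (rule eqf[OF x(1)])
    have x01: "x \<in> {0..1}" using x(1)[of 0] unfolding D_def by simp
    have "(f ^^ n) x \<notin> C" for n using x(1)[of n] unfolding e D_def by blast
    then have "x \<notin> backward_orbit f C" unfolding backward_orbit_def by blast
    moreover have "omega_limit f x \<subseteq> A" using om[OF x01] x(2) unfolding e by blast
    ultimately show "x \<in> basin f C A" using x01 unfolding basin_def by blast
  qed
  also have "\<dots> \<in> sets borel"
  proof -
    have [measurable]: "(\<lambda>x. (g ^^ n) x) \<in> borel_measurable borel" for n using gn .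
    have [measurable]: "(\<lambda>x. infdist x A) \<in> borel_measurable borel"
      by (intro borel_measurable_continuous_onI continuous_intros)
    have [measurable]: "(\<lambda>x. infdist ((g ^^ n) x) A) \<in> borel_measurable borel" for n by measurable
    have 1: "{x. \<forall>n. (g ^^ n) x \<in> D} = (\<Inter>n. (g ^^ n) -` D)" by auto
    have "{x. \<forall>n. (g ^^ n) x \<in> D} \<in> sets borel" unfolding 1
      using measurable_sets[OF gn Db] by (intro sets.countable_INT) auto
    moreover have "{x. \<forall>k. \<exists>N. \<forall>n\<ge>N. infdist ((g ^^ n) x) A < 1 / real (Suc k)} \<in> sets borel"
      by measurable
    ultimately have "{x. \<forall>n. (g ^^ n) x \<in> D} \<inter> {x. \<forall>k. \<exists>N. \<forall>n\<ge>N. infdist ((g ^^ n) x) A < 1 / real (Suc k)} \<in> sets borel"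
      by (rule sets.Int)
    then show ?thesis by (simp only: Collect_conj_eq)
  qed
  finally show ?thesis by simp
qed

lemma tendsto_lateral:
  assumes "p \<in> {0..1}" "\<And>n. (f ^^ n) p \<notin> C"
  shows "p < 1 \<Longrightarrow> ((f ^^ j) \<longlongrightarrow> (f ^^ j) p) (at_right p)" "0 < p \<Longrightarrow> ((f ^^ j) \<longlongrightarrow> (f ^^ j) p) (at_left p)"
proof -
  have t: "((f ^^ j) \<longlongrightarrow> (f ^^ j) p) (at p within {0..1})"
    using it_cont_within[OF assms(1), of j] assms(2) by (simp add: continuous_within)
  show "((f ^^ j) \<longlongrightarrow> (f ^^ j) p) (at_right p)" if "p < 1"
  proof -
    have "at p within {p<..} = at p within {p<..<1}"
      by (rule at_within_nhd[of _ "{..<1}"]) (use that in auto)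
    moreover have "{p<..<1} \<subseteq> {0..1}" using assms(1) by auto
    ultimately show ?thesis using tendsto_within_subset[OF t] by simp
  qed
  show "((f ^^ j) \<longlongrightarrow> (f ^^ j) p) (at_left p)" if "0 < p"
  proof -
    have "at p within {..<p} = at p within {0<..<p}"
      by (rule at_within_nhd[of _ "{0<..}"]) (use that in auto)
    moreover have "{0<..<p} \<subseteq> {0..1}" using assms(1) by auto
    ultimately show ?thesis using tendsto_within_subset[OF t] by simp
  qed
qed

text \<open>
  The lateral period of \<open>p\<close>, seen from the side of \<open>I\<close>, may be smaller than \<open>q\<close>. Whatever it is,
  the lateral limits are the points of the orbit of \<open>p\<close>, since \<open>f\<close> is continuous along that
  orbit.
\<close>

lemma periodic_like_orbit_of_attraction:
  assumes I: "openiv I" "p \<in> closure I - I" "(f ^^ q) ` I \<subseteq> I"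
    and q: "q \<ge> 1" "(f ^^ q) p = p" and p: "apart d p" "d > 0"
  shows "periodic_like_orbit f (range (\<lambda>j. (f ^^ j) p))"
proof -
  have p01: "p \<in> {0..1}" using apart01[OF p(1)] .
  have nC: "(f ^^ n) p \<notin> C" for n using apart_notC[OF p] .
  obtain u v where uv: "0 \<le> u" "u < v" "v \<le> 1" "I = {u<..<v}" using I(1) unfolding openiv_def by blast
  have "p = u \<or> p = v" using I(2) unfolding uv(4) closure_greaterThanLessThan[OF uv(2)] by auto
  have orb: "{y. \<exists>j<n. ((f ^^ j) \<longlongrightarrow> y) F} = range (\<lambda>j. (f ^^ j) p)"
    if F: "F \<noteq> bot" "\<And>j. ((f ^^ j) \<longlongrightarrow> (f ^^ j) p) F" and n: "n \<ge> 1" "((f ^^ n) \<longlongrightarrow> p) F" for n F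
  proof -
    have np: "(f ^^ n) p = p" using tendsto_unique[OF F(1) F(2) n(2)] .
    have "range (\<lambda>j. (f ^^ j) p) \<subseteq> {y. \<exists>j<n. ((f ^^ j) \<longlongrightarrow> y) F}"
    proof
      fix y assume "y \<in> range (\<lambda>j. (f ^^ j) p)"
      then obtain j where "y = (f ^^ j) p" by blast
      then have "y = (f ^^ (j mod n)) p" using funpow_mod_eq[OF np] by simp
      moreover have "j mod n < n" using n(1) by simp
      ultimately show "y \<in> {y. \<exists>j<n. ((f ^^ j) \<longlongrightarrow> y) F}" using F(2)[of "j mod n"] by blast
    qed
    moreover have "{y. \<exists>j<n. ((f ^^ j) \<longlongrightarrow> y) F} \<subseteq> range (\<lambda>j. (f ^^ j) p)"
      using tendsto_unique[OF F(1) F(2)] by blast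
    ultimately show ?thesis by blast
  qed
  from \<open>p = u \<or> p = v\<close> show ?thesis
  proof
    assume pu: "p = u"
    define P where "P l \<longleftrightarrow> 1 \<le> l \<and> filterlim (f ^^ l) (at_right p) (at_right p)" for l
    have p1: "p < 1" using pu uv by simp
    note tl = tendsto_lateral(1)[OF p01 nC p1]
    have "\<forall>\<^sub>F x in at_right p. (f ^^ q) x \<in> {p<..} \<and> (f ^^ q) x \<noteq> p"
      unfolding eventually_at_right_field
    proof (intro exI[of _ v] conjI allI impI)
      fix y assume "p < y" "y < v"
      then have "y \<in> I" using uv(4) pu by simp
      then have "(f ^^ q) y \<in> I" using I(3) by blast
      then show "(f ^^ q) y \<in> {p<..}" "(f ^^ q) y \<noteq> p" using uv(4) pu by auto
    qed (use uv pu in simp)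
    then have "P q" unfolding P_def using q(1) tl[of q] q(2) by (auto simp: filterlim_at)
    define n where "n = (LEAST l. P l)"
    have n: "P n" "\<And>l. l < n \<Longrightarrow> \<not> P l" unfolding n_def by (rule LeastI[of P, OF \<open>P q\<close>]) (rule not_less_Least)
    have rp: "right_periodic f p n" unfolding right_periodic_def using n p01 p1 unfolding P_def by auto
    have "((f ^^ n) \<longlongrightarrow> p) (at_right p)" using n(1) unfolding P_def by (auto simp: filterlim_at)
    then have "{y. \<exists>j<n. ((f ^^ j) \<longlongrightarrow> y) (at_right p)} = range (\<lambda>j. (f ^^ j) p)"
      using n(1) unfolding P_def by (intro orb tl) (auto simp: trivial_limit_at_right_real)
    then show ?thesis unfolding periodic_like_orbit_def using rp by blast
  next
    assume pv: "p = v"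
    define P where "P l \<longleftrightarrow> 1 \<le> l \<and> filterlim (f ^^ l) (at_left p) (at_left p)" for l
    have p1: "0 < p" using pv uv by simp
    note tl = tendsto_lateral(2)[OF p01 nC p1]
    have "\<forall>\<^sub>F x in at_left p. (f ^^ q) x \<in> {..<p} \<and> (f ^^ q) x \<noteq> p"
      unfolding eventually_at_left_field
    proof (intro exI[of _ u] conjI allI impI)
      fix y assume "u < y" "y < p"
      then have "y \<in> I" using uv(4) pv by simp
      then have "(f ^^ q) y \<in> I" using I(3) by blast
      then show "(f ^^ q) y \<in> {..<p}" "(f ^^ q) y \<noteq> p" using uv(4) pv by auto
    qed (use uv pv in simp)
    then have "P q" unfolding P_def using q(1) tl[of q] q(2) by (auto simp: filterlim_at)
    define n where "n = (LEAST l. P l)"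
    have n: "P n" "\<And>l. l < n \<Longrightarrow> \<not> P l" unfolding n_def by (rule LeastI[of P, OF \<open>P q\<close>]) (rule not_less_Least)
    have rp: "left_periodic f p n" unfolding left_periodic_def using n p01 p1 unfolding P_def by auto
    have "((f ^^ n) \<longlongrightarrow> p) (at_left p)" using n(1) unfolding P_def by (auto simp: filterlim_at)
    then have "{y. \<exists>j<n. ((f ^^ j) \<longlongrightarrow> y) (at_left p)} = range (\<lambda>j. (f ^^ j) p)"
      using n(1) unfolding P_def by (intro orb tl) (auto simp: trivial_limit_at_left_real)
    then show ?thesis unfolding periodic_like_orbit_def using rp by blast
  qed
qed

text \<open>
  Every point of the open interval \<open>I\<close> has the full orbit of \<open>p\<close> as its \<open>\<omega>\<close>-limit set. So the
  basin has positive measure, and the basin of a smaller set misses all of \<open>I\<close>.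
\<close>

lemma attracted_imp_B0:
  assumes a: "attracted x m q p I" and q: "q \<ge> 1" "(f ^^ q) p = p" and p: "apart d p" "d > 0"
    and x: "x \<in> {0..1}" "\<And>n. (f ^^ n) x \<notin> C"
  shows "x \<in> B0 f C"
proof -
  let ?A = "range (\<lambda>j. (f ^^ j) p)"
  have h: "homterval I" and I: "openiv I" "p \<in> closure I - I" "(f ^^ q) ` I \<subseteq> I" "(f ^^ m) x \<in> I"
    using a homterval_openiv unfolding attracted_def by blast+
  have om: "omega_limit f t = ?A" if "t \<in> I" for t
    by (rule omega_periodic_attractor[OF q(1) attracted_iter[OF a p that]])
  have fin: "finite ?A"
  proof -
    have "?A \<subseteq> (\<lambda>j. (f ^^ j) p) ` {..<q}"
    proof
      fix z assume "z \<in> ?A"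
      then obtain j where "z = (f ^^ j) p" by blast
      then have "z = (f ^^ (j mod q)) p" using funpow_mod_eq[OF q(2)] by simp
      then show "z \<in> (\<lambda>j. (f ^^ j) p) ` {..<q}" using q(1) by auto
    qed
    then show ?thesis using finite_surj by blast
  qed
  have tb: "t \<notin> backward_orbit f C" if "t \<in> I" for t
    unfolding backward_orbit_def using freeD[OF homterval_free[OF h] that] by blast
  have Ib: "I \<subseteq> basin f C ?A" unfolding basin_def using om tb openiv_sub01[OF I(1)] by blast
  have Ipos: "emeasure lebesgue I > 0"
    using openiv_len_pos[OF I(1)] unfolding emeasure_eq_measure2[OF openiv_lmeas[OF I(1)]] by simp
  have bm: "basin f C ?A \<in> sets lebesgue" by (rule basin_measurable[OF fin]) blast
  have "emeasure lebesgue (basin f C ?A) > 0"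
    using less_le_trans[OF Ipos emeasure_mono[OF Ib bm]] .
  moreover have "\<not> (\<exists>A'. closed A' \<and> A' \<subset> ?A \<and> sym_diff (basin f C A') (basin f C ?A) \<in> null_sets lebesgue)"
  proof
    assume "\<exists>A'. closed A' \<and> A' \<subset> ?A \<and> sym_diff (basin f C A') (basin f C ?A) \<in> null_sets lebesgue"
    then obtain A' where A': "A' \<subset> ?A" "sym_diff (basin f C A') (basin f C ?A) \<in> null_sets lebesgue" by blast
    have "I \<inter> basin f C A' = {}" unfolding basin_def using om A'(1) by auto
    then have s: "I \<subseteq> sym_diff (basin f C A') (basin f C ?A)" using Ib by blast
    have "emeasure lebesgue I \<le> emeasure lebesgue (sym_diff (basin f C A') (basin f C ?A))"
      by (rule emeasure_mono[OF s null_setsD2[OF A'(2)]])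
    then show False using null_setsD1[OF A'(2)] Ipos by simp
  qed
  moreover have "?A \<subseteq> {0..1}" using it_range[OF apart01[OF p(1)]] by blast
  ultimately have at: "attractor f C ?A" unfolding attractor_def using finite_imp_compact[OF fin] by blast
  have "omega_limit f x = ?A" using om[OF I(4)] unfolding omega_limit_shift .
  then have xb: "x \<in> basin f C ?A" unfolding basin_def backward_orbit_def using x by blast
  have "basin f C ?A \<in> {basin f C A | A. periodic_like_orbit f A \<and> attractor f C A}"
    unfolding mem_Collect_eq using at periodic_like_orbit_of_attraction[OF I(1-3) q p] by blast
  then show ?thesis unfolding B0_def using xb by (rule UnionI)
qed

text \<open>
  Attraction by a homterval puts \<open>x\<close> into the basin of an attractor; otherwise \<open>x\<close> lands on a
  periodic point.
\<close>

lemma B0_or_preperiodic_of_homterval: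
  assumes J: "homterval J" and xJ: "x \<in> closure J" and x: "apart d x" "d > 0"
  shows "x \<in> B0 f C \<union> backward_orbit f (periodic_points f C)"
proof -
  obtain m q p where h: "q \<ge> 1" "apart d p" "(f ^^ q) p = p" "(f ^^ m) x = p \<or> (\<exists>I. attracted x m q p I)"
    using homterval_attracted[OF assms] by blast
  from h(4) show ?thesis
  proof
    assume e: "(f ^^ m) x = p"
    have "p \<in> periodic_points f C" unfolding periodic_points_def backward_orbit_def
      using h(1,3) apart01[OF h(2)] apart_notC[OF h(2) x(2)] by auto
    then show ?thesis unfolding backward_orbit_def using e apart01[OF x(1)] by auto
  next
    assume "\<exists>I. attracted x m q p I"
    then obtain I where "attracted x m q p I" by blast
    from attracted_imp_B0[OF this h(1,3,2) x(2) apart01[OF x(1)] apart_notC[OF x]] show ?thesis by blast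
  qed
qed

section \<open>Short pullbacks along wild orbits\<close>

lemma omega_apart:
  assumes x: "apart d x" "d > 0" and z: "z \<in> omega_limit f x"
  shows "apart d z"
proof -
  obtain r where "strict_mono r" "(\<lambda>n. (f ^^ r n) x) \<longlonglongrightarrow> z" using z unfolding omega_limit_def by blast
  then show ?thesis using apart_tendsto(1)[OF apart_it[OF x(1)] _ x(2)] by blast
qed

lemma omega_invariant:
  assumes x: "apart d x" "d > 0" and z: "z \<in> omega_limit f x"
  shows "(f ^^ n) z \<in> omega_limit f x"
proof -
  obtain r where r: "strict_mono r" "(\<lambda>n. (f ^^ r n) x) \<longlonglongrightarrow> z" using z unfolding omega_limit_def by blast
  have "(\<lambda>k. (f ^^ n) ((f ^^ r k) x)) \<longlonglongrightarrow> (f ^^ n) z"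
    using apart_tendsto(2)[OF apart_it[OF x(1)] r(2) x(2)] .
  then have "(\<lambda>k. (f ^^ (n + r k)) x) \<longlonglongrightarrow> (f ^^ n) z" by (simp add: it_add)
  moreover have "strict_mono (\<lambda>k. n + r k)" using r(1) by (auto simp: strict_mono_def)
  ultimately show ?thesis unfolding omega_limit_def by blast
qed

lemma omega_closed: "closed (omega_limit f x)"
  unfolding closed_limpt islimpt_approachable
proof (intro allI impI)
  fix z assume a: "\<forall>e>0. \<exists>y\<in>omega_limit f x. y \<noteq> z \<and> dist y z < e"
  show "z \<in> omega_limit f x" unfolding omega_limit_iff
  proof (intro allI impI)
    fix e :: real and N assume "e > 0"
    then obtain y where y: "y \<in> omega_limit f x" "dist y z < e/2" using a by (metis half_gt_zero)
    then obtain n where "n \<ge> N" "\<bar>(f ^^ n) x - y\<bar> < e/2" using \<open>e > 0\<close> unfolding omega_limit_iff by (metis half_gt_zero)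
    moreover have "\<bar>y - z\<bar> < e/2" using y(2) by (simp add: dist_real_def)
    ultimately have "n \<ge> N \<and> \<bar>(f ^^ n) x - z\<bar> < e" by linarith
    then show "\<exists>n\<ge>N. \<bar>(f ^^ n) x - z\<bar> < e" by blast
  qed
qed

text \<open>
  The last two conditions concern orbits that come close to the boundary of \<open>[0,1]\<close>: there,
  inverse branches can only be cut off at \<open>0\<close> or \<open>1\<close>, and the images of these points then bound
  \<open>[0,1]\<close> as well and cut nothing off. Every point that satisfies the other conditions
  satisfies these after decreasing \<open>d\<close>, see \<open>wildI\<close>.
\<close>

definition wild :: "real \<Rightarrow> real \<Rightarrow> bool" where
  "wild d x \<longleftrightarrow> d > 0 \<and> x \<in> {0<..<1} \<and> apart d x \<and> (\<forall>i j. i < j \<longrightarrow> (f ^^ i) x \<noteq> (f ^^ j) x) \<and>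
     (\<forall>n J. homterval J \<longrightarrow> (f ^^ n) x \<notin> closure J) \<and>
     ((\<exists>n. (f ^^ n) x < d) \<longrightarrow> f 0 \<in> {0,1}) \<and> ((\<exists>n. (f ^^ n) x > 1 - d) \<longrightarrow> f 1 \<in> {0,1})"

lemma
  assumes "wild d x"
  shows wild_pos: "d > 0" and wild_apart: "apart d x" and wild_distinct: "i < j \<Longrightarrow> (f ^^ i) x \<noteq> (f ^^ j) x"
    and wild_not_closure_homterval: "homterval J \<Longrightarrow> (f ^^ n) x \<notin> closure J" and wild01: "(f ^^ n) x \<in> {0<..<1}"
    and wild_0: "(f ^^ n) x < d \<Longrightarrow> f 0 \<in> {0,1}" and wild_1: "(f ^^ n) x > 1 - d \<Longrightarrow> f 1 \<in> {0,1}"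
proof -
  show "d > 0" "apart d x" "i < j \<Longrightarrow> (f ^^ i) x \<noteq> (f ^^ j) x" "homterval J \<Longrightarrow> (f ^^ n) x \<notin> closure J"
    "(f ^^ n) x < d \<Longrightarrow> f 0 \<in> {0,1}" "(f ^^ n) x > 1 - d \<Longrightarrow> f 1 \<in> {0,1}"
    using assms unfolding wild_def by blast+
  have x: "x \<in> {0<..<1}" "apart d x" "d > 0" using assms unfolding wild_def by blast+
  show "(f ^^ n) x \<in> {0<..<1}" by (rule it_interior[OF x(1) apart_notC[OF x(2,3)]])
qed

lemma wild_away: "wild d x \<Longrightarrow> c \<in> C \<Longrightarrow> d \<le> \<bar>(f ^^ n) x - c\<bar>"
  using wild_apart unfolding apart_def by blast

lemma compact_away: "compact (away C e)"
proof -
  have "away C e = {0..1} \<inter> (\<Inter>c\<in>C. {t. e \<le> \<bar>t - c\<bar>})" unfolding away_def by auto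
  moreover have "closed (\<Inter>c\<in>C. {t. e \<le> \<bar>t - c\<bar>})"
    by (intro closed_INT ballI closed_Collect_le continuous_intros)
  ultimately show ?thesis using compact_Int_closed[OF compact_Icc] by simp
qed

lemma away_notC: "e > 0 \<Longrightarrow> t \<in> away C e \<Longrightarrow> t \<notin> C"
proof
  assume "e > 0" "t \<in> away C e" "t \<in> C"
  then have "e \<le> \<bar>t - t\<bar>" unfolding away_def by blast
  then show False using \<open>e > 0\<close> by simp
qed

lemma away_sub: "e > 0 \<Longrightarrow> away C e \<subseteq> {0..1} - C"
  using away_notC unfolding away_def by blast

lemma deriv_lower:
  assumes e: "e > 0" shows "\<exists>m>0. \<forall>t\<in>away C e. m \<le> \<bar>f' t\<bar>"
proof (cases "away C e = {}")
  case False
  have "continuous_on (away C e) (\<lambda>t. \<bar>f' t\<bar>)"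
    by (intro continuous_intros continuous_on_subset[OF contf' away_sub[OF e]])
  then obtain t0 where t0: "t0 \<in> away C e" "\<forall>t\<in>away C e. \<bar>f' t0\<bar> \<le> \<bar>f' t\<bar>"
    using continuous_attains_inf[OF compact_away False] by blast
  have "f' t0 \<noteq> 0" using nz away_sub[OF e] t0(1) by blast
  then show ?thesis using t0(2) by (intro exI[of _ "\<bar>f' t0\<bar>"]) auto
qed (auto intro: exI[of _ 1])

lemma f_cont_on: "S \<subseteq> {0..1} - C \<Longrightarrow> continuous_on S f"
  unfolding continuous_on_eq_continuous_within
proof
  fix x assume S: "S \<subseteq> {0..1} - C" and x: "x \<in> S"
  have "(f has_real_derivative f' x) (at x within {0..1})" using deriv S x by blast
  then have "continuous (at x within {0..1}) f" using has_field_derivative_imp_has_derivative has_derivative_continuous by blast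
  then show "continuous (at x within S) f" by (rule continuous_within_subset) (use S in blast)
qed

lemma expansion_bound:
  assumes sub: "{u..v} \<subseteq> away C e" and e: "e > 0" and m: "\<forall>t\<in>away C e. m \<le> \<bar>f' t\<bar>" and uv: "u < v"
  shows "m * (v - u) \<le> \<bar>f v - f u\<bar>"
proof -
  have i: "t \<in> {0<..<1}" if "u < t" "t < v" for t
  proof -
    have "u \<in> {u..v}" "v \<in> {u..v}" using uv by auto
    then have "u \<in> {0..1}" "v \<in> {0..1}" using sub unfolding away_def by blast+
    then show ?thesis using that by auto
  qed
  have d: "DERIV f t :> f' t" if t: "u < t" "t < v" for t
  proof -
    have "t \<in> {u..v}" using t by simp
    then have "t \<in> {0..1} - C" using sub away_sub[OF e] by blast
    then show ?thesis using deriv[of t] at_within_unit_interval[OF i[OF t]] by simp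
  qed
  have "\<exists>l z. u < z \<and> z < v \<and> DERIV f z :> l \<and> f v - f u = (v - u) * l"
    by (rule MVT[OF uv f_cont_on]) (use sub away_sub[OF e] d in \<open>auto simp: real_differentiable_def\<close>)
  then obtain l z where z: "u < z" "z < v" "DERIV f z :> l" "f v - f u = (v - u) * l" by blast
  have "l = f' z" using DERIV_unique[OF z(3) d[OF z(1,2)]] .
  moreover have "z \<in> {u..v}" using z by simp
  then have "z \<in> away C e" using sub by blast
  ultimately have "m \<le> \<bar>l\<bar>" using m by blast
  then show ?thesis using z(4) uv by (simp add: abs_mult mult.commute mult_left_mono)
qed

text \<open>
  On the \<open>d/2\<close>-neighbourhood \<open>B\<close> of an orbit point \<open>\<bar>f'\<bar>\<close> is bounded below by some \<open>m\<close>. So \<open>f B\<close>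
  contains all short intervals around the image, except where \<open>B\<close> is cut off by \<open>0\<close> or \<open>1\<close>; there
  the conditions at the boundary in \<open>wild\<close> help.
\<close>

lemma inverse_branch_along_orbit:
  assumes w: "wild d x"
  shows "\<exists>\<eta>0>0. \<forall>i J'. openiv J' \<and> (f ^^ Suc i) x \<in> J' \<and> len J' < \<eta>0 \<longrightarrow>
    (\<exists>J. openiv J \<and> (f ^^ i) x \<in> J \<and> J \<subseteq> {(f ^^ i) x - d/2<..<(f ^^ i) x + d/2} \<and> J \<inter> C = {} \<and> f ` J = J')"
proof -
  have d: "d > 0" "d/2 > 0" using wild_pos[OF w] by auto
  obtain m where m: "m > 0" "\<forall>t\<in>away C (d/2). m \<le> \<bar>f' t\<bar>" using deriv_lower[OF d(2)] by blast
  show ?thesis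
  proof (intro exI[of _ "m * (d/2)"] conjI allI impI)
    show "m * (d/2) > 0" using m d by simp
    fix i J' assume J': "openiv J' \<and> (f ^^ Suc i) x \<in> J' \<and> len J' < m * (d/2)"
    define X where "X = (f ^^ i) x"
    have X: "X \<in> {0<..<1}" "\<And>c. c \<in> C \<Longrightarrow> d \<le> \<bar>X - c\<bar>" unfolding X_def using wild01[OF w] wild_away[OF w] by blast+
    have fX: "f X \<in> J'" using J' unfolding X_def by simp
    define \<alpha> where "\<alpha> = max 0 (X - d/2)"
    define \<beta> where "\<beta> = min 1 (X + d/2)"
    have ab: "0 \<le> \<alpha>" "\<alpha> < X" "X < \<beta>" "\<beta> \<le> 1" unfolding \<alpha>_def \<beta>_def using X d by auto
    have sub: "{\<alpha>..\<beta>} \<subseteq> away C (d/2)"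
    proof
      fix t assume t: "t \<in> {\<alpha>..\<beta>}"
      then have "X - d/2 \<le> t" "t \<le> X + d/2" unfolding \<alpha>_def \<beta>_def by auto
      then have "\<bar>t - X\<bar> \<le> d/2" by linarith
      then have "d/2 \<le> \<bar>t - c\<bar>" if "c \<in> C" for c using X(2)[OF that] by linarith
      then show "t \<in> away C (d/2)" unfolding away_def using t ab by auto
    qed
    define B where "B = {\<alpha><..<\<beta>}"
    have B: "openiv B" unfolding B_def openiv_def using ab by (intro exI conjI refl) auto
    have "B \<subseteq> {\<alpha>..\<beta>}" unfolding B_def by auto
    then have BC: "B \<inter> C = {}" using sub away_sub[OF d(2)] by blast
    have fr: "free 1 B" unfolding free_def using BC by simp
    have fBo: "openiv (f ` B)" using free_image[OF B fr] by simp
    have XB: "X \<in> B" unfolding B_def using ab by simp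
    have J'B: "J' \<subseteq> f ` B"
    proof (rule ccontr)
      assume "\<not> J' \<subseteq> f ` B"
      moreover have "J' \<inter> f ` B \<noteq> {}" using fX XB by blast
      ultimately have "J' \<inter> frontier (f ` B) \<noteq> {}"
        using connected_Int_frontier[of J' "f ` B"] openiv_conn J' by blast
      then obtain y where y: "y \<in> J'" "y \<in> closure (f ` B)" "y \<notin> f ` B"
        using openiv_open[OF fBo] unfolding frontier_def by (auto simp: interior_open)
      have cf: "continuous_on {\<alpha>..\<beta>} f" by (rule f_cont_on) (use sub away_sub[OF d(2)] in blast)
      have "closure (f ` B) \<subseteq> f ` {\<alpha>..\<beta>}"
        by (rule closure_minimal) (use compact_imp_closed[OF compact_continuous_image[OF cf compact_Icc]] in \<open>auto simp: B_def\<close>)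
      then obtain e where e: "e \<in> {\<alpha>..\<beta>}" "y = f e" using y(2) by blast
      have y01: "y \<noteq> 0" "y \<noteq> 1" using openiv_sub[of J'] J' y(1) by auto
      have close: "\<bar>f e - f X\<bar> < m * (d/2)" using openiv_diff_less_len[of J' y "f X"] J' y(1) fX e(2) by auto
      have "e = \<alpha> \<or> e = \<beta>" using e y(3) unfolding B_def by force
      then show False
      proof
        assume ea: "e = \<alpha>"
        show False
        proof (cases "X - d/2 > 0")
          case True
          then have "\<alpha> = X - d/2" unfolding \<alpha>_def by simp
          moreover have "m * (X - \<alpha>) \<le> \<bar>f X - f \<alpha>\<bar>"
            by (rule expansion_bound[OF _ d(2) m(2) ab(2)]) (use sub ab in auto)
          ultimately show False using close ea by (simp add: abs_minus_commute)
        next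
          case False
          then have "\<alpha> = 0" "X < d" unfolding \<alpha>_def using d by auto
          then show False using wild_0[OF w, of i] y01 e(2) ea unfolding X_def by auto
        qed
      next
        assume eb: "e = \<beta>"
        show False
        proof (cases "X + d/2 < 1")
          case True
          then have "\<beta> = X + d/2" unfolding \<beta>_def by simp
          moreover have "m * (\<beta> - X) \<le> \<bar>f \<beta> - f X\<bar>"
            by (rule expansion_bound[OF _ d(2) m(2) ab(3)]) (use sub ab in auto)
          ultimately show False using close eb by simp
        next
          case False
          then have "\<beta> = 1" "X > 1 - d" unfolding \<beta>_def using d by auto
          then show False using wild_1[OF w, of i] y01 e(2) eb unfolding X_def by auto
        qed
      qed
    qed
    define J where "J = {t\<in>B. f t \<in> J'}"
    have "(f ^^ 1) ` B \<inter> J' \<noteq> {}" using fX XB by auto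
    then have "openiv J" unfolding J_def using openiv_pre[OF B fr, of J'] J' by simp
    moreover have "f ` J = J'" unfolding J_def using J'B by blast
    moreover have "J \<subseteq> {X - d/2<..<X + d/2}" unfolding J_def B_def \<alpha>_def \<beta>_def by auto
    moreover have "J \<inter> C = {}" "X \<in> J" using BC XB fX unfolding J_def by auto
    ultimately show "\<exists>J. openiv J \<and> (f ^^ i) x \<in> J \<and> J \<subseteq> {(f ^^ i) x - d/2<..<(f ^^ i) x + d/2} \<and> J \<inter> C = {} \<and> f ` J = J'"
      unfolding X_def by blast
  qed
qed

text \<open>
  Whenever the orbit is in \<open>V\<close> at time \<open>i + n\<close>, the pullback of \<open>V\<close> along \<open>x\<^sub>i, \<dots>, x\<^sub>i\<^sub>+\<^sub>n\<close> exists
  and all its images are shorter than \<open>\<eta>\<close>.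
\<close>

definition small_pb :: "real \<Rightarrow> real \<Rightarrow> real set \<Rightarrow> bool" where
  "small_pb \<eta> x V \<longleftrightarrow> (\<forall>i n. (f ^^ (i + n)) x \<in> V \<longrightarrow>
     (\<exists>J. pb n J V \<and> (f ^^ i) x \<in> J \<and> (\<forall>j\<le>n. len ((f ^^ j) ` J) < \<eta>)))"

text \<open>
  Suppose that arbitrarily small intervals \<open>V\<close> near \<open>z\<close> have pullbacks that grow to the size \<open>\<epsilon>\<close>.
  Pullbacks of minimal order with this property have all proper images shorter than \<open>\<epsilon>\<close>, and a
  subsequence of them contains a common interval \<open>U\<close>. The orders tend to infinity, since for
  bounded orders the images of \<open>U\<close> would not shrink. So \<open>U\<close> is a homterval whose orbit shadows
  pieces of the orbit of \<open>x\<close> and returns to every neighbourhood \<open>R k\<close> of \<open>z\<close>. Hypothesis \<open>Q\<close>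
  excludes this; \<open>R\<close> is a parameter so that one-sided neighbourhoods are covered.
\<close>

lemma small_pullbacks_exist:
  assumes w: "wild d x" and \<eta>: "\<eta> > 0"
    and R: "\<And>N. R N \<subseteq> {z - 1 / real (Suc N)<..<z + 1 / real (Suc N)}" "\<And>N N'. N \<le> N' \<Longrightarrow> R N' \<subseteq> R N"
    and Q: "\<And>c U. homterval U \<Longrightarrow> c \<in> U \<Longrightarrow> apart (d/2) c \<Longrightarrow> (\<And>k. \<exists>n\<ge>k. (f ^^ n) c \<in> R k) \<Longrightarrow> False"
  shows "\<exists>N. \<forall>V. openiv V \<and> V \<subseteq> R N \<longrightarrow> small_pb \<eta> x V"
proof (rule ccontr)
  assume neg: "\<not> (\<exists>N. \<forall>V. openiv V \<and> V \<subseteq> R N \<longrightarrow> small_pb \<eta> x V)"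
  have d: "d > 0" using wild_pos[OF w] .
  obtain \<eta>0 where \<eta>0: "\<eta>0 > 0" "\<And>i J'. openiv J' \<Longrightarrow> (f ^^ Suc i) x \<in> J' \<Longrightarrow> len J' < \<eta>0 \<Longrightarrow>
    (\<exists>J. openiv J \<and> (f ^^ i) x \<in> J \<and> J \<subseteq> {(f ^^ i) x - d/2<..<(f ^^ i) x + d/2} \<and> J \<inter> C = {} \<and> f ` J = J')"
    using inverse_branch_along_orbit[OF w] by blast
  \<comment> \<open>below \<open>\<eta>0\<close>, inverse branches along the orbit exist; below \<open>d/4\<close>, shadowing keeps the limit orbit apart from \<open>C\<close>\<close>
  define \<epsilon> where "\<epsilon> = min \<eta> (min \<eta>0 (d/4))"
  have \<epsilon>: "\<epsilon> > 0" "\<epsilon> \<le> \<eta>" "\<epsilon> \<le> \<eta>0" "\<epsilon> \<le> d/4" using \<eta> \<eta>0(1) d unfolding \<epsilon>_def by auto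
  define good where "good V i n \<longleftrightarrow> (\<exists>J. pb n J V \<and> (f ^^ i) x \<in> J \<and> (\<forall>j\<le>n. len ((f ^^ j) ` J) < \<epsilon>))" for V i n
  have Rlen: "len V \<le> 2 / real (Suc N)" if V: "openiv V" "V \<subseteq> R N" for V N
  proof -
    have "len V \<le> len {z - 1 / real (Suc N)<..<z + 1 / real (Suc N)}"
      by (rule measure_mono_fmeasurable) (use V R(1)[of N] openiv_lmeas[OF V(1)] in \<open>auto simp: fmeasurableD\<close>)
    also have "\<dots> = 2 / real (Suc N)"
    proof -
      have "len {z - e<..<z + e} = 2 * e" if "e \<ge> 0" for e :: real using that by simp
      from this[of "1 / real (Suc N)"] show ?thesis by simp
    qed
    finally show ?thesis .
  qed
  obtain N1 where N1: "2 / real (Suc N1) < \<epsilon>"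
  proof -
    obtain n where "1 / real (Suc n) < \<epsilon>/2" using nat_approx_posE[of "\<epsilon>/2"] \<epsilon>(1) by auto
    then have "2 / real (Suc n) < \<epsilon>" by simp
    then show ?thesis by (rule that)
  qed
  have ex: "\<exists>V n i J. pb n J V \<and> V \<subseteq> R N \<and> \<epsilon> \<le> len J \<and> (f ^^ i) x \<in> J \<and> J \<subseteq> {(f ^^ i) x - d/2<..<(f ^^ i) x + d/2} \<and>
      (\<forall>j. 1 \<le> j \<and> j \<le> n \<longrightarrow> len ((f ^^ j) ` J) < \<epsilon>)" if N: "N \<ge> N1" for N
  proof -
    obtain V where V: "openiv V" "V \<subseteq> R N" "\<not> small_pb \<eta> x V" using neg by blast
    have "\<exists>n i. (f ^^ (i + n)) x \<in> V \<and> \<not> good V i n"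
    proof (rule ccontr)
      assume "\<not> (\<exists>n i. (f ^^ (i + n)) x \<in> V \<and> \<not> good V i n)"
      then have g: "good V i n" if "(f ^^ (i + n)) x \<in> V" for i n using that by blast
      have "small_pb \<eta> x V" unfolding small_pb_def
      proof (intro allI impI)
        fix i n assume "(f ^^ (i + n)) x \<in> V"
        from g[OF this] obtain J where J: "pb n J V" "(f ^^ i) x \<in> J" "\<forall>j\<le>n. len ((f ^^ j) ` J) < \<epsilon>"
          unfolding good_def by blast
        then have "\<forall>j\<le>n. len ((f ^^ j) ` J) < \<eta>" using \<epsilon>(2) by (auto intro: less_le_trans)
        then show "\<exists>J. pb n J V \<and> (f ^^ i) x \<in> J \<and> (\<forall>j\<le>n. len ((f ^^ j) ` J) < \<eta>)" using J by blast
      qed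
      then show False using V(3) by blast
    qed
    then obtain n0 where n0: "\<exists>i. (f ^^ (i + n0)) x \<in> V \<and> \<not> good V i n0" by blast
    \<comment> \<open>minimality of the order makes all proper images of the pullback short\<close>
    define n where "n = (LEAST n. \<exists>i. (f ^^ (i + n)) x \<in> V \<and> \<not> good V i n)"
    have n: "\<exists>i. (f ^^ (i + n)) x \<in> V \<and> \<not> good V i n"
      "\<And>n'. n' < n \<Longrightarrow> \<not> (\<exists>i. (f ^^ (i + n')) x \<in> V \<and> \<not> good V i n')"
      unfolding n_def by (rule LeastI[of "\<lambda>n. \<exists>i. (f ^^ (i + n)) x \<in> V \<and> \<not> good V i n", OF n0], rule not_less_Least)
    obtain i where i: "(f ^^ (i + n)) x \<in> V" "\<not> good V i n" using n(1) by blast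
    have lV: "len V < \<epsilon>"
    proof -
      have "2 / real (Suc N) \<le> 2 / real (Suc N1)" using N by (intro divide_left_mono) auto
      then show ?thesis using Rlen[OF V(1,2)] N1 by linarith
    qed
    have "n \<noteq> 0"
    proof
      assume "n = 0"
      then have "good V i n" unfolding good_def using pb_0[OF V(1)] i(1) lV by (intro exI[of _ V]) auto
      then show False using i(2) by blast
    qed
    then obtain n' where n': "n = Suc n'" using not0_implies_Suc by blast
    have "good V (Suc i) n'" using n(2)[of n'] n' i(1) by auto
    then obtain J' where J': "pb n' J' V" "(f ^^ Suc i) x \<in> J'" "\<And>j. j \<le> n' \<Longrightarrow> len ((f ^^ j) ` J') < \<epsilon>"
      unfolding good_def by blast
    have "len J' < \<eta>0" using J'(3)[of 0] \<epsilon>(3) by simp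
    then obtain J where J: "openiv J" "(f ^^ i) x \<in> J" "J \<subseteq> {(f ^^ i) x - d/2<..<(f ^^ i) x + d/2}" "J \<inter> C = {}" "f ` J = J'"
      using \<eta>0(2)[OF pb_openiv[OF J'(1)] J'(2)] by blast
    have "pb 1 J J'" unfolding pb_def free_def using J by simp
    then have pJ: "pb n J V" using pb_comp[OF _ J'(1), of 1 J] n' by simp
    have fj: "(f ^^ Suc j) ` J = (f ^^ j) ` J'" for j
    proof -
      have "(f ^^ Suc j) ` J = (f ^^ j) ` (f ` J)" by (simp only: funpow_Suc_right image_comp)
      then show ?thesis using J(5) by simp
    qed
    have sm: "len ((f ^^ j) ` J) < \<epsilon>" if "1 \<le> j" "j \<le> n" for j
      using fj[of "j - 1"] J'(3)[of "j - 1"] that n' by simp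
    have "\<epsilon> \<le> len J"
    proof (rule ccontr)
      assume "\<not> \<epsilon> \<le> len J"
      then have l0: "len ((f ^^ 0) ` J) < \<epsilon>" by simp
      have "\<forall>j\<le>n. len ((f ^^ j) ` J) < \<epsilon>"
      proof (intro allI impI)
        fix j assume "j \<le> n"
        then show "len ((f ^^ j) ` J) < \<epsilon>" using l0 sm[of j] by (cases "j = 0") auto
      qed
      then have "good V i n" unfolding good_def using pJ J(2) by blast
      then show False using i(2) by blast
    qed
    then show ?thesis using pJ V(2) J(2,3) sm by blast
  qed
  define P where "P N V n i J \<longleftrightarrow> pb n J V \<and> V \<subseteq> R N \<and> \<epsilon> \<le> len J \<and> (f ^^ i) x \<in> J \<and> J \<subseteq> {(f ^^ i) x - d/2<..<(f ^^ i) x + d/2} \<and>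
      (\<forall>j. 1 \<le> j \<and> j \<le> n \<longrightarrow> len ((f ^^ j) ` J) < \<epsilon>)" for N V n i J
  have "\<exists>V n i J. P N V n i J" if "N \<ge> N1" for N unfolding P_def using ex[OF that] .
  then have "\<forall>N\<in>{N1..}. \<exists>V n i J. P N V n i J" by simp
  then obtain V n i J where "\<forall>N\<in>{N1..}. P N (V N) (n N) (i N) (J N)" by metis
  then have PN: "P N (V N) (n N) (i N) (J N)" if "N \<ge> N1" for N using that by simp
  have A: "pb (n N) (J N) (V N)" "V N \<subseteq> R N" "\<epsilon> \<le> len (J N)" "(f ^^ (i N)) x \<in> J N"
      "J N \<subseteq> {(f ^^ (i N)) x - d/2<..<(f ^^ (i N)) x + d/2}"
      "\<And>j. 1 \<le> j \<Longrightarrow> j \<le> n N \<Longrightarrow> len ((f ^^ j) ` (J N)) < \<epsilon>" if "N \<ge> N1" for N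
    using PN[OF that] unfolding P_def by blast+
  have "\<forall>N. \<exists>m. N \<ge> N1 \<longrightarrow> m \<in> {0..1} \<and> {m - \<epsilon>/2<..<m + \<epsilon>/2} \<subseteq> J N"
  proof
    fix N show "\<exists>m. N \<ge> N1 \<longrightarrow> m \<in> {0..1} \<and> {m - \<epsilon>/2<..<m + \<epsilon>/2} \<subseteq> J N"
    proof (cases "N \<ge> N1")
      case True
      obtain a b where ab: "0 \<le> a" "a < b" "b \<le> 1" "J N = {a<..<b}" using pb_openiv[OF A(1)[OF True]] unfolding openiv_def by blast
      have e: "\<epsilon> \<le> b - a" using A(3)[OF True] ab(2) unfolding ab(4) by simp
      have "{(a + b)/2 - \<epsilon>/2<..<(a + b)/2 + \<epsilon>/2} \<subseteq> J N" unfolding ab(4) using e by (auto simp: field_simps)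
      moreover have "(a + b)/2 \<in> {0..1}" using ab(1-3) by auto
      ultimately show ?thesis by blast
    qed simp
  qed
  then obtain mid where mid: "\<And>N. N \<ge> N1 \<Longrightarrow> mid N \<in> {0..1}" "\<And>N. N \<ge> N1 \<Longrightarrow> {mid N - \<epsilon>/2<..<mid N + \<epsilon>/2} \<subseteq> J N" by metis
  have "\<forall>k. mid (k + N1) \<in> {0..1}" using mid(1) by simp
  then obtain c r where r: "c \<in> {0..1}" "strict_mono r" "((\<lambda>k. mid (k + N1)) \<circ> r) \<longlonglongrightarrow> c"
    using compact_imp_seq_compact[OF compact_Icc[of 0 1]] unfolding seq_compact_def by meson
  have "\<forall>\<^sub>F k in sequentially. dist (mid (r k + N1)) c < \<epsilon>/4"
    using tendstoD[OF r(3), of "\<epsilon>/4"] \<epsilon>(1) by (simp add: o_def)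
  then obtain K where K: "\<And>k. k \<ge> K \<Longrightarrow> dist (mid (r k + N1)) c < \<epsilon>/4" unfolding eventually_sequentially by blast
  define U where "U = {c - \<epsilon>/4<..<c + \<epsilon>/4}"
  have UJ: "U \<subseteq> J (r k + N1)" if "k \<ge> K" for k
  proof -
    have "U \<subseteq> {mid (r k + N1) - \<epsilon>/2<..<mid (r k + N1) + \<epsilon>/2}"
    proof
      fix t assume "t \<in> U"
      then have t: "c - \<epsilon>/4 < t" "t < c + \<epsilon>/4" unfolding U_def by auto
      have "\<bar>mid (r k + N1) - c\<bar> < \<epsilon>/4" using K[OF that] by (simp add: dist_real_def)
      then have "mid (r k + N1) - \<epsilon>/2 < t" "t < mid (r k + N1) + \<epsilon>/2" using t by linarith+
      then show "t \<in> {mid (r k + N1) - \<epsilon>/2<..<mid (r k + N1) + \<epsilon>/2}" by simp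
    qed
    moreover have "{mid (r k + N1) - \<epsilon>/2<..<mid (r k + N1) + \<epsilon>/2} \<subseteq> J (r k + N1)" by (rule mid(2)) simp
    ultimately show ?thesis by (rule subset_trans)
  qed
  have rk: "k \<le> r k + N1" for k using strict_mono_imp_increasing[OF r(2), of k] by simp
  have cU: "c \<in> U" unfolding U_def using \<epsilon>(1) by simp
  have Uo: "openiv U"
  proof (rule openivI)
    have "U \<subseteq> J (r K + N1)" by (rule UJ) simp
    moreover have "J (r K + N1) \<subseteq> {0..1}" by (rule openiv_sub01[OF pb_openiv[OF A(1)]]) simp
    ultimately show "U \<subseteq> {0..1}" by (rule subset_trans)
  qed (use cU in \<open>auto simp: U_def\<close>)
  have Ufr: "free (n (r k + N1)) U" if "k \<ge> K" for k
    by (rule free_mono[OF pb_free[OF A(1)] UJ[OF that]]) simp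
  \<comment> \<open>the images of \<open>U\<close> of order below \<open>m\<close> have lengths at least \<open>l\<close>, but must fit into arbitrarily small neighbourhoods of \<open>z\<close>\<close>
  have unb: "\<exists>k\<ge>k0. k \<ge> K \<and> n (r k + N1) \<ge> m" for m k0
  proof (rule ccontr)
    assume "\<not> (\<exists>k\<ge>k0. k \<ge> K \<and> n (r k + N1) \<ge> m)"
    then have lt: "n (r k + N1) < m" if "k \<ge> k0" "k \<ge> K" for k using that not_le by blast
    define l where "l = Min (insert 1 ((\<lambda>j. if free j U then len ((f ^^ j) ` U) else 1) ` {..<m}))"
    have l0: "l > 0" unfolding l_def
      by (subst Min_gr_iff) (auto intro: openiv_len_pos free_image[OF Uo])
    obtain k1 where k1: "2 / real (Suc k1) < l"
    proof -
      obtain n where "1 / real (Suc n) < l/2" using nat_approx_posE[of "l/2"] l0 by auto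
      then have "2 / real (Suc n) < l" by simp
      then show ?thesis by (rule that)
    qed
    define k where "k = max k0 (max K k1)"
    have kk: "k \<ge> k0" "k \<ge> K" "k \<ge> k1" unfolding k_def by auto
    let ?n = "n (r k + N1)"
    have N: "r k + N1 \<ge> N1" by simp
    have "(f ^^ ?n) ` U \<subseteq> (f ^^ ?n) ` J (r k + N1)" by (rule image_mono[OF UJ[OF kk(2)]])
    then have "(f ^^ ?n) ` U \<subseteq> V (r k + N1)" unfolding pb_img[OF A(1)[OF N]] .
    then have "(f ^^ ?n) ` U \<subseteq> R (r k + N1)" using A(2)[OF N] by (rule subset_trans)
    then have "len ((f ^^ ?n) ` U) \<le> 2 / real (Suc (r k + N1))" by (rule Rlen[OF free_image[OF Uo Ufr[OF kk(2)]]])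
    also have "\<dots> \<le> 2 / real (Suc k1)" using kk(3) rk[of k] by (intro divide_left_mono) auto
    finally have "len ((f ^^ ?n) ` U) < l" using k1 by linarith
    moreover have "l \<le> len ((f ^^ ?n) ` U)" unfolding l_def
    proof (rule Min_le)
      have "?n \<in> {..<m}" using lt[OF kk(1,2)] by simp
      moreover have "len ((f ^^ ?n) ` U) = (\<lambda>j. if free j U then len ((f ^^ j) ` U) else 1) ?n" using Ufr[OF kk(2)] by simp
      ultimately show "len ((f ^^ ?n) ` U) \<in> insert 1 ((\<lambda>j. if free j U then len ((f ^^ j) ` U) else 1) ` {..<m})" by blast
    qed simp
    ultimately show False by linarith
  qed
  have hU: "homterval U" unfolding homterval_def
  proof (intro conjI allI Uo)
    fix m obtain k where "k \<ge> K" "n (r k + N1) \<ge> m" using unb by blast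
    then show "free m U" using Ufr free_le by blast
  qed
  have "apart (d/2) c" unfolding apart_def
  proof (intro conjI allI ballI r(1))
    fix m c' assume c': "c' \<in> C"
    obtain k where k: "k \<ge> K" "n (r k + N1) \<ge> m" using unb by blast
    let ?N = "r k + N1"
    have N: "?N \<ge> N1" by simp
    have cJ: "c \<in> J ?N" using cU UJ[OF k(1)] by blast
    have "\<bar>(f ^^ m) c - (f ^^ (m + i ?N)) x\<bar> \<le> d/2"
    proof (cases "m = 0")
      case True
      have "c \<in> {(f ^^ (i ?N)) x - d/2<..<(f ^^ (i ?N)) x + d/2}" using A(5)[OF N] cJ by blast
      then have "\<bar>c - (f ^^ (i ?N)) x\<bar> \<le> d/2" unfolding greaterThanLessThan_iff by linarith
      then show ?thesis using True by simp
    next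
      case False
      have "openiv ((f ^^ m) ` J ?N)" using free_image[OF pb_openiv[OF A(1)[OF N]] free_le[OF pb_free[OF A(1)[OF N]] k(2)]] .
      then have "\<bar>(f ^^ m) c - (f ^^ m) ((f ^^ i ?N) x)\<bar> < len ((f ^^ m) ` J ?N)"
        by (rule openiv_diff_less_len) (use cJ A(4)[OF N] in auto)
      also have "\<dots> < \<epsilon>" using A(6)[OF N, of m] False k(2) by simp
      finally show ?thesis using \<epsilon>(4) d by (simp add: it_add)
    qed
    then show "d/2 \<le> \<bar>(f ^^ m) c - c'\<bar>" using wild_away[OF w c', of "m + i ?N"] by linarith
  qed
  moreover have "\<exists>m\<ge>k0. (f ^^ m) c \<in> R k0" for k0
  proof -
    obtain k where k: "k \<ge> k0" "k \<ge> K" "n (r k + N1) \<ge> k0" using unb by blast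
    have "c \<in> J (r k + N1)" using cU UJ[OF k(2)] by blast
    then have "(f ^^ n (r k + N1)) c \<in> V (r k + N1)" by (rule pb_in[OF A(1), rotated]) simp
    moreover have "V (r k + N1) \<subseteq> R (r k + N1)" by (rule A(2)) simp
    ultimately have "(f ^^ n (r k + N1)) c \<in> R (r k + N1)" by blast
    moreover have "R (r k + N1) \<subseteq> R k0" by (rule R(2)) (use rk[of k] k(1) in linarith)
    ultimately show ?thesis using k(3) by blast
  qed
  ultimately show False using Q[OF hU cU] by blast
qed

end

section \<open>Admissible intervals\<close>

lemma inverse_Suc_antimono: "N \<le> N' \<Longrightarrow> 1 / real (Suc N') \<le> 1 / real (Suc N)"
  by (intro divide_left_mono) auto

context interval_map begin

lemma hits_C_neighborhood:
  assumes y: "y \<in> {0..1}" "\<And>i. i < N \<Longrightarrow> (f ^^ i) y \<notin> C"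
  shows "\<exists>e>0. \<forall>t\<in>{0..1}. \<bar>t - y\<bar> < e \<longrightarrow> (\<forall>i<N. (f ^^ i) t \<notin> C)"
  using y(2)
proof (induction N)
  case 0
  show ?case by (intro exI[of _ 1]) simp
next
  case (Suc N)
  have "\<exists>e>0. \<forall>t\<in>{0..1}. \<bar>t - y\<bar> < e \<longrightarrow> (\<forall>i<N. (f ^^ i) t \<notin> C)" by (rule Suc.IH) (use Suc.prems in simp)
  then obtain e1 where e1: "e1 > 0" "\<forall>t\<in>{0..1}. \<bar>t - y\<bar> < e1 \<longrightarrow> (\<forall>i<N. (f ^^ i) t \<notin> C)" by blast
  have "open (- C)" using finC by (simp add: finite_imp_closed open_Compl)
  moreover have "(f ^^ N) y \<in> - C" using Suc.prems[of N] by simp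
  ultimately obtain r where r: "r > 0" "ball ((f ^^ N) y) r \<subseteq> - C" using openE by blast
  have "continuous (at y within {0..1}) (f ^^ N)" by (rule it_cont_within[OF y(1)]) (use Suc.prems in simp)
  then obtain e2 where e2: "e2 > 0" "\<And>t. t \<in> {0..1} \<Longrightarrow> dist t y < e2 \<Longrightarrow> dist ((f ^^ N) t) ((f ^^ N) y) < r"
    using r(1) unfolding continuous_within_eps_delta by blast
  show ?case
  proof (intro exI[of _ "min e1 e2"] conjI ballI impI allI)
    show "min e1 e2 > 0" using e1 e2 by simp
    fix t i assume t: "t \<in> {0..1}" "\<bar>t - y\<bar> < min e1 e2" "i < Suc N"
    show "(f ^^ i) t \<notin> C"
    proof (cases "i = N")
      case True
      have "dist ((f ^^ N) y) ((f ^^ N) t) < r" using e2(2)[OF t(1)] t(2) by (simp add: dist_real_def dist_commute)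
      then have "(f ^^ N) t \<in> ball ((f ^^ N) y) r" by simp
      then show ?thesis using r(2) True by blast
    next
      case False
      then have "i < N" using t(3) by simp
      moreover have "\<bar>t - y\<bar> < e1" using t(2) by simp
      ultimately show ?thesis using e1(2) t(1) by blast
    qed
  qed
qed

text \<open>
  The orbit of \<open>t\<close> meets \<open>C\<close> before time \<open>N\<close>.
\<close>

definition hits_C :: "nat \<Rightarrow> real \<Rightarrow> bool" where
  "hits_C N t \<longleftrightarrow> (\<exists>j<N. (f ^^ j) t \<in> C)"

lemma compact_hits_C:
  assumes "{u..v} \<subseteq> {0..1}" shows "compact {t\<in>{u..v}. hits_C N t}"
proof -
  have "closed {t\<in>{u..v}. hits_C N t}"
    unfolding closed_limpt islimpt_approachable
  proof (intro allI impI)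
    fix y assume a: "\<forall>e>0. \<exists>t\<in>{t\<in>{u..v}. hits_C N t}. t \<noteq> y \<and> dist t y < e"
    have "y islimpt {u..v}" unfolding islimpt_approachable using a by blast
    then have y: "y \<in> {u..v}" using closed_limpt closed_real_atLeastAtMost by blast
    have "hits_C N y"
    proof (rule ccontr)
      assume "\<not> hits_C N y"
      then have nC: "(f ^^ i) y \<notin> C" if "i < N" for i using that unfolding hits_C_def by blast
      have "y \<in> {0..1}" using y assms by blast
      from hits_C_neighborhood[OF this nC] obtain e where e: "e > 0" "\<forall>t\<in>{0..1}. \<bar>t - y\<bar> < e \<longrightarrow> (\<forall>i<N. (f ^^ i) t \<notin> C)"
        by blast
      obtain t where t: "t \<in> {u..v}" "hits_C N t" "dist t y < e" using a e(1) by blast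
      then have "t \<in> {0..1}" "\<bar>t - y\<bar> < e" using assms by (auto simp: dist_real_def)
      then show False using e(2) t(2) unfolding hits_C_def by blast
    qed
    then show "y \<in> {t\<in>{u..v}. hits_C N t}" using y by blast
  qed
  moreover have "bounded {t\<in>{u..v}. hits_C N t}" by (rule bounded_subset[OF bounded_closed_interval]) blast
  ultimately show ?thesis by (simp add: compact_eq_bounded_closed)
qed

text \<open>
  The point of \<open>hits_C N\<close> closest to \<open>z\<close> on the left.
\<close>

lemma left_cut:
  assumes z: "z \<le> 1" "\<not> hits_C N z" and s: "0 < s" "s < z" and nf: "\<not> free N {z - s<..<z}"
  obtains a where "z - s \<le> a" "a < z" "hits_C N a" "free N {a<..<z}"
proof -
  let ?B = "{t\<in>{z - s..z}. hits_C N t}"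
  have "\<exists>t\<in>{z - s<..<z}. hits_C N t" using nf unfolding free_def hits_C_def by blast
  then obtain t where "t \<in> {z - s<..<z}" "hits_C N t" by blast
  then have "t \<in> ?B" by auto
  then have ne: "?B \<noteq> {}" by blast
  have "compact ?B" by (rule compact_hits_C) (use z s in auto)
  from compact_attains_sup[OF this ne] obtain a where a: "a \<in> ?B" "\<forall>t\<in>?B. t \<le> a" by blast
  have az: "a \<noteq> z" using a(1) z(2) by blast
  show thesis
  proof (rule that[of a])
    show "z - s \<le> a" "a < z" "hits_C N a" using a(1) az by auto
    show "free N {a<..<z}"
    proof (rule freeI)
      fix t i assume t: "t \<in> {a<..<z}" and i: "i < N"
      show "(f ^^ i) t \<notin> C"
      proof
        assume "(f ^^ i) t \<in> C"
        then have "hits_C N t" using i unfolding hits_C_def by blast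
        then have "t \<in> ?B" using t a(1) by auto
        then have "t \<le> a" using a(2) by blast
        then show False using t by simp
      qed
    qed
  qed
qed

lemma right_cut:
  assumes z: "0 \<le> z" "\<not> hits_C N z" and s: "0 < s" "z + s < 1" and nf: "\<not> free N {z<..<z + s}"
  obtains b where "b \<le> z + s" "z < b" "hits_C N b" "free N {z<..<b}"
proof -
  let ?B = "{t\<in>{z..z + s}. hits_C N t}"
  have "\<exists>t\<in>{z<..<z + s}. hits_C N t" using nf unfolding free_def hits_C_def by blast
  then obtain t where "t \<in> {z<..<z + s}" "hits_C N t" by blast
  then have "t \<in> ?B" by auto
  then have ne: "?B \<noteq> {}" by blast
  have "compact ?B" by (rule compact_hits_C) (use z s in auto)
  from compact_attains_inf[OF this ne] obtain b where b: "b \<in> ?B" "\<forall>t\<in>?B. b \<le> t" by blast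
  have bz: "b \<noteq> z" using b(1) z(2) by blast
  show thesis
  proof (rule that[of b])
    show "b \<le> z + s" "z < b" "hits_C N b" using b(1) bz by auto
    show "free N {z<..<b}"
    proof (rule freeI)
      fix t i assume t: "t \<in> {z<..<b}" and i: "i < N"
      show "(f ^^ i) t \<notin> C"
      proof
        assume "(f ^^ i) t \<in> C"
        then have "hits_C N t" using i unfolding hits_C_def by blast
        then have "t \<in> ?B" using t b(1) by auto
        then have "b \<le> t" using b(2) by blast
        then show False using t by simp
      qed
    qed
  qed
qed

text \<open>
  If an end point reaches \<open>C\<close> at a time \<open>j < N\<close> and enters \<open>V\<close> before, then a point of \<open>V\<close> reaches \<open>C\<close>
  before time \<open>N\<close>.
\<close>

lemma nice_interval:
  assumes V: "openiv V" "free N V" and e: "\<And>e. e \<in> closure V - V \<Longrightarrow> hits_C N e \<or> (\<forall>k\<ge>1. (f ^^ k) e \<notin> V)"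
  shows "nice V"
  unfolding nice_def
proof (intro conjI ballI allI impI V(1))
  fix y k assume y: "y \<in> closure V - V" and k: "1 \<le> k" and av: "\<forall>j<k. (f ^^ j) y \<notin> C"
  from e[OF y] show "(f ^^ k) y \<notin> V"
  proof
    assume "hits_C N y"
    then obtain j where j: "j < N" "(f ^^ j) y \<in> C" unfolding hits_C_def by blast
    then have kj: "k \<le> j" using av not_le by blast
    show ?thesis
    proof
      assume "(f ^^ k) y \<in> V"
      then have "(f ^^ (j - k)) ((f ^^ k) y) \<notin> C" by (rule freeD[OF V(2)]) (use j in simp)
      then show False using j(2) kj by (simp flip: it_add)
    qed
  qed (use k in blast)
qed

text \<open>
  The intervals on which the orbit of \<open>x\<close> is induced.
\<close>

definition admissible :: "real \<Rightarrow> real \<Rightarrow> real set \<Rightarrow> bool" where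
  "admissible \<eta> x V \<longleftrightarrow> nice V \<and> small_pb \<eta> x V \<and> (\<forall>k. \<exists>n\<ge>k. (f ^^ n) x \<in> V)"

lemma wild_omega_notC: "wild d x \<Longrightarrow> z \<in> omega_limit f x \<Longrightarrow> (f ^^ n) z \<notin> C"
  using apart_notC[OF omega_apart[OF wild_apart wild_pos]] wild_pos by blast

lemma wild_not_homterval:
  assumes "wild d x" "homterval J" shows "(f ^^ n) x \<notin> J"
  using wild_not_closure_homterval[OF assms] closure_subset by blast

text \<open>
  The homterval \<open>U\<close> is attracted to a periodic orbit. If this orbit misses \<open>p\<close>, the iterates of
  \<open>c\<close> stay away from \<open>p\<close> eventually. Otherwise they come to \<open>p\<close> inside a homterval adjacent to \<open>p\<close>;
  when such an iterate lies in the side \<open>S\<close>, this homterval contains points of the orbit of \<open>x\<close>,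
  which accumulates at \<open>p\<close> from \<open>S\<close>.
\<close>

lemma no_capture_periodic:
  assumes w: "wild d x" and acc: "\<And>y. y \<in> S \<Longrightarrow> \<exists>n. (f ^^ n) x \<in> open_segment y p" and pS: "p \<notin> S"
    and c: "homterval U" "c \<in> U" "apart (d/2) c"
    and inf: "\<And>k. \<exists>n\<ge>k. (f ^^ n) c \<in> S \<inter> {p - 1 / real (Suc k)<..<p + 1 / real (Suc k)}"
  shows False
proof -
  have d: "d/2 > 0" using wild_pos[OF w] by simp
  have "c \<in> closure U" using c(2) closure_subset by blast
  from homterval_attracted[OF c(1) this c(3) d] obtain m q p' where
    h: "q \<ge> 1" "apart (d/2) p'" "(f ^^ q) p' = p'" "(f ^^ m) c = p' \<or> (\<exists>I. attracted c m q p' I)" by blast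
  have fq: "(f ^^ (q * i)) p' = p'" for i
    by (induction i) (use h(3) in \<open>auto simp: it_add\<close>)
  define y where "y j i = (f ^^ (m + (j + q * i))) c" for j i
  have yl: "y j \<longlonglongrightarrow> (f ^^ j) p'" and notS: "(f ^^ j) p' = p \<Longrightarrow> y j i \<notin> S" for j i
  proof -
    have "y j \<longlonglongrightarrow> (f ^^ j) p' \<and> ((f ^^ j) p' = p \<longrightarrow> y j i \<notin> S)"
      using h(4)
    proof
      assume e: "(f ^^ m) c = p'"
      have "y j i = (f ^^ j) p'" for i
      proof -
        have "y j i = (f ^^ j) ((f ^^ (q * i)) ((f ^^ m) c))" unfolding y_def by (simp add: ac_simps flip: it_add)
        then show ?thesis using e fq by simp
      qed
      moreover from this have "y j = (\<lambda>i. (f ^^ j) p')" by blast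
      ultimately show ?thesis using pS by simp
    next
      assume "\<exists>I. attracted c m q p' I"
      then obtain I where I: "attracted c m q p' I" by blast
      then have Im: "(f ^^ m) c \<in> I" and hI: "homterval I" and pI: "p' \<in> closure I - I" and qI: "(f ^^ q) ` I \<subseteq> I"
        unfolding attracted_def by blast+
      have ye: "y j i = (f ^^ (j + q * i)) ((f ^^ m) c)" for i unfolding y_def by (simp add: ac_simps flip: it_add)
      have 1: "y j \<longlonglongrightarrow> (f ^^ j) p'" using attracted_iter[OF I h(2) d Im, of j] unfolding ye[symmetric] .
      have "y j i \<notin> S" if e: "(f ^^ j) p' = p"
      proof
        assume yS: "y j i \<in> S"
        have qiI: "(f ^^ (q * i)) ((f ^^ m) c) \<in> I"
        proof (induction i)
          case (Suc i)
          have "(f ^^ (q * Suc i)) ((f ^^ m) c) = (f ^^ q) ((f ^^ (q * i)) ((f ^^ m) c))"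
            using it_add[of q "q * i" "(f ^^ m) c"] by simp
          then show ?case using Suc qI by auto
        qed (use Im in simp)
        have "y j i = (f ^^ j) ((f ^^ (q * i)) ((f ^^ m) c))" unfolding ye by (simp add: it_add)
        then have yI: "y j i \<in> (f ^^ j) ` I" using qiI by blast
        have hj: "homterval ((f ^^ j) ` I)" by (rule homterval_image[OF hI])
        have pc: "p \<in> closure ((f ^^ j) ` I)" unfolding e[symmetric]
          by (rule closure_img[OF _ openiv_sub01[OF homterval_openiv[OF hI]] apart_notC[OF h(2) d]]) (use pI in blast)
        obtain u v where uv: "u < v" "(f ^^ j) ` I = {u<..<v}" using homterval_openiv[OF hj] unfolding openiv_def by blast
        have "open_segment (y j i) p \<subseteq> (f ^^ j) ` I"
          using yI pc unfolding uv(2) closure_greaterThanLessThan[OF uv(1)] by (auto simp: open_segment_eq_real_ivl split: if_splits)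
        then show False using acc[OF yS] wild_not_homterval[OF w hj] by blast
      qed
      then show ?thesis using 1 by blast
    qed
    then show "y j \<longlonglongrightarrow> (f ^^ j) p'" "(f ^^ j) p' = p \<Longrightarrow> y j i \<notin> S" by blast+
  qed
  have "\<exists>k. \<forall>i\<ge>k. y j i \<notin> S \<inter> {p - 1 / real (Suc k)<..<p + 1 / real (Suc k)}" for j
  proof (cases "(f ^^ j) p' = p")
    case True then show ?thesis using notS by blast
  next
    case False
    define e where "e = \<bar>(f ^^ j) p' - p\<bar> / 2"
    have e: "e > 0" using False unfolding e_def by simp
    obtain k1 where k1: "1 / real (Suc k1) < e" using nat_approx_posE[OF e] .
    obtain k2 where k2: "\<And>i. i \<ge> k2 \<Longrightarrow> dist (y j i) ((f ^^ j) p') < e"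
      using tendstoD[OF yl e] unfolding eventually_sequentially by blast
    have "y j i \<notin> {p - 1 / real (Suc (max k1 k2))<..<p + 1 / real (Suc (max k1 k2))}" if i: "i \<ge> max k1 k2" for i
    proof
      assume a: "y j i \<in> {p - 1 / real (Suc (max k1 k2))<..<p + 1 / real (Suc (max k1 k2))}"
      have "1 / real (Suc (max k1 k2)) \<le> 1 / real (Suc k1)" by (intro divide_left_mono) auto
      then have "\<bar>y j i - p\<bar> < e" using a k1 unfolding greaterThanLessThan_iff by linarith
      moreover have "\<bar>y j i - (f ^^ j) p'\<bar> < e" using k2[of i] i by (simp add: dist_real_def)
      moreover have "\<bar>(f ^^ j) p' - p\<bar> \<le> \<bar>y j i - p\<bar> + \<bar>y j i - (f ^^ j) p'\<bar>" by linarith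
      moreover have "\<bar>(f ^^ j) p' - p\<bar> = 2 * e" unfolding e_def by simp
      ultimately show False by linarith
    qed
    then show ?thesis by blast
  qed
  then obtain k where k: "\<And>j i. i \<ge> k j \<Longrightarrow> y j i \<notin> S \<inter> {p - 1 / real (Suc (k j))<..<p + 1 / real (Suc (k j))}" by metis
  define K where "K = Max (k ` {..<q})"
  have kK: "k j \<le> K" if "j < q" for j unfolding K_def using that by (intro Max_ge) auto
  obtain n where n: "n \<ge> m + q * Suc K" "(f ^^ n) c \<in> S \<inter> {p - 1 / real (Suc (m + q * Suc K))<..<p + 1 / real (Suc (m + q * Suc K))}"
    using inf by blast
  let ?j = "(n - m) mod q" and ?i = "(n - m) div q"
  have jq: "?j < q" using h(1) by simp
  have "n = m + (?j + q * ?i)" using n(1) by simp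
  then have yn: "(f ^^ n) c = y ?j ?i" unfolding y_def by simp
  have "?i \<ge> (q * Suc K) div q" using n(1) by (intro div_le_mono) simp
  then have iK: "?i \<ge> k ?j" using kK[OF jq] h(1) by simp
  have "q * Suc K \<ge> K" using h(1) by (cases q) auto
  then have "1 / real (Suc (m + q * Suc K)) \<le> 1 / real (Suc (k ?j))"
    using kK[OF jq] by (intro inverse_Suc_antimono) linarith
  then have "(f ^^ n) c \<in> S \<inter> {p - 1 / real (Suc (k ?j))<..<p + 1 / real (Suc (k ?j))}"
    using n(2) unfolding Int_iff greaterThanLessThan_iff by linarith
  then show False using k[OF iK] yn by simp
qed

text \<open>
  The point \<open>z\<close> would be an accumulation point of an orbit that is attracted to a periodic
  orbit, hence periodic.
\<close>

lemma no_capture_aperiodic: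
  assumes w: "wild d x" and z: "z \<in> omega_limit f x" and nop: "\<And>p q. p \<in> omega_limit f x \<Longrightarrow> q \<ge> 1 \<Longrightarrow> (f ^^ q) p \<noteq> p"
    and c: "homterval U" "c \<in> U" "apart (d/2) c"
    and inf: "\<And>k. \<exists>n\<ge>k. (f ^^ n) c \<in> {z - 1 / real (Suc k)<..<z + 1 / real (Suc k)}"
  shows False
proof -
  have d: "d/2 > 0" using wild_pos[OF w] by simp
  have "c \<in> closure U" using c(2) closure_subset by blast
  from homterval_attracted[OF c(1) this c(3) d] obtain m q p' where
    h: "q \<ge> 1" "apart (d/2) p'" "(f ^^ q) p' = p'" "(f ^^ m) c = p' \<or> (\<exists>I. attracted c m q p' I)" by blast
  have zc: "z \<in> omega_limit f c" unfolding omega_limit_iff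
  proof (intro allI impI)
    fix e :: real and N assume "e > 0"
    then obtain k where k: "1 / real (Suc k) < e" using nat_approx_posE by blast
    obtain n where n: "n \<ge> max k N" "(f ^^ n) c \<in> {z - 1 / real (Suc (max k N))<..<z + 1 / real (Suc (max k N))}" using inf by blast
    have "1 / real (Suc (max k N)) \<le> 1 / real (Suc k)" by (intro divide_left_mono) auto
    then have "\<bar>(f ^^ n) c - z\<bar> < e" using n(2) k unfolding greaterThanLessThan_iff by linarith
    then show "\<exists>n\<ge>N. \<bar>(f ^^ n) c - z\<bar> < e" using n(1) by (intro exI[of _ n]) simp
  qed
  have fq: "(f ^^ (q * i)) p' = p'" for i
    by (induction i) (use h(3) in \<open>auto simp: it_add\<close>)
  have "omega_limit f ((f ^^ m) c) = range (\<lambda>j. (f ^^ j) p')"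
  proof (rule omega_periodic_attractor[OF h(1)])
    fix j from h(4) show "(\<lambda>i. (f ^^ (j + q * i)) ((f ^^ m) c)) \<longlonglongrightarrow> (f ^^ j) p'"
    proof
      assume e: "(f ^^ m) c = p'"
      have "(f ^^ (j + q * i)) ((f ^^ m) c) = (f ^^ j) p'" for i using fq e by (simp add: it_add)
      then show ?thesis by simp
    next
      assume "\<exists>I. attracted c m q p' I"
      then obtain I where I: "attracted c m q p' I" by blast
      show ?thesis by (rule attracted_iter[OF I h(2) d]) (use I in \<open>simp add: attracted_def\<close>)
    qed
  qed
  then obtain j where "z = (f ^^ j) p'" using zc unfolding omega_limit_shift by blast
  then have "(f ^^ q) z = z" using h(3) by (simp add: add.commute flip: it_add) (simp add: it_add)
  then show False using nop[OF z h(1)] by blast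
qed

lemma omega_one_sided:
  assumes z: "z \<in> omega_limit f x" and ne: "\<And>n. (f ^^ n) x \<noteq> z"
  shows "(\<forall>e>0. \<forall>k. \<exists>n\<ge>k. (f ^^ n) x \<in> {z - e<..<z}) \<or> (\<forall>e>0. \<forall>k. \<exists>n\<ge>k. (f ^^ n) x \<in> {z<..<z + e})"
proof (rule ccontr)
  assume "\<not> ?thesis"
  then obtain e1 k1 e2 k2 where a: "e1 > 0" "\<And>n. n \<ge> k1 \<Longrightarrow> (f ^^ n) x \<notin> {z - e1<..<z}"
     "e2 > 0" "\<And>n. n \<ge> k2 \<Longrightarrow> (f ^^ n) x \<notin> {z<..<z + e2}" by blast
  have "min e1 e2 > 0" using a by simp
  then obtain n where n: "n \<ge> max k1 k2" "\<bar>(f ^^ n) x - z\<bar> < min e1 e2" using z unfolding omega_limit_iff by blast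
  show False using a(2)[of n] a(4)[of n] n ne[of n] by auto
qed

text \<open>
  \<open>V\<close> is one-sided at \<open>p\<close>, on a side on which the orbit accumulates. One end point is \<open>p\<close>, which
  does not enter \<open>V\<close> if \<open>V\<close> is shorter than the distance from \<open>p\<close> to the rest of its orbit; the
  other end point is the point nearest to \<open>p\<close> that reaches \<open>C\<close> within a certain time. It exists
  because no interval next to \<open>p\<close> on this side is a homterval.
\<close>

lemma admissible_at_periodic:
  assumes w: "wild d x" and p: "p \<in> omega_limit f x" "q \<ge> 1" "(f ^^ q) p = p" and \<eta>: "\<eta> > 0"
  shows "\<exists>V. admissible \<eta> x V \<and> p \<in> closure V - V \<and> (\<forall>e>0. \<forall>k. \<exists>n\<ge>k. (f ^^ n) x \<in> V \<and> \<bar>(f ^^ n) x - p\<bar> < e) \<and>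
     (\<forall>e\<in>closure V - V. e \<noteq> p \<longrightarrow> (\<exists>j. (f ^^ j) e \<in> C))"
proof -
  have ap: "apart d p" using omega_apart[OF wild_apart[OF w] wild_pos[OF w] p(1)] .
  have p01: "p \<in> {0..1}" using apart01[OF ap] .
  have npC: "\<not> hits_C N p" for N unfolding hits_C_def using apart_notC[OF ap wild_pos[OF w]] by blast
  have orbfin: "finite (range (\<lambda>j. (f ^^ j) p))"
  proof -
    have "range (\<lambda>j. (f ^^ j) p) \<subseteq> (\<lambda>j. (f ^^ j) p) ` {..<q}"
    proof
      fix z assume "z \<in> range (\<lambda>j. (f ^^ j) p)"
      then obtain j where "z = (f ^^ j) p" by blast
      then have "z = (f ^^ (j mod q)) p" using funpow_mod_eq[OF p(3)] by simp
      then show "z \<in> (\<lambda>j. (f ^^ j) p) ` {..<q}" using p(2) by auto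
    qed
    then show ?thesis using finite_surj by blast
  qed
  obtain s0 where s0: "s0 > 0" "\<forall>y\<in>range (\<lambda>j. (f ^^ j) p). y \<noteq> p \<longrightarrow> s0 \<le> dist p y"
    using finite_set_avoid[OF orbfin, of p] by blast
  have orb: "\<bar>(f ^^ k) p - p\<bar> \<ge> s0 \<or> (f ^^ k) p = p" for k using s0(2) by (auto simp: dist_real_def)
  have ne: "(f ^^ n) x \<noteq> p" for n
  proof
    assume "(f ^^ n) x = p"
    then have "(f ^^ (q + n)) x = (f ^^ n) x" using p(3) by (simp add: it_add)
    then show False using wild_distinct[OF w, of n "q + n"] p(2) by simp
  qed
  let ?c = "\<lambda>k. 1 / real (Suc k)"
  have cle: "?c N' \<le> ?c N" if "N \<le> N'" for N N' :: nat using that by (intro divide_left_mono) auto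
  from omega_one_sided[OF p(1) ne] show ?thesis
  proof
    assume acc: "\<forall>e>0. \<forall>k. \<exists>n\<ge>k. (f ^^ n) x \<in> {p - e<..<p}"
    define R where "R k = {..<p} \<inter> {p - ?c k<..<p + ?c k}" for k
    have seg: "\<exists>n. (f ^^ n) x \<in> open_segment y p" if "y \<in> {..<p}" for y
    proof -
      have "p - y > 0" using that by simp
      then obtain n where "(f ^^ n) x \<in> {p - (p - y)<..<p}" using acc by blast
      then show ?thesis using that by (intro exI[of _ n]) (auto simp: open_segment_eq_real_ivl)
    qed
    have "\<exists>N. \<forall>V. openiv V \<and> V \<subseteq> R N \<longrightarrow> small_pb \<eta> x V"
    proof (rule small_pullbacks_exist[OF w \<eta>])
      show "R N \<subseteq> {p - ?c N<..<p + ?c N}" for N unfolding R_def by blast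
      show "R N' \<subseteq> R N" if "N \<le> N'" for N N' unfolding R_def using cle[OF that] by auto
      show False if "homterval U" "c \<in> U" "apart (d/2) c" "\<And>k. \<exists>n\<ge>k. (f ^^ n) c \<in> R k" for c U
        by (rule no_capture_periodic[OF w seg _ that(1-3) that(4)[unfolded R_def]]) auto
    qed
    then obtain N where N: "\<And>V. openiv V \<Longrightarrow> V \<subseteq> R N \<Longrightarrow> small_pb \<eta> x V" by blast
    have p0: "0 < p"
    proof -
      obtain n where "(f ^^ n) x \<in> {p - 1<..<p}" using acc by (meson zero_less_one)
      then show ?thesis using wild01[OF w, of n] by auto
    qed
    \<comment> \<open>shorter than the distance from \<open>p\<close> to the other points of its orbit, so that \<open>p\<close> does not return to \<open>V\<close>\<close>
    define s where "s = min (p/2) (min s0 (?c N))"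
    have s: "s > 0" "s < p" "s \<le> s0" "s \<le> ?c N" unfolding s_def using p0 s0(1) by auto
    have so: "openiv {p - s<..<p}" unfolding openiv_def using s p01 by (intro exI conjI refl) auto
    obtain n1 where "(f ^^ n1) x \<in> {p - s<..<p}" using acc s(1) by blast
    then have "\<not> homterval {p - s<..<p}" using wild_not_homterval[OF w] by blast
    then obtain M where M: "\<not> free M {p - s<..<p}" unfolding homterval_def using so by blast
    obtain a where a: "p - s \<le> a" "a < p" "hits_C M a" "free M {a<..<p}"
      by (rule left_cut[OF _ npC s(1,2) M]) (use p01 in auto)
    let ?V = "{a<..<p}"
    have Vo: "openiv ?V" unfolding openiv_def using a s p01 by (intro exI[of _ a] exI[of _ p]) auto
    have cl: "closure ?V - ?V = {a, p}" unfolding closure_greaterThanLessThan[OF a(2)] using a(2) by auto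
    have pk: "(f ^^ k) p \<notin> ?V" for k using orb[of k] a(1,2) s(3) by auto
    have nV: "nice ?V" by (rule nice_interval[OF Vo a(4)]) (use cl a(3) pk in auto)
    have VR: "?V \<subseteq> R N" unfolding R_def using a(1) s(4) by auto
    have vis: "\<exists>n\<ge>k. (f ^^ n) x \<in> ?V \<and> \<bar>(f ^^ n) x - p\<bar> < e" if "e > 0" for e k
    proof -
      have "min e (p - a) > 0" using that a(2) by simp
      then obtain n where "n \<ge> k" "(f ^^ n) x \<in> {p - min e (p - a)<..<p}" using acc by blast
      then show ?thesis by (intro exI[of _ n]) auto
    qed
    have "admissible \<eta> x ?V" unfolding admissible_def using nV N[OF Vo VR] vis[of 1] by auto
    moreover have "\<exists>j. (f ^^ j) a \<in> C" using a(3) unfolding hits_C_def by blast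
    ultimately show ?thesis using cl vis by (intro exI[of _ ?V]) auto
  next
    assume acc: "\<forall>e>0. \<forall>k. \<exists>n\<ge>k. (f ^^ n) x \<in> {p<..<p + e}"
    define R where "R k = {p<..} \<inter> {p - ?c k<..<p + ?c k}" for k
    have seg: "\<exists>n. (f ^^ n) x \<in> open_segment y p" if "y \<in> {p<..}" for y
    proof -
      have "y - p > 0" using that by simp
      then obtain n where "(f ^^ n) x \<in> {p<..<p + (y - p)}" using acc by blast
      then show ?thesis using that by (intro exI[of _ n]) (auto simp: open_segment_eq_real_ivl)
    qed
    have "\<exists>N. \<forall>V. openiv V \<and> V \<subseteq> R N \<longrightarrow> small_pb \<eta> x V"
    proof (rule small_pullbacks_exist[OF w \<eta>])
      show "R N \<subseteq> {p - ?c N<..<p + ?c N}" for N unfolding R_def by blast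
      show "R N' \<subseteq> R N" if "N \<le> N'" for N N' unfolding R_def using cle[OF that] by auto
      show False if "homterval U" "c \<in> U" "apart (d/2) c" "\<And>k. \<exists>n\<ge>k. (f ^^ n) c \<in> R k" for c U
        by (rule no_capture_periodic[OF w seg _ that(1-3) that(4)[unfolded R_def]]) auto
    qed
    then obtain N where N: "\<And>V. openiv V \<Longrightarrow> V \<subseteq> R N \<Longrightarrow> small_pb \<eta> x V" by blast
    have p0: "p < 1"
    proof -
      obtain n where "(f ^^ n) x \<in> {p<..<p + 1}" using acc by (meson zero_less_one)
      then show ?thesis using wild01[OF w, of n] by auto
    qed
    define s where "s = min ((1 - p)/2) (min s0 (?c N))"
    have s: "s > 0" "p + s < 1" "s \<le> s0" "s \<le> ?c N"
    proof -
      show "s > 0" unfolding s_def using p0 s0(1) by auto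
      have "s \<le> (1 - p)/2" unfolding s_def by (rule min.cobounded1)
      then have "2 * s \<le> 1 - p" by (simp only: le_divide_eq_numeral1 mult.commute)
      then show "p + s < 1" using p0 by linarith
      show "s \<le> s0" "s \<le> ?c N" unfolding s_def by auto
    qed
    have so: "openiv {p<..<p + s}" unfolding openiv_def using s p01 by (intro exI conjI refl) auto
    obtain n1 where "(f ^^ n1) x \<in> {p<..<p + s}" using acc s(1) by blast
    then have "\<not> homterval {p<..<p + s}" using wild_not_homterval[OF w] by blast
    then obtain M where M: "\<not> free M {p<..<p + s}" unfolding homterval_def using so by blast
    obtain b where b: "b \<le> p + s" "p < b" "hits_C M b" "free M {p<..<b}"
      by (rule right_cut[OF _ npC s(1,2) M]) (use p01 in auto)
    let ?V = "{p<..<b}"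
    have Vo: "openiv ?V" unfolding openiv_def using b s p01 by (intro exI[of _ p] exI[of _ b]) auto
    have cl: "closure ?V - ?V = {p, b}" unfolding closure_greaterThanLessThan[OF b(2)] using b(2) by auto
    have pk: "(f ^^ k) p \<notin> ?V" for k using orb[of k] b(1,2) s(3) by auto
    have nV: "nice ?V" by (rule nice_interval[OF Vo b(4)]) (use cl b(3) pk in auto)
    have VR: "?V \<subseteq> R N" unfolding R_def using b(1) s(4) by auto
    have vis: "\<exists>n\<ge>k. (f ^^ n) x \<in> ?V \<and> \<bar>(f ^^ n) x - p\<bar> < e" if "e > 0" for e k
    proof -
      have "min e (b - p) > 0" using that b(2) by simp
      then obtain n where "n \<ge> k" "(f ^^ n) x \<in> {p<..<p + min e (b - p)}" using acc by blast
      then show ?thesis by (intro exI[of _ n]) auto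
    qed
    have "admissible \<eta> x ?V" unfolding admissible_def using nV N[OF Vo VR] vis[of 1] by auto
    moreover have "\<exists>j. (f ^^ j) b \<in> C" using b(3) unfolding hits_C_def by blast
    ultimately show ?thesis using cl vis by (intro exI[of _ ?V]) auto
  qed
qed

text \<open>
  If \<open>0\<close> or \<open>1\<close> is an accumulation point, the boundary conditions in \<open>wild\<close> keep its orbit inside
  \<open>{0, 1}\<close>, and it is periodic or preperiodic to a periodic accumulation point.
\<close>

lemma omega_interior:
  assumes w: "wild d x" and nop: "\<And>p q. p \<in> omega_limit f x \<Longrightarrow> q \<ge> 1 \<Longrightarrow> (f ^^ q) p \<noteq> p"
    and z: "z \<in> omega_limit f x"
  shows "z \<in> {0<..<1}"
proof -
  have inv: "(f ^^ n) y \<in> omega_limit f x" if "y \<in> omega_limit f x" for n y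
    using omega_invariant[OF wild_apart[OF w] wild_pos[OF w] that] .
  have 0: "f 0 \<in> {0,1}" if o: "0 \<in> omega_limit f x"
  proof -
    obtain n where "\<bar>(f ^^ n) x - 0\<bar> < d" using o wild_pos[OF w] unfolding omega_limit_iff by blast
    then show ?thesis using wild_0[OF w, of n] by auto
  qed
  have 1: "f 1 \<in> {0,1}" if o: "1 \<in> omega_limit f x"
  proof -
    obtain n where "\<bar>(f ^^ n) x - 1\<bar> < d" using o wild_pos[OF w] unfolding omega_limit_iff by blast
    then show ?thesis using wild_1[OF w, of n] by auto
  qed
  have "z \<noteq> 0"
  proof
    assume z0: "z = 0"
    then have f0: "f 0 = 1" using 0 nop[OF z, of 1] z by auto
    then have o: "1 \<in> omega_limit f x" using inv[OF z, of 1] z0 by simp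
    then have "f 1 = 0" using 1 nop[OF o, of 1] by auto
    then show False using nop[OF z, of 2] z0 f0 by (simp add: numeral_2_eq_2)
  qed
  moreover have "z \<noteq> 1"
  proof
    assume z1: "z = 1"
    then have f1: "f 1 = 0" using 1 nop[OF z, of 1] z by auto
    then have o: "0 \<in> omega_limit f x" using inv[OF z, of 1] z1 by simp
    then have "f 0 = 1" using 0 nop[OF o, of 1] by auto
    then show False using nop[OF z, of 2] z1 f1 by (simp add: numeral_2_eq_2)
  qed
  moreover have "z \<in> {0..1}" using apart01[OF omega_apart[OF wild_apart[OF w] wild_pos[OF w] z]] .
  ultimately show ?thesis by auto
qed

text \<open>
  Otherwise \<open>z\<close> is attracted to a periodic orbit, which then belongs to the closed invariant
  \<open>\<omega>\<close>-limit set.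
\<close>

lemma omega_not_closure_homterval:
  assumes w: "wild d x" and nop: "\<And>p q. p \<in> omega_limit f x \<Longrightarrow> q \<ge> 1 \<Longrightarrow> (f ^^ q) p \<noteq> p"
    and z: "z \<in> omega_limit f x" and J: "homterval J"
  shows "z \<notin> closure J"
proof
  assume "z \<in> closure J"
  have d: "d > 0" using wild_pos[OF w] .
  have inv: "(f ^^ n) z \<in> omega_limit f x" for n
    using omega_invariant[OF wild_apart[OF w] wild_pos[OF w] z] .
  have ap: "apart d z" using omega_apart[OF wild_apart[OF w] d z] .
  from homterval_attracted[OF J \<open>z \<in> closure J\<close> ap d] obtain m q p where
    h: "q \<ge> 1" "apart d p" "(f ^^ q) p = p" "(f ^^ m) z = p \<or> (\<exists>I. attracted z m q p I)" by blast
  have "p \<in> omega_limit f x" using h(4)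
  proof
    assume "(f ^^ m) z = p" then show ?thesis using inv[of m] by simp
  next
    assume "\<exists>I. attracted z m q p I"
    then obtain I where I: "attracted z m q p I" by blast
    have "(\<lambda>i. (f ^^ (0 + q * i)) ((f ^^ m) z)) \<longlonglongrightarrow> (f ^^ 0) p"
      by (rule attracted_iter[OF I h(2) d]) (use I in \<open>simp add: attracted_def\<close>)
    then have "(\<lambda>i. (f ^^ (q * i + m)) z) \<longlonglongrightarrow> p" by (simp add: it_add)
    then show ?thesis by (rule closed_sequentially[OF omega_closed inv])
  qed
  then show False using nop h(1,3) by blast
qed

text \<open>
  Both end points of \<open>V\<close> are the points nearest to \<open>z\<close> that reach \<open>C\<close> within time \<open>M\<close>. As \<open>z\<close> is not
  in the closure of a homterval, \<open>M\<close> can be chosen to make them close to \<open>z\<close>.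
\<close>

lemma admissible_at_aperiodic:
  assumes w: "wild d x" and nop: "\<And>p q. p \<in> omega_limit f x \<Longrightarrow> q \<ge> 1 \<Longrightarrow> (f ^^ q) p \<noteq> p"
    and z: "z \<in> omega_limit f x" and \<eta>: "\<eta> > 0" and \<sigma>: "\<sigma> > 0"
  shows "\<exists>V. admissible \<eta> x V \<and> z \<in> V \<and> V \<subseteq> {z - \<sigma><..<z + \<sigma>}"
proof -
  let ?c = "\<lambda>k. 1 / real (Suc k)"
  have cle: "?c N' \<le> ?c N" if "N \<le> N'" for N N' :: nat using that by (intro divide_left_mono) auto
  have "\<exists>N. \<forall>V. openiv V \<and> V \<subseteq> {z - ?c N<..<z + ?c N} \<longrightarrow> small_pb \<eta> x V"
  proof (rule small_pullbacks_exist[OF w \<eta>])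
    show "{z - ?c N'<..<z + ?c N'} \<subseteq> {z - ?c N<..<z + ?c N}" if "N \<le> N'" for N N' using cle[OF that] by auto
    show False if "homterval U" "c \<in> U" "apart (d/2) c" "\<And>k. \<exists>n\<ge>k. (f ^^ n) c \<in> {z - ?c k<..<z + ?c k}" for c U
      by (rule no_capture_aperiodic[OF w z nop that])
  qed auto
  then obtain N where N: "\<And>V. openiv V \<Longrightarrow> V \<subseteq> {z - ?c N<..<z + ?c N} \<Longrightarrow> small_pb \<eta> x V" by blast
  have z01: "z \<in> {0<..<1}" by (rule omega_interior[OF w nop z])
  have npC: "\<not> hits_C M z" for M unfolding hits_C_def using wild_omega_notC[OF w z] by blast
  define s where "s = min (min (z/2) ((1 - z)/2)) (min \<sigma> (?c N))"
  have s: "s > 0" "s < z" "z + s < 1" "s \<le> \<sigma>" "s \<le> ?c N"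
  proof -
    show "s > 0" unfolding s_def using z01 \<sigma> by auto
    have "s \<le> min (z/2) ((1 - z)/2)" unfolding s_def by (rule min.cobounded1)
    then have "s \<le> z/2" "s \<le> (1 - z)/2" by (simp_all only: min.bounded_iff)
    then have "2 * s \<le> z" "2 * s \<le> 1 - z" by (simp_all only: le_divide_eq_numeral1 mult.commute)
    moreover have "0 < z" "z < 1" using z01 by auto
    ultimately show "s < z" "z + s < 1" by linarith+
    show "s \<le> \<sigma>" "s \<le> ?c N" unfolding s_def by auto
  qed
  have o1: "openiv {z - s<..<z}" unfolding openiv_def using s z01 by (intro exI conjI refl) auto
  have o2: "openiv {z<..<z + s}" unfolding openiv_def using s z01 by (intro exI conjI refl) auto
  have "\<not> homterval {z - s<..<z}" using omega_not_closure_homterval[OF w nop z] s(1) by fastforce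
  then obtain M1 where M1: "\<not> free M1 {z - s<..<z}" unfolding homterval_def using o1 by blast
  have "\<not> homterval {z<..<z + s}" using omega_not_closure_homterval[OF w nop z] s(1) by fastforce
  then obtain M2 where M2: "\<not> free M2 {z<..<z + s}" unfolding homterval_def using o2 by blast
  define M where "M = max M1 M2"
  have M: "\<not> free M {z - s<..<z}" "\<not> free M {z<..<z + s}" using M1 M2 free_le unfolding M_def by (meson max.cobounded1 max.cobounded2)+
  obtain a where a: "z - s \<le> a" "a < z" "hits_C M a" "free M {a<..<z}"
    by (rule left_cut[OF _ npC s(1,2) M(1)]) (use z01 in auto)
  obtain b where b: "b \<le> z + s" "z < b" "hits_C M b" "free M {z<..<b}"
    by (rule right_cut[OF _ npC s(1,3) M(2)]) (use z01 in auto)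
  let ?V = "{a<..<b}"
  have ab: "a < b" using a b by simp
  have Vo: "openiv ?V" unfolding openiv_def using a b s by (intro exI[of _ a] exI[of _ b]) auto
  have fr: "free M ?V"
  proof -
    have "free M {z}" using npC[of M] unfolding free_def hits_C_def by auto
    then have "free M ({a<..<z} \<union> ({z} \<union> {z<..<b}))" using a(4) b(4) free_Un by blast
    then show ?thesis by (rule free_mono) auto
  qed
  have cl: "closure ?V - ?V = {a, b}" unfolding closure_greaterThanLessThan[OF ab] using ab by auto
  have nV: "nice ?V" by (rule nice_interval[OF Vo fr]) (use cl a(3) b(3) in auto)
  have sub: "?V \<subseteq> {z - ?c N<..<z + ?c N}" "?V \<subseteq> {z - \<sigma><..<z + \<sigma>}" using a b s by auto
  have "\<exists>n\<ge>k. (f ^^ n) x \<in> ?V" for k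
  proof -
    have "min (z - a) (b - z) > 0" using a b by simp
    then obtain n where "n \<ge> k" "\<bar>(f ^^ n) x - z\<bar> < min (z - a) (b - z)" using z unfolding omega_limit_iff by blast
    then show ?thesis by (intro exI[of _ n]) auto
  qed
  then have "admissible \<eta> x ?V" unfolding admissible_def using nV N[OF Vo sub(1)] by blast
  then show ?thesis using sub(2) a(2) b(2) by (intro exI[of _ ?V]) auto
qed

end

section \<open>Return branches and stages\<close>

lemma sum_lessThan_split:
  fixes g :: "nat \<Rightarrow> real" shows "(\<Sum>i<a + b. g i) = (\<Sum>i<a. g i) + (\<Sum>i<b. g (a + i))"
  by (induction b) auto

context interval_map begin

lemma it_after: "(f ^^ (i + j)) x = (f ^^ j) ((f ^^ i) x)"
  using it_add[of j i x] by (simp only: add.commute)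

text \<open>
  A pullback that contains the orbit point \<open>x\<^sub>i\<close> is unique by niceness.
\<close>

lemma small_pb_size:
  assumes V: "nice V" "small_pb \<eta> x V" and p: "pb n J V" "(f ^^ i) x \<in> J" and j: "j \<le> n"
  shows "len ((f ^^ j) ` J) < \<eta>"
proof -
  have "(f ^^ (n + i)) x \<in> V" using pb_in[OF p] by (simp add: it_add)
  then have "(f ^^ (i + n)) x \<in> V" by (simp only: add.commute)
  then obtain J' where J': "pb n J' V" "(f ^^ i) x \<in> J'" "\<forall>j\<le>n. len ((f ^^ j) ` J') < \<eta>"
    using V(2) unfolding small_pb_def by blast
  have "J = J'" by (rule pullbacks_equal[OF V(1) p(1) J'(1)]) (use p(2) J'(2) in blast)
  then show ?thesis using J'(3) j by blast
qed

lemma pb_orbit_in: "(f ^^ i) x \<in> J \<Longrightarrow> (f ^^ (i + j)) x \<in> (f ^^ j) ` J"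
proof -
  assume "(f ^^ i) x \<in> J"
  then have "(f ^^ j) ((f ^^ i) x) \<in> (f ^^ j) ` J" by blast
  then show ?thesis by (simp add: it_after)
qed

lemma pb_img_openiv: "pb n J V \<Longrightarrow> j \<le> n \<Longrightarrow> openiv ((f ^^ j) ` J)"
  using free_image pb_openiv pb_free free_le by blast

lemma small_away:
  assumes w: "wild d x" and \<eta>: "\<eta> \<le> d/2" and p: "pb n J V" "(f ^^ i) x \<in> J" and j: "j \<le> n" "len ((f ^^ j) ` J) < \<eta>"
  shows "(f ^^ j) ` J \<subseteq> away C (d/2)"
proof
  fix t assume t: "t \<in> (f ^^ j) ` J"
  have o: "openiv ((f ^^ j) ` J)" by (rule pb_img_openiv[OF p(1) j(1)])
  have "\<bar>t - (f ^^ (i + j)) x\<bar> < len ((f ^^ j) ` J)"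
    by (rule openiv_diff_less_len[OF o t pb_orbit_in[OF p(2)]])
  then have l: "\<bar>t - (f ^^ (i + j)) x\<bar> < d/2" using j(2) \<eta> by linarith
  have "d/2 \<le> \<bar>t - c\<bar>" if "c \<in> C" for c using wild_away[OF w that, of "i + j"] l by linarith
  then show "t \<in> away C (d/2)" unfolding away_def using openiv_sub01[OF o] t by blast
qed

lemma small_pb_pb:
  assumes V: "nice V" "small_pb \<eta> x V" and W: "pb m W V"
  shows "small_pb \<eta> x W"
  unfolding small_pb_def
proof (intro allI impI)
  fix i n assume a: "(f ^^ (i + n)) x \<in> W"
  have "(f ^^ (m + (i + n))) x \<in> V" using pb_in[OF W a] by (simp add: it_add)
  then have "(f ^^ (i + (n + m))) x \<in> V" by (simp only: ac_simps)
  then obtain J where J: "pb (n + m) J V" "(f ^^ i) x \<in> J" "\<forall>j\<le>n + m. len ((f ^^ j) ` J) < \<eta>"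
    using V(2) unfolding small_pb_def by blast
  have "pb (n + m - n) ((f ^^ n) ` J) V" by (rule pb_image[OF J(1)]) simp
  then have pm: "pb m ((f ^^ n) ` J) V" by simp
  have "(f ^^ n) ` J = W" by (rule pullbacks_equal[OF V(1) pm W]) (use pb_orbit_in[OF J(2), of n] a in blast)
  then have "pb n J W" unfolding pb_def using pb_openiv[OF J(1)] free_le[OF pb_free[OF J(1)]] by simp
  then show "\<exists>J. pb n J W \<and> (f ^^ i) x \<in> J \<and> (\<forall>j\<le>n. len ((f ^^ j) ` J) < \<eta>)" using J(2,3) by auto
qed

text \<open>
  The \<open>\<eta>\<close>-neighbourhood of the orbit of \<open>x\<close>. Its measure controls all distortions; it is small
  if the orbit closure is null.
\<close>

definition tube :: "real \<Rightarrow> real \<Rightarrow> real set" where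
  "tube x \<eta> = {t\<in>{0..1}. \<exists>i. \<bar>t - (f ^^ i) x\<bar> < \<eta>}"

lemma tube_lmeasurable: "tube x \<eta> \<in> lmeasurable" and tube_le1: "len (tube x \<eta>) \<le> 1"
proof -
  have e: "tube x \<eta> = {0..1} \<inter> (\<Union>i. ball ((f ^^ i) x) \<eta>)" unfolding tube_def by (auto simp: dist_real_def abs_minus_commute)
  have "open (\<Union>i. ball ((f ^^ i) x) \<eta>)" by blast
  then have "(\<Union>i. ball ((f ^^ i) x) \<eta>) \<in> sets lebesgue" by simp
  then show l: "tube x \<eta> \<in> lmeasurable" unfolding e using fmeasurable_Int_fmeasurable[of "{0..1::real}"] by auto
  have "len (tube x \<eta>) \<le> len {0..1}" by (rule measure_mono_fmeasurable) (use l in \<open>auto simp: tube_def fmeasurableD\<close>)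
  then show "len (tube x \<eta>) \<le> 1" by simp
qed

text \<open>
  The image at time \<open>a\<close> has the larger order, so by nesting it would lie inside the image at
  time \<open>b\<close>, and \<open>t\<close> would be in \<open>V\<close> at time \<open>n - (b - a)\<close>.
\<close>

lemma tower_disjoint:
  assumes V: "nice V" and p: "pb n J V" "t \<in> J" and ab: "a < b" "b \<le> n" and out: "(f ^^ (n - (b - a))) t \<notin> V"
  shows "(f ^^ a) ` J \<inter> (f ^^ b) ` J = {}"
proof (rule ccontr)
  assume ne: "(f ^^ a) ` J \<inter> (f ^^ b) ` J \<noteq> {}"
  have pa: "pb (n - a) ((f ^^ a) ` J) V" by (rule pb_image[OF p(1)]) (use ab in simp)
  have pB: "pb (n - b) ((f ^^ b) ` J) V" by (rule pb_image[OF p(1) ab(2)])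
  have "(f ^^ a) ` J \<subseteq> (f ^^ b) ` J" by (rule pullbacks_nested[OF V pa pB _ ne]) (use ab in simp)
  then have "(f ^^ a) t \<in> (f ^^ b) ` J" using p(2) by blast
  then have "(f ^^ (n - b)) ((f ^^ a) t) \<in> V" by (rule pb_in[OF pB])
  moreover have "n - b + a = n - (b - a)" using ab by simp
  ultimately show False using out by (simp flip: it_add)
qed

text \<open>
  The images of a pullback up to a first visit to \<open>V\<close> are disjoint and short, so they fit into
  the tube.
\<close>

lemma tower_sum:
  assumes V: "nice V" "small_pb \<eta> x V" and p: "pb n J V" "(f ^^ i) x \<in> J"
    and first: "\<And>l. 1 \<le> l \<Longrightarrow> l < n \<Longrightarrow> (f ^^ (i + l)) x \<notin> V"
  shows "(\<Sum>j<n. len ((f ^^ j) ` J)) \<le> len (tube x \<eta>)"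
proof (rule sum_len_disjoint_le[OF _ _ _ _ tube_lmeasurable])
  have dj: "(f ^^ a) ` J \<inter> (f ^^ b) ` J = {}" if ab: "a < b" "b < n" for a b
  proof (rule tower_disjoint[OF V(1) p ab(1)])
    have "(f ^^ (i + (n - (b - a)))) x \<notin> V" by (rule first) (use ab in auto)
    then show "(f ^^ (n - (b - a))) ((f ^^ i) x) \<notin> V" by (simp add: it_after)
  qed (use ab in simp)
  show "disjoint_family_on (\<lambda>j. (f ^^ j) ` J) {..<n}"
    unfolding disjoint_family_on_def
  proof (intro ballI impI)
    fix a b assume "a \<in> {..<n}" "b \<in> {..<n}" "a \<noteq> b"
    then consider "a < b" "b < n" | "b < a" "a < n" by fastforce
    then show "(f ^^ a) ` J \<inter> (f ^^ b) ` J = {}" using dj[of a b] dj[of b a] by cases blast+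
  qed
  fix j assume j: "j \<in> {..<n}"
  then have jn: "j \<le> n" by simp
  show o: "openiv ((f ^^ j) ` J)" by (rule pb_img_openiv[OF p(1) jn])
  show "(f ^^ j) ` J \<subseteq> tube x \<eta>"
  proof
    fix t assume t: "t \<in> (f ^^ j) ` J"
    have "\<bar>t - (f ^^ (i + j)) x\<bar> < len ((f ^^ j) ` J)"
      by (rule openiv_diff_less_len[OF o t pb_orbit_in[OF p(2)]])
    then have "\<bar>t - (f ^^ (i + j)) x\<bar> < \<eta>" using small_pb_size[OF V p jn] by linarith
    then show "t \<in> tube x \<eta>" unfolding tube_def using openiv_sub01[OF o] t by blast
  qed
qed simp

text \<open>
  Neither side of \<open>f\<^sup>n x\<close> contains an adjacent homterval, so intervals of length \<open>c/2\<close> on either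
  side stop being free at some time.
\<close>

lemma pullbacks_shrink:
  assumes w: "wild d x" and c: "c > 0"
  shows "\<exists>T0. \<forall>T U V. T \<ge> T0 \<and> pb T U V \<and> (f ^^ n) x \<in> U \<longrightarrow> len U < c"
proof -
  let ?y = "(f ^^ n) x"
  let ?A = "{?y<..<?y + c/2}" and ?B = "{?y - c/2<..<?y}"
  have A: "\<exists>T1. openiv ?A \<longrightarrow> \<not> free T1 ?A"
  proof (cases "openiv ?A")
    case True
    have "\<not> homterval ?A"
    proof
      assume "homterval ?A"
      moreover have "?y \<in> closure ?A" using c by simp
      ultimately show False using wild_not_closure_homterval[OF w] by blast
    qed
    then show ?thesis unfolding homterval_def using True by blast
  qed simp
  have B: "\<exists>T1. openiv ?B \<longrightarrow> \<not> free T1 ?B"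
  proof (cases "openiv ?B")
    case True
    have "\<not> homterval ?B"
    proof
      assume "homterval ?B"
      moreover have "?y \<in> closure ?B" using c by simp
      ultimately show False using wild_not_closure_homterval[OF w] by blast
    qed
    then show ?thesis unfolding homterval_def using True by blast
  qed simp
  obtain T1 T2 where T: "openiv ?A \<longrightarrow> \<not> free T1 ?A" "openiv ?B \<longrightarrow> \<not> free T2 ?B" using A B by blast
  show ?thesis
  proof (intro exI[of _ "max T1 T2"] allI impI)
    fix T U V assume a: "T \<ge> max T1 T2 \<and> pb T U V \<and> ?y \<in> U"
    then have U: "openiv U" "free T U" using pb_openiv pb_free by blast+
    obtain u v where uv: "0 \<le> u" "u < v" "v \<le> 1" "U = {u<..<v}" using U(1) unfolding openiv_def by blast
    have y: "u < ?y" "?y < v" using a uv(4) by auto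
    have f1: "free T1 U" "free T2 U" using free_le[OF U(2)] a by auto
    have "\<not> ?y + c/2 \<le> v"
    proof
      assume "?y + c/2 \<le> v"
      then have s: "?A \<subseteq> U" unfolding uv(4) using y by auto
      have "openiv ?A" unfolding openiv_def using \<open>?y + c/2 \<le> v\<close> uv y c by (intro exI conjI refl) auto
      then show False using T(1) free_mono[OF f1(1) s] by blast
    qed
    moreover have "\<not> u \<le> ?y - c/2"
    proof
      assume "u \<le> ?y - c/2"
      then have s: "?B \<subseteq> U" unfolding uv(4) using y by auto
      have "openiv ?B" unfolding openiv_def using \<open>u \<le> ?y - c/2\<close> uv y c by (intro exI conjI refl) auto
      then show False using T(2) free_mono[OF f1(2) s] by blast
    qed
    moreover have "len U = v - u" using uv by simp
    ultimately show "len U < c" by linarith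
  qed
qed

lemma first_return:
  assumes V: "admissible \<eta> x V" and n: "(f ^^ n) x \<in> V"
  obtains r W where "r \<ge> 1" "(f ^^ (n + r)) x \<in> V" "\<And>l. 1 \<le> l \<Longrightarrow> l < r \<Longrightarrow> (f ^^ (n + l)) x \<notin> V"
    "pb r W V" "(f ^^ n) x \<in> W" "W \<subseteq> V"
proof -
  have nV: "nice V" and sV: "small_pb \<eta> x V" using V unfolding admissible_def by blast+
  obtain m where m: "m \<ge> Suc n" "(f ^^ m) x \<in> V" using V unfolding admissible_def by blast
  define P where "P r \<longleftrightarrow> r \<ge> 1 \<and> (f ^^ (n + r)) x \<in> V" for r
  have "P (m - n)" unfolding P_def using m by simp
  define r where "r = (LEAST r. P r)"
  have r: "P r" "\<And>l. l < r \<Longrightarrow> \<not> P l" unfolding r_def by (rule LeastI[of P, OF \<open>P (m - n)\<close>]) (rule not_less_Least)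
  obtain W where W: "pb r W V" "(f ^^ n) x \<in> W" using sV r(1) unfolding small_pb_def P_def by blast
  have "W \<subseteq> V" by (rule pullbacks_nested[OF nV W(1) pb_0[OF nice_openiv[OF nV]]]) (use W(2) n in auto)
  then show thesis using that[of r W] r W unfolding P_def by blast
qed

lemma same_return:
  assumes V: "admissible \<eta> x V" and W: "pb r W V" "(f ^^ n) x \<in> W" "\<And>l. 1 \<le> l \<Longrightarrow> l < r \<Longrightarrow> (f ^^ (n + l)) x \<notin> V"
    and m: "(f ^^ m) x \<in> W" and l: "1 \<le> l" "l < r"
  shows "(f ^^ (m + l)) x \<notin> V"
proof
  assume a: "(f ^^ (m + l)) x \<in> V"
  have nV: "nice V" and sV: "small_pb \<eta> x V" using V unfolding admissible_def by blast+
  obtain J where J: "pb l J V" "(f ^^ m) x \<in> J" using sV a unfolding small_pb_def by blast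
  have "W \<subseteq> J" by (rule pullbacks_nested[OF nV W(1) J(1)]) (use l m J(2) in auto)
  then have "(f ^^ l) ((f ^^ n) x) \<in> V" using pb_in[OF J(1)] W(2) by blast
  then show False using W(3)[OF l] by (simp add: it_after)
qed

text \<open>
  Nesting: if the return times differ, the branch with the longer return time lies in the
  other one, so its return was not the first.
\<close>

lemma return_branches_disjoint:
  assumes V: "admissible \<eta> x V"
    and W: "pb r W V" "(f ^^ n) x \<in> W" "\<And>l. 1 \<le> l \<Longrightarrow> l < r \<Longrightarrow> (f ^^ (n + l)) x \<notin> V" "r \<ge> 1"
    and W': "pb r' W' V" "(f ^^ n') x \<in> W'" "\<And>l. 1 \<le> l \<Longrightarrow> l < r' \<Longrightarrow> (f ^^ (n' + l)) x \<notin> V" "r' \<ge> 1"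
    and ne: "W \<inter> W' \<noteq> {}"
  shows "W = W' \<and> r = r'"
proof -
  have nV: "nice V" using V unfolding admissible_def by blast
  have rr: "r = r'"
  proof (rule ccontr)
    assume "r \<noteq> r'"
    then consider "r < r'" | "r' < r" by linarith
    then show False
    proof cases
      case 1
      have "W' \<subseteq> W" by (rule pullbacks_nested[OF nV W'(1) W(1)]) (use 1 ne in auto)
      then have "(f ^^ r) ((f ^^ n') x) \<in> V" using pb_in[OF W(1)] W'(2) by blast
      then show False using W'(3)[OF W(4) 1] by (simp add: it_after)
    next
      case 2
      have "W \<subseteq> W'" by (rule pullbacks_nested[OF nV W(1) W'(1)]) (use 2 ne in auto)
      then have "(f ^^ r') ((f ^^ n) x) \<in> V" using pb_in[OF W'(1)] W(2) by blast
      then show False using W(3)[OF W'(4) 2] by (simp add: it_after)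
    qed
  qed
  then show ?thesis using pullbacks_equal[OF nV W(1)] W'(1) ne by blast
qed

text \<open>
  The domain of the \<open>i\<close>-th iterate of the branch \<open>f\<^sup>r : W \<rightarrow> V\<close>; \<open>iter_branch W r V 1\<close> is \<open>W\<close>.
\<close>

primrec iter_branch :: "real set \<Rightarrow> nat \<Rightarrow> real set \<Rightarrow> nat \<Rightarrow> real set" where
  "iter_branch W r V 0 = V"
| "iter_branch W r V (Suc i) = {t\<in>W. (f ^^ r) t \<in> iter_branch W r V i}"

lemma iter_branch_pb:
  assumes W: "pb r W V" "W \<subseteq> V"
  shows "iter_branch W r V i \<subseteq> V \<and> pb (i * r) (iter_branch W r V i) V \<and>
     pb r (iter_branch W r V (Suc i)) (iter_branch W r V i)"
proof (induction i)
  case 0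
  have "pb r {t\<in>W. (f ^^ r) t \<in> V} V" by (rule pb_sub[OF W(1) pb_target[OF W(1)]]) simp
  then show ?case using pb_0[OF pb_target[OF W(1)]] by simp
next
  case (Suc i)
  let ?J = "iter_branch W r V"
  have p: "pb r (?J (Suc i)) (?J i)" "pb (i * r) (?J i) V" using Suc by blast+
  have sub: "?J (Suc i) \<subseteq> V" using W(2) by auto
  have "pb (Suc i * r) (?J (Suc i)) V" using pb_comp[OF p] by simp
  moreover have "pb r (?J (Suc (Suc i))) (?J (Suc i))"
    unfolding iter_branch.simps(2)[of _ _ _ "Suc i"]
    by (rule pb_sub[OF W(1) pb_openiv[OF p(1)] sub])
  ultimately show ?case using sub by blast
qed

lemma iter_branch_mem:
  assumes m: "\<And>l. l < k \<Longrightarrow> (f ^^ (n + l * r)) x \<in> W"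
  shows "\<lbrakk>i + l \<le> k; (f ^^ (n + (l + i) * r)) x \<in> V\<rbrakk> \<Longrightarrow> (f ^^ (n + l * r)) x \<in> iter_branch W r V i"
proof (induction i arbitrary: l)
  case (Suc i)
  have 1: "(f ^^ (n + l * r)) x \<in> W" using Suc.prems m[of l] by simp
  have "(f ^^ (n + Suc l * r)) x \<in> iter_branch W r V i" by (rule Suc.IH) (use Suc.prems in simp_all)
  moreover have "(f ^^ (n + Suc l * r)) x = (f ^^ r) ((f ^^ (n + l * r)) x)" by (simp add: ac_simps flip: it_add)
  ultimately show ?case using 1 by simp
qed simp

text \<open>
  An orbit that stays in \<open>W\<close> under \<open>f\<^sup>r\<close> lies in all \<open>iter_branch W r V i\<close>. These shrink to a
  point, while \<open>x\<^sub>n \<noteq> x\<^sub>n\<^sub>+\<^sub>r\<close>.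
\<close>

lemma run_ends:
  assumes w: "wild d x" and W: "pb r W V" "W \<subseteq> V" "r \<ge> 1"
  shows "\<exists>k. (f ^^ (n + k * r)) x \<notin> W"
proof (rule ccontr)
  assume "\<not> ?thesis"
  then have inW: "(f ^^ (n + l * r)) x \<in> W" for l by blast
  then have inJ: "(f ^^ (n + l * r)) x \<in> iter_branch W r V i" for l i
    using iter_branch_mem[of "i + l" n r x W i l V] W(2) pb_in[OF W(1)] by blast
  define c where "c = \<bar>(f ^^ n) x - (f ^^ (n + r)) x\<bar>"
  have "c > 0" unfolding c_def using wild_distinct[OF w, of n "n + r"] W(3) by simp
  then obtain T0 where T0: "\<forall>T U V. T \<ge> T0 \<and> pb T U V \<and> (f ^^ n) x \<in> U \<longrightarrow> len U < c"
    using pullbacks_shrink[OF w] by blast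
  have p: "pb (T0 * r) (iter_branch W r V T0) V" using iter_branch_pb[OF W(1,2)] by blast
  have "len (iter_branch W r V T0) < c"
    using T0 p inJ[of 0 T0] W(3) by (metis add_cancel_right_right le_add1 mult_0 mult_eq_if not_one_le_zero mult.commute add.commute)
  moreover have "c < len (iter_branch W r V T0)" unfolding c_def
    by (rule openiv_diff_less_len[OF pb_openiv[OF p]]) (use inJ[of 0 T0] inJ[of 1 T0] in simp_all)
  ultimately show False by simp
qed

text \<open>
  A stage. The orbit follows the branch \<open>W\<close> for \<open>k\<close> rounds until it falls into another branch
  \<open>W'\<close>, and then returns to \<open>V\<close> through \<open>W'\<close>; \<open>J\<close> is the pullback of \<open>W'\<close> of order \<open>k r\<close>. Following the
  run to its end has two merits. The images of \<open>J\<close> before time \<open>k r\<close> are the pullbacks to a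
  first visit to \<open>W'\<close>, so they form one disjoint tower, and the return through \<open>W'\<close> adds another
  one. And \<open>f\<^sup>r J\<close> is disjoint from \<open>J\<close> and at least \<open>exp (- L S)\<close> times as long, so that \<open>J\<close> is
  definitely shorter than \<open>V\<close>.
\<close>

lemma run_stage:
  assumes w: "wild d x" and V: "admissible \<eta> x V" and \<eta>: "\<eta> \<le> d/2" and L: "log_lipschitz f' C (d/2) L" and n: "(f ^^ n) x \<in> V"
    and S: "len (tube x \<eta>) \<le> S"
  obtains T J W r k where "(f ^^ (k * r)) ` J \<subseteq> V - W" "r \<ge> 1" "k \<ge> 1" "pb r W V" "(f ^^ n) x \<in> W" "W \<subseteq> V"
    "\<And>l. 1 \<le> l \<Longrightarrow> l < r \<Longrightarrow> (f ^^ (n + l)) x \<notin> V" "\<And>i. i < k \<Longrightarrow> (f ^^ (n + i * r)) x \<in> W"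
    "(f ^^ (n + k * r)) x \<in> V - W" "k * r < T" "pb T J V" "(f ^^ n) x \<in> J" "J \<subseteq> W" "(f ^^ (n + T)) x \<in> V"
    "(\<Sum>i<T. len ((f ^^ i) ` J)) \<le> 2 * S" "len J * (1 + exp (- (L * S))) \<le> len V"
proof -
  have nV: "nice V" and sV: "small_pb \<eta> x V" using V unfolding admissible_def by blast+
  obtain r W where W: "r \<ge> 1" "(f ^^ (n + r)) x \<in> V" "\<And>l. 1 \<le> l \<Longrightarrow> l < r \<Longrightarrow> (f ^^ (n + l)) x \<notin> V"
    "pb r W V" "(f ^^ n) x \<in> W" "W \<subseteq> V" by (rule first_return[OF V n]) blast
  define P where "P k \<longleftrightarrow> (f ^^ (n + k * r)) x \<notin> W" for k
  obtain k0 where "P k0" using run_ends[OF w W(4,6,1)] unfolding P_def by blast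
  define k where "k = (LEAST k. P k)"
  have k: "P k" "\<And>l. l < k \<Longrightarrow> \<not> P l" unfolding k_def by (rule LeastI[of P, OF \<open>P k0\<close>]) (rule not_less_Least)
  have run: "(f ^^ (n + i * r)) x \<in> W" if "i < k" for i using k(2)[OF that] unfolding P_def by blast
  have k1: "k \<ge> 1" using k(1) W(5) unfolding P_def by (cases k) auto
  have inV: "(f ^^ (n + k * r)) x \<in> V"
  proof -
    have e: "n + (k - 1) * r + r = n + k * r" using k1 by (cases k) auto
    have "(f ^^ r) ((f ^^ (n + (k - 1) * r)) x) \<in> V" by (rule pb_in[OF W(4) run]) (use k1 in simp)
    then show ?thesis unfolding it_after[symmetric] e .
  qed
  let ?n = "n + k * r"
  obtain r' W' where W': "r' \<ge> 1" "(f ^^ (?n + r')) x \<in> V" "\<And>l. 1 \<le> l \<Longrightarrow> l < r' \<Longrightarrow> (f ^^ (?n + l)) x \<notin> V"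
    "pb r' W' V" "(f ^^ ?n) x \<in> W'" "W' \<subseteq> V" by (rule first_return[OF V inV]) blast
  \<comment> \<open>both are first return branches and the orbit has left \<open>W\<close>\<close>
  have WW': "W \<inter> W' = {}"
    using return_branches_disjoint[OF V W(4,5,3,1) W'(4,5,3,1)] k(1) W'(5) unfolding P_def by blast
  have nW': "nice W'" by (rule nice_pb[OF nV W'(4)])
  have sW': "small_pb \<eta> x W'" by (rule small_pb_pb[OF nV sV W'(4)])
  obtain J where J: "pb (k * r) J W'" "(f ^^ n) x \<in> J" using sW' W'(5) unfolding small_pb_def by blast
  define T where "T = k * r + r'"
  have pT: "pb T J V" unfolding T_def by (rule pb_comp[OF J(1) W'(4)])
  have rk: "r \<le> k * r" using k1 by (cases k) auto
  have JW: "J \<subseteq> W"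
  proof (rule pullbacks_nested[OF nV pT W(4)])
    show "r \<le> T" using rk unfolding T_def by linarith
    show "J \<inter> W \<noteq> {}" using J(2) W(5) by blast
  qed
  \<comment> \<open>during the run the orbit visits \<open>V\<close> only inside \<open>W\<close>, so time \<open>k r\<close> is its first visit to \<open>W'\<close>\<close>
  have s1: "(\<Sum>i<k * r. len ((f ^^ i) ` J)) \<le> len (tube x \<eta>)"
  proof (rule tower_sum[OF nW' sW' J])
    fix l assume l: "1 \<le> l" "l < k * r"
    define i where "i = l div r"
    have ik: "i < k" unfolding i_def using l(2) W(1) by (simp add: less_mult_imp_div_less)
    have li: "n + l = n + i * r + l mod r" unfolding i_def by simp
    show "(f ^^ (n + l)) x \<notin> W'"
    proof (cases "l mod r = 0")
      case True
      then have "(f ^^ (n + l)) x \<in> W" using run[OF ik] li by simp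
      then show ?thesis using WW' by blast
    next
      case False
      have "(f ^^ (n + i * r + l mod r)) x \<notin> V"
        by (rule same_return[OF V W(4,5,3) run[OF ik]]) (use False W(1) in simp_all)
      then show ?thesis unfolding li using W'(6) by blast
    qed
  qed
  have s2: "(\<Sum>i<r'. len ((f ^^ i) ` W')) \<le> len (tube x \<eta>)"
    by (rule tower_sum[OF nV sV W'(4,5,3)])
  have "(\<Sum>i<T. len ((f ^^ i) ` J)) = (\<Sum>i<k * r. len ((f ^^ i) ` J)) + (\<Sum>i<r'. len ((f ^^ (k * r + i)) ` J))"
    unfolding T_def by (rule sum_lessThan_split)
  also have "(\<Sum>i<r'. len ((f ^^ (k * r + i)) ` J)) = (\<Sum>i<r'. len ((f ^^ i) ` W'))"
  proof (rule sum.cong[OF refl])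
    fix i have "(f ^^ (k * r + i)) ` J = (f ^^ i) ` ((f ^^ (k * r)) ` J)"
      unfolding add.commute[of "k * r" i] funpow_add image_comp ..
    then show "len ((f ^^ (k * r + i)) ` J) = len ((f ^^ i) ` W')" using pb_img[OF J(1)] by simp
  qed
  finally have sum: "(\<Sum>i<T. len ((f ^^ i) ` J)) \<le> 2 * S" using s1 s2 S by linarith
  \<comment> \<open>one round before the end of the run the orbit is in \<open>W\<close>, hence not in \<open>W'\<close>\<close>
  have dj: "(f ^^ 0) ` J \<inter> (f ^^ r) ` J = {}"
  proof (rule tower_disjoint[OF nW' J])
    have e: "k * r - (r - 0) = (k - 1) * r" using k1 by (cases k) auto
    have "(f ^^ (n + (k - 1) * r)) x \<in> W" by (rule run) (use k1 in simp)
    then show "(f ^^ (k * r - (r - 0))) ((f ^^ n) x) \<notin> W'" unfolding e it_after[symmetric] using WW' by blast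
  qed (use W(1) rk in simp_all)
  have JV: "J \<subseteq> V" using JW W(6) by blast
  have frV: "(f ^^ r) ` J \<subseteq> V" using JW pb_img[OF W(4)] by blast
  have Jo: "openiv J" using pb_openiv[OF pT] .
  have fJo: "openiv ((f ^^ r) ` J)" by (rule pb_img_openiv[OF J(1) rk])
  have two: "len J + len ((f ^^ r) ` J) \<le> len V"
  proof -
    let ?A = "\<lambda>i::nat. if i = 0 then J else (f ^^ r) ` J"
    have "(\<Sum>i\<in>{0,1}. len (?A i)) \<le> len V"
      by (rule sum_len_disjoint_le)
         (use dj JV frV Jo fJo openiv_lmeas[OF nice_openiv[OF nV]] in \<open>auto simp: disjoint_family_on_def\<close>)
    then show ?thesis by simp
  qed
  have L0: "L > 0" using L unfolding log_lipschitz_def by simp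
  have dW: "\<bar>Dn r u\<bar> \<le> exp (L * S) * \<bar>Dn r v\<bar>" if "u \<in> W" "v \<in> W" for u v
  proof (rule distortion[OF L pb_openiv[OF W(4)] pb_free[OF W(4)] _ _ that])
    show "(f ^^ i) ` W \<subseteq> away C (d/2)" if "i < r" for i
      by (rule small_away[OF w \<eta> W(4,5) _ small_pb_size[OF nV sV W(4,5)]]) (use that in auto)
    show "(\<Sum>i<r. len ((f ^^ i) ` W)) \<le> S" using tower_sum[OF nV sV W(4,5,3)] S by simp
  qed
  have "len J * len V \<le> exp (L * S) * len ((f ^^ r) ` J) * len W"
    using ratio_ge[OF pb_openiv[OF W(4)] pb_free[OF W(4)] dW openiv_open[OF Jo] JW] pb_img[OF W(4)] by simp
  also have "\<dots> \<le> exp (L * S) * len ((f ^^ r) ` J) * len V"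
    using openiv_len_mono[OF pb_openiv[OF W(4)] nice_openiv[OF nV] W(6)] by (intro mult_left_mono) auto
  finally have "len J \<le> exp (L * S) * len ((f ^^ r) ` J)" using openiv_len_pos[OF nice_openiv[OF nV]] by simp
  then have "len J * exp (- (L * S)) \<le> len ((f ^^ r) ` J)" by (simp add: exp_minus field_simps)
  then have bound: "len J * (1 + exp (- (L * S))) \<le> len V" using two by (simp add: algebra_simps)
  show thesis
  proof (rule that[OF _ W(1) k1 W(4,5,6,3) run _ _ pT J(2) JW _ sum bound])
    show "(f ^^ (k * r)) ` J \<subseteq> V - W" unfolding pb_img[OF J(1)] using W'(6) WW' by blast
    show "(f ^^ (n + k * r)) x \<in> V - W" using inV k(1) unfolding P_def by blast
    show "k * r < T" unfolding T_def using W'(1) by simp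
    show "(f ^^ (n + T)) x \<in> V" unfolding T_def using W'(2) by (simp add: add.assoc)
  qed
qed

lemma stage_distortion:
  assumes w: "wild d x" and V: "nice V" "small_pb \<eta> x V" and \<eta>: "\<eta> \<le> d/2" and L: "log_lipschitz f' C (d/2) L"
    and p: "pb T J V" "(f ^^ n) x \<in> J" and S: "(\<Sum>i<T. len ((f ^^ i) ` J)) \<le> S" and uv: "u \<in> J" "v \<in> J"
  shows "\<bar>Dn T u\<bar> \<le> exp (L * S) * \<bar>Dn T v\<bar>"
proof (rule distortion[OF L pb_openiv[OF p(1)] pb_free[OF p(1)] _ S uv])
  show "(f ^^ i) ` J \<subseteq> away C (d/2)" if "i < T" for i
    by (rule small_away[OF w \<eta> p _ small_pb_size[OF V p]]) (use that in auto)
qed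

text \<open>
  A stage maps \<open>J\<close>, which is little more than half of \<open>V\<close> at most, onto \<open>V\<close> almost linearly.
\<close>

lemma stage_expansion:
  assumes w: "wild d x" and V: "admissible \<eta> x V" and \<eta>: "\<eta> \<le> d/2" and L: "log_lipschitz f' C (d/2) L" and n: "(f ^^ n) x \<in> V"
    and S: "len (tube x \<eta>) \<le> S" "L * S \<le> 1/10"
  shows "\<exists>T J. T \<ge> 1 \<and> pb T J V \<and> (f ^^ n) x \<in> J \<and> J \<subseteq> V \<and> (f ^^ (n + T)) x \<in> V \<and>
     (\<Sum>i<T. len ((f ^^ i) ` J)) \<le> 2 * S \<and> (\<forall>t\<in>J. 3/2 \<le> \<bar>Dn T t\<bar>)"
proof -
  have nV: "nice V" and sV: "small_pb \<eta> x V" using V unfolding admissible_def by blast+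
  obtain T J W r k where h0: "(f ^^ (k * r)) ` J \<subseteq> V - W" and h: "r \<ge> 1" "k \<ge> 1" "pb r W V" "(f ^^ n) x \<in> W" "W \<subseteq> V"
    "\<And>l. 1 \<le> l \<Longrightarrow> l < r \<Longrightarrow> (f ^^ (n + l)) x \<notin> V" "\<And>i. i < k \<Longrightarrow> (f ^^ (n + i * r)) x \<in> W"
    "(f ^^ (n + k * r)) x \<in> V - W" "k * r < T" "pb T J V" "(f ^^ n) x \<in> J" "J \<subseteq> W" "(f ^^ (n + T)) x \<in> V"
    "(\<Sum>i<T. len ((f ^^ i) ` J)) \<le> 2 * S" "len J * (1 + exp (- (L * S))) \<le> len V"
    by (rule run_stage[OF w V \<eta> L n S(1)]) (rule that; assumption)
  have D: "\<bar>Dn T u\<bar> \<le> exp (L * (2 * S)) * \<bar>Dn T v\<bar>" if "u \<in> J" "v \<in> J" for u v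
    by (rule stage_distortion[OF w nV sV \<eta> L h(10,11,14) that])
  have lJ: "len J > 0" using openiv_len_pos[OF pb_openiv[OF h(10)]] .
  have "3/2 \<le> \<bar>Dn T t\<bar>" if t: "t \<in> J" for t
  proof -
    have "len J * (1 + exp (- (L * S))) \<le> exp (L * (2 * S)) * \<bar>Dn T t\<bar> * len J"
      using ratio_deriv[OF pb_openiv[OF h(10)] pb_free[OF h(10)] D t] h(15) pb_img[OF h(10)] by simp
    then have a: "1 + exp (- (L * S)) \<le> exp (L * (2 * S)) * \<bar>Dn T t\<bar>" using lJ by (simp add: mult.commute)
    have e1: "exp (- (L * S)) \<ge> 9/10" using exp_ge_add_one_self[of "- (L * S)"] S(2) by linarith
    have e2: "exp (- (L * (2 * S))) \<ge> 8/10" using exp_ge_add_one_self[of "- (L * (2 * S))"] S(2) by (simp add: algebra_simps)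
    \<comment> \<open>\<open>0.8 \<cdot> 1.9 = 1.52\<close> exceeds \<open>3/2\<close>; the two factors come from \<open>L S \<le> 1/10\<close>\<close>
    have "(8/10) * (19/10) \<le> exp (- (L * (2 * S))) * (1 + exp (- (L * S)))" using e1 e2 by (intro mult_mono) auto
    also have "\<dots> \<le> exp (- (L * (2 * S))) * (exp (L * (2 * S)) * \<bar>Dn T t\<bar>)" using a by (intro mult_left_mono) auto
    also have "\<dots> = \<bar>Dn T t\<bar>" by (simp add: exp_minus)
    finally show ?thesis by simp
  qed
  moreover have "T \<ge> 1" using h(9) by simp
  moreover have "J \<subseteq> V" using h(5,12) by blast
  ultimately show ?thesis using h(10,11,13,14) by (intro exI[of _ T] exI[of _ J] conjI) auto
qed

section \<open>Orbits whose closure is null\<close>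

definition orbit_closure :: "real \<Rightarrow> real set" where
  "orbit_closure x = closure (range (\<lambda>n. (f ^^ n) x))"

lemma tube_small:
  assumes N: "negligible (orbit_closure x)" and c: "c > 0"
  shows "\<exists>\<eta>>0. \<forall>\<eta>'\<le>\<eta>. len (tube x \<eta>') \<le> c"
proof -
  let ?T = "\<lambda>k. tube x (1 / real (Suc k))"
  have dec: "tube x a \<subseteq> tube x b" if ab: "a \<le> b" for a b
  proof
    fix t assume "t \<in> tube x a"
    then obtain i where "t \<in> {0..1}" "\<bar>t - (f ^^ i) x\<bar> < a" unfolding tube_def by blast
    then have "t \<in> {0..1}" "\<bar>t - (f ^^ i) x\<bar> < b" using ab by auto
    then show "t \<in> tube x b" unfolding tube_def by blast
  qed
  have lim: "(\<lambda>k. len (?T k)) \<longlonglongrightarrow> len (\<Inter>k. ?T k)"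
  proof (rule Lim_measure_decseq)
    show "range ?T \<subseteq> sets lebesgue" using tube_lmeasurable fmeasurableD by blast
    show "decseq ?T" unfolding decseq_def using dec inverse_Suc_antimono by blast
    show "emeasure lebesgue (?T k) \<noteq> \<infinity>" for k using fmeasurableD2[OF tube_lmeasurable] by simp
  qed
  have "(\<Inter>k. ?T k) \<subseteq> orbit_closure x"
  proof
    fix t assume t: "t \<in> (\<Inter>k. ?T k)"
    show "t \<in> orbit_closure x" unfolding orbit_closure_def closure_approachable
    proof (intro allI impI)
      fix e :: real assume "e > 0"
      then obtain k where k: "1 / real (Suc k) < e" using nat_approx_posE by blast
      obtain i where "\<bar>t - (f ^^ i) x\<bar> < 1 / real (Suc k)" using t unfolding tube_def by blast
      then have "dist ((f ^^ i) x) t < e" using k by (simp add: dist_real_def abs_minus_commute)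
      then show "\<exists>y\<in>range (\<lambda>n. (f ^^ n) x). dist y t < e" by blast
    qed
  qed
  then have "len (\<Inter>k. ?T k) = 0" using N negligible_subset negligible_imp_measure0 by blast
  then have "\<forall>\<^sub>F k in sequentially. len (?T k) < c" using order_tendstoD(2)[OF lim] c by simp
  then obtain k where k: "len (?T k) < c" unfolding eventually_sequentially by blast
  show ?thesis
  proof (intro exI[of _ "1 / real (Suc k)"] conjI allI impI)
    fix \<eta>' assume "\<eta>' \<le> 1 / real (Suc k)"
    then have "len (tube x \<eta>') \<le> len (?T k)"
      by (intro measure_mono_fmeasurable dec) (use tube_lmeasurable fmeasurableD in blast)+
    then show "len (tube x \<eta>') \<le> c" using k by linarith
  qed simp
qed

lemma omega_nonempty: "x \<in> {0..1} \<Longrightarrow> omega_limit f x \<noteq> {}"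
proof -
  assume "x \<in> {0..1}"
  then have o: "(f ^^ n) x \<in> {0..1}" for n by (rule it_range)
  have "compact {0..1::real}" by simp
  then have "seq_compact {0..1::real}" by (rule compact_imp_seq_compact)
  moreover have "\<forall>n. (f ^^ n) x \<in> {0..1}" using o ..
  ultimately obtain z r where "strict_mono r" "((\<lambda>n. (f ^^ n) x) \<circ> r) \<longlonglongrightarrow> z"
    by (rule seq_compactE)
  then have "z \<in> omega_limit f x" unfolding omega_limit_def comp_def by (intro CollectI exI[of _ r] conjI)
  then show ?thesis by (rule ex_in_conv[THEN iffD1, OF exI])
qed

lemma admissible_exists:
  assumes w: "wild d x" and \<eta>: "\<eta> > 0" shows "\<exists>V. admissible \<eta> x V"
proof (cases "\<exists>p q. p \<in> omega_limit f x \<and> q \<ge> 1 \<and> (f ^^ q) p = p")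
  case True
  then show ?thesis using admissible_at_periodic[OF w _ _ _ \<eta>] by blast
next
  case False
  have "x \<in> {0..1}" using apart01[OF wild_apart[OF w]] .
  then obtain z where "z \<in> omega_limit f x" using omega_nonempty by blast
  then show ?thesis using admissible_at_aperiodic[OF w _ _ \<eta>, of z 1] False by auto
qed

text \<open>
  Stages that expand by \<open>3/2\<close> can be concatenated along the orbit forever.
\<close>

lemma orbit_derivative_unbounded:
  assumes w: "wild d x" and N: "negligible (orbit_closure x)"
  shows "\<exists>n. B < \<bar>Dn n x\<bar>"
proof -
  have d: "d > 0" using wild_pos[OF w] .
  obtain L where L: "log_lipschitz f' C (d/2) L" using log_lipschitz_exists[of "d/2"] d by auto
  have L0: "L > 0" using L unfolding log_lipschitz_def by simp
  obtain \<eta>0 where \<eta>0: "\<eta>0 > 0" "\<forall>\<eta>'\<le>\<eta>0. len (tube x \<eta>') \<le> 1 / (10 * L)"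
    using tube_small[OF N, of "1 / (10 * L)"] L0 by auto
  define \<eta> where "\<eta> = min \<eta>0 (d/2)"
  have \<eta>: "\<eta> > 0" "\<eta> \<le> d/2" "len (tube x \<eta>) \<le> 1 / (10 * L)" unfolding \<eta>_def using \<eta>0 d by auto
  obtain V where V: "admissible \<eta> x V" using admissible_exists[OF w \<eta>(1)] by blast
  obtain n0 where n0: "(f ^^ n0) x \<in> V" using V unfolding admissible_def by blast
  have st: "\<exists>T. (f ^^ (n + T)) x \<in> V \<and> 3/2 \<le> \<bar>Dn T ((f ^^ n) x)\<bar>" if "(f ^^ n) x \<in> V" for n
    using stage_expansion[OF w V \<eta>(2) L that \<eta>(3)] L0 by fastforce
  have grow: "\<exists>T. (f ^^ (n0 + T)) x \<in> V \<and> (3/2)^k \<le> \<bar>Dn T ((f ^^ n0) x)\<bar>" for k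
  proof (induction k)
    case 0 show ?case using n0 by (intro exI[of _ 0]) (simp add: Dn_def)
  next
    case (Suc k)
    then obtain T where T: "(f ^^ (n0 + T)) x \<in> V" "(3/2)^k \<le> \<bar>Dn T ((f ^^ n0) x)\<bar>" by blast
    obtain T' where T': "(f ^^ (n0 + T + T')) x \<in> V" "3/2 \<le> \<bar>Dn T' ((f ^^ (n0 + T)) x)\<bar>" using st[OF T(1)] by blast
    have "\<bar>Dn (T' + T) ((f ^^ n0) x)\<bar> = \<bar>Dn T' ((f ^^ (n0 + T)) x)\<bar> * \<bar>Dn T ((f ^^ n0) x)\<bar>"
      by (simp add: Dn_add abs_mult it_after)
    moreover have "3/2 * (3/2)^k \<le> \<bar>Dn T' ((f ^^ (n0 + T)) x)\<bar> * \<bar>Dn T ((f ^^ n0) x)\<bar>"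
      using T(2) T'(2) by (intro mult_mono) auto
    ultimately show ?case using T'(1) by (intro exI[of _ "T' + T"]) (simp add: ac_simps)
  qed
  have nz0: "\<bar>Dn n0 x\<bar> > 0"
    using Dn_nz[OF apart01[OF wild_apart[OF w]] apart_notC[OF wild_apart[OF w] d]] by simp
  obtain k where k: "\<bar>B\<bar> / \<bar>Dn n0 x\<bar> < (3/2::real)^k" using real_arch_pow[of "3/2"] by auto
  obtain T where T: "(3/2)^k \<le> \<bar>Dn T ((f ^^ n0) x)\<bar>" using grow by blast
  have "\<bar>B\<bar> / \<bar>Dn n0 x\<bar> < \<bar>Dn T ((f ^^ n0) x)\<bar>" using k T by linarith
  then have "\<bar>B\<bar> < \<bar>Dn T ((f ^^ n0) x)\<bar> * \<bar>Dn n0 x\<bar>" using nz0 by (simp add: field_simps)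
  then have "B < \<bar>Dn (T + n0) x\<bar>" by (simp add: Dn_add abs_mult)
  then show ?thesis by blast
qed

section \<open>Stages at density points\<close>

text \<open>
  If \<open>U\<close> is the part of \<open>J\<close> over \<open>U2 \<subseteq> V\<close>, then bounded distortion makes its share of each image
  of \<open>J\<close> comparable to the share of \<open>U2\<close> in \<open>V\<close>.
\<close>

lemma length_of_subpullback:
  assumes w: "wild d x" and V: "nice V" "small_pb \<eta> x V" and \<eta>: "\<eta> \<le> d/2" and L: "log_lipschitz f' C (d/2) L"
    and p: "pb T J V" "(f ^^ n) x \<in> J" and S: "(\<Sum>i<T. len ((f ^^ i) ` J)) \<le> S"
    and U: "openiv U2" "U2 \<subseteq> V" "U = {t\<in>J. (f ^^ T) t \<in> U2}" and i: "i \<le> T"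
  shows "len ((f ^^ i) ` U) * len V \<le> exp (L * S) * len U2 * len ((f ^^ i) ` J)"
proof -
  have pU: "pb T U U2" unfolding U(3) by (rule pb_sub[OF p(1) U(1,2)])
  have pi: "pb (T - i) ((f ^^ i) ` J) V" by (rule pb_image[OF p(1) i])
  have im: "(f ^^ (i + j)) ` A = (f ^^ j) ` ((f ^^ i) ` A)" for j A
    unfolding add.commute[of i j] funpow_add image_comp ..
  have "(\<Sum>j<T - i. len ((f ^^ j) ` ((f ^^ i) ` J))) = (\<Sum>j<T - i. len ((f ^^ (i + j)) ` J))" unfolding im ..
  also have "\<dots> \<le> (\<Sum>j<i. len ((f ^^ j) ` J)) + (\<Sum>j<T - i. len ((f ^^ (i + j)) ` J))"
    using sum_nonneg[of "{..<i}" "\<lambda>j. len ((f ^^ j) ` J)"] by simp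
  also have "\<dots> = (\<Sum>j<i + (T - i). len ((f ^^ j) ` J))" by (rule sum_lessThan_split[symmetric])
  also have "\<dots> \<le> S" using S i by simp
  finally have Si: "(\<Sum>j<T - i. len ((f ^^ j) ` ((f ^^ i) ` J))) \<le> S" .
  have D: "\<bar>Dn (T - i) u\<bar> \<le> exp (L * S) * \<bar>Dn (T - i) v\<bar>" if "u \<in> (f ^^ i) ` J" "v \<in> (f ^^ i) ` J" for u v
    by (rule stage_distortion[OF w V \<eta> L pi pb_orbit_in[OF p(2)] Si that])
  have sub: "(f ^^ i) ` U \<subseteq> (f ^^ i) ` J" unfolding U(3) by blast
  have op: "open ((f ^^ i) ` U)" by (rule openiv_open[OF pb_img_openiv[OF pU i]])
  have "(f ^^ (T - i)) ` ((f ^^ i) ` U) = U2" unfolding im[symmetric] using pb_img[OF pU] i by simp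
  then show ?thesis
    using ratio_ge[OF pb_openiv[OF pi] pb_free[OF pi] D op sub] pb_img[OF pi] by simp
qed

text \<open>
  Composing \<open>k\<close> expanding stages. The part of the first stage that survives the other \<open>k - 1\<close>
  ones is contracted by \<open>(1/\<rho>)\<^sup>k\<^sup>-\<^sup>1\<close>, so the total lengths are bounded by a geometric series.
\<close>

lemma composed_stages:
  assumes w: "wild d x" and V: "nice V" "small_pb \<eta> x V" and \<eta>: "\<eta> \<le> d/2" and L: "log_lipschitz f' C (d/2) L"
    and \<rho>: "\<rho> > 1"
    and stage: "\<And>n. (f ^^ n) x \<in> V \<Longrightarrow> \<exists>T J. T \<ge> 1 \<and> pb T J V \<and> (f ^^ n) x \<in> J \<and> J \<subseteq> V \<and> (f ^^ (n + T)) x \<in> V \<and>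
     (\<Sum>i<T. len ((f ^^ i) ` J)) \<le> s \<and> (\<forall>t\<in>J. \<rho> \<le> \<bar>Dn T t\<bar>)"
  shows "(f ^^ n) x \<in> V \<Longrightarrow> \<exists>T U. T \<ge> k \<and> pb T U V \<and> (f ^^ n) x \<in> U \<and> U \<subseteq> V \<and> len U \<le> (1/\<rho>)^k * len V \<and>
     (\<Sum>i<T. len ((f ^^ i) ` U)) \<le> exp (L * s) * s * (\<Sum>j<k. (1/\<rho>)^j)"
proof (induction k arbitrary: n)
  case 0
  then show ?case using pb_0[OF nice_openiv[OF V(1)]] by (intro exI[of _ 0] exI[of _ V]) simp
next
  case (Suc k)
  obtain T1 J where J: "T1 \<ge> 1" "pb T1 J V" "(f ^^ n) x \<in> J" "J \<subseteq> V" "(f ^^ (n + T1)) x \<in> V"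
     "(\<Sum>i<T1. len ((f ^^ i) ` J)) \<le> s" "\<And>t. t \<in> J \<Longrightarrow> \<rho> \<le> \<bar>Dn T1 t\<bar>" using stage[OF Suc.prems] by blast
  obtain T2 U2 where U2: "T2 \<ge> k" "pb T2 U2 V" "(f ^^ (n + T1)) x \<in> U2" "U2 \<subseteq> V" "len U2 \<le> (1/\<rho>)^k * len V"
     "(\<Sum>i<T2. len ((f ^^ i) ` U2)) \<le> exp (L * s) * s * (\<Sum>j<k. (1/\<rho>)^j)" using Suc.IH[OF J(5)] by blast
  define U where "U = {t\<in>J. (f ^^ T1) t \<in> U2}"
  have p1: "pb T1 U U2" unfolding U_def by (rule pb_sub[OF J(2) pb_openiv[OF U2(2)] U2(4)])
  have p: "pb (T1 + T2) U V" by (rule pb_comp[OF p1 U2(2)])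
  have xU: "(f ^^ n) x \<in> U" unfolding U_def using J(3) U2(3) by (simp add: it_after)
  have UJ: "U \<subseteq> J" unfolding U_def by blast
  have lV: "len V > 0" using openiv_len_pos[OF nice_openiv[OF V(1)]] .
  have "\<rho> * len U \<le> len ((f ^^ T1) ` U)"
    by (rule img_ge[OF pb_openiv[OF J(2)] pb_free[OF J(2)] openiv_open[OF pb_openiv[OF p1]] UJ]) (use J(7) UJ in blast)
  then have "\<rho> * len U \<le> (1/\<rho>)^k * len V" using pb_img[OF p1] U2(5) by simp
  then have lU: "len U \<le> (1/\<rho>)^Suc k * len V" using \<rho> by (simp add: field_simps)
  have "(\<Sum>i<T1. len ((f ^^ i) ` U)) \<le> (\<Sum>i<T1. exp (L * s) * (1/\<rho>)^k * len ((f ^^ i) ` J))"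
  proof (rule sum_mono)
    fix i assume "i \<in> {..<T1}"
    then have "len ((f ^^ i) ` U) * len V \<le> exp (L * s) * len U2 * len ((f ^^ i) ` J)"
      by (intro length_of_subpullback[OF w V \<eta> L J(2,3,6) pb_openiv[OF U2(2)] U2(4) U_def]) simp
    also have "\<dots> \<le> exp (L * s) * ((1/\<rho>)^k * len V) * len ((f ^^ i) ` J)"
      using U2(5) by (intro mult_right_mono mult_left_mono) auto
    finally show "len ((f ^^ i) ` U) \<le> exp (L * s) * (1/\<rho>)^k * len ((f ^^ i) ` J)"
      using lV by (simp add: mult_ac)
  qed
  also have "\<dots> = exp (L * s) * (1/\<rho>)^k * (\<Sum>i<T1. len ((f ^^ i) ` J))" by (rule sum_distrib_left[symmetric])
  also have "\<dots> \<le> exp (L * s) * (1/\<rho>)^k * s" using J(6) \<rho> by (intro mult_left_mono) auto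
  finally have s1: "(\<Sum>i<T1. len ((f ^^ i) ` U)) \<le> exp (L * s) * s * (1/\<rho>)^k" by (simp add: mult_ac)
  have "(\<Sum>i<T1 + T2. len ((f ^^ i) ` U)) = (\<Sum>i<T1. len ((f ^^ i) ` U)) + (\<Sum>i<T2. len ((f ^^ (T1 + i)) ` U))"
    by (rule sum_lessThan_split)
  also have "(\<Sum>i<T2. len ((f ^^ (T1 + i)) ` U)) = (\<Sum>i<T2. len ((f ^^ i) ` U2))"
  proof (rule sum.cong[OF refl])
    fix i have "(f ^^ (T1 + i)) ` U = (f ^^ i) ` ((f ^^ T1) ` U)"
      unfolding add.commute[of T1 i] funpow_add image_comp ..
    then show "len ((f ^^ (T1 + i)) ` U) = len ((f ^^ i) ` U2)" using pb_img[OF p1] by simp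
  qed
  finally have "(\<Sum>i<T1 + T2. len ((f ^^ i) ` U)) \<le> exp (L * s) * s * (\<Sum>j<Suc k. (1/\<rho>)^j)"
    using s1 U2(6) by (simp add: algebra_simps)
  moreover have "T1 + T2 \<ge> Suc k" using J(1) U2(1) by simp
  moreover have "U \<subseteq> V" using UJ J(4) by blast
  ultimately show ?case using p xU lU by blast
qed

text \<open>
  The pullback along the first entrance of \<open>x\<close> into \<open>V\<close>; its images form one disjoint tower.
\<close>

lemma first_entrance:
  assumes V: "nice V" "small_pb \<eta> x V" and vis: "(f ^^ n) x \<in> V"
  obtains l P where "pb l P V" "x \<in> P" "(f ^^ l) x \<in> V" "(\<Sum>i<l. len ((f ^^ i) ` P)) \<le> 1" "l \<le> n"
proof -
  define l where "l = (LEAST l. (f ^^ l) x \<in> V)"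
  have l: "(f ^^ l) x \<in> V" "\<And>j. j < l \<Longrightarrow> (f ^^ j) x \<notin> V" "l \<le> n"
    unfolding l_def by (rule LeastI[of "\<lambda>l. (f ^^ l) x \<in> V", OF vis], rule not_less_Least, assumption, rule Least_le[of "\<lambda>l. (f ^^ l) x \<in> V", OF vis])
  obtain P where P: "pb l P V" "(f ^^ 0) x \<in> P" using V(2) l(1) unfolding small_pb_def by (metis add_0)
  have "(\<Sum>i<l. len ((f ^^ i) ` P)) \<le> len (tube x \<eta>)"
    by (rule tower_sum[OF V P]) (use l(2) in simp)
  then have "(\<Sum>i<l. len ((f ^^ i) ` P)) \<le> 1" using tube_le1[of x \<eta>] by linarith
  then show thesis using that[of l P] P l by simp
qed

text \<open>
  Forward invariance is required at interior points only: \<open>0\<close> and \<open>1\<close> lie in no open subinterval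
  of \<open>(0,1)\<close>, but their images may lie in a homterval.
\<close>

definition absorbing :: "real set \<Rightarrow> bool" where
  "absorbing K \<longleftrightarrow> closed K \<and> (\<forall>t\<in>K \<inter> {0<..<1}. f t \<in> K) \<and> (\<forall>J. openiv J \<longrightarrow> \<not> J \<subseteq> K)"

lemma absorbing_iter:
  assumes K: "absorbing K" and U: "openiv U" "free T U" and t: "t \<in> U" "t \<in> K"
  shows "(f ^^ T) t \<in> K"
proof -
  have "(f ^^ i) t \<in> K" if "i \<le> T" for i using that
  proof (induction i)
    case (Suc i)
    have "(f ^^ i) t \<in> {0<..<1}"
      by (rule it_interior) (use openiv_sub[OF U(1)] t(1) freeD[OF U(2) t(1)] Suc.prems in auto)
    then show ?case using K Suc unfolding absorbing_def by auto
  qed (use t in simp)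
  then show ?thesis by blast
qed

text \<open>
  A pullback \<open>U\<close> of \<open>V\<close> of high order that contains \<open>x\<close> is short, so \<open>K\<close> fills it almost completely.
  With bounded distortion and invariance of \<open>K\<close>, this makes \<open>V - K\<close> smaller than its actual
  measure \<open>b\<close>.
\<close>

lemma dense_bounded_distortion:
  assumes w: "wild d x" and V: "nice V" "small_pb \<eta> x V" and \<eta>: "\<eta> \<le> d/2" and L: "log_lipschitz f' C (d/2) L"
    and K: "absorbing K" "dense_at K x"
  shows "\<exists>T0. \<forall>T U. T \<ge> T0 \<and> pb T U V \<and> x \<in> U \<longrightarrow> \<not> (\<Sum>i<T. len ((f ^^ i) ` U)) \<le> s"
proof -
  have Vo: "openiv V" using nice_openiv[OF V(1)] .
  have VK: "open (V - K)" using K(1) openiv_open[OF Vo] unfolding absorbing_def by (simp add: open_Diff)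
  have ne: "V - K \<noteq> {}" using K(1) Vo unfolding absorbing_def by blast
  have m: "V - K \<in> lmeasurable" using VK bounded_subset[of "{0..1}" "V - K"] openiv_sub01[OF Vo]
    by (intro lmeasurable_open) auto
  define b where "b = len (V - K)"
  have b: "b > 0"
  proof -
    have "\<not> negligible (V - K)" using open_not_negligible[OF VK ne] .
    then have "len (V - K) \<noteq> 0" using negligible_iff_measure0[OF m] by blast
    then show ?thesis unfolding b_def by (simp add: zero_less_measure_iff)
  qed
  \<comment> \<open>the distortion factor turns the fraction \<open>\<beta>\<close> at \<open>x\<close> into at most \<open>b/2\<close> in \<open>V\<close>\<close>
  define \<beta> where "\<beta> = b / (2 * exp (L * s))"
  have \<beta>: "\<beta> > 0" unfolding \<beta>_def using b by simp
  obtain \<epsilon> where \<epsilon>: "\<epsilon> > 0" "\<And>u v. u < x \<Longrightarrow> x < v \<Longrightarrow> v - u < \<epsilon> \<Longrightarrow> len ({u<..<v} - K) \<le> \<beta> * (v - u)"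
    using K(2) \<beta> unfolding dense_at_def by blast
  obtain T0 where T0: "\<forall>T U V. T \<ge> T0 \<and> pb T U V \<and> (f ^^ 0) x \<in> U \<longrightarrow> len U < \<epsilon>"
    using pullbacks_shrink[OF w \<epsilon>(1)] by blast
  show ?thesis
  proof (intro exI[of _ T0] allI impI notI)
    fix T U assume a: "T \<ge> T0 \<and> pb T U V \<and> x \<in> U" and sm: "(\<Sum>i<T. len ((f ^^ i) ` U)) \<le> s"
    have p: "pb T U V" "(f ^^ 0) x \<in> U" using a by auto
    have lU: "len U < \<epsilon>" using T0 a by auto
    have Uo: "openiv U" using pb_openiv[OF p(1)] .
    obtain u v where uv: "u < v" "U = {u<..<v}" using Uo unfolding openiv_def by blast
    have lb: "len (U - K) \<le> \<beta> * len U" using \<epsilon>(2)[of u v] a lU uv by auto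
    have UK: "open (U - K)" using K(1) openiv_open[OF Uo] unfolding absorbing_def by (simp add: open_Diff)
    have D: "\<bar>Dn T t\<bar> \<le> exp (L * s) * \<bar>Dn T t'\<bar>" if "t \<in> U" "t' \<in> U" for t t'
      by (rule stage_distortion[OF w V \<eta> L p sm that])
    have "len ((f ^^ T) ` (U - K)) * len U \<le> exp (L * s) * len (U - K) * len V"
      using ratio_le[OF Uo pb_free[OF p(1)] D UK] pb_img[OF p(1)] by auto
    also have "\<dots> \<le> exp (L * s) * (\<beta> * len U) * 1"
      using lb openiv_len_le[OF Vo] \<beta> by (intro mult_mono mult_nonneg_nonneg) auto
    finally have "len ((f ^^ T) ` (U - K)) \<le> exp (L * s) * \<beta>" using openiv_len_pos[OF Uo] by simp
    also have "\<dots> = b / 2" unfolding \<beta>_def by simp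
    finally have c: "len ((f ^^ T) ` (U - K)) \<le> b / 2" .
    have "V - K \<subseteq> (f ^^ T) ` (U - K)"
    proof
      fix t assume t: "t \<in> V - K"
      then obtain y where y: "y \<in> U" "t = (f ^^ T) y" using pb_img[OF p(1)] by blast
      have "y \<notin> K" using absorbing_iter[OF K(1) Uo pb_free[OF p(1)] y(1)] t y(2) by blast
      then show "t \<in> (f ^^ T) ` (U - K)" using y by blast
    qed
    then have "b \<le> len ((f ^^ T) ` (U - K))" unfolding b_def
      by (rule measure_mono_fmeasurable[OF _ fmeasurableD[OF m] img_open(3)[OF Uo pb_free[OF p(1)] UK]]) blast
    then show False using c b by linarith
  qed
qed

text \<open>
  Prefixing the first entrance of \<open>x\<close> moves the pullback to the density point \<open>x\<close> and adds at
  most \<open>1\<close> to the total length.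
\<close>

lemma stage_times_bounded:
  assumes w: "wild d x" and V: "nice V" "small_pb \<eta> x V" and \<eta>: "\<eta> \<le> d/2" and L: "log_lipschitz f' C (d/2) L"
    and K: "absorbing K" "dense_at K x"
  shows "\<exists>T0. \<forall>n T J. pb T J V \<and> (f ^^ n) x \<in> J \<and> (\<Sum>i<T. len ((f ^^ i) ` J)) \<le> s \<longrightarrow> T < T0"
proof -
  obtain T0 where T0: "\<forall>T U. T \<ge> T0 \<and> pb T U V \<and> x \<in> U \<longrightarrow> \<not> (\<Sum>i<T. len ((f ^^ i) ` U)) \<le> 1 + s"
    using dense_bounded_distortion[OF assms, of "1 + s"] by blast
  show ?thesis
  proof (intro exI[of _ T0] allI impI)
    fix n T J assume a: "pb T J V \<and> (f ^^ n) x \<in> J \<and> (\<Sum>i<T. len ((f ^^ i) ` J)) \<le> s"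
    have nJ: "nice J" using nice_pb[OF V(1)] a by blast
    have sJ: "small_pb \<eta> x J" using small_pb_pb[OF V] a by blast
    obtain l P where P: "pb l P J" "x \<in> P" "(\<Sum>i<l. len ((f ^^ i) ` P)) \<le> 1"
      using first_entrance[OF nJ sJ] a by blast
    have p: "pb (l + T) P V" using pb_comp[OF P(1)] a by blast
    have "(\<Sum>i<l + T. len ((f ^^ i) ` P)) = (\<Sum>i<l. len ((f ^^ i) ` P)) + (\<Sum>i<T. len ((f ^^ (l + i)) ` P))"
      by (rule sum_lessThan_split)
    also have "(\<Sum>i<T. len ((f ^^ (l + i)) ` P)) = (\<Sum>i<T. len ((f ^^ i) ` J))"
    proof (rule sum.cong[OF refl])
      fix i have "(f ^^ (l + i)) ` P = (f ^^ i) ` ((f ^^ l) ` P)"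
        unfolding add.commute[of l i] funpow_add image_comp ..
      then show "len ((f ^^ (l + i)) ` P) = len ((f ^^ i) ` J)" using pb_img[OF P(1)] by simp
    qed
    finally have "(\<Sum>i<l + T. len ((f ^^ i) ` P)) \<le> 1 + s" using P(3) a by linarith
    then have "\<not> l + T \<ge> T0" using T0 p P(2) by blast
    then show "T < T0" by linarith
  qed
qed

text \<open>
  Compositions of uniformly expanding stages have bounded total length and unbounded
  duration.
\<close>

lemma no_uniform_stages:
  assumes w: "wild d x" and V: "admissible \<eta> x V" and \<eta>: "\<eta> \<le> d/2" and L: "log_lipschitz f' C (d/2) L"
    and K: "absorbing K" "dense_at K x" and \<rho>: "\<rho> > 1" and s: "s \<ge> 0"
    and stage: "\<And>n. (f ^^ n) x \<in> V \<Longrightarrow> \<exists>T J. T \<ge> 1 \<and> pb T J V \<and> (f ^^ n) x \<in> J \<and> J \<subseteq> V \<and> (f ^^ (n + T)) x \<in> V \<and>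
     (\<Sum>i<T. len ((f ^^ i) ` J)) \<le> s \<and> (\<forall>t\<in>J. \<rho> \<le> \<bar>Dn T t\<bar>)"
  shows False
proof -
  have nV: "nice V" and sV: "small_pb \<eta> x V" using V unfolding admissible_def by blast+
  define s' where "s' = exp (L * s) * s * (1 / (1 - 1/\<rho>))"
  obtain T0 where T0: "\<forall>n T J. pb T J V \<and> (f ^^ n) x \<in> J \<and> (\<Sum>i<T. len ((f ^^ i) ` J)) \<le> s' \<longrightarrow> T < T0"
    using stage_times_bounded[OF w nV sV \<eta> L K] by blast
  obtain n where n: "(f ^^ n) x \<in> V" using V unfolding admissible_def by blast
  obtain T U where U: "T \<ge> T0" "pb T U V" "(f ^^ n) x \<in> U"
     "(\<Sum>i<T. len ((f ^^ i) ` U)) \<le> exp (L * s) * s * (\<Sum>j<T0. (1/\<rho>)^j)"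
    using composed_stages[OF w nV sV \<eta> L \<rho> stage n, of T0] by blast
  have "(\<Sum>j<T0. (1/\<rho>)^j) \<le> 1 / (1 - 1/\<rho>)"
  proof -
    have "\<bar>1/\<rho>\<bar> < 1" using \<rho> by simp
    then have "summable (\<lambda>j. (1/\<rho>)^j)" "(\<Sum>j. (1/\<rho>)^j) = 1 / (1 - 1/\<rho>)"
      using summable_geometric suminf_geometric by (metis real_norm_def)+
    moreover have "(\<Sum>j<T0. (1/\<rho>)^j) \<le> (\<Sum>j. (1/\<rho>)^j)"
      by (rule sum_le_suminf) (use \<rho> \<open>summable (\<lambda>j. (1/\<rho>)^j)\<close> in auto)
    ultimately show ?thesis by simp
  qed
  then have "exp (L * s) * s * (\<Sum>j<T0. (1/\<rho>)^j) \<le> s'" unfolding s'_def using s by (intro mult_left_mono) auto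
  then have "(\<Sum>i<T. len ((f ^^ i) ` U)) \<le> s'" using U(4) by linarith
  then have "T < T0" using T0 U(2,3) by blast
  then show False using U(1) by simp
qed

lemma dense_wild_not_null:
  assumes w: "wild d x" and K: "absorbing K" "dense_at K x"
  shows "\<not> negligible (orbit_closure x)"
proof
  assume N: "negligible (orbit_closure x)"
  have d: "d > 0" using wild_pos[OF w] .
  obtain L where L: "log_lipschitz f' C (d/2) L" using log_lipschitz_exists[of "d/2"] d by auto
  have L0: "L > 0" using L unfolding log_lipschitz_def by simp
  obtain \<eta>0 where \<eta>0: "\<eta>0 > 0" "\<forall>\<eta>'\<le>\<eta>0. len (tube x \<eta>') \<le> 1 / (10 * L)"
    using tube_small[OF N, of "1 / (10 * L)"] L0 by auto
  define \<eta> where "\<eta> = min \<eta>0 (d/2)"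
  have \<eta>: "\<eta> > 0" "\<eta> \<le> d/2" "len (tube x \<eta>) \<le> 1 / (10 * L)" unfolding \<eta>_def using \<eta>0 d by auto
  obtain V where V: "admissible \<eta> x V" using admissible_exists[OF w \<eta>(1)] by blast
  show False
  proof (rule no_uniform_stages[OF w V \<eta>(2) L K, of "3/2" "2 * (1 / (10 * L))"])
    show "\<exists>T J. T \<ge> 1 \<and> pb T J V \<and> (f ^^ n) x \<in> J \<and> J \<subseteq> V \<and> (f ^^ (n + T)) x \<in> V \<and>
     (\<Sum>i<T. len ((f ^^ i) ` J)) \<le> 2 * (1 / (10 * L)) \<and> (\<forall>t\<in>J. 3/2 \<le> \<bar>Dn T t\<bar>)" if "(f ^^ n) x \<in> V" for n
      by (rule stage_expansion[OF w V \<eta>(2) L that \<eta>(3)]) (use L0 in simp)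
  qed (use L0 in auto)
qed

section \<open>Limit sets of density points\<close>

lemma it_uniformly_near:
  assumes y: "y \<in> {0..1}" "\<And>i. (f ^^ i) y \<notin> C" and e: "e > 0"
  shows "\<exists>\<delta>>0. \<forall>t\<in>{0..1}. \<bar>t - y\<bar> < \<delta> \<longrightarrow> (\<forall>j<N. \<bar>(f ^^ j) t - (f ^^ j) y\<bar> < e)"
proof (induction N)
  case 0 show ?case by (intro exI[of _ 1]) simp
next
  case (Suc N)
  then obtain \<delta> where \<delta>: "\<delta> > 0" "\<And>t j. t \<in> {0..1} \<Longrightarrow> \<bar>t - y\<bar> < \<delta> \<Longrightarrow> j < N \<Longrightarrow> \<bar>(f ^^ j) t - (f ^^ j) y\<bar> < e"
    by blast
  have "continuous (at y within {0..1}) (f ^^ N)" by (rule it_cont_within[OF y(1)]) (rule y(2))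
  then obtain \<delta>' where \<delta>': "\<delta>' > 0" "\<And>t. t \<in> {0..1} \<Longrightarrow> \<bar>t - y\<bar> < \<delta>' \<Longrightarrow> \<bar>(f ^^ N) t - (f ^^ N) y\<bar> < e"
    using e unfolding continuous_within_eps_delta dist_real_def by blast
  show ?case
  proof (intro exI[of _ "min \<delta> \<delta>'"] conjI ballI impI allI)
    fix t j assume t: "t \<in> {0..1}" "\<bar>t - y\<bar> < min \<delta> \<delta>'" and j: "j < Suc N"
    show "\<bar>(f ^^ j) t - (f ^^ j) y\<bar> < e"
    proof (cases "j = N")
      case True then show ?thesis using \<delta>'(2)[OF t(1)] t(2) by simp
    next
      case False then show ?thesis using \<delta>(2)[OF t(1), of j] t(2) j by simp
    qed
  qed (use \<delta>(1) \<delta>'(1) in simp)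
qed

lemma openiv_form: "openiv V \<Longrightarrow> \<exists>a b. a < b \<and> V = {a<..<b}"
  unfolding openiv_def by blast

text \<open>
  For each order there is at most one pullback that contains \<open>y\<close>.
\<close>

lemma finite_pullbacks_at:
  assumes "nice V" shows "finite {J. \<exists>T<T0. pb T J V \<and> y \<in> J}"
proof -
  have "finite {J. pb T J V \<and> y \<in> J}" for T
  proof (cases "\<exists>J. pb T J V \<and> y \<in> J")
    case True
    then obtain J where J: "pb T J V" "y \<in> J" by blast
    have "{J. pb T J V \<and> y \<in> J} \<subseteq> {J}"
    proof
      fix J' assume "J' \<in> {J. pb T J V \<and> y \<in> J}"
      then have J': "pb T J' V" "y \<in> J'" by auto
      have "J \<inter> J' \<noteq> {}" using J(2) J'(2) by blast
      then show "J' \<in> {J}" using pullbacks_equal[OF assms J(1) J'(1)] by simp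
    qed
    then show ?thesis using finite_subset by blast
  next
    case False
    then have "{J. pb T J V \<and> y \<in> J} = {}" by blast
    then show ?thesis by (metis finite.emptyI)
  qed
  moreover have "{J. \<exists>T<T0. pb T J V \<and> y \<in> J} = (\<Union>T<T0. {J. pb T J V \<and> y \<in> J})" by auto
  ultimately show ?thesis by simp
qed

lemma closure_Union_mem:
  assumes "finite S" "p \<in> closure (\<Union>S)" shows "\<exists>J\<in>S. p \<in> closure (J :: real set)"
proof -
  have "closed (\<Union>J\<in>S. closure J)" using assms(1) by auto
  moreover have "\<Union>S \<subseteq> (\<Union>J\<in>S. closure J)" using closure_subset by blast
  ultimately have "closure (\<Union>S) \<subseteq> (\<Union>J\<in>S. closure J)" by (rule closure_minimal[rotated])
  then show ?thesis using assms(2) by blast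
qed

text \<open>
  Induce on a one-sided interval \<open>V\<close> at the periodic point \<open>p\<close>. Stages have bounded duration,
  and the iterates of bounded order move points near \<open>p\<close> only little; so all stages that start
  near \<open>p\<close> contain a common point \<open>y\<close>, and there are finitely many of them. One of them, \<open>J\<close>, has
  \<open>p\<close> in its closure. The branch \<open>W\<close> in which this stage begins then contains a one-sided
  neighbourhood of \<open>p = f\<^sup>r p\<close>. But at the end of the run \<open>J\<close> is mapped outside \<open>W\<close>, while \<open>p\<close> stays
  in the closure of its image.
\<close>

lemma dense_no_periodic:
  assumes w: "wild d x" and K: "absorbing K" "dense_at K x"
    and p: "p \<in> omega_limit f x" "q \<ge> 1"
  shows "(f ^^ q) p \<noteq> p"
proof
  assume per: "(f ^^ q) p = p"
  have d: "d > 0" using wild_pos[OF w] .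
  obtain L where L: "log_lipschitz f' C (d/2) L" using log_lipschitz_exists[of "d/2"] d by auto
  have ap: "apart d p" by (rule omega_apart[OF wild_apart[OF w] d p(1)])
  have pC: "(f ^^ i) p \<notin> C" for i by (rule apart_notC[OF ap d])
  have p01: "p \<in> {0..1}" by (rule apart01[OF ap])
  have d2: "d/2 > 0" using d by simp
  obtain V where V: "admissible (d/2) x V" and pV: "p \<in> closure V - V"
    and vis: "\<And>e k. e > 0 \<Longrightarrow> \<exists>n\<ge>k. (f ^^ n) x \<in> V \<and> \<bar>(f ^^ n) x - p\<bar> < e"
    and oth: "\<And>e. e \<in> closure V - V \<Longrightarrow> e \<noteq> p \<Longrightarrow> \<exists>j. (f ^^ j) e \<in> C"
    using admissible_at_periodic[OF w p per d2] by blast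
  have nV: "nice V" and sV: "small_pb (d/2) x V" using V unfolding admissible_def by blast+
  have Vo: "openiv V" using nice_openiv[OF nV] .
  obtain T0 where T0: "\<And>n T J. pb T J V \<Longrightarrow> (f ^^ n) x \<in> J \<Longrightarrow> (\<Sum>i<T. len ((f ^^ i) ` J)) \<le> 2 * 1 \<Longrightarrow> T < T0"
    using stage_times_bounded[OF w nV sV order_refl L K, of "2 * 1"] by blast
  have "len V / 4 > 0" using openiv_len_pos[OF Vo] by simp
  then obtain \<delta> where \<delta>: "\<delta> > 0" "\<And>t j. t \<in> {0..1} \<Longrightarrow> \<bar>t - p\<bar> < \<delta> \<Longrightarrow> j < T0 \<Longrightarrow> \<bar>(f ^^ j) t - (f ^^ j) p\<bar> < len V / 4"
    using it_uniformly_near[OF p01 pC, of "len V / 4" T0] by blast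
  obtain a b where ab: "a < b" "V = {a<..<b}" using openiv_form[OF Vo] by blast
  have pab: "p = a \<or> p = b" using pV ab by auto
  \<comment> \<open>the common point: at distance \<open>\<delta>/2\<close> from \<open>p\<close>, inside \<open>V\<close>\<close>
  define y where "y = (if p = a then p + \<delta>/2 else p - \<delta>/2)"
  define good where "good = (\<lambda>J. (\<exists>T<T0. pb T J V \<and> y \<in> J) \<and>
     (\<exists>T W r k. r \<ge> 1 \<and> pb r W V \<and> W \<subseteq> V \<and> J \<subseteq> W \<and> (f ^^ (k * r)) ` J \<subseteq> V - W \<and> k * r < T \<and> pb T J V))"
  \<comment> \<open>a pullback within distance \<open>\<delta>\<close> of \<open>p\<close> would be mapped into an interval half as long as \<open>V\<close>\<close>
  have far: "\<exists>t\<in>J. \<bar>t - p\<bar> \<ge> \<delta>" if J: "pb T J V" "T < T0" for T J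
  proof (rule ccontr)
    assume "\<not> ?thesis"
    then have nr: "\<bar>t - p\<bar> < \<delta>" if "t \<in> J" for t using that by force
    have J01: "J \<subseteq> {0..1}" by (rule openiv_sub01[OF pb_openiv[OF J(1)]])
    have cl: "\<bar>s - (f ^^ T) p\<bar> < len V / 4" if sV: "s \<in> V" for s
    proof -
      obtain t where t: "t \<in> J" "s = (f ^^ T) t" using sV pb_img[OF J(1)] by blast
      show ?thesis unfolding t(2) by (rule \<delta>(2)) (use t J01 nr J(2) in auto)
    qed
    have lV: "len V = b - a" using ab by simp
    have m: "a + (b - a)/8 \<in> V" "b - (b - a)/8 \<in> V" using ab by (auto simp: field_simps)
    show False using cl[OF m(1)] cl[OF m(2)] lV ab(1) by (auto simp: abs_if field_simps split: if_splits)
  qed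
  have near: "\<exists>J. good J \<and> (f ^^ n) x \<in> J" if n: "(f ^^ n) x \<in> V" "\<bar>(f ^^ n) x - p\<bar> < \<delta>/2" for n
  proof -
    obtain T J W r k where J: "(f ^^ (k * r)) ` J \<subseteq> V - W" "r \<ge> 1" "pb r W V" "W \<subseteq> V" "k * r < T" "pb T J V" "(f ^^ n) x \<in> J"
       "J \<subseteq> W" "(\<Sum>i<T. len ((f ^^ i) ` J)) \<le> 2 * 1"
      by (rule run_stage[OF w V order_refl L n(1) tube_le1]) (rule that; assumption)
    have TT: "T < T0" by (rule T0[OF J(6,7,9)])
    obtain t where t: "t \<in> J" "\<bar>t - p\<bar> \<ge> \<delta>" using far[OF J(6) TT] by blast
    have tV: "t \<in> V" using t(1) J(4,8) by blast
    have "y \<in> J"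
    proof (cases "p = a")
      case True
      have "a < t" "a < (f ^^ n) x" using tV n(1) ab(2) by auto
      then have "y \<in> {(f ^^ n) x..t}" using True t(2) n(2) \<delta>(1) unfolding y_def by auto
      then show ?thesis using openiv_mid[OF pb_openiv[OF J(6)] J(7) t(1)] by blast
    next
      case False
      then have pb: "p = b" using pab by blast
      have "t < b" "(f ^^ n) x < b" using tV n(1) ab(2) by auto
      then have "y \<in> {t..(f ^^ n) x}" using False pb t(2) n(2) \<delta>(1) unfolding y_def by auto
      then show ?thesis using openiv_mid[OF pb_openiv[OF J(6)] t(1) J(7)] by blast
    qed
    then have "good J" unfolding good_def using J TT by blast
    then show ?thesis using J(7) by blast
  qed
  have "finite (Collect good)"
    by (rule finite_subset[OF _ finite_pullbacks_at[OF nV, of T0 y]]) (unfold good_def, blast)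
  moreover have "p \<in> closure (\<Union>(Collect good))" unfolding closure_approachable
  proof (intro allI impI)
    fix e :: real assume e: "e > 0"
    then have "min e (\<delta>/2) > 0" using \<delta>(1) by simp
    then obtain n where n: "(f ^^ n) x \<in> V" "\<bar>(f ^^ n) x - p\<bar> < min e (\<delta>/2)" using vis by blast
    then obtain J where "good J" "(f ^^ n) x \<in> J" using near[of n] by auto
    then have "(f ^^ n) x \<in> \<Union>(Collect good)" by blast
    moreover have "dist ((f ^^ n) x) p < e" using n(2) by (simp add: dist_real_def)
    ultimately show "\<exists>y\<in>\<Union>(Collect good). dist y p < e" by blast
  qed
  ultimately obtain J where gJ: "good J" and pJ: "p \<in> closure J" using closure_Union_mem by blast
  obtain T W r k where J: "r \<ge> 1" "pb r W V" "W \<subseteq> V" "J \<subseteq> W" "(f ^^ (k * r)) ` J \<subseteq> V - W" "k * r < T" "pb T J V"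
    using gJ unfolding good_def by blast
  have pW: "p \<in> closure W" using pJ closure_mono[OF J(4)] by blast
  have "p \<in> closure W - W" using pW pV J(3) by blast
  then have "(f ^^ r) p \<in> closure V - V" by (rule pb_boundary[OF J(2)]) (rule pC)
  \<comment> \<open>the other end point of \<open>V\<close> reaches \<open>C\<close>, but the orbit of \<open>p\<close> does not\<close>
  then have rp: "(f ^^ r) p = p" using oth[of "(f ^^ r) p"] pC by (metis it_after)
  have "(f ^^ (k * r)) p = p"
  proof (induction k)
    case (Suc k) then show ?case using rp by (simp add: funpow_add)
  qed simp
  moreover have "(f ^^ (k * r)) p \<in> closure ((f ^^ (k * r)) ` J)"
    by (rule closure_img[OF pJ openiv_sub01[OF pb_openiv[OF J(7)]]]) (rule pC)
  ultimately have "p \<in> closure (V - W)" using closure_mono[OF J(5)] by auto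
  moreover
  obtain w1 w2 where w12: "w1 < w2" "W = {w1<..<w2}" using openiv_form[OF pb_openiv[OF J(2)]] by blast
  have wc: "w1 \<le> p" "p \<le> w2" using pW w12 by auto
  have wab: "a \<le> w1" "w2 \<le> b" using J(3) w12 ab by (auto simp: greaterThanLessThan_subseteq_greaterThanLessThan)
  have "w2 - w1 > 0" using w12 by simp
  ultimately obtain u where u: "u \<in> V - W" "dist u p < w2 - w1" unfolding closure_approachable by blast
  have "\<bar>u - p\<bar> < w2 - w1" "a < u" "u < b" using u ab by (auto simp: dist_real_def)
  moreover have "u \<le> w1 \<or> w2 \<le> u" using u w12 by auto
  ultimately show False using pab wc wab by auto
qed

text \<open>
  Since durations are bounded, the orbit visits a neighbourhood \<open>V\<close> of \<open>z\<close> with bounded gaps.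
  The orbit of an accumulation point \<open>u\<close> is a limit of orbit pieces and comes close to \<open>z\<close> as
  well.
\<close>

lemma dense_omega_minimal:
  assumes w: "wild d x" and K: "absorbing K" "dense_at K x"
    and z: "z \<in> omega_limit f x" and u: "u \<in> omega_limit f x"
  shows "z \<in> orbit_closure u"
  unfolding orbit_closure_def closure_approachable
proof (intro allI impI, rule ccontr)
  fix e :: real assume e: "e > 0" and no: "\<not> (\<exists>y\<in>range (\<lambda>n. (f ^^ n) u). dist y z < e)"
  have nr: "e \<le> \<bar>(f ^^ n) u - z\<bar>" for n using no by (auto simp: dist_real_def not_less)
  have d: "d > 0" using wild_pos[OF w] .
  obtain L where L: "log_lipschitz f' C (d/2) L" using log_lipschitz_exists[of "d/2"] d by auto
  have nop: "\<And>p q. p \<in> omega_limit f x \<Longrightarrow> q \<ge> 1 \<Longrightarrow> (f ^^ q) p \<noteq> p" by (rule dense_no_periodic[OF w K])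
  have au: "apart d u" by (rule omega_apart[OF wild_apart[OF w] d u])
  obtain V where V: "admissible (d/2) x V" "V \<subseteq> {z - e/2<..<z + e/2}"
    using admissible_at_aperiodic[OF w nop z, of "d/2" "e/2"] d e by auto
  have nV: "nice V" and sV: "small_pb (d/2) x V" using V unfolding admissible_def by blast+
  obtain T0 where T0: "\<And>n T J. pb T J V \<Longrightarrow> (f ^^ n) x \<in> J \<Longrightarrow> (\<Sum>i<T. len ((f ^^ i) ` J)) \<le> 2 * 1 \<Longrightarrow> T < T0"
    using stage_times_bounded[OF w nV sV order_refl L K, of "2 * 1"] by blast
  have gap: "\<exists>T. 1 \<le> T \<and> T < T0 \<and> (f ^^ (n + T)) x \<in> V" if n: "(f ^^ n) x \<in> V" for n
  proof -
    obtain T J k r where J: "(k::nat) * r < T" "pb T J V" "(f ^^ n) x \<in> J" "(f ^^ (n + T)) x \<in> V"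
       "(\<Sum>i<T. len ((f ^^ i) ` J)) \<le> 2 * 1"
      by (rule run_stage[OF w V(1) order_refl L n tube_le1]) (rule that; assumption)
    have "T < T0" by (rule T0[OF J(2,3,5)])
    then show ?thesis using J(1,4) by (intro exI[of _ T]) simp
  qed
  obtain n0 where n0: "(f ^^ n0) x \<in> V" using V(1) unfolding admissible_def by blast
  have synd: "\<exists>j<T0. (f ^^ (m + j)) x \<in> V" if m: "m \<ge> n0" for m
  proof -
    \<comment> \<open>the last visit up to time \<open>m\<close>\<close>
    define n where "n = (GREATEST n. n \<le> m \<and> (f ^^ n) x \<in> V)"
    have ex: "n0 \<le> m \<and> (f ^^ n0) x \<in> V" using m n0 by simp
    have n: "n \<le> m \<and> (f ^^ n) x \<in> V" unfolding n_def
      by (rule GreatestI_nat[of "\<lambda>n. n \<le> m \<and> (f ^^ n) x \<in> V", OF ex]) blast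
    have gr: "n' \<le> n" if "n' \<le> m \<and> (f ^^ n') x \<in> V" for n' unfolding n_def
      by (rule Greatest_le_nat[of "\<lambda>n. n \<le> m \<and> (f ^^ n) x \<in> V", OF that]) blast
    obtain T where T: "1 \<le> T" "T < T0" "(f ^^ (n + T)) x \<in> V" using gap n by blast
    have "m < n + T" using gr[of "n + T"] T by (meson T(3) le_add_same_cancel1 not_le not_one_le_zero le_less_trans add_le_same_cancel1)
    then have "m + (n + T - m) = n + T" "n + T - m < T0" using n T(2) by auto
    then show ?thesis using T(3) by (intro exI[of _ "n + T - m"]) simp
  qed
  have e2: "e/2 > 0" using e by simp
  obtain \<delta> where \<delta>: "\<delta> > 0" "\<And>t j. t \<in> {0..1} \<Longrightarrow> \<bar>t - u\<bar> < \<delta> \<Longrightarrow> j < T0 \<Longrightarrow> \<bar>(f ^^ j) t - (f ^^ j) u\<bar> < e/2"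
    using it_uniformly_near[OF apart01[OF au] apart_notC[OF au d] e2, of T0] by blast
  obtain m where m: "m \<ge> n0" "\<bar>(f ^^ m) x - u\<bar> < \<delta>" using u \<delta>(1) unfolding omega_limit_iff by blast
  obtain j where j: "j < T0" "(f ^^ (m + j)) x \<in> V" using synd[OF m(1)] by blast
  have "\<bar>(f ^^ j) ((f ^^ m) x) - (f ^^ j) u\<bar> < e/2"
    by (rule \<delta>(2)[OF it_range[OF apart01[OF wild_apart[OF w]]] m(2) j(1)])
  moreover have "\<bar>(f ^^ j) ((f ^^ m) x) - z\<bar> < e/2" using j(2) V(2) by (auto simp: it_after abs_if)
  ultimately show False using nr[of j] by linarith
qed

section \<open>Density in minimal limit sets\<close>

text \<open>
  The density of \<open>K\<close> at \<open>x\<close>, transported by the first entrance into \<open>V\<close>. The constant does not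
  depend on \<open>V\<close>.
\<close>

lemma entrance_density:
  assumes w: "wild d x" and V: "nice V" "small_pb \<eta> x V" and \<eta>: "\<eta> \<le> d/2" and L: "log_lipschitz f' C (d/2) L"
    and vis: "(f ^^ n) x \<in> V" and K: "absorbing K"
    and den: "\<And>u v. u < x \<Longrightarrow> x < v \<Longrightarrow> v - u < \<eta> \<Longrightarrow> len ({u<..<v} - K) \<le> \<beta> * (v - u)"
  shows "len (V - K) \<le> exp L * \<beta> * len V"
proof -
  obtain l P where P: "pb l P V" "x \<in> P" "(f ^^ l) x \<in> V" "(\<Sum>i<l. len ((f ^^ i) ` P)) \<le> 1"
    by (rule first_entrance[OF V vis]) (rule that; assumption)
  have P0: "(f ^^ 0) x \<in> P" using P(2) by simp
  have Po: "openiv P" using pb_openiv[OF P(1)] .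
  have lP: "len P < \<eta>" using small_pb_size[OF V P(1) P0, of 0] by simp
  obtain u v where uv: "u < v" "P = {u<..<v}" using openiv_form[OF Po] by blast
  have lb: "len (P - K) \<le> \<beta> * len P" using den[of u v] P(2) lP uv by auto
  have PK: "open (P - K)" using K openiv_open[OF Po] unfolding absorbing_def by (simp add: open_Diff)
  have D: "\<bar>Dn l t\<bar> \<le> exp (L * 1) * \<bar>Dn l t'\<bar>" if "t \<in> P" "t' \<in> P" for t t'
    by (rule stage_distortion[OF w V \<eta> L P(1) P0 P(4) that])
  have "len ((f ^^ l) ` (P - K)) * len P \<le> exp (L * 1) * len (P - K) * len V"
    using ratio_le[OF Po pb_free[OF P(1)] D PK] pb_img[OF P(1)] by auto
  also have "\<dots> \<le> exp (L * 1) * (\<beta> * len P) * len V"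
    using lb by (intro mult_right_mono mult_left_mono) auto
  finally have c: "len ((f ^^ l) ` (P - K)) \<le> exp L * \<beta> * len V" using openiv_len_pos[OF Po] by (simp add: mult_ac)
  have VK: "open (V - K)" using K openiv_open[OF nice_openiv[OF V(1)]] unfolding absorbing_def by (simp add: open_Diff)
  have m: "V - K \<in> lmeasurable" using VK bounded_subset[of "{0..1}" "V - K"] openiv_sub01[OF nice_openiv[OF V(1)]]
    by (intro lmeasurable_open) auto
  have "V - K \<subseteq> (f ^^ l) ` (P - K)"
  proof
    fix t assume t: "t \<in> V - K"
    then obtain y where y: "y \<in> P" "t = (f ^^ l) y" using pb_img[OF P(1)] by blast
    have "y \<notin> K" using absorbing_iter[OF K Po pb_free[OF P(1)] y(1)] t y(2) by blast
    then show "t \<in> (f ^^ l) ` (P - K)" using y by blast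
  qed
  then have "len (V - K) \<le> len ((f ^^ l) ` (P - K))"
    by (rule measure_mono_fmeasurable[OF _ fmeasurableD[OF m] img_open(3)[OF Po pb_free[OF P(1)] PK]]) blast
  then show ?thesis using c by linarith
qed

text \<open>
  For the quotients \<open>\<rho>\<^sub>i = a\<^sub>i\<^sub>+\<^sub>1 / a\<^sub>i\<close> the hypothesis says \<open>\<rho>\<^sub>i\<^sub>+\<^sub>1 \<ge> \<rho>\<^sub>i exp (- M a\<^sub>i)\<close>. The
  sum of the \<open>a\<^sub>i\<close> need not be bounded, but as long as \<open>\<rho>\<^sub>i < 1/2\<close> the sequence halves at each
  step and \<open>3 - 2 a\<^sub>i\<close> increases by at least \<open>a\<^sub>i\<close>; and if \<open>\<rho>\<^sub>i \<ge> 1/2 \<ge> \<theta>\<close>, the bound can be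
  started afresh.
\<close>

lemma ratio_sequence:
  fixes a :: "nat \<Rightarrow> real"
  assumes a: "\<And>i. a i > 0" "a 0 = 1" "\<And>i. a (Suc i) \<le> a i" "\<And>i. a (Suc i) * a (Suc i) \<le> exp (M * a i) * a (Suc (Suc i)) * a i"
    and \<theta>: "\<theta> \<le> 1/2" "\<theta> > 0" "\<theta> \<le> a 1" and M: "M \<ge> 0"
  shows "\<theta> * exp (- (M * (3 - 2 * a i))) * a i \<le> a (Suc i)"
proof (induction i)
  case 0
  have "\<theta> * exp (- (M * (3 - 2 * 1))) \<le> \<theta> * 1" using \<theta> M by (intro mult_left_mono) auto
  then show ?case using \<theta>(3) a(2) by simp
next
  case (Suc i)
  have le1: "a i \<le> 1" for i by (induction i) (use a(2,3) order_trans in auto)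
  define \<rho> where "\<rho> = a (Suc i) / a i"
  have \<rho>: "\<rho> > 0" "a (Suc i) = \<rho> * a i" unfolding \<rho>_def using a(1)[of i] a(1)[of "Suc i"] by auto
  have "exp (- (M * a i)) * (a (Suc i) * a (Suc i)) \<le> exp (- (M * a i)) * (exp (M * a i) * a (Suc (Suc i)) * a i)"
    using a(4)[of i] by (intro mult_left_mono) auto
  also have "\<dots> = a (Suc (Suc i)) * a i" by (simp add: exp_minus)
  finally have "exp (- (M * a i)) * \<rho> * a (Suc i) * a i \<le> a (Suc (Suc i)) * a i" using \<rho>(2) by (simp add: mult_ac)
  then have n: "exp (- (M * a i)) * \<rho> * a (Suc i) \<le> a (Suc (Suc i))" using a(1)[of i] by simp
  have "\<theta> * exp (- (M * (3 - 2 * a (Suc i)))) \<le> exp (- (M * a i)) * \<rho>"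
  proof (cases "\<rho> \<ge> 1/2")
    case True
    have "a i \<le> 3 - 2 * a (Suc i)" using le1[of i] a(3)[of i] by linarith
    then have "M * a i \<le> M * (3 - 2 * a (Suc i))" using M by (rule mult_left_mono)
    then have "\<theta> * exp (- (M * (3 - 2 * a (Suc i)))) \<le> \<rho> * exp (- (M * a i))"
      using \<theta> True by (intro mult_mono) auto
    then show ?thesis by (simp add: mult_ac)
  next
    case False
    have "a (Suc i) \<le> 1/2 * a i" using False a(1)[of i] \<rho>(2) by (simp add: mult_right_mono)
    then have "3 - 2 * a i + a i \<le> 3 - 2 * a (Suc i)" by linarith
    then have "M * (3 - 2 * a i + a i) \<le> M * (3 - 2 * a (Suc i))" using M by (rule mult_left_mono)
    then have ex: "exp (- (M * (3 - 2 * a (Suc i)))) \<le> exp (- (M * (3 - 2 * a i))) * exp (- (M * a i))"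
      unfolding exp_add[symmetric] by (simp add: algebra_simps)
    have "\<theta> * exp (- (M * (3 - 2 * a i))) * a i \<le> \<rho> * a i" using Suc.IH \<rho>(2) by simp
    then have "\<theta> * exp (- (M * (3 - 2 * a i))) \<le> \<rho>" using a(1)[of i] by simp
    then have "\<theta> * exp (- (M * (3 - 2 * a i))) * exp (- (M * a i)) \<le> \<rho> * exp (- (M * a i))" by (rule mult_right_mono) simp
    moreover have "\<theta> * exp (- (M * (3 - 2 * a (Suc i)))) \<le> \<theta> * exp (- (M * (3 - 2 * a i))) * exp (- (M * a i))"
      unfolding mult.assoc using ex \<theta>(2) by (intro mult_left_mono) auto
    ultimately show ?thesis unfolding mult.commute[of "exp (- (M * a i))" \<rho>] by linarith
  qed
  then have "\<theta> * exp (- (M * (3 - 2 * a (Suc i)))) * a (Suc i) \<le> exp (- (M * a i)) * \<rho> * a (Suc i)"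
    using a(1)[of "Suc i"] by (intro mult_right_mono) auto
  then show ?case using n by linarith
qed

text \<open>
  With \<open>a\<^sub>i = \<bar>J\<^sub>i\<bar> / \<bar>V\<bar>\<close>, where \<open>J\<^sub>i\<close> is the domain of the \<open>i\<close>-th iterate of the branch, the
  distortion of \<open>f\<^sup>r\<close> on \<open>J\<^sub>i\<^sub>+\<^sub>1\<close> is at most \<open>exp (M a\<^sub>i)\<close> by \<open>length_of_subpullback\<close>. Applied to
  \<open>J\<^sub>i\<^sub>+\<^sub>2 \<subseteq> J\<^sub>i\<^sub>+\<^sub>1\<close>, this is the hypothesis of \<open>ratio_sequence\<close>.
\<close>

lemma branch_ratio:
  assumes w: "wild d x" and V: "nice V" "small_pb \<eta> x V" and \<eta>: "\<eta> \<le> d/2" and L: "log_lipschitz f' C (d/2) L"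
    and W: "pb r W V" "(f ^^ n) x \<in> W" "W \<subseteq> V" "(\<Sum>i<r. len ((f ^^ i) ` W)) \<le> 1"
    and \<theta>: "\<theta> \<le> 1/2" "\<theta> > 0" "\<theta> * len V \<le> len W"
  shows "\<theta> * exp (- (3 * (L * exp L))) * len (iter_branch W r V i) \<le> len (iter_branch W r V (Suc i))"
proof -
  define J where "J = iter_branch W r V"
  define M where "M = L * exp L"
  have L0: "L > 0" using L unfolding log_lipschitz_def by simp
  have M0: "M \<ge> 0" unfolding M_def using L0 by simp
  have Vo: "openiv V" using nice_openiv[OF V(1)] .
  have lV: "len V > 0" using openiv_len_pos[OF Vo] .
  have JV: "J i \<subseteq> V" and Jp: "pb (i * r) (J i) V" and Jr: "pb r (J (Suc i)) (J i)" for i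
    using iter_branch_pb[OF W(1,3), of i] unfolding J_def by blast+
  have Jo: "openiv (J i)" for i using pb_openiv[OF Jp] .
  have JS: "J (Suc i) = {t\<in>W. (f ^^ r) t \<in> J i}" for i unfolding J_def by simp
  have J0: "J 0 = V" unfolding J_def by simp
  have dec: "J (Suc i) \<subseteq> J i" for i
  proof (induction i)
    case 0 show ?case using JV J0 by blast
  next
    case (Suc i) then show ?case unfolding JS[of "Suc i"] JS[of i] by blast
  qed
  define a where "a = (\<lambda>i. len (J i) / len V)"
  have D: "\<bar>Dn r u\<bar> \<le> exp (M * a i) * \<bar>Dn r v\<bar>" if uv: "u \<in> J (Suc i)" "v \<in> J (Suc i)" for i u v
  proof -
    have "(\<Sum>j<r. len ((f ^^ j) ` J (Suc i))) \<le> (\<Sum>j<r. exp L * a i * len ((f ^^ j) ` W))"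
    proof (rule sum_mono)
      fix j assume "j \<in> {..<r}"
      then have "len ((f ^^ j) ` J (Suc i)) * len V \<le> exp (L * 1) * len (J i) * len ((f ^^ j) ` W)"
        by (intro length_of_subpullback[OF w V \<eta> L W(1,2,4) Jo JV JS]) simp
      then show "len ((f ^^ j) ` J (Suc i)) \<le> exp L * a i * len ((f ^^ j) ` W)"
        unfolding a_def using lV by (simp add: field_simps)
    qed
    also have "\<dots> = exp L * a i * (\<Sum>j<r. len ((f ^^ j) ` W))" by (rule sum_distrib_left[symmetric])
    also have "\<dots> \<le> exp L * a i * 1" using W(4) unfolding a_def by (intro mult_left_mono) auto
    finally have s: "(\<Sum>j<r. len ((f ^^ j) ` J (Suc i))) \<le> exp L * a i * 1" .
    have "\<bar>Dn r u\<bar> \<le> exp (L * (exp L * a i * 1)) * \<bar>Dn r v\<bar>"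
    proof (rule distortion[OF L Jo pb_free[OF Jr] _ s uv])
      fix j assume j: "j < r"
      have "(f ^^ j) ` W \<subseteq> away C (d/2)"
        by (rule small_away[OF w \<eta> W(1,2) less_imp_le[OF j] small_pb_size[OF V W(1,2) less_imp_le[OF j]]])
      moreover have "J (Suc i) \<subseteq> W" unfolding JS by blast
      ultimately show "(f ^^ j) ` J (Suc i) \<subseteq> away C (d/2)" by blast
    qed
    then show ?thesis unfolding M_def by (simp add: mult_ac)
  qed
  have "\<theta> * exp (- (M * (3 - 2 * a i))) * a i \<le> a (Suc i)"
  proof (rule ratio_sequence)
    show "a i > 0" for i unfolding a_def using lV openiv_len_pos[OF Jo] by simp
    show "a 0 = 1" unfolding a_def J0 using lV by simp
    show "a (Suc i) \<le> a i" for i unfolding a_def using lV openiv_len_mono[OF Jo Jo dec] by (simp add: divide_right_mono)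
    show "a (Suc i) * a (Suc i) \<le> exp (M * a i) * a (Suc (Suc i)) * a i" for i
    proof -
      have "len ((f ^^ r) ` J (Suc (Suc i))) * len (J (Suc i)) \<le> exp (M * a i) * len (J (Suc (Suc i))) * len ((f ^^ r) ` J (Suc i))"
        by (rule ratio_le[OF Jo pb_free[OF Jr] D openiv_open[OF Jo] dec])
      then have "len (J (Suc i)) * len (J (Suc i)) \<le> exp (M * a i) * len (J (Suc (Suc i))) * len (J i)"
        using pb_img[OF Jr] by simp
      then have "len (J (Suc i)) * len (J (Suc i)) / (len V * len V) \<le> exp (M * a i) * len (J (Suc (Suc i))) * len (J i) / (len V * len V)"
        using lV by (intro divide_right_mono) auto
      then show ?thesis unfolding a_def by simp
    qed
    have "J 1 = W" using JS[of 0] J0 pb_in[OF W(1)] by auto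
    then show "\<theta> \<le> a 1" unfolding a_def using \<theta>(3) lV by (simp add: field_simps)
  qed (use \<theta> M0 in auto)
  moreover have "\<theta> * exp (- (3 * M)) * a i \<le> \<theta> * exp (- (M * (3 - 2 * a i))) * a i"
  proof -
    have "a i \<ge> 0" unfolding a_def by simp
    moreover have "- (3 * M) \<le> - (M * (3 - 2 * a i))" using M0 calculation by (simp add: algebra_simps)
    ultimately show ?thesis using \<theta>(2) by (intro mult_right_mono mult_left_mono) auto
  qed
  ultimately have "\<theta> * exp (- (3 * M)) * a i \<le> a (Suc i)" by linarith
  then have "\<theta> * exp (- (3 * M)) * a i * len V \<le> a (Suc i) * len V" using lV by (intro mult_right_mono) auto
  then show ?thesis unfolding a_def M_def J_def[symmetric] using lV by simp
qed

text \<open>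
  The case distinction between short and long first return branches, with threshold \<open>\<theta> = exp
  (- L) / 2\<close>: a branch shorter than \<open>\<theta> \<bar>V\<bar>\<close> expands by \<open>2\<close>. If there is a long branch \<open>W\<close>, let \<open>k\<close> be
  the greatest index such that the orbit visits \<open>J\<^sub>k\<close>. It is finite because a stage that
  starts in \<open>J\<^sub>i\<close> stays on \<open>W\<close> for at least \<open>i\<close> rounds.
\<close>

lemma dense_minimal_impossible:
  assumes w: "wild d x" and K: "absorbing (orbit_closure x)" "dense_at (orbit_closure x) x"
  shows False
proof -
  let ?K = "orbit_closure x"
  have d: "d > 0" using wild_pos[OF w] .
  obtain L where L: "log_lipschitz f' C (d/2) L" using log_lipschitz_exists[of "d/2"] d by auto
  have L0: "L > 0" using L unfolding log_lipschitz_def by simp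
  define \<theta> where "\<theta> = exp (- L) / 2"
  have \<theta>: "\<theta> \<le> 1/2" "\<theta> > 0" unfolding \<theta>_def using L0 by auto
  \<comment> \<open>the lower bound of \<open>branch_ratio\<close>; gaps of relative size \<open>Q/2\<close> are then too small\<close>
  define Q where "Q = \<theta> * exp (- (3 * (L * exp L)))"
  have Q: "Q > 0" unfolding Q_def using \<theta>(2) by simp
  define \<beta> where "\<beta> = exp (- L) * Q / 2"
  have \<beta>: "\<beta> > 0" unfolding \<beta>_def using Q by simp
  obtain \<epsilon> where \<epsilon>: "\<epsilon> > 0" "\<And>u v. u < x \<Longrightarrow> x < v \<Longrightarrow> v - u < \<epsilon> \<Longrightarrow> len ({u<..<v} - ?K) \<le> \<beta> * (v - u)"
    using K(2) \<beta> unfolding dense_at_def by blast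
  define \<eta> where "\<eta> = min \<epsilon> (d/2)"
  have \<eta>: "\<eta> > 0" "\<eta> \<le> d/2" "\<eta> \<le> \<epsilon>" unfolding \<eta>_def using \<epsilon>(1) d by auto
  obtain V where V: "admissible \<eta> x V" using admissible_exists[OF w \<eta>(1)] by blast
  have nV: "nice V" and sV: "small_pb \<eta> x V" using V unfolding admissible_def by blast+
  have Vo: "openiv V" using nice_openiv[OF nV] .
  have ts: "(\<Sum>j<r. len ((f ^^ j) ` W)) \<le> 1"
    if "pb r W V" "(f ^^ n) x \<in> W" "\<And>l. 1 \<le> l \<Longrightarrow> l < r \<Longrightarrow> (f ^^ (n + l)) x \<notin> V" for r W n
    using tower_sum[OF nV sV that] tube_le1[of x \<eta>] by linarith
  have "\<exists>n r W. r \<ge> 1 \<and> pb r W V \<and> (f ^^ n) x \<in> W \<and> W \<subseteq> V \<and> (\<forall>l. 1 \<le> l \<and> l < r \<longrightarrow> (f ^^ (n + l)) x \<notin> V) \<and> \<theta> * len V \<le> len W"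
  proof (rule ccontr)
    assume none: "\<not> ?thesis"
    show False
    proof (rule no_uniform_stages[OF w V \<eta>(2) L K, of 2 1])
      fix n assume n: "(f ^^ n) x \<in> V"
      obtain r W where W: "r \<ge> 1" "(f ^^ (n + r)) x \<in> V" "\<And>l. 1 \<le> l \<Longrightarrow> l < r \<Longrightarrow> (f ^^ (n + l)) x \<notin> V"
        "pb r W V" "(f ^^ n) x \<in> W" "W \<subseteq> V" by (rule first_return[OF V n]) (rule that; assumption)
      have sm: "\<not> \<theta> * len V \<le> len W" using none W by blast
      have s1: "(\<Sum>j<r. len ((f ^^ j) ` W)) \<le> 1" by (rule ts[OF W(4,5,3)])
      have "2 \<le> \<bar>Dn r t\<bar>" if t: "t \<in> W" for t
      proof -
        have "len ((f ^^ r) ` W) \<le> exp (L * 1) * \<bar>Dn r t\<bar> * len W"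
          by (rule ratio_deriv[OF pb_openiv[OF W(4)] pb_free[OF W(4)] stage_distortion[OF w nV sV \<eta>(2) L W(4,5) s1] t])
        then have "len V \<le> exp L * \<bar>Dn r t\<bar> * len W" using pb_img[OF W(4)] by simp
        also have "\<dots> \<le> exp L * \<bar>Dn r t\<bar> * (\<theta> * len V)" using sm by (intro mult_left_mono) auto
        also have "\<dots> = \<bar>Dn r t\<bar> / 2 * len V" unfolding \<theta>_def by (simp add: exp_minus)
        finally show ?thesis using openiv_len_pos[OF Vo] by simp
      qed
      then show "\<exists>T J. T \<ge> 1 \<and> pb T J V \<and> (f ^^ n) x \<in> J \<and> J \<subseteq> V \<and> (f ^^ (n + T)) x \<in> V \<and>
         (\<Sum>i<T. len ((f ^^ i) ` J)) \<le> 1 \<and> (\<forall>t\<in>J. 2 \<le> \<bar>Dn T t\<bar>)" using W s1 by blast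
    qed auto
  qed
  then obtain n r W where r: "r \<ge> 1" and W: "pb r W V" "(f ^^ n) x \<in> W" "W \<subseteq> V"
    and fr: "\<And>l. 1 \<le> l \<Longrightarrow> l < r \<Longrightarrow> (f ^^ (n + l)) x \<notin> V" and big: "\<theta> * len V \<le> len W" by blast
  define J where "J = iter_branch W r V"
  have Jp: "pb (i * r) (J i) V" for i using iter_branch_pb[OF W(1,3), of i] unfolding J_def by blast
  have Jr: "pb r (J (Suc i)) (J i)" for i using iter_branch_pb[OF W(1,3), of i] unfolding J_def by blast
  have Jo: "openiv (J i)" for i using pb_openiv[OF Jp] .
  have JW: "J (Suc i) \<subseteq> W" for i unfolding J_def by auto
  have J0: "J 0 = V" unfolding J_def by simp
  obtain T0 where T0: "\<And>n T J. pb T J V \<Longrightarrow> (f ^^ n) x \<in> J \<Longrightarrow> (\<Sum>i<T. len ((f ^^ i) ` J)) \<le> 2 * 1 \<Longrightarrow> T < T0"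
    using stage_times_bounded[OF w nV sV \<eta>(2) L K, of "2 * 1"] by blast
  have bd: "i \<le> T0" if vi: "(f ^^ m) x \<in> J i" for i m
  proof (cases i)
    case (Suc i')
    have mW: "(f ^^ m) x \<in> W" using vi JW unfolding Suc by blast
    have mV: "(f ^^ m) x \<in> V" using mW W(3) by blast
    obtain T J' W' r' k where R: "r' \<ge> 1" "pb r' W' V" "(f ^^ m) x \<in> W'" "W' \<subseteq> V"
      "\<And>l. 1 \<le> l \<Longrightarrow> l < r' \<Longrightarrow> (f ^^ (m + l)) x \<notin> V"
      "(f ^^ (m + k * r')) x \<in> V - W'" "k * r' < T" "pb T J' V" "(f ^^ m) x \<in> J'" "(\<Sum>i<T. len ((f ^^ i) ` J')) \<le> 2 * 1"
      by (rule run_stage[OF w V \<eta>(2) L mV tube_le1]) (rule that; assumption)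
    have ne: "W \<inter> W' \<noteq> {}" using mW R(3) by blast
    have eq: "W = W' \<and> r = r'" by (rule return_branches_disjoint[OF V W(1,2) fr r R(2,3,5,1) ne])
    have run: "(f ^^ (m + l * r)) x \<in> J (i - l)" if "l \<le> i" for l using that
    proof (induction l)
      case (Suc l)
      have "(f ^^ r) ((f ^^ (m + l * r)) x) \<in> J (i - Suc l)"
        using pb_in[OF Jr[of "i - Suc l"], of "(f ^^ (m + l * r)) x"] Suc by (simp add: Suc_diff_Suc)
      then show ?case unfolding it_after[symmetric] by (simp add: add.assoc add.commute[of r])
    qed (use vi in simp)
    \<comment> \<open>after \<open>k\<close> rounds the orbit is outside \<open>W\<close>, but in \<open>J\<^sub>i\<^sub>-\<^sub>k\<close>\<close>
    have "\<not> k < i"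
    proof
      assume ki: "k < i"
      then have "(f ^^ (m + k * r)) x \<in> J (Suc (i - Suc k))" using run[of k] by (simp add: Suc_diff_Suc)
      then show False using JW R(6) eq by blast
    qed
    moreover have "T < T0" by (rule T0[OF R(8,9,10)])
    moreover have "k \<le> k * r'" using R(1) by simp
    ultimately show ?thesis using R(7) by linarith
  qed simp
  define k where "k = (GREATEST i. \<exists>m. (f ^^ m) x \<in> J i)"
  have vis0: "\<exists>m. (f ^^ m) x \<in> J 0" using W(2,3) J0 by blast
  have bd': "\<forall>i. (\<exists>m. (f ^^ m) x \<in> J i) \<longrightarrow> i \<le> T0" using bd by blast
  have kv: "\<exists>m. (f ^^ m) x \<in> J k" unfolding k_def
    by (rule GreatestI_nat[of "\<lambda>i. \<exists>m. (f ^^ m) x \<in> J i", OF vis0]) (rule bd'[rule_format])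
  have kmax: "i \<le> k" if "\<exists>m. (f ^^ m) x \<in> J i" for i unfolding k_def
    by (rule Greatest_le_nat[of "\<lambda>i. \<exists>m. (f ^^ m) x \<in> J i", OF that]) (rule bd'[rule_format])
  have notv: "(f ^^ m) x \<notin> J (Suc k)" for m using kmax[of "Suc k"] by auto
  have "?K \<inter> J (Suc k) = {}"
  proof -
    have "J (Suc k) \<inter> range (\<lambda>n. (f ^^ n) x) = {}" using notv by blast
    then have "J (Suc k) \<inter> closure (range (\<lambda>n. (f ^^ n) x)) = {}"
      by (rule iffD2[OF open_Int_closure_eq_empty[OF openiv_open[OF Jo]]])
    then show ?thesis unfolding orbit_closure_def by blast
  qed
  moreover have "J (Suc k) \<subseteq> J k"
  proof -
    have "pb (Suc k * r) (J (Suc k)) V" "pb (k * r) (J k) V" by (rule Jp)+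
    have dec: "J (Suc i) \<subseteq> J i" for i
    proof (induction i)
      case 0 show ?case using JW[of 0] W(3) J0 by blast
    next
      case (Suc i) then show ?case unfolding J_def by auto
    qed
    then show ?thesis .
  qed
  ultimately have sub: "J (Suc k) \<subseteq> J k - ?K" by blast
  have nJ: "nice (J k)" by (rule nice_pb[OF nV Jp])
  have sJ: "small_pb \<eta> x (J k)" by (rule small_pb_pb[OF nV sV Jp])
  obtain m where m: "(f ^^ m) x \<in> J k" using kv by blast
  have dd: "len ({u<..<v} - ?K) \<le> \<beta> * (v - u)" if "u < x" "x < v" "v - u < \<eta>" for u v
    using \<epsilon>(2)[OF that(1,2)] that(3) \<eta>(3) by linarith
  have ub: "len (J k - ?K) \<le> exp L * \<beta> * len (J k)"
    by (rule entrance_density[OF w nJ sJ \<eta>(2) L m K(1) dd])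
  have oK: "open (J k - ?K)" unfolding orbit_closure_def using openiv_open[OF Jo] by (simp add: open_Diff)
  have mK: "J k - ?K \<in> lmeasurable" using oK bounded_subset[of "{0..1}" "J k - ?K"] openiv_sub01[OF Jo]
    by (intro lmeasurable_open) auto
  have "len (J (Suc k)) \<le> len (J k - ?K)"
    by (rule measure_mono_fmeasurable[OF sub fmeasurableD[OF openiv_lmeas[OF Jo]] mK])
  moreover have "Q * len (J k) \<le> len (J (Suc k))" unfolding Q_def J_def
    by (rule branch_ratio[OF w nV sV \<eta>(2) L W ts[OF W(1,2) fr] \<theta> big])
  ultimately have "Q * len (J k) \<le> exp L * \<beta> * len (J k)" using ub by linarith
  then have "Q \<le> exp L * \<beta>" using openiv_len_pos[OF Jo, of k] by simp
  moreover have "exp L * \<beta> = Q / 2" unfolding \<beta>_def by (simp add: exp_minus)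
  ultimately show False using Q by simp
qed

end

section \<open>The points that stay apart from the exceptional set\<close>

lemma negligible_of_countable: "countable A \<Longrightarrow> negligible (A :: real set)"
  using countable_imp_null_set_lborel null_sets_completionI negligible_iff_null_sets by blast

text \<open>
  Each point is singled out by an interval with rational end points.
\<close>

lemma countable_of_isolated:
  fixes P :: "real set"
  assumes iso: "\<And>y. y \<in> P \<Longrightarrow> \<exists>e>0. \<forall>s\<in>P. \<bar>s - y\<bar> < e \<longrightarrow> s = y"
  shows "countable P"
proof -
  let ?g = "\<lambda>(a, b). THE y. y \<in> P \<and> a < y \<and> y < b"
  have "P \<subseteq> ?g ` (\<rat> \<times> \<rat>)"
  proof
    fix y assume y: "y \<in> P"
    then obtain e where e: "e > 0" "\<And>s. s \<in> P \<Longrightarrow> \<bar>s - y\<bar> < e \<Longrightarrow> s = y" using iso by blast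
    have "y - e < y" using e(1) by simp
    then obtain a where a: "a \<in> \<rat>" "y - e < a" "a < y" using Rats_dense_in_real by blast
    have "y < y + e" using e(1) by simp
    then obtain b where b: "b \<in> \<rat>" "y < b" "b < y + e" using Rats_dense_in_real by blast
    have "(THE y. y \<in> P \<and> a < y \<and> y < b) = y"
    proof (rule the_equality)
      fix s assume s: "s \<in> P \<and> a < s \<and> s < b"
      show "s = y" by (rule e(2)) (use s a b in auto)
    qed (use y a b in simp)
    then have g: "y = ?g (a, b)" by simp
    have "(a, b) \<in> \<rat> \<times> \<rat>" using a(1) b(1) by simp
    then show "y \<in> ?g ` (\<rat> \<times> \<rat>)" by (rule image_eqI[where f = ?g and x = "(a, b)", OF g])
  qed
  moreover have "countable (?g ` (\<rat> \<times> \<rat> :: (real \<times> real) set))"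
    by (intro countable_image countable_SIGMA countable_rat)
  ultimately show ?thesis by (rule countable_subset)
qed

context interval_map begin

lemma apart_mono:
  assumes a: "apart d x" and d: "d' \<le> d" shows "apart d' x"
  unfolding apart_def
proof (intro conjI allI ballI)
  show "x \<in> {0..1}" by (rule apart01[OF a])
  fix n c assume "c \<in> C"
  then have "d \<le> \<bar>(f ^^ n) x - c\<bar>" using a unfolding apart_def by blast
  then show "d' \<le> \<bar>(f ^^ n) x - c\<bar>" using d by linarith
qed

lemma orbit_closure_sub_omega: "orbit_closure x \<subseteq> range (\<lambda>n. (f ^^ n) x) \<union> omega_limit f x"
proof
  fix t assume t: "t \<in> orbit_closure x"
  show "t \<in> range (\<lambda>n. (f ^^ n) x) \<union> omega_limit f x"
  proof (cases "t \<in> range (\<lambda>n. (f ^^ n) x)")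
    case False
    have "\<forall>e>0. \<forall>N. \<exists>n\<ge>N. \<bar>(f ^^ n) x - t\<bar> < e"
    proof (intro allI impI)
      fix e :: real and N :: nat assume e: "e > 0"
      let ?F = "(\<lambda>n. (f ^^ n) x) ` {..<N}" and ?G = "(\<lambda>n. (f ^^ n) x) ` {N..}"
      have U: "UNIV = {..<N} \<union> {N..}" by auto
      have "closure (range (\<lambda>n. (f ^^ n) x)) = closure ?F \<union> closure ?G" unfolding U image_Un closure_Un ..
      then have "t \<in> closure ?F \<union> closure ?G" using t unfolding orbit_closure_def by simp
      moreover have "closure ?F = ?F" by (intro closure_closed finite_imp_closed finite_imageI finite_lessThan)
      ultimately have "t \<in> closure ?G" using False by blast
      then obtain s where "s \<in> ?G" "dist s t < e" unfolding closure_approachable using e by blast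
      then show "\<exists>n\<ge>N. \<bar>(f ^^ n) x - t\<bar> < e" unfolding dist_real_def by auto
    qed
    then have "t \<in> omega_limit f x" unfolding omega_limit_iff .
    then show ?thesis by blast
  qed simp
qed

lemma orbit_closure_eq_omega:
  assumes x: "apart d x" "d > 0" and u: "u \<in> omega_limit f x"
    and min: "\<And>z. z \<in> omega_limit f x \<Longrightarrow> z \<in> orbit_closure u"
  shows "orbit_closure u = omega_limit f x"
proof
  show "orbit_closure u \<subseteq> omega_limit f x" unfolding orbit_closure_def
    by (rule closure_minimal[OF _ omega_closed]) (use omega_invariant[OF x u] in blast)
  show "omega_limit f x \<subseteq> orbit_closure u" using min by blast
qed

text \<open>
  If the orbit closure of \<open>y\<close> is not null, then \<open>\<omega>(y)\<close> is not null either, and minimality allows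
  to replace \<open>K\<close> and \<open>y\<close> by \<open>\<omega>(y)\<close> and one of its density points. This point is wild because \<open>\<omega>(y)\<close>
  contains no periodic points and keeps away from \<open>0\<close>, \<open>1\<close> and the closures of homtervals.
\<close>

lemma dense_wild_impossible:
  assumes w: "wild d y" and K: "absorbing K" "dense_at K y"
  shows False
proof -
  have d: "d > 0" using wild_pos[OF w] .
  have ay: "apart d y" by (rule wild_apart[OF w])
  have nop: "\<And>p q. p \<in> omega_limit f y \<Longrightarrow> q \<ge> 1 \<Longrightarrow> (f ^^ q) p \<noteq> p" by (rule dense_no_periodic[OF w K])
  let ?O = "omega_limit f y"
  have O1: "?O \<subseteq> {0<..<1}" using omega_interior[OF w nop] by blast
  have bO: "bounded ?O" by (rule bounded_subset[of "{0..1}"]) (use O1 in auto)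
  have inv: "(f ^^ n) t \<in> ?O" if "t \<in> ?O" for n t by (rule omega_invariant[OF ay d that])
  have "\<not> negligible ?O"
  proof
    assume "negligible ?O"
    moreover have "negligible (range (\<lambda>n. (f ^^ n) y))" by (intro negligible_of_countable) simp
    ultimately have "negligible (orbit_closure y)" by (rule negligible_subset[OF negligible_Un[rotated] orbit_closure_sub_omega])
    then show False using dense_wild_not_null[OF w K] by blast
  qed
  moreover have "negligible {x \<in> ?O. \<not> dense_at ?O x}" by (rule negligible_not_dense_at[OF omega_closed bO])
  ultimately have "?O \<noteq> {x \<in> ?O. \<not> dense_at ?O x}" by metis
  then obtain x where x: "x \<in> ?O" "dense_at ?O x" by blast
  have cO: "compact ?O" using omega_closed bO by (simp add: compact_eq_bounded_closed)
  have neO: "?O \<noteq> {}" using x(1) by blast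
  obtain l where l: "l \<in> ?O" "\<And>t. t \<in> ?O \<Longrightarrow> l \<le> t" using compact_attains_inf[OF cO neO] by blast
  obtain h where h: "h \<in> ?O" "\<And>t. t \<in> ?O \<Longrightarrow> t \<le> h" using compact_attains_sup[OF cO neO] by blast
  define d' where "d' = min d (min l (1 - h))"
  have lh: "0 < l" "h < 1" using l(1) h(1) O1 by auto
  have d': "d' > 0" "d' \<le> d" "d' \<le> l" "d' \<le> 1 - h" unfolding d'_def using d lh by auto
  have ax: "apart d x" by (rule omega_apart[OF ay d x(1)])
  have w': "wild d' x" unfolding wild_def
  proof (intro conjI allI impI)
    show "apart d' x" by (rule apart_mono[OF ax d'(2)])
    show "(f ^^ i) x \<noteq> (f ^^ j) x" if "i < j" for i j
    proof
      assume e: "(f ^^ i) x = (f ^^ j) x"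
      have "(f ^^ (j - i)) ((f ^^ i) x) = (f ^^ (i + (j - i))) x" by (rule it_after[symmetric])
      then have "(f ^^ (j - i)) ((f ^^ i) x) = (f ^^ i) x" using that e by simp
      then show False using nop[OF inv[OF x(1)], of "j - i" i] that by simp
    qed
    show "(f ^^ n) x \<notin> closure J" if "homterval J" for n J by (rule omega_not_closure_homterval[OF w nop inv[OF x(1)] that])
    show "f 0 \<in> {0,1}" if n: "\<exists>n. (f ^^ n) x < d'"
    proof -
      obtain n where "(f ^^ n) x < d'" using n by blast
      then show ?thesis using l(2)[OF inv[OF x(1), of n]] d'(3) by linarith
    qed
    show "f 1 \<in> {0,1}" if n: "\<exists>n. (f ^^ n) x > 1 - d'"
    proof -
      obtain n where "(f ^^ n) x > 1 - d'" using n by blast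
      then show ?thesis using h(2)[OF inv[OF x(1), of n]] d'(4) by linarith
    qed
  qed (use d' x O1 in auto)
  have oc: "orbit_closure x = ?O"
    by (rule orbit_closure_eq_omega[OF ay d x(1)]) (rule dense_omega_minimal[OF w K _ x(1)])
  have "absorbing ?O" unfolding absorbing_def
  proof (intro conjI ballI allI impI)
    show "closed ?O" by (rule omega_closed)
    show "f t \<in> ?O" if "t \<in> ?O \<inter> {0<..<1}" for t using inv[of t 1] that by simp
    show "\<not> J \<subseteq> ?O" if J: "openiv J" for J
    proof
      assume JO: "J \<subseteq> ?O"
      have "homterval J" unfolding homterval_def
      proof (intro conjI allI J freeI)
        fix n t and i :: nat assume "t \<in> J"
        then show "(f ^^ i) t \<notin> C" using apart_notC[OF omega_apart[OF ay d] d] JO by blast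
      qed
      moreover obtain t where "t \<in> J" using openiv_ne[OF J] by blast
      ultimately show False using omega_not_closure_homterval[OF w nop, of t J] JO closure_subset by blast
    qed
  qed
  then show False using dense_minimal_impossible[OF w'] x(2) unfolding oc by blast
qed

lemma small_neighborhood:
  assumes t: "t \<in> {0<..<1}" "t \<notin> C" and S: "open S" "f t \<in> S" and e: "e > 0"
  shows "\<exists>U. openiv U \<and> t \<in> U \<and> U \<subseteq> {t - e<..<t + e} \<and> U \<inter> C = {} \<and> f ` U \<subseteq> S"
proof -
  have "isCont (f ^^ 1) t" by (rule it_cont[OF t(1)]) (use t(2) in simp)
  then have "isCont f t" by simp
  then have "\<forall>\<^sub>F s in at t. f s \<in> S" using S unfolding isCont_def tendsto_def by blast
  then obtain \<delta>1 where \<delta>1: "\<delta>1 > 0" "\<And>s. s \<noteq> t \<Longrightarrow> dist s t < \<delta>1 \<Longrightarrow> f s \<in> S" unfolding eventually_at by blast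
  have "open (- C)" using finite_imp_closed[OF finC] by (simp add: open_Compl)
  then obtain \<delta>2 where \<delta>2: "\<delta>2 > 0" "ball t \<delta>2 \<subseteq> - C" using t(2) unfolding open_contains_ball by blast
  define \<delta> where "\<delta> = min e (min \<delta>1 \<delta>2)"
  have \<delta>: "\<delta> > 0" "\<delta> \<le> e" "\<delta> \<le> \<delta>1" "\<delta> \<le> \<delta>2" unfolding \<delta>_def using e \<delta>1(1) \<delta>2(1) by auto
  define U where "U = {max 0 (t - \<delta>)<..<min 1 (t + \<delta>)}"
  have Ub: "\<bar>s - t\<bar> < \<delta>" if "s \<in> U" for s using that unfolding U_def by auto
  show ?thesis
  proof (intro exI[of _ U] conjI)
    show "openiv U" unfolding openiv_def U_def
      by (intro exI[of _ "max 0 (t - \<delta>)"] exI[of _ "min 1 (t + \<delta>)"]) (use t \<delta>(1) in auto)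
    show "t \<in> U" unfolding U_def using t \<delta>(1) by auto
    show "U \<subseteq> {t - e<..<t + e}" unfolding U_def using \<delta>(2) by auto
    show "U \<inter> C = {}"
    proof -
      have "s \<notin> C" if "s \<in> U" for s
      proof -
        have "s \<in> ball t \<delta>2" using Ub[OF that] \<delta>(4) by (simp add: dist_real_def abs_minus_commute)
        then show ?thesis using \<delta>2(2) by blast
      qed
      then show ?thesis by blast
    qed
    show "f ` U \<subseteq> S"
    proof
      fix y assume "y \<in> f ` U"
      then obtain s where s: "s \<in> U" "y = f s" by blast
      have "dist s t < \<delta>1" using Ub[OF s(1)] \<delta>(3) by (simp add: dist_real_def)
      then show "y \<in> S" using s(2) \<delta>1(2)[of s] S(2) by (cases "s = t") auto
    qed
  qed
qed

lemma homterval_of_image: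
  assumes U: "openiv U" "U \<inter> C = {}" and J: "homterval J" "f ` U \<subseteq> J"
  shows "homterval U"
  unfolding homterval_def
proof (intro conjI allI U(1) freeI)
  fix n t and i :: nat assume t: "t \<in> U"
  show "(f ^^ i) t \<notin> C"
  proof (cases i)
    case 0 then show ?thesis using t U(2) by auto
  next
    case (Suc i')
    have "f t \<in> J" using t J(2) by blast
    then have "(f ^^ i') (f t) \<notin> C" using freeD[OF homterval_free[OF J(1), of "Suc i'"], of "f t" i'] by simp
    then show ?thesis unfolding Suc it_Suc .
  qed
qed

lemma homterval_preimage:
  assumes t: "t \<in> {0<..<1}" "t \<notin> C" and J: "homterval J" "f t \<in> J"
  shows "\<exists>U. homterval U \<and> t \<in> U"
proof -
  obtain U where "openiv U" "t \<in> U" "U \<inter> C = {}" "f ` U \<subseteq> J"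
    using small_neighborhood[OF t openiv_open[OF homterval_openiv[OF J(1)]] J(2), of 1] by auto
  then show ?thesis using homterval_of_image J(1) by blast
qed

text \<open>
  Near \<open>t\<close> the map is a homeomorphism onto a neighbourhood of \<open>f t\<close>, so the preimages of \<open>J\<close> near
  \<open>t\<close> form a homterval adjacent to \<open>t\<close>.
\<close>

lemma closure_homterval_preimage:
  assumes t: "t \<in> {0<..<1}" "t \<notin> C" and J: "homterval J" "f t \<in> closure J"
  shows "\<exists>A. homterval A \<and> t \<in> closure A"
proof -
  have meet: "f ` U \<inter> J \<noteq> {}" if U: "openiv U" "t \<in> U" "U \<inter> C = {}" for U
  proof -
    have "free 1 U" unfolding free_def using U(3) by simp
    then have "openiv ((f ^^ 1) ` U)" by (rule free_image[OF U(1)])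
    then have o: "open (f ` U)" using openiv_open by simp
    show ?thesis using open_Int_closure_eq_empty[OF o, of J] J(2) U(2) by blast
  qed
  obtain U where U: "openiv U" "t \<in> U" "U \<inter> C = {}" using small_neighborhood[OF t open_UNIV, of 1] by auto
  have fU: "free 1 U" unfolding free_def using U(3) by simp
  define A where "A = {s\<in>U. (f ^^ 1) s \<in> J}"
  have "(f ^^ 1) ` U \<inter> J \<noteq> {}" using meet[OF U] by simp
  then have Ao: "openiv A" unfolding A_def by (rule openiv_pre[OF U(1) fU homterval_openiv[OF J(1)]])
  have "homterval A" by (rule homterval_of_image[OF Ao _ J(1)]) (use U(3) in \<open>auto simp: A_def\<close>)
  moreover have "t \<in> closure A" unfolding closure_approachable
  proof (intro allI impI)
    fix e :: real assume e: "e > 0"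
    obtain e' where e': "e' > 0" "ball t e' \<subseteq> U" using openiv_open[OF U(1)] U(2) unfolding open_contains_ball by blast
    have m: "min e e' > 0" using e e'(1) by simp
    obtain U' where U': "openiv U'" "t \<in> U'" "U' \<subseteq> {t - min e e'<..<t + min e e'}" "U' \<inter> C = {}"
      using small_neighborhood[OF t open_UNIV _ m] by auto
    obtain s where s: "s \<in> U'" "f s \<in> J" using meet[OF U'(1,2,4)] by blast
    have st: "t - min e e' < s" "s < t + min e e'" using s(1) U'(3) by auto
    then have "dist s t < e" "s \<in> ball t e'" by (auto simp: dist_real_def)
    then show "\<exists>y\<in>A. dist y t < e" using s(2) e'(2) unfolding A_def by auto
  qed
  ultimately show ?thesis by blast
qed

lemma closure_homterval_preimage_iter:
  assumes "y \<in> {0<..<1}" "\<And>i. (f ^^ i) y \<notin> C" "homterval J" "(f ^^ n) y \<in> closure J"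
  shows "\<exists>A. homterval A \<and> y \<in> closure A"
  using assms
proof (induction n arbitrary: y)
  case 0 then show ?case by auto
next
  case (Suc n)
  have yC: "y \<notin> C" using Suc.prems(2)[of 0] by simp
  have nC: "(f ^^ i) (f y) \<notin> C" for i using Suc.prems(2)[of "Suc i"] unfolding it_Suc .
  have "(f ^^ n) (f y) \<in> closure J" using Suc.prems(4) unfolding it_Suc .
  then obtain A where "homterval A" "f y \<in> closure A"
    using Suc.IH[OF interior_step[OF Suc.prems(1) yC] nC Suc.prems(3)] by blast
  then show ?case using closure_homterval_preimage[OF Suc.prems(1) yC] by blast
qed

lemma segment_image:
  assumes U: "openiv U" "free n U" and s: "s \<in> U" "t \<in> U" "s < t"
  shows "openiv {s<..<t}" "(f ^^ n) ` {s<..<t} = {min ((f ^^ n) s) ((f ^^ n) t)<..<max ((f ^^ n) s) ((f ^^ n) t)}"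
proof -
  let ?J = "{s<..<t}"
  have st: "s \<in> {0<..<1}" "t \<in> {0<..<1}" using openiv_sub[OF U(1)] s by blast+
  show J: "openiv ?J" unfolding openiv_def by (intro exI[of _ s] exI[of _ t]) (use st s in auto)
  have JU: "?J \<subseteq> U" using openiv_mid[OF U(1) s(1,2)] by auto
  have fJ: "free n ?J" by (rule free_mono[OF U(2) JU])
  obtain a b where ab: "a < b" "(f ^^ n) ` ?J = {a<..<b}" using openiv_form[OF free_image[OF J fJ]] by blast
  have "(f ^^ n) s \<in> closure ((f ^^ n) ` ?J) - (f ^^ n) ` ?J"
    by (rule endpoint_image[OF J fJ]) (use s freeD[OF U(2) s(1)] in auto)
  moreover have "(f ^^ n) t \<in> closure ((f ^^ n) ` ?J) - (f ^^ n) ` ?J"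
    by (rule endpoint_image[OF J fJ]) (use s freeD[OF U(2) s(2)] in auto)
  moreover have "(f ^^ n) s \<noteq> (f ^^ n) t" using inj_onD[OF free_inj[OF U] _ s(1,2)] s(3) by auto
  ultimately have "((f ^^ n) s = a \<and> (f ^^ n) t = b) \<or> ((f ^^ n) s = b \<and> (f ^^ n) t = a)" unfolding ab(2) using ab(1) by auto
  then show "(f ^^ n) ` ?J = {min ((f ^^ n) s) ((f ^^ n) t)<..<max ((f ^^ n) s) ((f ^^ n) t)}"
    unfolding ab(2) using ab(1) by auto
qed

text \<open>
  The images of the segment under \<open>f\<^sup>i\<close> and \<open>f\<^sup>j\<close> have the same end points and hence coincide.
  So all later images recur among the first \<open>j\<close> ones, which avoid \<open>C\<close>.
\<close>

lemma preperiodic_segment_hom: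
  assumes U: "openiv U" "free j U" and s: "s \<in> U" "t \<in> U" "s < t" and ij: "i < j"
    and e: "(f ^^ i) s = (f ^^ j) s" "(f ^^ i) t = (f ^^ j) t"
  shows "homterval {s<..<t}"
proof -
  let ?J = "{s<..<t}"
  have fi: "free i U" by (rule free_le[OF U(2)]) (use ij in simp)
  have JU: "?J \<subseteq> U" using openiv_mid[OF U(1) s(1,2)] by auto
  have eq: "(f ^^ j) ` ?J = (f ^^ i) ` ?J"
    unfolding segment_image(2)[OF U s] segment_image(2)[OF U(1) fi s] e ..
  have "\<exists>m<j. (f ^^ k) ` ?J = (f ^^ m) ` ?J" for k
  proof (induction k rule: less_induct)
    case (less k)
    show ?case
    proof (cases "k < j")
      case False
      have sp: "(f ^^ (a + b)) ` ?J = (f ^^ b) ` ((f ^^ a) ` ?J)" for a b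
        unfolding add.commute[of a b] funpow_add image_comp ..
      have "(f ^^ k) ` ?J = (f ^^ (j + (k - j))) ` ?J" using False by simp
      also have "\<dots> = (f ^^ (i + (k - j))) ` ?J" unfolding sp eq ..
      finally have "(f ^^ k) ` ?J = (f ^^ (i + (k - j))) ` ?J" .
      moreover have "i + (k - j) < k" using False ij by simp
      ultimately show ?thesis using less.IH by metis
    qed blast
  qed
  then have "(f ^^ k) ` ?J \<inter> C = {}" for k using free_mono[OF U(2) JU] unfolding free_def by metis
  then show ?thesis unfolding homterval_def free_def using segment_image(1)[OF U s] by blast
qed

lemma countable_preperiodic:
  assumes ij: "i < j"
  shows "countable {y\<in>{0<..<1}. (\<forall>n. (f ^^ n) y \<notin> C) \<and> (\<forall>J. homterval J \<longrightarrow> y \<notin> closure J) \<and> (f ^^ i) y = (f ^^ j) y}"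
    (is "countable ?P")
proof (rule countable_of_isolated)
  fix y assume y: "y \<in> ?P"
  then have y1: "y \<in> {0<..<1}" and yC: "\<And>n. (f ^^ n) y \<notin> C" and yh: "\<And>J. homterval J \<Longrightarrow> y \<notin> closure J"
    and ye: "(f ^^ i) y = (f ^^ j) y" by auto
  have y01: "y \<in> {0..1}" using y1 by auto
  obtain e where e: "e > 0" "\<And>t m. t \<in> {0..1} \<Longrightarrow> \<bar>t - y\<bar> < e \<Longrightarrow> m < j \<Longrightarrow> (f ^^ m) t \<notin> C"
    using hits_C_neighborhood[OF y01, of j] yC by blast
  define U where "U = {max 0 (y - e)<..<min 1 (y + e)}"
  have U: "openiv U" unfolding openiv_def U_def
    by (intro exI[of _ "max 0 (y - e)"] exI[of _ "min 1 (y + e)"]) (use y1 e(1) in auto)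
  have fU: "free j U"
  proof (rule freeI)
    fix t m assume t: "t \<in> U" and m: "m < j"
    show "(f ^^ m) t \<notin> C" by (rule e(2)[OF _ _ m]) (use t in \<open>auto simp: U_def\<close>)
  qed
  show "\<exists>e>0. \<forall>s\<in>?P. \<bar>s - y\<bar> < e \<longrightarrow> s = y"
  proof (intro exI[of _ e] conjI ballI impI e(1), rule ccontr)
    fix s assume s: "s \<in> ?P" "\<bar>s - y\<bar> < e" "s \<noteq> y"
    have se: "(f ^^ i) s = (f ^^ j) s" using s(1) by simp
    have sU: "s \<in> U" and yU: "y \<in> U" unfolding U_def using s(1,2) y1 e(1) by auto
    consider "s < y" | "y < s" using s(3) by linarith
    then show False
    proof cases
      case 1
      have "homterval {s<..<y}" by (rule preperiodic_segment_hom[OF U fU sU yU 1 ij se ye])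
      moreover have "y \<in> closure {s<..<y}" using 1 by simp
      ultimately show False using yh by blast
    next
      case 2
      have "homterval {y<..<s}" by (rule preperiodic_segment_hom[OF U fU yU sU 2 ij ye se])
      moreover have "y \<in> closure {y<..<s}" using 2 by simp
      ultimately show False using yh by blast
    qed
  qed
qed

lemma omega_preimage:
  assumes y: "apart d y" "d > 0" and z: "z \<in> omega_limit f y"
  shows "\<exists>u\<in>omega_limit f y. f u = z"
proof -
  obtain r :: "nat \<Rightarrow> nat" where r: "strict_mono r" "(\<lambda>n. (f ^^ r n) y) \<longlonglongrightarrow> z" using z unfolding omega_limit_def by blast
  define g where "g = (\<lambda>n. (f ^^ (r (Suc n) - 1)) y)"
  have r1: "Suc (r (Suc n) - 1) = r (Suc n)" for n using seq_suble[OF r(1), of "Suc n"] by simp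
  have "compact {0..1::real}" by simp
  then have "seq_compact {0..1::real}" by (rule compact_imp_seq_compact)
  moreover have "\<forall>n. g n \<in> {0..1}" unfolding g_def using it_range[OF apart01[OF y(1)]] ..
  ultimately obtain u t where t: "strict_mono t" "(g \<circ> t) \<longlonglongrightarrow> u" by (rule seq_compactE)
  have uo: "u \<in> omega_limit f y" unfolding omega_limit_def
  proof (intro CollectI exI[of _ "\<lambda>n. r (Suc (t n)) - 1"] conjI)
    show "strict_mono (\<lambda>n. r (Suc (t n)) - 1)"
    proof (rule strict_monoI)
      fix m n :: nat assume "m < n"
      then have "r (Suc (t m)) < r (Suc (t n))" using strict_monoD[OF r(1)] strict_monoD[OF t(1)] by simp
      then show "r (Suc (t m)) - 1 < r (Suc (t n)) - 1" using r1[of "t m"] by linarith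
    qed
    show "(\<lambda>n. (f ^^ (r (Suc (t n)) - 1)) y) \<longlonglongrightarrow> u" using t(2) unfolding g_def comp_def .
  qed
  have "(\<lambda>n. (f ^^ 1) ((g \<circ> t) n)) \<longlonglongrightarrow> (f ^^ 1) u"
    by (rule apart_tendsto(2)[OF _ t(2) y(2)]) (simp add: g_def apart_it[OF y(1)])
  moreover have "(f ^^ 1) ((g \<circ> t) n) = (f ^^ r (Suc (t n))) y" for n
  proof -
    have "(f ^^ 1) ((g \<circ> t) n) = (f ^^ (Suc (r (Suc (t n)) - 1))) y" by (simp add: g_def)
    then show ?thesis unfolding r1[of "t n"] .
  qed
  ultimately have l1: "(\<lambda>n. (f ^^ r (Suc (t n))) y) \<longlonglongrightarrow> f u" by simp
  have "(\<lambda>n. (f ^^ r (Suc n)) y) \<longlonglongrightarrow> z" by (rule LIMSEQ_Suc[OF r(2)])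
  from LIMSEQ_subseq_LIMSEQ[OF this t(1)]
  have "(\<lambda>n. (f ^^ r (Suc (t n))) y) \<longlonglongrightarrow> z" unfolding comp_def .
  then have "f u = z" by (rule LIMSEQ_unique[OF l1])
  then show ?thesis using uo by blast
qed

text \<open>
  An interior point is never mapped to \<open>0\<close> or \<open>1\<close>, so within the \<open>\<omega>\<close>-limit set the preimages of
  these points are \<open>0\<close> and \<open>1\<close> themselves.
\<close>

lemma omega_end:
  assumes y: "apart d y" "d > 0" and e: "e \<in> {0,1}" "e \<in> omega_limit f y"
  shows "f e \<in> {0,1}"
proof -
  have pre: "\<exists>u\<in>omega_limit f y. u \<in> {0,1} \<and> f u = e'" if e': "e' \<in> {0,1}" "e' \<in> omega_limit f y" for e'
  proof -
    obtain u where u: "u \<in> omega_limit f y" "f u = e'" using omega_preimage[OF y e'(2)] by blast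
    have au: "apart d u" by (rule omega_apart[OF y u(1)])
    have "u \<notin> C" using apart_notC[OF au y(2), of 0] by simp
    then have "u \<notin> {0<..<1}" using interior_step[of u] u(2) e'(1) by auto
    then have "u \<in> {0,1}" using apart01[OF au] by auto
    then show ?thesis using u by blast
  qed
  obtain u where u: "u \<in> omega_limit f y" "u \<in> {0,1}" "f u = e" using pre[OF e] by blast
  show ?thesis
  proof (cases "u = e")
    case True then show ?thesis using u(3) e(1) by simp
  next
    case False
    obtain u' where u': "u' \<in> {0,1}" "f u' = u" using pre[OF u(2,1)] by blast
    have "u' = e" using u' u(2,3) e(1) False by auto
    then show ?thesis using u'(2) u(2) by simp
  qed
qed

lemma orbit_near_end:
  assumes y: "apart d y" "d > 0" "y \<in> {0<..<1}" and e: "e \<in> {0,1}"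
  shows "\<exists>\<delta>>0. (\<exists>n. \<bar>(f ^^ n) y - e\<bar> < \<delta>) \<longrightarrow> f e \<in> {0,1}"
proof (cases "e \<in> omega_limit f y")
  case True
  then show ?thesis using omega_end[OF y(1,2) e] by (intro exI[of _ 1]) simp
next
  case False
  have int: "(f ^^ n) y \<in> {0<..<1}" for n by (rule it_interior[OF y(3)]) (rule apart_notC[OF y(1,2)])
  have "e \<notin> range (\<lambda>n. (f ^^ n) y)"
  proof
    assume "e \<in> range (\<lambda>n. (f ^^ n) y)"
    then obtain n where "e = (f ^^ n) y" by blast
    then show False using int[of n] e by auto
  qed
  then have "e \<notin> orbit_closure y" using False orbit_closure_sub_omega by blast
  then obtain \<delta> where "\<delta> > 0" "\<And>n. \<not> dist ((f ^^ n) y) e < \<delta>" unfolding orbit_closure_def closure_approachable by blast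
  then show ?thesis unfolding dist_real_def by blast
qed

text \<open>
  The constant \<open>d\<close> has to be decreased to satisfy the conditions at the boundary.
\<close>

lemma wildI:
  assumes y: "apart d y" "d > 0" "y \<in> {0<..<1}" and dis: "\<And>i j. i < j \<Longrightarrow> (f ^^ i) y \<noteq> (f ^^ j) y"
    and nh: "\<And>J. homterval J \<Longrightarrow> y \<notin> closure J"
  shows "\<exists>d'>0. d' \<le> d \<and> wild d' y"
proof -
  obtain d0 where d0: "d0 > 0" "(\<exists>n. \<bar>(f ^^ n) y - 0\<bar> < d0) \<longrightarrow> f 0 \<in> {0,1}" using orbit_near_end[OF y, of 0] by blast
  obtain d1 where d1: "d1 > 0" "(\<exists>n. \<bar>(f ^^ n) y - 1\<bar> < d1) \<longrightarrow> f 1 \<in> {0,1}" using orbit_near_end[OF y, of 1] by blast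
  have int: "(f ^^ n) y \<in> {0<..<1}" for n by (rule it_interior[OF y(3)]) (rule apart_notC[OF y(1,2)])
  define d' where "d' = min d (min d0 d1)"
  have d': "d' > 0" "d' \<le> d" "d' \<le> d0" "d' \<le> d1" unfolding d'_def using y(2) d0(1) d1(1) by auto
  have "wild d' y" unfolding wild_def
  proof (intro conjI allI impI)
    show "apart d' y" by (rule apart_mono[OF y(1) d'(2)])
    show "(f ^^ n) y \<notin> closure J" if "homterval J" for n J
      using closure_homterval_preimage_iter[OF y(3) apart_notC[OF y(1,2)] that] nh by blast
    show "f 0 \<in> {0,1}" if n: "\<exists>n. (f ^^ n) y < d'"
    proof -
      obtain n where "(f ^^ n) y < d'" using n by blast
      then have "\<bar>(f ^^ n) y - 0\<bar> < d0" using int[of n] d'(3) by auto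
      then show ?thesis using d0(2) by blast
    qed
    show "f 1 \<in> {0,1}" if n: "\<exists>n. (f ^^ n) y > 1 - d'"
    proof -
      obtain n where "(f ^^ n) y > 1 - d'" using n by blast
      then have "\<bar>(f ^^ n) y - 1\<bar> < d1" using int[of n] d'(4) by auto
      then show ?thesis using d1(2) by blast
    qed
  qed (use d'(1) y(3) dis in auto)
  then show ?thesis using d' by blast
qed

text \<open>
  Points in no homterval whose orbit stays \<open>d\<close>-apart from \<open>C\<close>. Only the open homtervals are
  removed, not their closures, so that this is a closed set.
\<close>

definition unsettled :: "real \<Rightarrow> real set" where
  "unsettled d = {t. apart d t \<and> (\<forall>J. homterval J \<longrightarrow> t \<notin> J)}"

lemma unsettled_closed: "d > 0 \<Longrightarrow> closed (unsettled d)"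
  unfolding closed_sequential_limits
proof (intro allI impI)
  fix s p assume d: "d > 0" and s: "(\<forall>n. s n \<in> unsettled d) \<and> s \<longlonglongrightarrow> p"
  have "apart d (s n)" for n using s unfolding unsettled_def by blast
  then have "apart d p" using apart_tendsto(1)[of d s p] s d by blast
  moreover have "p \<notin> J" if J: "homterval J" for J
  proof
    assume "p \<in> J"
    then have "\<forall>\<^sub>F n in sequentially. s n \<in> J" using topological_tendstoD[OF conjunct2[OF s] openiv_open[OF homterval_openiv[OF J]]] by blast
    then show False using s J unfolding unsettled_def eventually_sequentially by blast
  qed
  ultimately show "p \<in> unsettled d" unfolding unsettled_def by blast
qed

lemma unsettled_absorbing: assumes d: "d > 0" shows "absorbing (unsettled d)"
  unfolding absorbing_def
proof (intro conjI ballI allI impI unsettled_closed d)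
  fix t assume t: "t \<in> unsettled d \<inter> {0<..<1}"
  then have a: "apart d t" and nh: "\<And>J. homterval J \<Longrightarrow> t \<notin> J" and t1: "t \<in> {0<..<1}" unfolding unsettled_def by auto
  have "t \<notin> C" using apart_notC[OF a d, of 0] by simp
  then have "f t \<notin> J" if "homterval J" for J using homterval_preimage[OF t1 _ that] nh by blast
  moreover have "apart d (f t)" using apart_it[OF a, of 1] by simp
  ultimately show "f t \<in> unsettled d" unfolding unsettled_def by blast
next
  fix J assume J: "openiv J"
  show "\<not> J \<subseteq> unsettled d"
  proof
    assume JU: "J \<subseteq> unsettled d"
    have "homterval J" unfolding homterval_def
    proof (intro conjI allI J freeI)
      fix n t and i :: nat assume "t \<in> J"
      then have "apart d t" using JU unfolding unsettled_def by blast
      then show "(f ^^ i) t \<notin> C" by (rule apart_notC[OF _ d])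
    qed
    moreover obtain t where "t \<in> J" using openiv_ne[OF J] by blast
    ultimately show False using JU unfolding unsettled_def by blast
  qed
qed

text \<open>
  A gap adjacent to \<open>y\<close> fills half of the short symmetric intervals around \<open>y\<close>.
\<close>

lemma dense_not_closure_gap:
  assumes K: "closed K" "dense_at K y" and J: "openiv J" "K \<inter> J = {}"
  shows "y \<notin> closure J"
proof
  assume yJ: "y \<in> closure J"
  obtain a b where ab: "a < b" "J = {a<..<b}" using openiv_form[OF J(1)] by blast
  obtain \<eta> where \<eta>: "\<eta> > 0" "\<And>u v. u < y \<Longrightarrow> y < v \<Longrightarrow> v - u < \<eta> \<Longrightarrow> len ({u<..<v} - K) \<le> 1/4 * (v - u)"
    using K(2) unfolding dense_at_def by (metis zero_less_divide_1_iff zero_less_numeral)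
  define h where "h = min (\<eta>/3) ((b - a)/2)"
  have h: "h > 0" "2 * h < \<eta>" "2 * h \<le> b - a"
  proof -
    show "h > 0" unfolding h_def using \<eta>(1) ab(1) by simp
    have h3: "h \<le> \<eta>/3" "h \<le> (b - a)/2" unfolding h_def by (rule min.cobounded1, rule min.cobounded2)
    show "2 * h < \<eta>" using h3(1) \<eta>(1) by linarith
    show "2 * h \<le> b - a" using h3(2) by (simp add: le_divide_eq_numeral1 mult.commute)
  qed
  have le: "len ({y - h<..<y + h} - K) \<le> 1/4 * (2 * h)" using \<eta>(2)[of "y - h" "y + h"] h by simp
  have yab: "a \<le> y" "y \<le> b" using yJ ab by auto
  have m: "{y - h<..<y + h} - K \<in> lmeasurable"
    by (intro lmeasurable_open open_Diff K(1) open_greaterThanLessThan bounded_subset[OF bounded_box[of "y - h" "y + h"]]) (auto simp: box_real)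
  define u where "u = (if y + h \<le> b then y else y - h)"
  have ub: "a \<le> u" "u + h \<le> b" "y - h \<le> u" "u \<le> y" unfolding u_def using yab h by auto
  have u: "{u<..<u + h} \<subseteq> J" "{u<..<u + h} \<subseteq> {y - h<..<y + h}" unfolding ab(2) using ub by auto
  have "{u<..<u + h} \<subseteq> {y - h<..<y + h} - K" using u J(2) by blast
  then have "len {u<..<u + h} \<le> len ({y - h<..<y + h} - K)"
    by (rule measure_mono_fmeasurable[OF _ _ m]) simp
  moreover have "len {u<..<u + h} = h" using h(1) by simp
  ultimately show False using le h(1) by linarith
qed

text \<open>
  A density point of this set is not in the closure of a homterval. If it is neither \<open>0\<close> nor \<open>1\<close>
  nor one of the countably many preperiodic points, it is wild.
\<close>

theorem unsettled_negligible:
  assumes d: "d > 0" shows "negligible (unsettled d)"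
proof -
  let ?K = "unsettled d"
  define P where "P = (\<lambda>i j. {y\<in>{0<..<1}. (\<forall>n. (f ^^ n) y \<notin> C) \<and> (\<forall>J. homterval J \<longrightarrow> y \<notin> closure J) \<and> (f ^^ i) y = (f ^^ j) y})"
  have K: "absorbing ?K" by (rule unsettled_absorbing[OF d])
  have cK: "closed ?K" by (rule unsettled_closed[OF d])
  have K01: "?K \<subseteq> {0..1}" unfolding unsettled_def using apart01 by blast
  have bK: "bounded ?K" by (rule bounded_subset[OF _ K01]) simp
  have "{y\<in>?K. dense_at ?K y} \<subseteq> {0,1} \<union> (\<Union>j. \<Union>i<j. P i j)"
  proof
    fix y assume "y \<in> {y\<in>?K. dense_at ?K y}"
    then have yK: "y \<in> ?K" and de: "dense_at ?K y" by auto
    have ay: "apart d y" using yK unfolding unsettled_def by blast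
    have yC: "(f ^^ n) y \<notin> C" for n by (rule apart_notC[OF ay d])
    have nh: "y \<notin> closure J" if J: "homterval J" for J
      by (rule dense_not_closure_gap[OF cK de homterval_openiv[OF J]]) (use J in \<open>auto simp: unsettled_def\<close>)
    show "y \<in> {0,1} \<union> (\<Union>j. \<Union>i<j. P i j)"
    proof (rule ccontr)
      assume no: "\<not> ?thesis"
      have y1: "y \<in> {0<..<1}" using no apart01[OF ay] by auto
      have dis: "(f ^^ i) y \<noteq> (f ^^ j) y" if ij: "i < j" for i j
      proof
        assume "(f ^^ i) y = (f ^^ j) y"
        then have "y \<in> P i j" unfolding P_def using y1 yC nh by blast
        then show False using no ij by blast
      qed
      obtain d' where "wild d' y" using wildI[OF ay d y1 dis nh] by blast
      then show False by (rule dense_wild_impossible[OF _ K de])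
    qed
  qed
  moreover have "countable ({0,1} \<union> (\<Union>j. \<Union>i<j. P i j))"
  proof (intro countable_Un countable_UN)
    fix i j :: nat assume "i \<in> {..<j}"
    then show "countable (P i j)" unfolding P_def by (intro countable_preperiodic) simp
  qed auto
  ultimately have "negligible {y\<in>?K. dense_at ?K y}" using negligible_of_countable countable_subset by blast
  moreover have "negligible {y\<in>?K. \<not> dense_at ?K y}" by (rule negligible_not_dense_at[OF cK bK])
  moreover have "?K = {y\<in>?K. dense_at ?K y} \<union> {y\<in>?K. \<not> dense_at ?K y}" by blast
  ultimately show ?thesis by (metis negligible_Un)
qed

section \<open>Exceptional orbits\<close>

text \<open>
  Points of a fibre off \<open>C\<close> are isolated in it, because the derivative does not vanish.
\<close>

lemma countable_fiber: "countable {x\<in>{0..1}. f x = s}"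
proof -
  have "countable {x\<in>{0..1} - C. f x = s}"
  proof (rule countable_of_isolated)
    fix y assume y: "y \<in> {x\<in>{0..1} - C. f x = s}"
    then have yM: "y \<in> {0..1} - C" by simp
    have "((\<lambda>t. (f t - f y) / (t - y)) \<longlongrightarrow> f' y) (at y within {0..1})"
      using deriv[OF yM] unfolding has_field_derivative_iff .
    then have "\<forall>\<^sub>F t in at y within {0..1}. (f t - f y) / (t - y) \<noteq> 0"
      by (rule tendsto_imp_eventually_ne) (rule nz[OF yM])
    then obtain e where e: "e > 0" "\<And>t. t \<in> {0..1} \<Longrightarrow> t \<noteq> y \<Longrightarrow> dist t y < e \<Longrightarrow> (f t - f y) / (t - y) \<noteq> 0"
      unfolding eventually_at by blast
    show "\<exists>e>0. \<forall>t\<in>{x\<in>{0..1} - C. f x = s}. \<bar>t - y\<bar> < e \<longrightarrow> t = y"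
    proof (intro exI[of _ e] conjI ballI impI e(1), rule ccontr)
      fix t assume t: "t \<in> {x\<in>{0..1} - C. f x = s}" "\<bar>t - y\<bar> < e" "t \<noteq> y"
      then have "(f t - f y) / (t - y) \<noteq> 0" by (intro e(2)) (auto simp: dist_real_def)
      then show False using t(1) y by simp
    qed
  qed
  moreover have "countable C" using finC by (rule countable_finite)
  moreover have "{x\<in>{0..1}. f x = s} \<subseteq> {x\<in>{0..1} - C. f x = s} \<union> C" by blast
  ultimately show ?thesis using countable_subset countable_Un by metis
qed

lemma countable_backward_orbit:
  assumes "countable S" shows "countable (backward_orbit f S)"
proof -
  have "countable {x\<in>{0..1}. (f ^^ j) x \<in> S}" for j
  proof (induction j)
    case 0 show ?case by (rule countable_subset[OF _ assms]) auto
  next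
    case (Suc j)
    have "{x\<in>{0..1}. (f ^^ Suc j) x \<in> S} \<subseteq> (\<Union>s\<in>{x\<in>{0..1}. (f ^^ j) x \<in> S}. {x\<in>{0..1}. f x = s})"
    proof
      fix x assume x: "x \<in> {x\<in>{0..1}. (f ^^ Suc j) x \<in> S}"
      then have "x \<in> {0..1}" "(f ^^ j) (f x) \<in> S" unfolding mem_Collect_eq it_Suc by simp_all
      moreover then have "f x \<in> {0..1}" by (intro maps)
      ultimately show "x \<in> (\<Union>s\<in>{x\<in>{0..1}. (f ^^ j) x \<in> S}. {x\<in>{0..1}. f x = s})" by blast
    qed
    then show ?case by (rule countable_subset) (intro countable_UN Suc.IH countable_fiber)
  qed
  then show ?thesis unfolding backward_orbit_def by (intro countable_UN) auto
qed

lemma orbit_closure_apart: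
  assumes x: "x \<in> {0..1}" and dis: "orbit_closure x \<inter> C = {}"
  shows "\<exists>d>0. apart d x"
proof -
  have cl: "closed (orbit_closure x)" unfolding orbit_closure_def by (rule closed_closure)
  have "C \<inter> orbit_closure x = {}" using dis by (simp add: Int_commute)
  from separate_compact_closed[OF finite_imp_compact[OF finC] cl this]
  obtain d where d: "d > 0" "\<forall>c\<in>C. \<forall>t\<in>orbit_closure x. d \<le> dist c t" by (elim exE conjE)
  have "apart d x" unfolding apart_def
  proof (intro conjI allI ballI x)
    fix n c assume c: "c \<in> C"
    have "(f ^^ n) x \<in> orbit_closure x" unfolding orbit_closure_def by (rule subsetD[OF closure_subset rangeI])
    then have "d \<le> dist c ((f ^^ n) x)" by (rule d(2)[rule_format, OF c])
    then show "d \<le> \<bar>(f ^^ n) x - c\<bar>" by (simp add: dist_real_def abs_minus_commute)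
  qed
  then show ?thesis using d(1) by blast
qed

lemma D_iter_eq:
  assumes fD: "x \<in> {0..1}" "\<And>i. (f ^^ i) x \<notin> C"
  shows "D_iter f n x = Dn n x"
proof -
  have "((f ^^ n) has_vector_derivative Dn n x) (at x within {0..1})"
    using it_deriv_within[OF fD(1), of n] fD(2) by (simp add: has_real_derivative_iff_has_vector_derivative)
  then show ?thesis unfolding D_iter_def using fD(1) by (intro vector_derivative_within_closed_interval) auto
qed

lemma B0_of_iterate:
  assumes x: "x \<in> {0..1}" "x \<notin> backward_orbit f C" and b: "(f ^^ m) x \<in> B0 f C"
  shows "x \<in> B0 f C"
proof -
  obtain A where A: "periodic_like_orbit f A" "attractor f C A" "(f ^^ m) x \<in> basin f C A" using b unfolding B0_def by blast
  have "x \<in> basin f C A" using A(3) x by (simp add: basin_def omega_limit_shift)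
  then show ?thesis using A(1,2) unfolding B0_def by blast
qed

lemma backward_orbit_of_iterate:
  assumes "x \<in> {0..1}" "(f ^^ m) x \<in> backward_orbit f S" shows "x \<in> backward_orbit f S"
proof -
  obtain j where "(f ^^ j) ((f ^^ m) x) \<in> S" using assms(2) unfolding backward_orbit_def by blast
  then have "(f ^^ (j + m)) x \<in> S" by (simp add: it_add)
  then show ?thesis using assms(1) unfolding backward_orbit_def by blast
qed

lemma preperiodic_backward_orbit:
  assumes x: "x \<in> {0..1}" "\<And>n. (f ^^ n) x \<notin> C" and e: "i < j" "(f ^^ i) x = (f ^^ j) x"
  shows "x \<in> backward_orbit f (periodic_points f C)"
proof -
  have "(f ^^ n) ((f ^^ i) x) \<notin> C" for n using x(2)[of "i + n"] unfolding it_after .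
  then have "(f ^^ i) x \<notin> backward_orbit f C" unfolding backward_orbit_def by blast
  moreover have "(f ^^ (j - i)) ((f ^^ i) x) = (f ^^ i) x"
  proof -
    have "(f ^^ (j - i)) ((f ^^ i) x) = (f ^^ (i + (j - i))) x" by (rule it_after[symmetric])
    then show ?thesis using e by simp
  qed
  moreover have "j - i \<ge> 1" using e(1) by simp
  ultimately have "(f ^^ i) x \<in> periodic_points f C" unfolding periodic_points_def using it_range[OF x(1)] by blast
  then show ?thesis unfolding backward_orbit_def using x(1) by blast
qed

text \<open>
  An orbit that stayed in \<open>{0, 1}\<close> would be preperiodic, so some iterate \<open>y\<close> is an interior
  point; \<open>y\<close> is wild, and the derivatives along the orbits of \<open>x\<close> and \<open>y\<close> differ by the fixed
  factor \<open>Dn m x\<close>.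
\<close>

lemma unbounded_derivatives:
  assumes x: "x \<in> {0..1} - (B0 f C \<union> backward_orbit f (periodic_points f C))" and cl: "closure (forward_orbit f C x) \<inter> C = {}"
  shows "(SUP n. ereal \<bar>D_iter f n x\<bar>) = \<infinity>"
proof -
  have x01: "x \<in> {0..1}" using x by blast
  have xb: "x \<notin> backward_orbit f C"
  proof
    assume b: "x \<in> backward_orbit f C"
    then obtain j where j: "(f ^^ j) x \<in> C" unfolding backward_orbit_def by blast
    let ?n = "LEAST n. (f ^^ n) x \<in> C"
    have "(f ^^ ?n) x \<in> C" by (rule LeastI[of "\<lambda>n. (f ^^ n) x \<in> C", OF j])
    moreover have "(f ^^ ?n) x \<in> forward_orbit f C x" unfolding forward_orbit_def using b by auto
    ultimately show False using cl closure_subset by blast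
  qed
  have xC: "(f ^^ n) x \<notin> C" for n using xb x01 unfolding backward_orbit_def by blast
  have "forward_orbit f C x = range (\<lambda>n. (f ^^ n) x)" unfolding forward_orbit_def using xb by auto
  then have "orbit_closure x \<inter> C = {}" unfolding orbit_closure_def using cl by simp
  then obtain d where d: "d > 0" "apart d x" using orbit_closure_apart[OF x01] by blast
  have dis: "(f ^^ i) x \<noteq> (f ^^ j) x" if "i < j" for i j using preperiodic_backward_orbit[OF x01 xC that] x by blast
  have "\<exists>m. (f ^^ m) x \<in> {0<..<1}"
  proof (rule ccontr)
    assume no: "\<not> ?thesis"
    have e: "(f ^^ m) x = 0 \<or> (f ^^ m) x = 1" for m
    proof -
      have "(f ^^ m) x \<notin> {0<..<1}" using no by blast
      then show ?thesis using it_range[OF x01, of m] by auto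
    qed
    \<comment> \<open>three distinct points do not fit into \<open>{0, 1}\<close>\<close>
    have "(f ^^ 0) x \<noteq> (f ^^ 1) x" "(f ^^ 0) x \<noteq> (f ^^ 2) x" "(f ^^ 1) x \<noteq> (f ^^ 2) x" by (rule dis, simp)+
    then show False using e[of 0] e[of 1] e[of 2] by linarith
  qed
  then obtain m where m: "(f ^^ m) x \<in> {0<..<1}" by blast
  define y where "y = (f ^^ m) x"
  have ay: "apart d y" unfolding y_def by (rule apart_it[OF d(2)])
  have y1: "y \<in> {0<..<1}" using m unfolding y_def .
  have dy: "(f ^^ i) y \<noteq> (f ^^ j) y" if ij: "i < j" for i j
    unfolding y_def it_after[symmetric] by (rule dis) (use ij in simp)
  have nh: "y \<notin> closure J" if J: "homterval J" for J
  proof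
    assume "y \<in> closure J"
    then have "y \<in> B0 f C \<union> backward_orbit f (periodic_points f C)" by (rule B0_or_preperiodic_of_homterval[OF J _ ay d(1)])
    then show False using B0_of_iterate[OF x01 xb] backward_orbit_of_iterate[OF x01] x unfolding y_def by blast
  qed
  obtain d' where w: "wild d' y" using wildI[OF ay d(1) y1 dy nh] by blast
  have "orbit_closure y \<subseteq> unsettled d" unfolding orbit_closure_def
  proof (rule closure_minimal[OF _ unsettled_closed[OF d(1)]])
    have "(f ^^ n) y \<in> unsettled d" for n unfolding unsettled_def
      using apart_it[OF ay] wild_not_closure_homterval[OF w] closure_subset by blast
    then show "range (\<lambda>n. (f ^^ n) y) \<subseteq> unsettled d" by blast
  qed
  then have "negligible (orbit_closure y)" by (rule negligible_subset[OF unsettled_negligible[OF d(1)]])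
  then have unb: "\<exists>n. B < \<bar>Dn n y\<bar>" for B by (rule orbit_derivative_unbounded[OF w])
  have nzm: "\<bar>Dn m x\<bar> > 0" using Dn_nz[OF x01 xC] by simp
  show ?thesis
  proof (rule SUP_PInfty)
    fix N :: nat
    obtain n where n: "real N / \<bar>Dn m x\<bar> < \<bar>Dn n y\<bar>" using unb by blast
    have "\<bar>D_iter f (n + m) x\<bar> = \<bar>Dn n y\<bar> * \<bar>Dn m x\<bar>" unfolding D_iter_eq[OF x01 xC] Dn_add y_def by (rule abs_mult)
    moreover have "real N < \<bar>Dn n y\<bar> * \<bar>Dn m x\<bar>" using n nzm by (simp add: divide_less_eq)
    ultimately show "\<exists>i\<in>UNIV. ereal (real N) \<le> ereal \<bar>D_iter f i x\<bar>" by (intro bexI[of _ "n + m"]) auto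
  qed
qed

text \<open>
  The exceptional points lie in the backward orbit of \<open>C\<close>, which is countable, or are
  unsettled for some \<open>d\<close>, which may be taken of the form \<open>1 / (k + 1)\<close>.
\<close>

lemma ae_omega_limit_meets_C:
  "AE x in lebesgue. x \<in> {0..1} - (B0 f C \<union> backward_orbit f (periodic_points f C)) \<longrightarrow> omega_limit f x \<inter> C \<noteq> {}"
proof -
  let ?N = "backward_orbit f C \<union> (\<Union>k. unsettled (1 / real (Suc k)))"
  have "negligible (backward_orbit f C)" by (intro negligible_of_countable countable_backward_orbit countable_finite finC)
  moreover have "negligible (\<Union>k. unsettled (1 / real (Suc k)))"
    by (rule negligible_countable_Union) (rule countable_image[OF countableI_type], elim rangeE, simp add: unsettled_negligible)
  ultimately have "?N \<in> null_sets lebesgue" unfolding negligible_iff_null_sets[symmetric] by (rule negligible_Un)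
  then show ?thesis
  proof (rule AE_I', intro subsetI)
    fix x assume "x \<in> {x\<in>space lebesgue. \<not> (x \<in> {0..1} - (B0 f C \<union> backward_orbit f (periodic_points f C)) \<longrightarrow> omega_limit f x \<inter> C \<noteq> {})}"
    then have x: "x \<in> {0..1}" "x \<notin> B0 f C \<union> backward_orbit f (periodic_points f C)" and oC: "omega_limit f x \<inter> C = {}" by auto
    show "x \<in> ?N"
    proof (cases "x \<in> backward_orbit f C")
      case False
      then have xC: "(f ^^ n) x \<notin> C" for n using x(1) unfolding backward_orbit_def by blast
      have "c \<notin> C" if c: "c \<in> orbit_closure x" for c
      proof -
        consider "c \<in> range (\<lambda>n. (f ^^ n) x)" | "c \<in> omega_limit f x" using subsetD[OF orbit_closure_sub_omega c] by (rule UnE)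
        then show ?thesis
        proof cases
          case 1 then show ?thesis using xC by (elim rangeE) simp
        next
          case 2 then show ?thesis using oC by (metis IntI emptyE)
        qed
      qed
      then have "orbit_closure x \<inter> C = {}" by (rule disjoint_iff[THEN iffD2, rule_format])
      then obtain d where d: "d > 0" "apart d x" using orbit_closure_apart[OF x(1)] by blast
      obtain k where k: "1 / real (Suc k) < d" using nat_approx_posE[OF d(1)] by blast
      have ak: "apart (1 / real (Suc k)) x" by (rule apart_mono[OF d(2) less_imp_le[OF k]])
      have "x \<notin> J" if J: "homterval J" for J
      proof
        assume "x \<in> J"
        then have "x \<in> closure J" by (rule subsetD[OF closure_subset])
        then have "x \<in> B0 f C \<union> backward_orbit f (periodic_points f C)" by (rule B0_or_preperiodic_of_homterval[OF J _ d(2,1)])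
        then show False using x(2) by contradiction
      qed
      then have "x \<in> unsettled (1 / real (Suc k))" unfolding unsettled_def using ak by blast
      then show ?thesis by blast
    qed simp
  qed
qed

end

section \<open>Local diffeomorphisms of class C2\<close>

text \<open>
  The derivative does not vanish because the local inverse is differentiable too. The
  derivatives relative to the chart are those relative to \<open>[0,1]\<close>, as the chart is relatively
  open.
\<close>

lemma C2_local_diffeo_chart:
  assumes C: "finite C" "C2_local_diffeo_on ({0..1} - C) f" and x: "x \<in> {0..1} - C"
  shows "\<exists>T g' g''. open T \<and> x \<in> T \<and> T \<inter> C = {} \<and> continuous_on (T \<inter> {0..1}) g'' \<and>
    (\<forall>y\<in>T \<inter> {0..1::real}. (f has_real_derivative g' y) (at y within {0..1}) \<and>
       (g' has_real_derivative g'' y) (at y within {0..1}) \<and> g' y \<noteq> 0)"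
proof -
  obtain U where U: "openin (top_of_set ({0..1} - C)) U" "x \<in> U" "C2_diffeo_on U f"
    using C(2)[unfolded C2_local_diffeo_on_def, rule_format, OF x] by (elim exE conjE)
  obtain T0 where T0: "open T0" "U = ({0..1} - C) \<inter> T0" using U(1)[unfolded openin_open] by (elim exE conjE)
  define T where "T = T0 \<inter> - C"
  have oT: "open T" unfolding T_def by (intro open_Int T0(1) open_Compl finite_imp_closed C(1))
  have UT: "U = T \<inter> {0..1}" unfolding T0(2) T_def by (rule set_eqI) (simp add: conj_ac)
  have xT: "x \<in> T" using U(2) unfolding UT by (rule IntD1)
  have inj: "inj_on f U" and c2: "C2_on U f" and c2i: "C2_on (f ` U) (inv_into U f)"
    using U(3) unfolding C2_diffeo_on_def by simp_all
  obtain g' g'' where g: "\<forall>y\<in>U. (f has_real_derivative g' y) (at y within U)"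
     "\<forall>y\<in>U. (g' has_real_derivative g'' y) (at y within U)" "continuous_on U g''"
    using c2[unfolded C2_on_def] by (elim exE conjE)
  obtain h' h'' where h: "\<forall>z\<in>f ` U. (inv_into U f has_real_derivative h' z) (at z within f ` U)"
     "\<forall>z\<in>f ` U. (h' has_real_derivative h'' z) (at z within f ` U)"
    using c2i[unfolded C2_on_def] by (elim exE conjE)
  have at: "at y within U = at y within {0..1}" if y: "y \<in> U" for y
  proof (rule at_within_nhd[OF _ oT])
    show "y \<in> T" using y unfolding UT by (rule IntD1)
    show "U \<inter> T - {y} = {0..1} \<inter> T - {y}" unfolding UT by (rule set_eqI) auto
  qed
  have g0: "g' y \<noteq> 0" if y: "y \<in> U" for y
  proof
    assume z: "g' y = 0"
    have y01: "y \<in> {0..1}" using y unfolding UT by (rule IntD2)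
    have "((inv_into U f \<circ> f) has_real_derivative h' (f y) * g' y) (at y within U)"
      by (rule DERIV_image_chain[OF h(1)[rule_format, OF imageI[OF y]] g(1)[rule_format, OF y]])
    then have "((\<lambda>t. t) has_real_derivative h' (f y) * g' y) (at y within U)"
    proof (rule has_field_derivative_transform_within[OF _ zero_less_one y])
      fix t assume "t \<in> U" then show "(inv_into U f \<circ> f) t = t" using inv_into_f_f[OF inj] by simp
    qed
    then have v0: "((\<lambda>t. t) has_vector_derivative 0) (at y within {0..1})"
      unfolding at[OF y] z mult_zero_right has_real_derivative_iff_has_vector_derivative .
    have v1: "((\<lambda>t. t) has_vector_derivative 1) (at y within {0..1::real})"
      unfolding has_real_derivative_iff_has_vector_derivative[symmetric] by (rule DERIV_ident)
    have "vector_derivative (\<lambda>t. t) (at y within {0..1}) = 0" by (rule vector_derivative_within_closed_interval[OF zero_less_one y01 v0])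
    moreover have "vector_derivative (\<lambda>t. t) (at y within {0..1}) = 1" by (rule vector_derivative_within_closed_interval[OF zero_less_one y01 v1])
    ultimately show False by simp
  qed
  have "(f has_real_derivative g' y) (at y within {0..1}) \<and> (g' has_real_derivative g'' y) (at y within {0..1}) \<and> g' y \<noteq> 0"
    if y0: "y \<in> T \<inter> {0..1}" for y
  proof -
    have y: "y \<in> U" using y0 unfolding UT .
    show ?thesis using g(1,2)[rule_format, OF y] g0[OF y] unfolding at[OF y] by (intro conjI)
  qed
  moreover have "continuous_on (T \<inter> {0..1}) g''" using g(3) unfolding UT .
  moreover have "T \<inter> C = {}" unfolding T_def by (rule set_eqI) simp
  ultimately show ?thesis using oT xT by (intro exI[of _ T] exI[of _ g'] exI[of _ g''] conjI ballI) simp_all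
qed

text \<open>
  The logarithm of \<open>\<bar>g\<bar>\<close> is written as half the logarithm of \<open>g\<^sup>2\<close> to differentiate it without
  knowing the sign of \<open>g\<close>.
\<close>

lemma lipschitz_ln_derivative:
  fixes g :: "real \<Rightarrow> real"
  assumes g: "\<And>t. t \<in> {u..v} \<Longrightarrow> (g has_real_derivative g' t) (at t within {u..v})" "\<And>t. t \<in> {u..v} \<Longrightarrow> g t \<noteq> 0"
    and B: "\<And>t. t \<in> {u..v} \<Longrightarrow> \<bar>g' t / g t\<bar> \<le> B" and uv: "u \<le> v"
  shows "\<bar>ln \<bar>g u\<bar> - ln \<bar>g v\<bar>\<bar> \<le> B * (v - u)"
proof -
  have ab: "ln \<bar>g t\<bar> = ln ((g t)\<^sup>2) / 2" for t
    using ln_realpow[of "\<bar>g t\<bar>" 2] by (cases "g t = 0") auto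
  have "norm (ln ((g u)\<^sup>2) / 2 - ln ((g v)\<^sup>2) / 2) \<le> B * norm (u - v)"
  proof (rule field_differentiable_bound[where f = "\<lambda>t. ln ((g t)\<^sup>2) / 2" and S = "{u..v}"])
    fix t assume t: "t \<in> {u..v}"
    have p: "(g t)\<^sup>2 > 0" using g(2)[OF t] by simp
    show "((\<lambda>t. ln ((g t)\<^sup>2) / 2) has_field_derivative g' t / g t) (at t within {u..v})"
      by (rule derivative_eq_intros g(1)[OF t] refl p zero_neq_numeral[symmetric])+
        (use g(2)[OF t] in \<open>simp add: divide_simps power2_eq_square\<close>)
    show "norm (g' t / g t) \<le> B" using B[OF t] by simp
  qed (use uv in auto)
  then show ?thesis unfolding ab using uv by (simp add: abs_minus_commute)
qed

text \<open>
  On the compact set of points at distance at least \<open>d\<close> from \<open>C\<close> the continuous function \<open>f'' /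
  f'\<close> is bounded.
\<close>

lemma interval_map_of_C2_local_diffeo:
  assumes maps: "f ` {0..1} \<subseteq> {0..1}" and C: "finite C" and loc: "C2_local_diffeo_on ({0..1} - C) f"
  shows "interval_map f (\<lambda>x. vector_derivative f (at x within {0..1})) C"
proof -
  define f' where "f' = (\<lambda>x. vector_derivative f (at x within {0..1}))"
  define f'' where "f'' = (\<lambda>x. vector_derivative f' (at x within {0..1}))"
  have vd: "vector_derivative g (at x within {0..1}) = D" if "x \<in> {0..1::real}" "(g has_real_derivative D) (at x within {0..1})" for g x D
    using that by (intro vector_derivative_within_closed_interval) (auto simp: has_real_derivative_iff_has_vector_derivative)
  have chart: "\<exists>T. open T \<and> x \<in> T \<and> continuous_on (T \<inter> {0..1}) f'' \<and>
      (f has_real_derivative f' x) (at x within {0..1}) \<and> (f' has_real_derivative f'' x) (at x within {0..1}) \<and> f' x \<noteq> 0"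
    if x: "x \<in> {0..1} - C" for x
  proof -
    obtain T g' g'' where T: "open T" "x \<in> T" "continuous_on (T \<inter> {0..1}) g''"
      and g: "\<And>y. y \<in> T \<inter> {0..1} \<Longrightarrow> (f has_real_derivative g' y) (at y within {0..1})"
       "\<And>y. y \<in> T \<inter> {0..1} \<Longrightarrow> (g' has_real_derivative g'' y) (at y within {0..1})"
       "\<And>y. y \<in> T \<inter> {0..1} \<Longrightarrow> g' y \<noteq> 0"
      using C2_local_diffeo_chart[OF C loc x] by blast
    have e1: "f' y = g' y" if "y \<in> T \<inter> {0..1}" for y unfolding f'_def by (rule vd[OF _ g(1)[OF that]]) (use that in blast)
    have d2: "(f' has_real_derivative g'' y) (at y within {0..1})" if y: "y \<in> T \<inter> {0..1}" for y
    proof -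
      obtain \<delta> where \<delta>: "\<delta> > 0" "ball y \<delta> \<subseteq> T" using T(1) y unfolding open_contains_ball by blast
      have y01: "y \<in> {0..1}" using y by blast
      show ?thesis
      proof (rule has_field_derivative_transform_within[OF g(2)[OF y] \<delta>(1) y01])
        fix t assume "t \<in> {0..1}" "dist t y < \<delta>"
        then have "t \<in> T \<inter> {0..1}" using \<delta>(2) by (auto simp: dist_commute)
        then show "g' t = f' t" using e1 by simp
      qed
    qed
    have e2: "f'' y = g'' y" if "y \<in> T \<inter> {0..1}" for y unfolding f''_def by (rule vd[OF _ d2[OF that]]) (use that in blast)
    have xT: "x \<in> T \<inter> {0..1}" using T(2) x by blast
    have "continuous_on (T \<inter> {0..1}) f''" by (rule continuous_on_eq[OF T(3)]) (rule e2[symmetric])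
    then show ?thesis using T(1,2) g(1,3)[OF xT] d2[OF xT] e1[OF xT] e2[OF xT] by auto
  qed
  have d1: "(f has_real_derivative f' x) (at x within {0..1})" and d2: "(f' has_real_derivative f'' x) (at x within {0..1})"
    and nz: "f' x \<noteq> 0" if "x \<in> {0..1} - C" for x using chart[OF that] by blast+
  have c2: "continuous_on ({0..1} - C) f''"
  proof (rule continuous_on_eq_continuous_within[THEN iffD2], rule ballI)
    fix x assume x: "x \<in> {0..1} - C"
    obtain T where T: "open T" "x \<in> T" "continuous_on (T \<inter> {0..1}) f''" using chart[OF x] by blast
    have "continuous (at x within T \<inter> {0..1}) f''" using T(2,3) x by (simp add: continuous_on_eq_continuous_within)
    moreover have "at x within T \<inter> {0..1} = at x within {0..1}" by (rule at_within_nhd[OF T(2,1)]) auto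
    ultimately have "continuous (at x within {0..1}) f''" by simp
    then show "continuous (at x within {0..1} - C) f''" by (rule continuous_within_subset) auto
  qed
  have c1: "continuous_on ({0..1} - C) f'"
  proof (rule continuous_on_eq_continuous_within[THEN iffD2], rule ballI)
    fix x assume x: "x \<in> {0..1} - C"
    have "continuous (at x within {0..1}) f'" by (rule DERIV_continuous[OF d2[OF x]])
    then show "continuous (at x within {0..1} - C) f'" by (rule continuous_within_subset) auto
  qed
  have lip: "\<exists>L. log_lipschitz f' C d L" if d: "d > 0" for d
  proof -
    have sub: "away C d \<subseteq> {0..1} - C" unfolding away_def using d by force
    have "away C d = {0..1} \<inter> (\<Inter>c\<in>C. {t. d \<le> \<bar>t - c\<bar>})" unfolding away_def by auto
    moreover have "closed {t. d \<le> \<bar>t - c\<bar>}" for c :: real by (intro closed_Collect_le continuous_intros)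
    ultimately have "compact (away C d)" by (auto intro!: compact_Int_closed closed_INT)
    moreover have "continuous_on (away C d) (\<lambda>t. f'' t / f' t)"
      by (intro continuous_on_divide continuous_on_subset[OF c2 sub] continuous_on_subset[OF c1 sub]) (use nz sub in blast)
    ultimately have "bounded ((\<lambda>t. f'' t / f' t) ` away C d)" by (intro compact_imp_bounded compact_continuous_image)
    then obtain B where B: "B > 0" "\<And>t. t \<in> away C d \<Longrightarrow> \<bar>f'' t / f' t\<bar> \<le> B" unfolding bounded_pos by auto
    have "log_lipschitz f' C d B" unfolding log_lipschitz_def
    proof (intro conjI allI impI B(1))
      fix u v assume uv: "u \<le> v \<and> {u..v} \<subseteq> away C d"
      then have s: "t \<in> away C d" "t \<in> {0..1} - C" if "t \<in> {u..v}" for t using that sub by blast+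
      have s01: "{u..v} \<subseteq> {0..1}" using uv sub by blast
      show "\<bar>ln \<bar>f' u\<bar> - ln \<bar>f' v\<bar>\<bar> \<le> B * (v - u)"
      proof (rule lipschitz_ln_derivative[where g' = f''])
        fix t assume t: "t \<in> {u..v}"
        show "(f' has_real_derivative f'' t) (at t within {u..v})"
          by (rule has_field_derivative_subset[OF d2[OF s(2)[OF t]] s01])
        show "f' t \<noteq> 0" by (rule nz[OF s(2)[OF t]])
        show "\<bar>f'' t / f' t\<bar> \<le> B" by (rule B(2)[OF s(1)[OF t]])
      qed (use uv in simp)
    qed
    then show ?thesis by blast
  qed
  have m: "f x \<in> {0..1}" if "x \<in> {0..1}" for x using maps that by blast
  have "interval_map f f' C" by (intro interval_map.intro m C d1 nz lip c1)
  then show ?thesis unfolding f'_def .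
qed

theorem theorem4:
  fixes f :: "real \<Rightarrow> real" and C :: "real set"
  assumes "f ` {0..1} \<subseteq> {0..1}"
    and "finite C" and "C \<subseteq> {0<..<1}"
    and "C2_local_diffeo_on ({0..1} - C) f"
    and "nonflat f"
  shows "(\<forall>x \<in> {0..1} - (B0 f C \<union> backward_orbit f (periodic_points f C)).
            closure (forward_orbit f C x) \<inter> C = {} \<longrightarrow>
            (SUP n. ereal \<bar>D_iter f n x\<bar>) = \<infinity>) \<and>
         (AE x in lebesgue.
            x \<in> {0..1} - (B0 f C \<union> backward_orbit f (periodic_points f C)) \<longrightarrow>
            omega_limit f x \<inter> C \<noteq> {})"
proof -
  interpret interval_map f "\<lambda>x. vector_derivative f (at x within {0..1})" C
    by (rule interval_map_of_C2_local_diffeo[OF assms(1,2,4)])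
  show ?thesis
  proof (intro conjI ballI impI)
    fix x assume "x \<in> {0..1} - (B0 f C \<union> backward_orbit f (periodic_points f C))" "closure (forward_orbit f C x) \<inter> C = {}"
    then show "(SUP n. ereal \<bar>D_iter f n x\<bar>) = \<infinity>" by (rule unbounded_derivatives)
  next
    show "AE x in lebesgue. x \<in> {0..1} - (B0 f C \<union> backward_orbit f (periodic_points f C)) \<longrightarrow> omega_limit f x \<inter> C \<noteq> {}"
      by (rule ae_omega_limit_meets_C)
  qed
qed

end
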